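(* Let $f\in RBMO(\mu)$ and $h\in\mathcal H^{1}(\mu)$. Then the product $f\times h$ can be given a meaning in the sense of distributions, namely, for a decomposition $h=\sum_{j}b_{j}$ into atomic blocks $b_j$ supported in cubes $R_j$ with $\sum_j|b_j|_{\mathcal H^{1,\infty}_{atb}(\mu)}<\infty$, as the sum of the two series (converging in the sense of distributions) $$f\times h:=\sum_{j=1}^{\infty}\left(f-f_{\tilde R_j}\right)b_j+\sum_{j=1}^{\infty}f_{\tilde R_j}\,b_j.$$ Moreover, $$f\times h\in L^{1}(\mu)+\mathcal H^{\wp}(\nu),$$ where $\wp(t)=\dfrac{t}{\log(e+t)}$ and $d\nu(x)=\dfrac{d\mu(x)}{\log(e+|x|)}$.
   Context: Setting. $0<n\le d$ are fixed integers and $\mu$ is a positive Radon measure on $\mathbb R^d$ (Euclidean norm $|\cdot|$) with $\mu(B(x,r))\le C_0r^n$ for all $x\in\mathbb R^d$, $r>0$; $\mu$ need not be doubling. A cube is a closed cube with sides parallel to the axes, centered at a point $x_Q$ of $\mathrm{supp}(\mu)$; if $\mu(\mathbb R^d)<\infty$, $Q=\mathbb R^d$ is also allowed. $\ell(Q)$ is the side length and $\alpha Q$ the concentric cube of side length $\alpha\ell(Q)$; $C_0$ is chosen so that also $\mu(Q)\le C_0\ell(Q)^n$ for all cubes. For cubes $Q\subset R$, $S_{Q,R}=1+\sum_{k=1}^{N_{Q,R}}\frac{\mu(2^kQ)}{\ell(2^kQ)^n}$, where $N_{Q,R}$ is the smallest positive integer $k$ with $\ell(2^kQ)\ge\ell(R)$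 ($N_{Q,R}=\infty$ if $R=\mathbb R^d\ne Q$). Doubling cubes. Let $\alpha>1$ and $\beta>\alpha^n$. A cube $Q$ is $(\alpha,\beta)$-doubling if $\mu(\alpha Q)\le\beta\mu(Q)$. For $\rho>1$, $\beta_\rho$ is a fixed large constant $\beta$ (for definiteness, twice the infimum of such constants) for which there are arbitrarily large $(\rho,\beta)$-doubling cubes centered at every point of $\mathrm{supp}(\mu)$, and, for $\mu$-a.e. $x$, a sequence of $(\rho,\beta)$-doubling cubes centered at $x$ with side lengths tending to $0$. For a cube $Q$, $\tilde Q=2^NQ$ with $N$ the smallest non-negative integer such that $2^NQ$ is $(\rho,\beta_\rho)$-doubling. $f_Q$ denotes the $\mu$-mean of $f$ over $Q$. $RBMO(\mu)$. Fix $\rho>1$, $\eta>1$. $f\in L^1_{loc}(\mu)$ is in $RBMO(\mu)$ if there is $C_2\ge0$ with $\frac1{\mu(\eta Q)}\int_Q|f-f_{\tilde Q}|\,d\mu\le C_2$ for every cube $Q$, and $|f_Q-f_R|\le C_2S_{Q,R}$ for any two $(\rho,\beta_\rho)$-doubling cubes $Q\subset R$. The norm $\|f\|_{RBMO(\mu)}$ is the infimum of such $C_2$. The space does not depend on the choice of $\eta,\rho,\beta_\rho$. $\mathcal H^1(\mu)=\mathcal H^{1,\infty}_{atb}(\mu)$. An ($\infty$-)atomic block is $b\in L^1_{loc}(\mu)$ such that (i) $\mathrm{supp}\,b\subset R$ for some cube $R$; (ii) $\int b\,d\mu=0$; (iii) $b=\sum_{i}\lambda_ia_i$ with $\lambda_i\in\mathbb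 R$ and $a_i$ supported in cubes $Q_i\subset R$ with $\|a_i\|_{L^\infty(\mu)}\le\mu(2Q_i)^{-1}S_{Q_i,R}^{-1}$; one puts $|b|_{\mathcal H^{1,\infty}_{atb}(\mu)}=\sum_i|\lambda_i|$. $h\in\mathcal H^1(\mu)$ iff $h=\sum_jb_j$ with atomic blocks $b_j$ such that $\sum_j|b_j|_{\mathcal H^{1,\infty}_{atb}(\mu)}<\infty$. Orlicz and Hardy–Orlicz spaces. For a measure $m$, $L^{\wp}(m)$ is the set of $m$-measurable $g$ with $\|g\|_{L^\wp(m)}=\inf\{k>0:\int\wp(|g|/k)\,dm\le1\}<\infty$. For $x\in\mathbb R^d$, $F(x)$ is the set of $\varphi\in L^1(\mu)\cap C^1(\mathbb R^d)$ with $\|\varphi\|_{L^1(\mu)}\le1$, $0\le\varphi(y)\le|y-x|^{-n}$ and $|\nabla\varphi(y)|\le|y-x|^{-n-1}$ for all $y\in\mathbb R^d$. For $g\in L^1_{loc}(\mu)$, the maximal function is $\mathcal Mg(x)=\sup_{\varphi\in F(x)}\left|\int g\varphi\,d\mu\right|$. The Hardy–Orlicz space $\mathcal H^\wp(\nu)$ consists of the locally integrable functions $g$ such that $\mathcal Mg\in L^\wp(\nu)$, with $\|g\|_{\mathcal H^\wp(\nu)}=\|\mathcal Mg\|_{L^\wp(\nu)}$; here $\mathcal M$ is defined with respect to $\mu$.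
   Formalization: H^℘(ν) is completed to include distributional limits of sequences Cauchy in its norm, since f×h need not be locally integrable (f=log|x|, h=sgn x/(|x|log²|x|)); β_ρ is any admissible constant >2^{n⌈log₂ρ⌉}, since twice the infimum may leave Q̃ undefined. *)

theory Defs
  imports "HOL-Analysis.Analysis"
begin

section \<open>The measure and its cubes\<close>

definition msupport :: "'a::euclidean_space measure \<Rightarrow> 'a set" where
  "msupport \<mu> = {x. \<forall>r>0. emeasure \<mu> (ball x r) > 0}"

text \<open>\<open>Cube c l\<close> is the closed axis-parallel cube with centre \<open>c\<close> and side length \<open>l\<close>;
  \<open>Whole\<close> is the whole space, with infinite side length.\<close>

datatype 'a cube = Cube 'a real | Whole

fun cube_set :: "'a::euclidean_space cube \<Rightarrow> 'a set" where
  "cube_set (Cube c l) = cbox (c - (l / 2) *\<^sub>R One) (c + (l / 2) *\<^sub>R One)"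
| "cube_set Whole = UNIV"

fun cube_scale :: "real \<Rightarrow> 'a cube \<Rightarrow> 'a cube" where
  "cube_scale \<alpha> (Cube c l) = Cube c (\<alpha> * l)"
| "cube_scale \<alpha> Whole = Whole"

fun is_cube :: "'a::euclidean_space measure \<Rightarrow> 'a cube \<Rightarrow> bool" where
  "is_cube \<mu> (Cube c l) \<longleftrightarrow> c \<in> msupport \<mu> \<and> l > 0"
| "is_cube \<mu> Whole \<longleftrightarrow> emeasure \<mu> UNIV < \<infinity>"

abbreviation mcube :: "'a::euclidean_space measure \<Rightarrow> 'a cube \<Rightarrow> real" where
  "mcube \<mu> Q \<equiv> measure \<mu> (cube_set Q)"

text \<open>A Borel measure on a Euclidean space that is finite on balls is a Radon measure, so the
  growth condition contains that requirement. Functions are taken to be Borel measurable, which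
  up to null sets is no restriction.\<close>

definition growth_measure :: "'a::euclidean_space measure \<Rightarrow> nat \<Rightarrow> real \<Rightarrow> bool" where
  "growth_measure \<mu> n C0 \<longleftrightarrow>
     sets \<mu> = sets borel \<and>
     (\<forall>x. \<forall>r>0. emeasure \<mu> (ball x r) \<le> ennreal (C0 * r ^ n)) \<and>
     (\<forall>x\<in>msupport \<mu>. \<forall>l>0. emeasure \<mu> (cube_set (Cube x l)) \<le> ennreal (C0 * l ^ n))"

text \<open>The coefficients \<open>S\<^bsub>Q,R\<^esub>\<close> for \<open>Q \<subseteq> R\<close>. For \<open>Q = Whole\<close> the only
  term of the sum is a finite number divided by infinity.\<close>

fun S_coeff :: "'a::euclidean_space measure \<Rightarrow> nat \<Rightarrow> 'a cube \<Rightarrow> 'a cube \<Rightarrow> real" where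
  "S_coeff \<mu> n (Cube c l) (Cube c' l') =
     1 + (\<Sum>k = 1..(LEAST k. k > 0 \<and> 2 ^ k * l \<ge> l'). mcube \<mu> (Cube c (2 ^ k * l)) / (2 ^ k * l) ^ n)"
| "S_coeff \<mu> n (Cube c l) Whole =
     1 + (\<Sum>k. mcube \<mu> (Cube c (2 ^ Suc k * l)) / (2 ^ Suc k * l) ^ n)"
| "S_coeff \<mu> n Whole R = 1"

definition doubling :: "'a::euclidean_space measure \<Rightarrow> real \<Rightarrow> real \<Rightarrow> 'a cube \<Rightarrow> bool" where
  "doubling \<mu> \<alpha> \<beta> Q \<longleftrightarrow> mcube \<mu> (cube_scale \<alpha> Q) \<le> \<beta> * mcube \<mu> Q"

text \<open>The constants allowed as \<open>\<beta>\<^sub>\<rho>\<close>. The first conjunct makes ``large'' precise. With \<open>2\<^sup>m\<close> the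
  least power of two that is at least \<open>\<rho>\<close>, it implies \<open>\<beta> > \<rho>\<^sup>n\<close> and guarantees that among
  the cubes \<open>2\<^sup>N Q\<close> there is a doubling one; \<open>\<beta> > \<rho>\<^sup>n\<close> alone does not, unless \<open>\<rho>\<close> is itself a
  power of two.\<close>

definition doubling_constant :: "'a::euclidean_space measure \<Rightarrow> nat \<Rightarrow> real \<Rightarrow> real \<Rightarrow> bool" where
  "doubling_constant \<mu> n \<rho> \<beta> \<longleftrightarrow>
     \<beta> > (2 ^ nat \<lceil>log 2 \<rho>\<rceil>) ^ n \<and>
     (\<forall>x\<in>msupport \<mu>. \<forall>L. \<exists>l>L. l > 0 \<and> doubling \<mu> \<rho> \<beta> (Cube x l)) \<and>
     (AE x in \<mu>. \<exists>l::nat \<Rightarrow> real. (\<forall>k. l k > 0 \<and> doubling \<mu> \<rho> \<beta> (Cube x (l k))) \<and> l \<longlonglongrightarrow> 0)"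

definition cube_tilde :: "'a::euclidean_space measure \<Rightarrow> real \<Rightarrow> real \<Rightarrow> 'a cube \<Rightarrow> 'a cube" where
  "cube_tilde \<mu> \<rho> \<beta> Q = cube_scale (2 ^ (LEAST N. doubling \<mu> \<rho> \<beta> (cube_scale (2 ^ N) Q))) Q"

section \<open>\<open>RBMO\<close> and the atomic Hardy space\<close>

definition L1loc :: "'a::euclidean_space measure \<Rightarrow> ('a \<Rightarrow> real) set" where
  "L1loc \<mu> = {g \<in> borel_measurable \<mu>. \<forall>K. compact K \<longrightarrow> set_integrable \<mu> K g}"

definition mean :: "'a::euclidean_space measure \<Rightarrow> ('a \<Rightarrow> real) \<Rightarrow> 'a cube \<Rightarrow> real" where
  "mean \<mu> f Q = (LINT x:cube_set Q|\<mu>. f x) / mcube \<mu> Q"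

definition RBMO :: "'a::euclidean_space measure \<Rightarrow> nat \<Rightarrow> real \<Rightarrow> real \<Rightarrow> real \<Rightarrow> ('a \<Rightarrow> real) set" where
  "RBMO \<mu> n \<rho> \<eta> \<beta> = {f \<in> L1loc \<mu>. \<exists>C2\<ge>0.
     (\<forall>Q. is_cube \<mu> Q \<longrightarrow>
        (\<integral>\<^sup>+x\<in>cube_set Q. ennreal \<bar>f x - mean \<mu> f (cube_tilde \<mu> \<rho> \<beta> Q)\<bar> \<partial>\<mu>)
          / emeasure \<mu> (cube_set (cube_scale \<eta> Q)) \<le> ennreal C2) \<and>
     (\<forall>Q R. is_cube \<mu> Q \<and> is_cube \<mu> R \<and> cube_set Q \<subseteq> cube_set R \<and>
        doubling \<mu> \<rho> \<beta> Q \<and> doubling \<mu> \<rho> \<beta> R \<longrightarrow>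
        \<bar>mean \<mu> f Q - mean \<mu> f R\<bar> \<le> C2 * S_coeff \<mu> n Q R)}"

text \<open>\<open>b\<close> is an atomic block with cube \<open>R\<close>, and \<open>s\<close> is the number \<open>|b|\<close> belonging
  to one of its representations \<open>b = \<Sum>i. \<lambda>\<^sub>i a\<^sub>i\<close>; only blocks with \<open>|b| < \<infinity>\<close> matter for
  the Hardy space. As \<open>\<parallel>a\<^sub>i\<parallel> \<le> 1\<close> in \<open>L\<^sup>1\<close>, this series converges absolutely in \<open>L\<^sup>1\<close> and
  almost everywhere, to the same sum; likewise for the series of blocks below.\<close>

definition atomic_block ::
  "'a::euclidean_space measure \<Rightarrow> nat \<Rightarrow> 'a cube \<Rightarrow> ('a \<Rightarrow> real) \<Rightarrow> real \<Rightarrow> bool" where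
  "atomic_block \<mu> n R b s \<longleftrightarrow>
     b \<in> L1loc \<mu> \<and> is_cube \<mu> R \<and>
     (AE x in \<mu>. x \<notin> cube_set R \<longrightarrow> b x = 0) \<and>
     integrable \<mu> b \<and> (\<integral>x. b x \<partial>\<mu>) = 0 \<and>
     (\<exists>(c :: nat \<Rightarrow> real) (a :: nat \<Rightarrow> 'a \<Rightarrow> real) (Q :: nat \<Rightarrow> 'a cube).
        (\<forall>i. a i \<in> borel_measurable \<mu> \<and> is_cube \<mu> (Q i) \<and> cube_set (Q i) \<subseteq> cube_set R \<and>
             (AE x in \<mu>. x \<notin> cube_set (Q i) \<longrightarrow> a i x = 0) \<and>
             (AE x in \<mu>. \<bar>a i x\<bar> \<le> 1 / (mcube \<mu> (cube_scale 2 (Q i)) * S_coeff \<mu> n (Q i) R))) \<and>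
        (AE x in \<mu>. (\<lambda>i. c i * a i x) sums b x) \<and>
        (\<lambda>i. \<bar>c i\<bar>) sums s)"

definition atb_decomposition ::
  "'a::euclidean_space measure \<Rightarrow> nat \<Rightarrow> ('a \<Rightarrow> real) \<Rightarrow> (nat \<Rightarrow> 'a \<Rightarrow> real) \<Rightarrow> (nat \<Rightarrow> 'a cube)
     \<Rightarrow> (nat \<Rightarrow> real) \<Rightarrow> bool" where
  "atb_decomposition \<mu> n h b R s \<longleftrightarrow>
     (\<forall>j. atomic_block \<mu> n (R j) (b j) (s j)) \<and> summable s \<and>
     (AE x in \<mu>. (\<lambda>j. b j x) sums h x)"

definition H1atb :: "'a::euclidean_space measure \<Rightarrow> nat \<Rightarrow> ('a \<Rightarrow> real) set" where
  "H1atb \<mu> n = {h \<in> borel_measurable \<mu>. \<exists>b R s. atb_decomposition \<mu> n h b R s}"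

section \<open>Distributions\<close>

fun iter_deriv :: "'a::euclidean_space list \<Rightarrow> ('a \<Rightarrow> real) \<Rightarrow> 'a \<Rightarrow> real" where
  "iter_deriv [] \<phi> = \<phi>"
| "iter_deriv (v # vs) \<phi> = (\<lambda>x. frechet_derivative (iter_deriv vs \<phi>) (at x) v)"

definition test_functions :: "('a::euclidean_space \<Rightarrow> real) set" where
  "test_functions =
     {\<phi>. (\<forall>vs\<in>lists Basis. \<forall>x. iter_deriv vs \<phi> differentiable (at x)) \<and>
         (\<exists>K. compact K \<and> (\<forall>x. x \<notin> K \<longrightarrow> \<phi> x = 0))}"

text \<open>Distributions are represented by functionals on all functions, of which only the values on
  test functions matter.\<close>

definition is_distribution :: "(('a::euclidean_space \<Rightarrow> real) \<Rightarrow> real) \<Rightarrow> bool" where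
  "is_distribution T \<longleftrightarrow>
     (\<forall>\<phi>\<in>test_functions. \<forall>\<psi>\<in>test_functions. \<forall>a b.
        T (\<lambda>x. a * \<phi> x + b * \<psi> x) = a * T \<phi> + b * T \<psi>) \<and>
     (\<forall>K. compact K \<longrightarrow> (\<exists>C m. \<forall>\<phi>\<in>test_functions. \<forall>M.
        (\<forall>x. x \<notin> K \<longrightarrow> \<phi> x = 0) \<and>
        (\<forall>vs\<in>lists Basis. length vs \<le> m \<longrightarrow> (\<forall>x. \<bar>iter_deriv vs \<phi> x\<bar> \<le> M)) \<longrightarrow>
        \<bar>T \<phi>\<bar> \<le> C * M))"

definition dist_limit ::
  "'a::euclidean_space measure \<Rightarrow> (nat \<Rightarrow> 'a \<Rightarrow> real) \<Rightarrow> (('a \<Rightarrow> real) \<Rightarrow> real) \<Rightarrow> bool" where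
  "dist_limit \<mu> g T \<longleftrightarrow>
     (\<forall>k. g k \<in> L1loc \<mu>) \<and> is_distribution T \<and>
     (\<forall>\<phi>\<in>test_functions. (\<lambda>k. \<integral>x. g k x * \<phi> x \<partial>\<mu>) \<longlonglongrightarrow> T \<phi>)"

definition dist_sums ::
  "'a::euclidean_space measure \<Rightarrow> (nat \<Rightarrow> 'a \<Rightarrow> real) \<Rightarrow> (('a \<Rightarrow> real) \<Rightarrow> real) \<Rightarrow> bool" where
  "dist_sums \<mu> g T \<longleftrightarrow>
     (\<forall>j. g j \<in> L1loc \<mu>) \<and> is_distribution T \<and>
     (\<forall>\<phi>\<in>test_functions. (\<lambda>j. \<integral>x. g j x * \<phi> x \<partial>\<mu>) sums T \<phi>)"

section \<open>Hardy--Orlicz spaces\<close>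

definition wp :: "ennreal \<Rightarrow> ennreal" where
  "wp t = (if t = \<infinity> then \<infinity> else ennreal (enn2real t / ln (exp 1 + enn2real t)))"

definition wp_norm :: "'a measure \<Rightarrow> ('a \<Rightarrow> ennreal) \<Rightarrow> ennreal" where
  "wp_norm m G = Inf {ennreal k |k. k > 0 \<and> (\<integral>\<^sup>+x. wp (G x / ennreal k) \<partial>m) \<le> 1}"

definition Lwp :: "'a measure \<Rightarrow> ('a \<Rightarrow> ennreal) set" where
  "Lwp m = {G \<in> borel_measurable m. wp_norm m G < \<infinity>}"

definition log_weighted :: "'a::euclidean_space measure \<Rightarrow> 'a measure" where
  "log_weighted \<mu> = density \<mu> (\<lambda>x. ennreal (1 / ln (exp 1 + norm x)))"

text \<open>At \<open>y = x\<close> the two upper bounds are infinite, i.e.\ void.\<close>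

definition F_class :: "'a::euclidean_space measure \<Rightarrow> nat \<Rightarrow> 'a \<Rightarrow> ('a \<Rightarrow> real) set" where
  "F_class \<mu> n x = {\<phi>. integrable \<mu> \<phi> \<and> (\<integral>y. \<bar>\<phi> y\<bar> \<partial>\<mu>) \<le> 1 \<and>
     (\<forall>y. 0 \<le> \<phi> y) \<and> (\<forall>y. y \<noteq> x \<longrightarrow> \<phi> y \<le> 1 / norm (y - x) ^ n) \<and>
     (\<exists>D. continuous_on UNIV D \<and> (\<forall>y. GDERIV \<phi> y :> D y) \<and>
          (\<forall>y. y \<noteq> x \<longrightarrow> norm (D y) \<le> 1 / norm (y - x) ^ (n + 1)))}"

text \<open>For \<open>g\<close> merely locally integrable, \<open>g \<phi>\<close> need not be integrable; such \<open>\<phi>\<close>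
  contribute the value infinity.\<close>

definition maximal_fun ::
  "'a::euclidean_space measure \<Rightarrow> nat \<Rightarrow> ('a \<Rightarrow> real) \<Rightarrow> 'a \<Rightarrow> ennreal" where
  "maximal_fun \<mu> n g x = (SUP \<phi>\<in>F_class \<mu> n x.
     if integrable \<mu> (\<lambda>y. g y * \<phi> y) then ennreal \<bar>\<integral>y. g y * \<phi> y \<partial>\<mu>\<bar> else \<infinity>)"

definition hardy_orlicz :: "'a::euclidean_space measure \<Rightarrow> nat \<Rightarrow> ('a \<Rightarrow> real) set" where
  "hardy_orlicz \<mu> n = {g \<in> L1loc \<mu>. maximal_fun \<mu> n g \<in> Lwp (log_weighted \<mu>)}"

definition hardy_orlicz_norm :: "'a::euclidean_space measure \<Rightarrow> nat \<Rightarrow> ('a \<Rightarrow> real) \<Rightarrow> ennreal" where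
  "hardy_orlicz_norm \<mu> n g = wp_norm (log_weighted \<mu>) (maximal_fun \<mu> n g)"

text \<open>A distribution belongs to the Hardy--Orlicz space if it lies in the completion of the space
  of functions above: it is the limit, in the sense of distributions, of a sequence in
  \<open>hardy_orlicz\<close> that is Cauchy for \<open>hardy_orlicz_norm\<close>. Every \<open>g\<close> in
  \<open>hardy_orlicz\<close> qualifies, by the constant sequence. The completion is needed because a product
  \<open>f \<times> h\<close> is in general not a locally integrable function: for Lebesgue measure on the line,
  let \<open>f(x) = ln |x|\<close> and, near 0, \<open>h(x) = sgn x / (|x| (ln |x|)\<^sup>2)\<close>. The odd function
  \<open>h\<close> is a sum over \<open>k\<close> of atomic blocks, carried by \<open>2\<^sup>-\<^sup>k < |x| < 2\<^sup>1\<^sup>-\<^sup>k\<close> and of size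
  comparable to \<open>1 / k\<^sup>2\<close>, but \<open>f h\<close>, with which \<open>f \<times> h\<close> agrees off 0, is not integrable
  near 0.\<close>

definition hardy_orlicz_dist ::
  "'a::euclidean_space measure \<Rightarrow> nat \<Rightarrow> (('a \<Rightarrow> real) \<Rightarrow> real) \<Rightarrow> bool" where
  "hardy_orlicz_dist \<mu> n T \<longleftrightarrow> (\<exists>g.
     (\<forall>k. g k \<in> hardy_orlicz \<mu> n) \<and>
     (\<forall>\<epsilon>>0. \<exists>N. \<forall>k\<ge>N. \<forall>l\<ge>N. hardy_orlicz_norm \<mu> n (\<lambda>x. g k x - g l x) < \<epsilon>) \<and>
     dist_limit \<mu> g T)"

definition in_L1_plus_hardy_orlicz ::
  "'a::euclidean_space measure \<Rightarrow> nat \<Rightarrow> (('a \<Rightarrow> real) \<Rightarrow> real) \<Rightarrow> bool" where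
  "in_L1_plus_hardy_orlicz \<mu> n T \<longleftrightarrow> (\<exists>u v.
     integrable \<mu> u \<and> hardy_orlicz_dist \<mu> n v \<and>
     (\<forall>\<phi>\<in>test_functions. T \<phi> = (\<integral>x. u x * \<phi> x \<partial>\<mu>) + v \<phi>))"

end

theory Submission
  imports Defs
begin

text \<open>Of \<open>f\<close> only two facts are used, and both survive truncation of \<open>f\<close>: the numbers
  \<open>c Q = f\<^bsub>Q~\<^esub>\<close> satisfy \<open>|c Q - c R| \<le> A S\<^bsub>Q,R\<^esub>\<close>, and \<open>f - c Q\<close> has bounded mean over
  every cube \<open>Q\<close>. For a truncation \<open>f'\<close> the integral of \<open>f' h \<phi>\<close> converges absolutely, which identifies
  \<open>\<Sum>j. \<integral> f b\<^sub>j \<phi>\<close> with a limit not depending on the decomposition of \<open>h\<close>.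

  To place the product, \<open>h\<close> is decomposed anew, into blocks carried by two cubes \<open>P \<subseteq> R\<close> with
  \<open>S\<^bsub>P,R\<^esub>\<close> bounded: the cube \<open>Q\<close> of an atom is joined to \<open>R\<close> by a chain of doubling cubes, whose number
  of links is paid for by the factor \<open>1 / S\<^bsub>Q,R\<^esub>\<close> in the size of the atom. For such a block \<open>\<beta>\<close> both
  its maximal function \<open>M \<beta>\<close> and \<open>|f - c R| M \<beta>\<close> have integrals bounded by the size of \<open>\<beta>\<close>. So the
  maximal function of \<open>\<Sum>j. c R\<^sub>j \<beta>\<^sub>j\<close> is at most \<open>|f| G + E\<close> with \<open>G\<close> and \<open>E\<close> integrable. By a
  John--Nirenberg argument along cubes that are doubling at almost every point, \<open>|f|\<close> is
  exponentially integrable with a polynomial weight, and this puts \<open>|f| G\<close> into the Orlicz space,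
  while \<open>\<Sum>j. (f - c R\<^sub>j) \<beta>\<^sub>j\<close> converges in \<open>L\<^sup>1\<close>.\<close>

section \<open>Cubes and density sums\<close>

text \<open>The definition of atomic blocks controls sums of densities, but not such sums weighted
  by \<open>f\<close>. Between the cube \<open>Q\<close> of an atom and \<open>R\<close> the maximal
  function of the atom decays only like the inverse \<open>n\<close>-th power of the distance.
  Summed over the scales this costs one factor S = \<open>S_coeff \<mu> n Q R\<close>, which the
  normalisation of the atom cancels. With the weight \<open>|f - c R|\<close>, which near
  \<open>Q\<close> may itself be of order S, the same sum can be of order S squared, and one factor
  S remains. Splitting the atom along a chain distributes this loss: each link sees only a bounded
  part of S, there are at most about S links, and each has size about 1 / S. A second obstacle is
  that the numbers \<open>c R\<close> are unbounded, so that even pairing \<open>c R\<close> times a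
  block with a test function needs an argument. For small \<open>R\<close> the block has integral 0,
  and the smoothness of the test function beats the logarithmic growth of \<open>c R\<close>; for
  large \<open>R\<close> the normalisation of the atoms beats the growth of \<open>c R\<close> on
  the support of the test function.\<close>

lemma mem_cube_set: "(y :: 'a::euclidean_space) \<in> cube_set (Cube c l) \<longleftrightarrow> infnorm (y - c) \<le> l / 2"
proof -
  have "infnorm (y - c) \<le> l / 2 \<longleftrightarrow> (\<forall>i\<in>Basis. \<bar>(y - c) \<bullet> i\<bar> \<le> l / 2)"
    unfolding infnorm_Max by (subst Max_le_iff) auto
  also have "\<dots> \<longleftrightarrow> y \<in> cube_set (Cube c l)"
    unfolding cube_set.simps mem_box
  proof (intro ball_cong refl)
    fix i :: 'a assume "i \<in> Basis"
    then have e: "(c - (l / 2) *\<^sub>R One) \<bullet> i = c \<bullet> i - l / 2" "(c + (l / 2) *\<^sub>R One) \<bullet> i = c \<bullet> i + l / 2"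
      by (simp_all add: inner_diff_left inner_add_left)
    show "(\<bar>(y - c) \<bullet> i\<bar> \<le> l / 2) =
      ((c - (l / 2) *\<^sub>R One) \<bullet> i \<le> y \<bullet> i \<and> y \<bullet> i \<le> (c + (l / 2) *\<^sub>R One) \<bullet> i)"
      unfolding e inner_diff_left[of y c] by arith
  qed
  finally show ?thesis by simp
qed

lemma bounded_cube: "bounded (cube_set (Cube c l))" and closed_cube: "closed (cube_set Q)"
  by simp (cases Q; auto intro: closed_cbox)

declare cube_set.simps(1) [simp del] S_coeff.simps(1,2) [simp del]

lemma cube_subsetI:
  assumes "infnorm (x - y) + r / 2 \<le> s / 2"
  shows "cube_set (Cube x r) \<subseteq> cube_set (Cube y s)"
proof
  fix z assume "z \<in> cube_set (Cube x r)"
  then have "infnorm (z - x) \<le> r / 2" by (simp add: mem_cube_set)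
  moreover have "infnorm (z - y) \<le> infnorm (z - x) + infnorm (x - y)"
    using infnorm_triangle[of "z - x" "x - y"] by simp
  ultimately show "z \<in> cube_set (Cube y s)" using assms by (simp add: mem_cube_set)
qed

lemma cube_mono: "r \<le> s \<Longrightarrow> cube_set (Cube x r) \<subseteq> cube_set (Cube x s)"
  by (rule cube_subsetI) (simp add: infnorm_0)

lemma centre_in_cube: "0 \<le> r \<Longrightarrow> x \<in> cube_set (Cube x r)"
  by (simp add: mem_cube_set infnorm_0)

text \<open>The sign of a coordinate that attains the norm is unknown, but one of the two diagonal
  shifts moves this coordinate away from 0. The lemma provides a far corner of a cube in
  \<open>cube_subset_centre\<close>.\<close>

lemma infnorm_add_One:
  fixes v :: "'a::euclidean_space"
  obtains w where "w = v + t *\<^sub>R One \<or> w = v - t *\<^sub>R One" "infnorm w \<ge> infnorm v + \<bar>t\<bar>"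
proof -
  obtain b :: 'a where b: "b \<in> Basis" "infnorm v = \<bar>v \<bullet> b\<bar>"
    using Max_in[of "(\<lambda>i. \<bar>v \<bullet> i\<bar>) ` Basis"] by (force simp: infnorm_Max simp del: Max_in)
  have "(v + t *\<^sub>R One) \<bullet> b = v \<bullet> b + t" "(v - t *\<^sub>R One) \<bullet> b = v \<bullet> b - t"
    using b by (auto simp: inner_add_left inner_diff_left)
  then have "\<bar>(v + t *\<^sub>R One) \<bullet> b\<bar> \<ge> \<bar>v \<bullet> b\<bar> + \<bar>t\<bar> \<or> \<bar>(v - t *\<^sub>R One) \<bullet> b\<bar> \<ge> \<bar>v \<bullet> b\<bar> + \<bar>t\<bar>"
    by linarith
  then show ?thesis
    using that[of "v + t *\<^sub>R One"] that[of "v - t *\<^sub>R One"] b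
      Basis_le_infnorm[OF b(1), of "v + t *\<^sub>R One"] Basis_le_infnorm[OF b(1), of "v - t *\<^sub>R One"]
    by (metis order_trans)
qed

text \<open>Converse of \<open>cube_subsetI\<close>: one of the two opposite corners of the inner
  cube, reached from \<open>x\<close> by adding or subtracting \<open>r / 2\<close> in all
  coordinates, is at least \<open>infnorm (x - y) + r / 2\<close> away from
  \<open>y\<close>.\<close>

lemma cube_subset_centre:
  assumes "cube_set (Cube x r) \<subseteq> cube_set (Cube y s)" "0 \<le> r"
  shows "infnorm (x - y) + r / 2 \<le> s / 2"
proof -
  have o: "infnorm (t *\<^sub>R One :: 'a) = \<bar>t\<bar>" for t
    by (simp add: infnorm_mul) (simp add: infnorm_Max)
  obtain w where w: "w = (x - y) + (r/2) *\<^sub>R One \<or> w = (x - y) - (r/2) *\<^sub>R One"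
      "infnorm w \<ge> infnorm (x - y) + \<bar>r/2\<bar>" by (rule infnorm_add_One)
  have "infnorm (y + w - x) \<le> r/2" using w(1) assms(2) o[of "r/2"] by (auto simp: infnorm_neg)
  then have "y + w \<in> cube_set (Cube y s)" using assms(1) by (auto simp add: mem_cube_set)
  then show ?thesis using w assms(2) by (simp add: mem_cube_set)
qed

lemma cube_subset_side:
  assumes "cube_set (Cube x r) \<subseteq> cube_set (Cube y s)" "0 \<le> r"
  shows "r \<le> s" "infnorm (x - y) \<le> s / 2"
  using cube_subset_centre[OF assms] infnorm_pos_le[of "x - y"] assms(2) by linarith+

lemma Whole_subset: "cube_set Whole \<subseteq> cube_set R \<longleftrightarrow> R = (Whole :: 'a::euclidean_space cube)"
proof (cases R)
  case (Cube c l)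
  have "c + (\<bar>l\<bar> + 1) *\<^sub>R One \<notin> cube_set (Cube c l)"
    unfolding mem_cube_set by (simp add: infnorm_mul) (simp add: infnorm_Max)
  then show ?thesis using Cube by (metis UNIV_I cube.distinct(1) cube_set.simps(2) subsetD)
qed simp

lemma compact_subset_cube:
  assumes "bounded (K :: 'a::euclidean_space set)"
  obtains r where "r > 0" "K \<subseteq> cube_set (Cube x r)"
proof -
  obtain B where B: "\<And>y. y \<in> K \<Longrightarrow> norm (y - x) \<le> B"
    using assms by (metis bounded_any_center dist_norm norm_minus_commute)
  have "K \<subseteq> cube_set (Cube x (2 * \<bar>B\<bar> + 1))"
    using order_trans[OF infnorm_le_norm B] by (fastforce simp: mem_cube_set)
  then show ?thesis using that[of "2 * \<bar>B\<bar> + 1"] by auto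
qed

section \<open>Dyadic levels of side lengths\<close>

definition level :: "real \<Rightarrow> int" where "level r = \<lfloor>log 2 r\<rfloor>"

lemma powi_le_iff: "(2::real) powi a \<le> 2 powi b \<longleftrightarrow> a \<le> b"
  by (metis linorder_not_le one_less_numeral_iff power_int_increasing power_int_strict_increasing
      semiring_norm(76) less_imp_le)

lemma powi_less_iff: "(2::real) powi a < 2 powi b \<longleftrightarrow> a < b"
  using powi_le_iff[of b a] by linarith

lemma powr_powi: "2 powr of_int k = (2::real) powi k"
  by (metis powr_real_of_int' zero_less_numeral zero_le_numeral zero_neq_numeral)

lemma level_bounds:
  assumes "r > 0" shows "2 powi level r \<le> r" "r < 2 powi (level r + 1)"
proof -
  have "2 powr of_int (level r) \<le> r"
    using assms of_int_floor_le[of "log 2 r"] le_log_iff[of 2 r "of_int (level r)"]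
      by (simp add: level_def)
  then show "2 powi level r \<le> r" by (simp add: powr_powi)
  have "log 2 r < of_int (level r + 1)" unfolding level_def by linarith
  then have "r < 2 powr of_int (level r + 1)" using assms by (simp add: log_less_iff)
  then show "r < 2 powi (level r + 1)" by (metis powr_powi)
qed

lemma level_mono: "0 < r \<Longrightarrow> r \<le> s \<Longrightarrow> level r \<le> level s"
  unfolding level_def by (intro floor_mono) auto

lemma level_unique: "2 powi k \<le> r \<Longrightarrow> r < 2 powi (k + 1) \<Longrightarrow> level r = k"
proof -
  assume a: "2 powi k \<le> r" "r < 2 powi (k + 1)"
  then have r: "r > 0" by (meson less_le_trans zero_less_numeral zero_less_power_int)
  have "(2::real) powi k < 2 powi (level r + 1)" "(2::real) powi level r < 2 powi (k+1)"
    using level_bounds[OF r] a by linarith+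
  then show ?thesis unfolding powi_less_iff by linarith
qed

lemma level_mult_power: "r > 0 \<Longrightarrow> level (2 ^ k * r) = level r + int k"
proof (rule level_unique)
  assume r: "r > 0"
  have e: "2 powi (level r + int k) = 2 ^ k * (2::real) powi (level r)"
       "2 powi (level r + int k + 1) = 2 ^ k * (2::real) powi (level r + 1)"
    by (simp_all add: power_int_add)
  show "2 powi (level r + int k) \<le> 2 ^ k * r" "2 ^ k * r < 2 powi (level r + int k + 1)"
    unfolding e using level_bounds[OF r] by auto
qed

lemma level_powi [simp]: "level (2 powi k) = k"
  by (rule level_unique) (auto simp: powi_less_iff)

text \<open>The growth constant is taken to be at least 1, which enlarging it achieves, so that
  additive constants can be absorbed into multiples of \<open>C\<close>.\<close>

locale growth_space =
  fixes \<mu> :: "'a::euclidean_space measure" and n :: nat and C :: real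
  assumes n_pos: "0 < n" and n_le: "n \<le> DIM('a)" and growth: "growth_measure \<mu> n C" and C1: "1 \<le> C"
begin

definition "mass x r = measure \<mu> (cube_set (Cube x r))"
definition "dens x r = mass x r / r ^ n"

text \<open>Up to constants, \<open>dens_sum x (level r) (level s)\<close> is \<open>S\<^bsub>Q,R\<^esub> - 1\<close> for cubes of side lengths \<open>r \<le> s\<close>
  with \<open>Q\<close> centred at \<open>x\<close>; unlike \<open>S\<^bsub>Q,R\<^esub>\<close> it is additive in the scales.\<close>

definition "dens_sum x p q = (\<Sum>k\<in>{p<..q}. dens x (2 powi k))"

section \<open>Masses of cubes, the support and density sums\<close>

lemma sets_mu [measurable_cong, simp]: "sets \<mu> = sets borel"
  using growth by (simp add: growth_measure_def)

lemma space_mu [simp]: "space \<mu> = UNIV"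
  using sets_eq_imp_space_eq[OF sets_mu] by simp

lemma measurable_mu: "f \<in> measurable \<mu> N \<longleftrightarrow> f \<in> measurable borel N"
  using measurable_cong_sets[OF sets_mu refl] by blast

lemma cube_sets [measurable, simp]: "cube_set Q \<in> sets borel"
  by (simp add: borel_closed closed_cube)

lemma bounded_finite:
  assumes "bounded S" shows "emeasure \<mu> S < \<infinity>"
proof -
  obtain r where r: "r > 0" "S \<subseteq> ball 0 r"
    using assms bounded_subset_ballD by blast
  have "emeasure \<mu> S \<le> emeasure \<mu> (ball 0 r)" using r by (intro emeasure_mono) auto
  also have "\<dots> \<le> ennreal (C * r ^ n)" using growth r by (auto simp: growth_measure_def)
  finally show ?thesis by (simp add: le_less_trans)
qed

lemma cube_finite: "emeasure \<mu> (cube_set (Cube x r)) < \<infinity>"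
  by (rule bounded_finite) (rule bounded_cube)

lemma is_cube_finite: "is_cube \<mu> Q \<Longrightarrow> emeasure \<mu> (cube_set Q) < \<infinity>"
  using cube_finite by (cases Q) (auto simp del: cube_set.simps(1))

lemma is_cube_scale: "is_cube \<mu> Q \<Longrightarrow> a > 0 \<Longrightarrow> is_cube \<mu> (cube_scale a Q)"
  by (cases Q) auto

lemma emeasure_cube: "is_cube \<mu> Q \<Longrightarrow> emeasure \<mu> (cube_set Q) = ennreal (mcube \<mu> Q)"
  using is_cube_finite[of Q] by (intro emeasure_eq_ennreal_measure) auto

lemma emeasure_mass: "emeasure \<mu> (cube_set (Cube x r)) = ennreal (mass x r)"
  using cube_finite[of x r] unfolding mass_def by (intro emeasure_eq_ennreal_measure) auto

lemma mass_nonneg [simp]: "0 \<le> mass x r" by (simp add: mass_def)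

lemma mass_le: assumes "x \<in> msupport \<mu>" "r > 0" shows "mass x r \<le> C * r ^ n"
proof -
  have "emeasure \<mu> (cube_set (Cube x r)) \<le> ennreal (C * r ^ n)"
    using growth assms by (simp add: growth_measure_def)
  then show ?thesis using emeasure_mass[of x r] C1 assms
    by (metis ennreal_le_iff mult_nonneg_nonneg zero_le_power less_imp_le order_trans zero_le_one)
qed

lemma mass_subset: "cube_set (Cube x r) \<subseteq> cube_set (Cube y s) \<Longrightarrow> mass x r \<le> mass y s"
  using cube_finite[of y s]
    by (auto simp: mass_def less_top intro!: measure_mono_fmeasurable fmeasurableI)

lemma mass_mono: "r \<le> s \<Longrightarrow> mass x r \<le> mass x s"
  by (intro mass_subset cube_mono)

lemma mcube_mono: "is_cube \<mu> R \<Longrightarrow> cube_set Q \<subseteq> cube_set R \<Longrightarrow> mcube \<mu> Q \<le> mcube \<mu> R"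
  using is_cube_finite[of R] by (auto simp: less_top intro!: measure_mono_fmeasurable fmeasurableI)

lemma mass_pos: assumes "x \<in> msupport \<mu>" "r > 0" shows "0 < mass x r"
proof -
  have "ball x (r/2) \<subseteq> cube_set (Cube x r)"
    unfolding mem_cube_set subset_iff mem_ball dist_norm
    by (metis infnorm_le_norm infnorm_sub less_imp_le order_trans)
  then have "emeasure \<mu> (ball x (r/2)) \<le> emeasure \<mu> (cube_set (Cube x r))"
    by (intro emeasure_mono) auto
  moreover have "emeasure \<mu> (ball x (r/2)) > 0" using assms by (auto simp: msupport_def)
  ultimately show ?thesis unfolding emeasure_mass
    by (metis ennreal_less_zero_iff less_le_trans)
qed

text \<open>The complement of the support is a union of null balls, and by the Lindelof property
  countably many of them have the same union.\<close>

lemma AE_msupport: "AE x in \<mu>. x \<in> msupport \<mu>"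
proof -
  let ?F = "{ball x r |x r. r > 0 \<and> emeasure \<mu> (ball x r) = 0}"
  obtain F' where F': "F' \<subseteq> ?F" "countable F'" "\<Union>F' = \<Union>?F"
    by (rule Lindelof[of ?F]) auto
  have "emeasure \<mu> (\<Union>F') = 0"
  proof -
    have "F' \<subseteq> null_sets \<mu>" using F'(1) by (auto simp: null_sets_def)
    then have "(\<Union>x\<in>F'. x) \<in> null_sets \<mu>" using F'(2) by (intro null_sets_UN') auto
    then show ?thesis by (simp add: null_sets_def)
  qed
  moreover have "\<Union>F' \<in> sets borel" using F'(1) by (intro borel_open open_Union) auto
  ultimately have "AE x in \<mu>. x \<notin> \<Union>F'" by (intro AE_not_in) (auto simp: null_sets_def)
  moreover have "x \<in> msupport \<mu>" if "x \<notin> \<Union>F'" for x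
  proof -
    have "emeasure \<mu> (ball x r) > 0" if "r > 0" for r
    proof (rule ccontr)
      assume "\<not> emeasure \<mu> (ball x r) > 0"
      then have "ball x r \<in> ?F" using \<open>r > 0\<close> by (auto simp: not_gr_zero)
      then have "x \<in> \<Union>?F" using \<open>r > 0\<close> by (meson UnionI centre_in_ball)
      then show False using F'(3) \<open>x \<notin> \<Union>F'\<close> by blast
    qed
    then show ?thesis by (simp add: msupport_def)
  qed
  ultimately show ?thesis by (auto elim!: eventually_mono)
qed

lemma dens_nonneg: "r > 0 \<Longrightarrow> 0 \<le> dens x r" by (simp add: dens_def)

lemma dens_le: "x \<in> msupport \<mu> \<Longrightarrow> r > 0 \<Longrightarrow> dens x r \<le> C"
  using mass_le[of x r] by (simp add: dens_def field_simps)

lemma dens_compare: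
  assumes "cube_set (Cube x r) \<subseteq> cube_set (Cube y s)" "s \<le> c * r" "0 < r" "0 < s"
  shows "dens x r \<le> c ^ n * dens y s"
proof -
  have "mass x r * s ^ n \<le> mass y s * (c * r) ^ n"
    using assms mass_subset by (intro mult_mono power_mono) auto
  then show ?thesis using assms by (simp add: dens_def field_simps power_mult_distrib)
qed

lemma dens_sum_nonneg: "0 \<le> dens_sum x p q"
  unfolding dens_sum_def by (intro sum_nonneg dens_nonneg) auto

lemma dens_sum_split: "dens_sum x p r \<le> dens_sum x p q + dens_sum x q r"
proof -
  have "dens_sum x p r \<le> (\<Sum>k\<in>{p<..q} \<union> {q<..r}. dens x (2 powi k))"
    unfolding dens_sum_def by (intro sum_mono2 dens_nonneg) auto
  also have "\<dots> \<le> dens_sum x p q + dens_sum x q r" unfolding dens_sum_def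
    by (subst sum_Un) (auto intro!: sum_nonneg dens_nonneg)
  finally show ?thesis .
qed

lemma dens_sum_mono: "p' \<le> p \<Longrightarrow> q \<le> q' \<Longrightarrow> dens_sum x p q \<le> dens_sum x p' q'"
  unfolding dens_sum_def by (intro sum_mono2 dens_nonneg) auto

lemma dens_sum_bound: "x \<in> msupport \<mu> \<Longrightarrow> dens_sum x p q \<le> C * nat (q - p)"
  unfolding dens_sum_def using sum_bounded_above[of "{p<..q}" "\<lambda>k. dens x (2 powi k)" C]
  by (auto simp: dens_le mult.commute)

text \<open>At scales above the distance of the centres, a cube about \<open>x\<close> lies in the
  cube of four times its side about \<open>y\<close>. This costs the factor \<open>4 ^ n\<close> and
  moves the range of scales up by two, which the term \<open>2 * C\<close> repays.\<close>

lemma dens_sum_shift: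
  assumes "y \<in> msupport \<mu>" "infnorm (x - y) \<le> 2 powi p"
  shows "dens_sum x p q \<le> 4 ^ n * (dens_sum y p q + 2 * C)"
proof -
  have "dens_sum x p q \<le> (\<Sum>k\<in>{p<..q}. 4 ^ n * dens y (2 powi (k + 2)))"
    unfolding dens_sum_def
  proof (rule sum_mono)
    fix k assume k: "k \<in> {p<..q}"
    have "2 powi p \<le> (2::real) powi k" using k by (simp add: powi_le_iff)
    moreover have e: "(2::real) powi (k + 2) = 4 * 2 powi k" by (simp add: power_int_add)
    moreover have "(0::real) < 2 powi k" by simp
    ultimately show "dens x (2 powi k) \<le> 4 ^ n * dens y (2 powi (k + 2))"
      using assms unfolding e by (intro dens_compare cube_subsetI) (linarith, auto)
  qed
  also have "\<dots> = 4 ^ n * dens_sum y (p + 2) (q + 2)"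
  proof -
    have "(\<Sum>k\<in>{p<..q}. dens y (2 powi (k + 2))) = dens_sum y (p + 2) (q + 2)" unfolding dens_sum_def
      by (rule sum.reindex_bij_witness[where i="\<lambda>k. k - 2" and j="\<lambda>k. k + 2"]) auto
    then show ?thesis by (simp add: sum_distrib_left[symmetric])
  qed
  also have "\<dots> \<le> 4 ^ n * (dens_sum y p q + 2 * C)"
  proof -
    have "dens_sum y (p + 2) (q + 2) \<le> dens_sum y p q + dens_sum y q (q + 2)"
      using dens_sum_split[of y "p+2" "q+2" q] dens_sum_mono[of p "p+2" q q y] by linarith
    then show ?thesis using dens_sum_bound[OF assms(1), of q "q+2"] by auto
  qed
  finally show ?thesis .
qed

text \<open>The coefficients S run through the side lengths \<open>2 ^ k * r\<close>, density sums
  through powers of two. As \<open>2 ^ k * r\<close> lies between two consecutive powers of two,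
  passing to the larger of two neighbouring cubes costs only \<open>2 ^ n\<close>.\<close>

lemma dens_sum_dens_sum:
  assumes "r > 0" "x \<in> msupport \<mu>"
  shows "(\<Sum>k=1..N. dens x (2 ^ k * r)) \<le> 2 ^ n * dens_sum x (level r) (level r + int N + 1)"
    and "dens_sum x (level r) (level r + int N) \<le> 2 ^ n * (\<Sum>k=1..N. dens x (2 ^ k * r))"
proof -
  note b = level_bounds[OF assms(1)]
  have "(\<Sum>k=1..N. dens x (2 ^ k * r)) \<le> (\<Sum>k=1..N. 2 ^ n * dens x (2 powi (level r + int k + 1)))"
  proof (rule sum_mono)
    fix k
    have "2 powi (level r + int k + 1) = 2 ^ k * (2::real) powi (level r + 1)"
         "2 powi (level r + int k + 1) = 2 * (2 ^ k * (2::real) powi (level r))"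
      by (simp_all add: power_int_add)
    then show "dens x (2 ^ k * r) \<le> 2 ^ n * dens x (2 powi (level r + int k + 1))"
      using b assms by (intro dens_compare cube_mono) auto
  qed
  also have "\<dots> = 2 ^ n * (\<Sum>k\<in>{level r + 1<..level r + int N + 1}. dens x (2 powi k))"
    unfolding sum_distrib_left[symmetric]
    by (intro arg_cong[where f="(*) (2^n)"]
          sum.reindex_bij_witness[where i="\<lambda>k. nat (k - level r - 1)" and j="\<lambda>k. level r + int k + 1"]) auto
  also have "\<dots> \<le> 2 ^ n * dens_sum x (level r) (level r + int N + 1)"
    unfolding dens_sum_def by (intro mult_left_mono sum_mono2) (auto intro: dens_nonneg)
  finally show "(\<Sum>k=1..N. dens x (2 ^ k * r)) \<le> 2 ^ n * dens_sum x (level r) (level r + int N + 1)" .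
  have "dens_sum x (level r) (level r + int N) = (\<Sum>k=1..N. dens x (2 powi (level r + int k)))"
    unfolding dens_sum_def
    by (intro sum.reindex_bij_witness[where j="\<lambda>k. nat (k - level r)" and i="\<lambda>k. level r + int k"]) auto
  also have "\<dots> \<le> (\<Sum>k=1..N. 2 ^ n * dens x (2 ^ k * r))"
  proof (rule sum_mono)
    fix k
    have "2 * 2 powi (level r + int k) = 2 ^ k * (2::real) powi (level r + 1)"
         "2 powi (level r + int k) = (2 ^ k * (2::real) powi (level r))"
      by (simp_all add: power_int_add)
    then show "dens x (2 powi (level r + int k)) \<le> 2 ^ n * dens x (2 ^ k * r)"
      using b assms by (intro dens_compare cube_mono) auto
  qed
  finally show "dens_sum x (level r) (level r + int N) \<le> 2 ^ n * (\<Sum>k=1..N. dens x (2 ^ k * r))"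
    by (simp add: sum_distrib_left)
qed

section \<open>Comparison of the coefficients S with density sums\<close>

definition "Nst r s = (LEAST k::nat. k > 0 \<and> 2 ^ k * r \<ge> (s::real))"

lemma Nst: assumes "0 < r" "r \<le> s"
  shows "0 < Nst r s" "s \<le> 2 ^ Nst r s * r" "\<And>k. k > 0 \<Longrightarrow> s \<le> 2 ^ k * r \<Longrightarrow> Nst r s \<le> k"
    "int (Nst r s) \<le> level s - level r + 1" "level s - level r \<le> int (Nst r s)"
proof -
  obtain k :: nat where "s / r < 2 ^ k" using real_arch_pow[of 2 "s/r"] by auto
  then have "Suc k > 0 \<and> 2 ^ Suc k * r \<ge> s" using assms by (auto simp: field_simps)
  then have *: "Nst r s > 0 \<and> 2 ^ Nst r s * r \<ge> s"
    unfolding Nst_def by (rule LeastI)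
  then show "0 < Nst r s" "s \<le> 2 ^ Nst r s * r" by auto
  show L: "Nst r s \<le> k" if "k > 0" "s \<le> 2 ^ k * r" for k
    unfolding Nst_def using that by (intro Least_le) auto
  have "level s \<le> level (2 ^ Nst r s * r)" using * assms by (intro level_mono) auto
  then show "level s - level r \<le> int (Nst r s)" using assms by (simp add: level_mult_power)
  show "int (Nst r s) \<le> level s - level r + 1"
  proof (rule ccontr)
    assume a: "\<not> int (Nst r s) \<le> level s - level r + 1"
    have "level r \<le> level s" using assms by (intro level_mono) auto
    with a have g: "Nst r s - 1 > 0" by linarith
    then have "2 ^ (Nst r s - 1) * r < s" using L[of "Nst r s - 1"] *
      by (metis diff_less less_le_not_le linorder_le_less_linear zero_less_one)
    then have "level (2 ^ (Nst r s - 1) * r) \<le> level s" using assms by (intro level_mono) auto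
    then show False using a g assms by (simp add: level_mult_power of_nat_diff)
  qed
qed

lemma S_Cube: "S_coeff \<mu> n (Cube x r) (Cube y s) = 1 + (\<Sum>k=1..Nst r s. dens x (2 ^ k * r))"
  by (simp add: Nst_def dens_def mass_def S_coeff.simps)

lemma S_Whole: "S_coeff \<mu> n (Cube x r) Whole = 1 + (\<Sum>k. dens x (2 ^ Suc k * r))"
  by (simp add: dens_def mass_def S_coeff.simps)

text \<open>For finite total mass the numerators are bounded, and since \<open>n\<close> is at least
  1 the denominators grow at least geometrically.\<close>

lemma summable_dens:
  assumes "emeasure \<mu> UNIV < \<infinity>" "r > 0"
  shows "summable (\<lambda>k. dens x (2 ^ Suc k * r))"
proof (rule summable_comparison_test[of _ "\<lambda>k. measure \<mu> UNIV / r ^ n * (1/2) ^ k"])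
  show "summable (\<lambda>k. measure \<mu> UNIV / r ^ n * (1/2) ^ k)"
    by (intro summable_mult summable_geometric) auto
  have "norm (dens x (2 ^ Suc k * r)) \<le> measure \<mu> UNIV / r ^ n * (1/2) ^ k" for k
  proof -
    have "mass x (2 ^ Suc k * r) \<le> measure \<mu> UNIV"
      using assms mcube_mono[of Whole "Cube x (2 ^ Suc k * r)"] by (simp add: mass_def)
    moreover have "(2::real) ^ k * r ^ n \<le> (2 ^ Suc k * r) ^ n"
    proof -
      have "(2::real) ^ k \<le> 2 ^ Suc k" by simp
      also have "(2::real) ^ Suc k \<le> (2 ^ Suc k) ^ n" using n_pos
        by (intro self_le_power one_le_power) auto
      finally show ?thesis using assms by (simp add: power_mult_distrib)
    qed
    ultimately have "mass x (2 ^ Suc k * r) / (2 ^ Suc k * r) ^ n \<le> measure \<mu> UNIV / (2 ^ k * r ^ n)"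
      using assms by (intro frac_le) auto
    then show ?thesis using assms dens_nonneg[of "2 ^ Suc k * r" x] by (simp add: dens_def field_simps)
  qed
  then show "\<exists>N. \<forall>k\<ge>N. norm (dens x (2 ^ Suc k * r)) \<le> measure \<mu> UNIV / r ^ n * (1/2) ^ k" by blast
qed

lemma S_ge_1: assumes "is_cube \<mu> Q" "is_cube \<mu> R" shows "1 \<le> S_coeff \<mu> n Q R"
proof (cases Q)
  case (Cube x r)
  show ?thesis
  proof (cases R)
    case (Cube y s) with \<open>Q = Cube x r\<close> show ?thesis using assms
      by (simp only: S_Cube) (auto intro!: sum_nonneg dens_nonneg)
  next
    case Whole with \<open>Q = Cube x r\<close> show ?thesis using assms summable_dens[of r x]
      by (simp only: S_Whole) (auto intro!: suminf_nonneg dens_nonneg)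
  qed
qed simp

text \<open>The last cube of the sum may exceed \<open>level s\<close> by up to two levels after
  rounding; the term \<open>2 * C\<close> pays for them.\<close>

lemma S_le_dens_sum:
  assumes "x \<in> msupport \<mu>" "0 < r" "r \<le> s"
  shows "S_coeff \<mu> n (Cube x r) (Cube y s) \<le> 1 + 2 ^ n * (dens_sum x (level r) (level s) + 2 * C)"
proof -
  have "(\<Sum>k=1..Nst r s. dens x (2 ^ k * r)) \<le> 2 ^ n * dens_sum x (level r) (level r + int (Nst r s) + 1)"
    using assms by (intro dens_sum_dens_sum) auto
  also have "\<dots> \<le> 2 ^ n * dens_sum x (level r) (level s + 2)"
    using Nst(4)[of r s] assms by (intro mult_left_mono dens_sum_mono) auto
  also have "\<dots> \<le> 2 ^ n * (dens_sum x (level r) (level s) + 2 * C)"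
    using dens_sum_split[of x "level r" "level s + 2" "level s"] dens_sum_bound[OF assms(1), of "level s" "level s + 2"]
      by simp
  finally show ?thesis by (simp add: S_Cube)
qed

lemma dens_sum_le_S:
  assumes "x \<in> msupport \<mu>" "0 < r" "r \<le> s"
  shows "dens_sum x (level r) (level s) \<le> 2 ^ n * S_coeff \<mu> n (Cube x r) (Cube y s)"
proof -
  have "dens_sum x (level r) (level s) \<le> dens_sum x (level r) (level r + int (Nst r s))"
    using Nst(5)[of r s] assms by (intro dens_sum_mono) auto
  also have "\<dots> \<le> 2 ^ n * (\<Sum>k=1..Nst r s. dens x (2 ^ k * r))" using assms
    by (intro dens_sum_dens_sum) auto
  finally show ?thesis by (simp add: S_Cube distrib_left add_increasing)
qed

lemma dens_sum_le_S_Whole: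
  assumes "x \<in> msupport \<mu>" "0 < r" "emeasure \<mu> UNIV < \<infinity>"
  shows "dens_sum x (level r) q \<le> 2 ^ n * S_coeff \<mu> n (Cube x r) Whole"
proof -
  let ?N = "nat (q - level r)"
  have "dens_sum x (level r) q \<le> dens_sum x (level r) (level r + int ?N)" by (intro dens_sum_mono) auto
  also have "\<dots> \<le> 2 ^ n * (\<Sum>k=1..?N. dens x (2 ^ k * r))" using assms by (intro dens_sum_dens_sum) auto
  also have "(\<Sum>k=1..?N. dens x (2 ^ k * r)) = (\<Sum>k<?N. dens x (2 ^ Suc k * r))"
    using sum.atLeast1_atMost_eq[of "\<lambda>k. dens x (2 ^ k * r)" ?N] by simp
  also have "\<dots> \<le> (\<Sum>k. dens x (2 ^ Suc k * r))"
    using assms summable_dens[of r x] by (intro sum_le_suminf) (auto intro: dens_nonneg)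
  finally show ?thesis by (simp add: S_Whole distrib_left add_increasing)
qed

text \<open>Along a chain of non-doubling cubes the densities grow geometrically, while they stay bounded.\<close>

lemma nondoubling_sum:
  fixes v :: "nat \<Rightarrow> real"
  assumes v: "\<And>k. 0 \<le> v k" "\<And>k. v k \<le> V" and g: "\<gamma> > 1" "\<And>k. k < N \<Longrightarrow> \<gamma> * v k \<le> v (k + m)"
  shows "(\<Sum>k<N. v k) \<le> m * V / (\<gamma> - 1)"
proof -
  have "\<gamma> * (\<Sum>k<N. v k) \<le> (\<Sum>k<N. v (k + m))"
    unfolding sum_distrib_left using g by (intro sum_mono) auto
  also have "\<dots> = (\<Sum>k\<in>{m..<N+m}. v k)"
    by (rule sum.reindex_bij_witness[where i="\<lambda>k. k - m" and j="\<lambda>k. k + m"]) auto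
  also have "\<dots> \<le> (\<Sum>k\<in>{..<N} \<union> {N..<N+m}. v k)" using v by (intro sum_mono2) auto
  also have "\<dots> = (\<Sum>k<N. v k) + (\<Sum>k\<in>{N..<N+m}. v k)" by (intro sum.union_disjoint) auto
  also have "(\<Sum>k\<in>{N..<N+m}. v k) \<le> m * V" using sum_bounded_above[of "{N..<N+m}" v V] v by simp
  finally show ?thesis using g by (simp add: field_simps)
qed

text \<open>This is what makes a sequence of dilates meet a doubling cube: along multiples of
  \<open>m\<close> a positive initial density would otherwise grow geometrically beyond the bound
  \<open>V\<close>.\<close>

lemma nondoubling_unbounded:
  fixes v :: "nat \<Rightarrow> real"
  assumes "v 0 > 0" "\<And>k. 0 \<le> v k" "\<And>k. v k \<le> V" and g: "\<gamma> > 1" "\<And>k. \<gamma> * v k \<le> v (k + m)"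
  shows False
proof -
  have *: "\<gamma> ^ i * v 0 \<le> v (i * m)" for i
  proof (induction i)
    case (Suc i)
    have "\<gamma> ^ Suc i * v 0 \<le> \<gamma> * v (i * m)" using Suc g by simp
    also have "\<dots> \<le> v (i * m + m)" by (rule g)
    finally show ?case by (simp add: add.commute)
  qed simp
  obtain i where "V / v 0 < \<gamma> ^ i" using real_arch_pow[OF g(1)] by auto
  then show False using *[of i] assms(1) assms(3)[of "i*m"] by (simp add: field_simps)
qed

end

section \<open>Oscillation relative to a function on cubes\<close>

text \<open>One point of \<open>A\<close> is chosen in every occupied cell of a grid of mesh
  \<open>r / (2 * M)\<close>; the cube of side \<open>r / M\<close> about it covers the cell. The
  centres have to lie in \<open>A\<close> because cubes must be centred in the support. Each
  coordinate has \<open>2 * M + 1\<close> possible cell indices, from \<open>- M\<close> to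
  \<open>M\<close>.\<close>

lemma grid_cover:
  fixes A :: "'a::euclidean_space set" and M :: nat
  assumes A: "A \<subseteq> cube_set (Cube x r)" and r: "r > 0" and M: "M > 0"
  obtains F where "finite F" "F \<subseteq> A" "card F \<le> (2 * M + 1) ^ DIM('a)"
    "A \<subseteq> (\<Union>y\<in>F. cube_set (Cube y (r / M)))"
proof -
  define g where "g y = (\<lambda>i\<in>(Basis::'a set). \<lfloor>((y - x) \<bullet> i) * (2 * M) / r\<rfloor>)" for y
  let ?P = "(Basis :: 'a set) \<rightarrow>\<^sub>E {- int M..int M}"
  have g: "g y \<in> ?P" if "y \<in> A" for y
  proof -
    have "- int M \<le> \<lfloor>((y - x) \<bullet> i) * (2 * M) / r\<rfloor>" "\<lfloor>((y - x) \<bullet> i) * (2 * M) / r\<rfloor> \<le> int M"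
      if "i \<in> Basis" for i
    proof -
      have "infnorm (y - x) \<le> r/2" using A \<open>y \<in> A\<close> by (auto simp: mem_cube_set)
      then have "\<bar>(y - x) \<bullet> i\<bar> \<le> r/2" using Basis_le_infnorm[OF \<open>i \<in> Basis\<close>, of "y - x"] by linarith
      then have "\<bar>(y - x) \<bullet> i\<bar> * (2 * M) \<le> r/2 * (2 * M)" by (intro mult_right_mono) auto
      then have "\<bar>((y - x) \<bullet> i) * (2 * M)\<bar> \<le> r * M" by (simp add: abs_mult)
      then have "\<bar>((y - x) \<bullet> i) * (2 * M) / r\<bar> \<le> M" using r
        by (simp add: abs_divide divide_le_eq mult.commute)
      then show "- int M \<le> \<lfloor>((y - x) \<bullet> i) * (2 * M) / r\<rfloor>" "\<lfloor>((y - x) \<bullet> i) * (2 * M) / r\<rfloor> \<le> int M"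
        by linarith+
    qed
    then show ?thesis by (auto simp: g_def)
  qed
  have fin: "finite ?P" by (intro finite_PiE) auto
  have finA: "finite (g ` A)" by (rule finite_subset[OF _ fin]) (use g in auto)
  define F where "F = inv_into A g ` g ` A"
  have 1: "finite F" using finA by (simp add: F_def)
  have 2: "F \<subseteq> A" by (auto simp: F_def inv_into_into)
  have "card F \<le> card (g ` A)" unfolding F_def using finA by (rule card_image_le)
  also have "\<dots> \<le> card ?P" using g by (auto intro!: card_mono[OF fin])
  also have "\<dots> = (2 * M + 1) ^ DIM('a)"
  proof -
    have "nat (int M + 1 + int M) = 2 * M + 1" by simp
    then show ?thesis by (simp add: card_PiE)
  qed
  finally have 3: "card F \<le> (2 * M + 1) ^ DIM('a)" .
  have 4: "y \<in> (\<Union>z\<in>F. cube_set (Cube z (r / M)))" if "y \<in> A" for y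
  proof -
    let ?z = "inv_into A g (g y)"
    have z: "g ?z = g y" "?z \<in> F" using that by (auto simp: F_def f_inv_into_f)
    have "\<bar>(y - ?z) \<bullet> i\<bar> \<le> r / M / 2" if i: "i \<in> Basis" for i
    proof -
      have "\<lfloor>((?z - x) \<bullet> i) * (2 * M) / r\<rfloor> = \<lfloor>((y - x) \<bullet> i) * (2 * M) / r\<rfloor>"
        using fun_cong[OF z(1), of i] i by (simp add: g_def)
      then have "\<bar>((y - x) \<bullet> i) * (2 * M) / r - ((?z - x) \<bullet> i) * (2 * M) / r\<bar> < 1" by linarith
      also have "((y - x) \<bullet> i) * (2 * M) / r - ((?z - x) \<bullet> i) * (2 * M) / r = ((y - ?z) \<bullet> i) * ((2 * M) / r)"
        by (simp add: inner_diff_left diff_divide_distrib left_diff_distrib)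
      finally have "\<bar>(y - ?z) \<bullet> i\<bar> * ((2 * M) / r) < 1" using r by (simp add: abs_mult)
      then show ?thesis using r M by (simp add: field_simps)
    qed
    then have "infnorm (y - ?z) \<le> r / M / 2" unfolding infnorm_Max by (subst Max_le_iff) auto
    then show ?thesis using z(2) by (auto simp: mem_cube_set)
  qed
  show ?thesis using that[OF 1 2 3] 4 by blast
qed

context growth_space
begin

lemma dens_sum_bound2: "x \<in> msupport \<mu> \<Longrightarrow> dens_sum x p (p + 2) \<le> 2 * C"
  using dens_sum_bound[of x p "p + 2"] by simp

definition "S_lipschitz c A \<longleftrightarrow> 0 \<le> A \<and> (\<forall>Q R. is_cube \<mu> Q \<and> is_cube \<mu> R \<and> cube_set Q \<subseteq> cube_set R \<longrightarrow>
    \<bar>c Q - c R\<bar> \<le> A * S_coeff \<mu> n Q R)"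

text \<open>Oscillation condition with respect to numbers \<open>c Q\<close> attached to the cubes in place of means.
  Unlike \<open>RBMO\<close> itself it is stable under truncation, and it also holds for \<open>f = 0\<close>, \<open>c = 1\<close>.\<close>

definition "osc_family f c A \<longleftrightarrow> f \<in> L1loc \<mu> \<and> S_lipschitz c A \<and>
   (\<forall>Q. is_cube \<mu> Q \<longrightarrow> (\<integral>\<^sup>+x\<in>cube_set Q. ennreal \<bar>f x - c Q\<bar> \<partial>\<mu>)
       \<le> ennreal (A * mcube \<mu> (cube_scale (4/3) Q)))"

lemma osc_family_measurable: "osc_family f c A \<Longrightarrow> f \<in> borel_measurable \<mu>"
  by (simp add: osc_family_def L1loc_def)

text \<open>The constant of \<open>S_lipschitz_compare\<close>, where two cubes are compared with a
  common larger one: 2 collects the leading 1 of both coefficients, the rest collects densities of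
  at most \<open>4 * C\<close> from each.\<close>

definition "Kc = 2 + 8 * 2 ^ n * C"

lemma Kc_pos: "Kc \<ge> 1" using C1 by (simp add: Kc_def)

text \<open>The two cubes need not be nested. Both lie in the cube of side \<open>4 * s\<close>
  about \<open>y\<close>, and the coefficient between \<open>Cube y s\<close> and that cube is
  bounded, so only the densities from \<open>r\<close> to \<open>s\<close> about \<open>x\<close>
  remain.\<close>

lemma S_lipschitz_compare:
  assumes c: "S_lipschitz c A" and xy: "x \<in> msupport \<mu>" "y \<in> msupport \<mu>"
    and r: "0 < r" "r \<le> s" "infnorm (x - y) \<le> s"
  shows "\<bar>c (Cube x r) - c (Cube y s)\<bar> \<le> A * (Kc * (1 + dens_sum x (level r) (level s)))"
proof -
  have A: "0 \<le> A" using c by (simp add: S_lipschitz_def)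
  have l4: "level (4 * s) = level s + 2" using level_mult_power[of s 2] r by simp
  let ?T = "Cube y (4 * s)"
  have "\<bar>c (Cube x r) - c ?T\<bar> \<le> A * S_coeff \<mu> n (Cube x r) ?T"
    using c xy r cube_subsetI[of x y r "4 * s"] unfolding S_lipschitz_def by auto
  moreover have "S_coeff \<mu> n (Cube x r) ?T \<le> 1 + 2 ^ n * (dens_sum x (level r) (level s) + 4 * C)"
  proof -
    have "S_coeff \<mu> n (Cube x r) ?T \<le> 1 + 2 ^ n * (dens_sum x (level r) (level (4 * s)) + 2 * C)"
      using xy r by (intro S_le_dens_sum) auto
    also have "dens_sum x (level r) (level (4 * s)) \<le> dens_sum x (level r) (level s) + 2 * C"
      using dens_sum_split[of x "level r" "level s + 2" "level s"] dens_sum_bound[OF xy(1), of "level s" "level s + 2"] l4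
        by simp
    finally show ?thesis by (simp add: add.commute)
  qed
  moreover have "\<bar>c (Cube y s) - c ?T\<bar> \<le> A * S_coeff \<mu> n (Cube y s) ?T"
    using c xy r cube_mono[of s "4 * s" y] unfolding S_lipschitz_def by auto
  moreover have "S_coeff \<mu> n (Cube y s) ?T \<le> 1 + 2 ^ n * (4 * C)"
  proof -
    have "S_coeff \<mu> n (Cube y s) ?T \<le> 1 + 2 ^ n * (dens_sum y (level s) (level (4 * s)) + 2 * C)"
      using xy r by (intro S_le_dens_sum) auto
    also have "dens_sum y (level s) (level (4 * s)) \<le> 2 * C"
      using dens_sum_bound[OF xy(2), of "level s" "level s + 2"] l4 by simp
    finally show ?thesis by simp
  qed
  ultimately have "\<bar>c (Cube x r) - c (Cube y s)\<bar> \<le>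
      A * (1 + 2 ^ n * (dens_sum x (level r) (level s) + 4 * C)) + A * (1 + 2 ^ n * (4 * C))"
    using A by (smt (verit) mult_left_mono)
  also have "\<dots> = A * (2 + 2 ^ n * dens_sum x (level r) (level s) + 8 * 2 ^ n * C)"
    by (simp add: algebra_simps)
  also have "\<dots> \<le> A * (Kc * (1 + dens_sum x (level r) (level s)))"
  proof (intro mult_left_mono A)
    have "(2::real) ^ n * 1 \<le> 2 ^ n * (8 * C)" using C1 by (intro mult_left_mono) auto
    also have "\<dots> = 8 * 2 ^ n * C" by simp
    finally have "2 ^ n \<le> Kc" unfolding Kc_def by linarith
    then have "2 ^ n * dens_sum x (level r) (level s) \<le> Kc * dens_sum x (level r) (level s)"
      using dens_sum_nonneg[of x "level r" "level s"] by (intro mult_right_mono)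
    then show "2 + 2 ^ n * dens_sum x (level r) (level s) + 8 * 2 ^ n * C \<le> Kc * (1 + dens_sum x (level r) (level s))"
      by (simp add: Kc_def distrib_left)
  qed
  finally show ?thesis .
qed

lemma S_lipschitz_compare_levels:
  assumes "S_lipschitz c A" "x \<in> msupport \<mu>" "y \<in> msupport \<mu>" "0 < r" "r \<le> s" "infnorm (x - y) \<le> s"
  shows "\<bar>c (Cube x r) - c (Cube y s)\<bar> \<le> A * (Kc * (1 + C * (level s - level r)))"
proof -
  have "level r \<le> level s" using assms by (intro level_mono) auto
  then have "dens_sum x (level r) (level s) \<le> C * (level s - level r)"
    using dens_sum_bound[OF assms(2), of "level r" "level s"] by simp
  moreover have "0 \<le> A" using assms by (simp add: S_lipschitz_def)
  ultimately have "A * (Kc * (1 + dens_sum x (level r) (level s))) \<le> A * (Kc * (1 + C * (level s - level r)))"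
    using Kc_pos by (intro mult_left_mono) auto
  then show ?thesis using S_lipschitz_compare[OF assms] by linarith
qed

text \<open>A positive number divided by 0 is infinite here, so for \<open>b = 0\<close> a finite
  quotient forces \<open>a = 0\<close>.\<close>

lemma ennreal_le_mult_of_divide:
  fixes a b :: ennreal
  assumes "a / b \<le> c" "b \<noteq> \<infinity>" "c \<noteq> \<infinity>"
  shows "a \<le> c * b"
proof (cases "b = 0")
  case True
  then have "a = 0" using assms
    by (metis add_diff_eq_iff_ennreal add_top_right_ennreal ennreal_divide_zero ennreal_top_minus
        infinity_ennreal_def nle_le)
  then show ?thesis by simp
next
  case False
  then have "a = a / b * b" using assms
    by (metis divide_eq_1_ennreal ennreal_divide_times infinity_ennreal_def mult.right_neutral)
  also have "\<dots> \<le> c * b" using assms(1) by (rule mult_right_mono) simp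
  finally show ?thesis .
qed

lemma nn_integral_osc:
  assumes f: "f \<in> borel_measurable \<mu>" and Q: "is_cube \<mu> Q"
    and "(\<integral>\<^sup>+x\<in>cube_set Q. ennreal \<bar>f x - a\<bar> \<partial>\<mu>) \<le> ennreal X" "0 \<le> X"
  shows "(\<integral>\<^sup>+x\<in>cube_set Q. ennreal \<bar>f x - k\<bar> \<partial>\<mu>) \<le> ennreal (X + \<bar>a - k\<bar> * mcube \<mu> Q)"
proof -
  have [measurable]: "f \<in> borel_measurable borel" using f by (simp add: measurable_mu)
  have "(\<integral>\<^sup>+x\<in>cube_set Q. ennreal \<bar>f x - k\<bar> \<partial>\<mu>)
      \<le> (\<integral>\<^sup>+x. ennreal \<bar>f x - a\<bar> * indicator (cube_set Q) x + ennreal \<bar>a - k\<bar> * indicator (cube_set Q) x \<partial>\<mu>)"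
    by (intro nn_integral_mono) (auto simp: indicator_def ennreal_plus[symmetric] simp del: ennreal_plus)
  also have "\<dots> = (\<integral>\<^sup>+x\<in>cube_set Q. ennreal \<bar>f x - a\<bar> \<partial>\<mu>) + ennreal \<bar>a - k\<bar> * emeasure \<mu> (cube_set Q)"
    by (subst nn_integral_add) (auto simp: nn_integral_cmult_indicator)
  also have "\<dots> \<le> ennreal X + ennreal \<bar>a - k\<bar> * ennreal (mcube \<mu> Q)"
    using assms emeasure_cube[OF Q] by (intro add_mono) auto
  also have "\<dots> = ennreal (X + \<bar>a - k\<bar> * mcube \<mu> Q)" using assms by (simp add: ennreal_mult'')
  finally show ?thesis .
qed

lemma osc_family_osc:
  assumes "osc_family f c A" "is_cube \<mu> Q"
  shows "(\<integral>\<^sup>+x\<in>cube_set Q. ennreal \<bar>f x - k\<bar> \<partial>\<mu>)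
    \<le> ennreal (A * mcube \<mu> (cube_scale (4/3) Q) + \<bar>c Q - k\<bar> * mcube \<mu> Q)"
  using assms by (intro nn_integral_osc) (auto simp: osc_family_def S_lipschitz_def L1loc_def)

lemma osc_family_osc_cube:
  assumes "osc_family f c A" "x \<in> msupport \<mu>" "r > 0" "\<bar>c (Cube x r) - k\<bar> \<le> B" "4/3 * r \<le> s"
  shows "(\<integral>\<^sup>+z\<in>cube_set (Cube x r). ennreal \<bar>f z - k\<bar> \<partial>\<mu>) \<le> ennreal ((A + B) * mass x s)"
proof -
  have A: "0 \<le> A" using assms by (simp add: osc_family_def S_lipschitz_def)
  have "(\<integral>\<^sup>+z\<in>cube_set (Cube x r). ennreal \<bar>f z - k\<bar> \<partial>\<mu>)
    \<le> ennreal (A * mass x (4/3*r) + \<bar>c (Cube x r) - k\<bar> * mass x r)"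
    using osc_family_osc[of f c A "Cube x r" k] assms by (simp add: mass_def)
  also have "\<dots> \<le> ennreal ((A + B) * mass x s)"
  proof -
    have "A * mass x (4/3*r) \<le> A * mass x s" using A assms mass_mono by (intro mult_left_mono) auto
    moreover have "\<bar>c (Cube x r) - k\<bar> * mass x r \<le> B * mass x s"
      using assms mass_mono[of r s x] by (intro mult_mono) auto
    ultimately show ?thesis by (intro ennreal_leI) (simp add: distrib_right)
  qed
  finally show ?thesis .
qed

section \<open>From RBMO to an oscillation family\<close>

context
  fixes \<rho> \<beta> :: real
  assumes \<rho>: "\<rho> > 1" and dc: "doubling_constant \<mu> n \<rho> \<beta>"
begin

text \<open>While the dilates of a cube are not doubling, the density gains the factor
  \<open>g\<close> every \<open>m\<close> steps, because the \<open>\<rho>\<close>-dilate lies in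
  the \<open>2 ^ m\<close>-dilate. As densities are bounded by \<open>C\<close>, a doubling dilate
  occurs, and up to it the densities have a bounded sum.\<close>

lemma tilde_cube:
  "\<exists>Ct\<ge>0. \<forall>x\<in>msupport \<mu>. \<forall>r>0. \<exists>N. cube_tilde \<mu> \<rho> \<beta> (Cube x r) = Cube x (2 ^ N * r) \<and>
     doubling \<mu> \<rho> \<beta> (Cube x (2 ^ N * r)) \<and> dens_sum x (level r) (level (2 ^ N * r)) \<le> Ct"
proof -
  define m where "m = nat \<lceil>log 2 \<rho>\<rceil>"
  define g where "g = \<beta> / (2 ^ m) ^ n"
  have g1: "g > 1" using dc by (simp add: doubling_constant_def g_def m_def)
  have \<beta>: "\<beta> > 0" using g1 by (simp add: g_def) (meson less_trans zero_less_numeral zero_less_power)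
  have rm: "\<rho> \<le> 2 ^ m"
  proof -
    have "log 2 \<rho> \<le> real m" unfolding m_def by linarith
    then have "\<rho> \<le> 2 powr real m" using \<rho> by (simp add: log_le_iff)
    then show ?thesis by (simp add: powr_realpow)
  qed
  have nd: "g * dens x (2 ^ k * r) \<le> dens x (2 ^ (k + m) * r)"
    if "r > 0" "\<not> doubling \<mu> \<rho> \<beta> (Cube x (2 ^ k * r))" for x k r
  proof -
    have "\<beta> * mass x (2 ^ k * r) < mass x (\<rho> * (2 ^ k * r))" using that
      by (simp add: doubling_def mass_def)
    also have "\<dots> \<le> mass x (2 ^ (k + m) * r)"
      using rm that by (intro mass_mono) (simp add: power_add mult.commute mult.left_commute)
    finally have "\<beta> * mass x (2 ^ k * r) / (2 ^ (k + m) * r) ^ n \<le> mass x (2 ^ (k + m) * r) / (2 ^ (k + m) * r) ^ n"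
      using that by (intro divide_right_mono) auto
    also have "\<beta> * mass x (2 ^ k * r) / (2 ^ (k + m) * r) ^ n = g * dens x (2 ^ k * r)"
      by (simp add: g_def dens_def power_add power_mult_distrib mult.commute mult.left_commute)
    finally show ?thesis by (simp add: dens_def)
  qed
  define Ct where "Ct = 2 ^ n * (m * C / (g - 1) + C)"
  show ?thesis
  proof (intro exI[of _ Ct] conjI ballI allI impI)
    show "0 \<le> Ct" using g1 C1 by (simp add: Ct_def)
    fix x and r :: real assume x: "x \<in> msupport \<mu>" and r: "r > 0"
    have "\<exists>N. doubling \<mu> \<rho> \<beta> (Cube x (2 ^ N * r))"
    proof (rule ccontr)
      assume "\<nexists>N. doubling \<mu> \<rho> \<beta> (Cube x (2 ^ N * r))"
      then show False
        using nondoubling_unbounded[of "\<lambda>k. dens x (2 ^ k * r)" C g m] nd[of r x] x r g1 mass_pos[OF x r]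
        by (auto simp: dens_le dens_nonneg) (simp add: dens_def)
    qed
    then obtain N where N: "doubling \<mu> \<rho> \<beta> (Cube x (2 ^ N * r))"
       "\<And>k. k < N \<Longrightarrow> \<not> doubling \<mu> \<rho> \<beta> (Cube x (2 ^ k * r))"
       "N = (LEAST N. doubling \<mu> \<rho> \<beta> (Cube x (2 ^ N * r)))"
      by (metis (no_types, lifting) LeastI not_less_Least)
    have "dens_sum x (level r) (level (2 ^ N * r)) \<le> 2 ^ n * (\<Sum>k=1..N. dens x (2 ^ k * r))"
      using dens_sum_dens_sum(2)[OF r x, of N] r by (simp add: level_mult_power)
    also have "(\<Sum>k=1..N. dens x (2 ^ k * r)) \<le> (\<Sum>k\<in>insert N {..<N}. dens x (2 ^ k * r))"
      using r by (intro sum_mono2) (auto intro: dens_nonneg)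
    also have "\<dots> \<le> m * C / (g - 1) + C"
    proof -
      have "(\<Sum>k<N. dens x (2 ^ k * r)) \<le> m * C / (g - 1)"
        using x r by (intro nondoubling_sum g1 nd[OF r N(2)]) (auto simp: dens_le dens_nonneg)
      then show ?thesis using dens_le[OF x, of "2^N*r"] r by simp
    qed
    finally have "dens_sum x (level r) (level (2 ^ N * r)) \<le> Ct" by (simp add: Ct_def)
    then show "\<exists>N. cube_tilde \<mu> \<rho> \<beta> (Cube x r) = Cube x (2 ^ N * r) \<and>
     doubling \<mu> \<rho> \<beta> (Cube x (2 ^ N * r)) \<and> dens_sum x (level r) (level (2 ^ N * r)) \<le> Ct"
      using N(1,3) by (intro exI[of _ N]) (simp add: cube_tilde_def)
  qed
qed

lemma tilde_Whole: "cube_tilde \<mu> \<rho> \<beta> Whole = Whole"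
  by (simp add: cube_tilde_def)

lemma doubling_Whole: "doubling \<mu> \<rho> \<beta> Whole"
proof -
  have "\<beta> \<ge> 1" using dc one_le_power[of "2 ^ nat \<lceil>log 2 \<rho>\<rceil>" n]
    unfolding doubling_constant_def by (smt (verit) one_le_power)
  then show ?thesis using mult_right_mono[of 1 \<beta> "measure \<mu> UNIV"] by (simp add: doubling_def)
qed

text \<open>Transfers a condition on nested doubling cubes to all nested cubes. The doubling dilates
  of \<open>Q\<close> and \<open>R\<close> need not be nested themselves, so both are compared with
  a third doubling cube about \<open>x\<close> that contains them. The dilations involved add only
  bounded density sums, which are absorbed because S is at least 1.\<close>

lemma RBMO_S_lipschitz:
  assumes dd: "\<And>Q R. is_cube \<mu> Q \<Longrightarrow> is_cube \<mu> R \<Longrightarrow> cube_set Q \<subseteq> cube_set R \<Longrightarrow>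
        doubling \<mu> \<rho> \<beta> Q \<Longrightarrow> doubling \<mu> \<rho> \<beta> R \<Longrightarrow> \<bar>g Q - g R\<bar> \<le> C2 * S_coeff \<mu> n Q R"
    and C2: "0 \<le> C2"
  shows "\<exists>A. S_lipschitz (\<lambda>Q. g (cube_tilde \<mu> \<rho> \<beta> Q)) A"
proof -
  obtain Ct where Ct: "Ct \<ge> 0" and T: "\<And>x r. x \<in> msupport \<mu> \<Longrightarrow> r > 0 \<Longrightarrow>
     \<exists>N. cube_tilde \<mu> \<rho> \<beta> (Cube x r) = Cube x (2 ^ N * r) \<and>
     doubling \<mu> \<rho> \<beta> (Cube x (2 ^ N * r)) \<and> dens_sum x (level r) (level (2 ^ N * r)) \<le> Ct"
    using tilde_cube by blast
  define K1 where "K1 = 2 * (Ct + 4 ^ n * (Ct + 2 * C) + 2 * C)"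
  define A where "A = C2 * (2 + 2 ^ n * (2 ^ n + 2 * K1 + 4 * C))"
  have K1: "K1 \<ge> 0" using Ct C1 by (simp add: K1_def)
  have A0: "A \<ge> C2" using mult_left_mono[of 1 "2 + 2 ^ n * (2 ^ n + 2 * K1 + 4 * C)" C2] C2 C1 K1
    by (simp add: A_def add_increasing2)
  have main: "\<bar>g (cube_tilde \<mu> \<rho> \<beta> (Cube x r)) - g (cube_tilde \<mu> \<rho> \<beta> (Cube y s))\<bar>
      \<le> A * S_coeff \<mu> n (Cube x r) (Cube y s)"
    if xy: "x \<in> msupport \<mu>" "y \<in> msupport \<mu>" and r: "0 < r" "0 < s"
     and sub: "cube_set (Cube x r) \<subseteq> cube_set (Cube y s)" for x y r s
  proof -
    have rs: "r \<le> s" "infnorm (x - y) \<le> s / 2" using cube_subset_side[OF sub] r by auto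
    obtain N where N: "cube_tilde \<mu> \<rho> \<beta> (Cube x r) = Cube x (2 ^ N * r)"
     "doubling \<mu> \<rho> \<beta> (Cube x (2 ^ N * r))" "dens_sum x (level r) (level (2 ^ N * r)) \<le> Ct"
      using T[of x r] xy r by blast
    obtain M where M: "cube_tilde \<mu> \<rho> \<beta> (Cube y s) = Cube y (2 ^ M * s)"
     "doubling \<mu> \<rho> \<beta> (Cube y (2 ^ M * s))" "dens_sum y (level s) (level (2 ^ M * s)) \<le> Ct"
      using T[of y s] xy r by blast
    define r1 s1 where "r1 = 2 ^ N * r" and "s1 = 2 ^ M * s"
    have r1: "r \<le> r1" "s \<le> s1" using r by (auto simp: r1_def s1_def)
    \<comment> \<open>Side \<open>4 * w\<close> suffices for a cube about \<open>x\<close> to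
      contain both dilates, since the distance of the centres is at most \<open>s / 2\<close>; a
      further dilation by \<open>2 ^ L\<close> makes it doubling.\<close>
    define w where "w = max r1 s1"
    have w: "0 < w" "r1 \<le> w" "s1 \<le> w" using r1 r by (auto simp: w_def)
    obtain L where L: "doubling \<mu> \<rho> \<beta> (Cube x (2 ^ L * (4 * w)))"
        "dens_sum x (level (4 * w)) (level (2 ^ L * (4 * w))) \<le> Ct"
      using T[of x "4 * w"] xy w by auto
    define w1 where "w1 = 2 ^ L * (4 * w)"
    have w1: "4 * w \<le> w1" using w by (auto simp: w1_def)
    have l4: "level (4 * w) = level w + 2" using level_mult_power[of w 2] w by simp
    have lev: "level r \<le> level r1" "level s \<le> level s1" "level r1 \<le> level w" "level s1 \<le> level w" "level r \<le> level s"
      using r r1 w rs by (auto intro!: level_mono)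
    have d: "infnorm (x - y) \<le> 2 powi level s" "infnorm (y - x) \<le> 2 powi level s"
      using rs level_bounds(2)[OF r(2)] by (auto simp: power_int_add infnorm_sub[of y x])
    have dw: "infnorm (y - x) \<le> 2 powi (level w + 2)"
      using d(2) lev powi_le_iff[of "level s" "level w + 2"] by linarith
    \<comment> \<open>Whichever of the two dilates has side \<open>w\<close>, the scales from
      \<open>s\<close> to \<open>w\<close> belong to its non-doubling stretch, where the densities
      have a bounded sum; if that is the dilate of the cube about \<open>y\<close>, the centre is
      moved to \<open>x\<close> first.\<close>
    have mid_x: "dens_sum x (level s) (level w) \<le> Ct + 4 ^ n * (Ct + 2 * C)"
    proof (cases "w = r1")
      case True
      have "dens_sum x (level s) (level r1) \<le> dens_sum x (level r) (level r1)" using lev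
        by (intro dens_sum_mono) auto
      then have "dens_sum x (level s) (level r1) \<le> Ct" using N by (simp add: r1_def)
      moreover have "0 \<le> 4 ^ n * (Ct + 2 * C)" using C1 Ct by simp
      ultimately show ?thesis using True by simp
    next
      case False
      then have ws: "w = s1" by (auto simp: w_def max_def split: if_splits)
      have "dens_sum x (level s) (level s1) \<le> 4 ^ n * (dens_sum y (level s) (level s1) + 2 * C)"
        by (intro dens_sum_shift xy d)
      also have "\<dots> \<le> 4 ^ n * (Ct + 2 * C)" using M by (intro mult_left_mono) (auto simp: s1_def)
      finally show ?thesis using Ct ws by simp
    qed
    have mid_y: "dens_sum y (level s) (level w) \<le> Ct + 4 ^ n * (Ct + 2 * C)"
    proof (cases "w = s1")
      case True
      moreover have "0 \<le> 4 ^ n * (Ct + 2 * C)" using C1 Ct by simp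
      ultimately show ?thesis using M by (simp add: s1_def)
    next
      case False
      then have ws: "w = r1" by (auto simp: w_def max_def split: if_splits)
      have "dens_sum y (level s) (level r1) \<le> 4 ^ n * (dens_sum x (level s) (level r1) + 2 * C)"
        by (intro dens_sum_shift xy d)
      also have "\<dots> \<le> 4 ^ n * (Ct + 2 * C)"
        using N dens_sum_mono[of "level r" "level s" "level r1" "level r1" x] lev
        by (intro mult_left_mono add_right_mono) (auto simp: r1_def)
      finally show ?thesis using Ct ws by simp
    qed
    have "dens_sum x (level r1) (level w1) \<le> dens_sum x (level r) (level w1)" using lev
      by (intro dens_sum_mono) auto
    also have "\<dots> \<le> dens_sum x (level r) (level s) + (dens_sum x (level s) (level w) + (dens_sum x (level w) (level w + 2) + dens_sum x (level w + 2) (level w1)))"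
      using dens_sum_split[of x "level r" "level w1" "level s"] dens_sum_split[of x "level s" "level w1" "level w"]
         dens_sum_split[of x "level w" "level w1" "level w + 2"] by linarith
    also have "\<dots> \<le> dens_sum x (level r) (level s) + K1"
    proof -
      define Z where "Z = 4 ^ n * (Ct + 2 * C)"
      have "0 \<le> Z" using C1 Ct by (simp add: Z_def)
      then show ?thesis
        using add_mono[OF mid_x add_mono[OF dens_sum_bound2[OF xy(1), of "level w"] L(2)]] Ct C1
        unfolding l4 w1_def[symmetric] K1_def Z_def[symmetric] by auto
    qed
    finally have 1: "dens_sum x (level r1) (level w1) \<le> dens_sum x (level r) (level s) + K1" .
    have "dens_sum y (level w + 2) (level w1) \<le> 4 ^ n * (dens_sum x (level w + 2) (level w1) + 2 * C)"
      by (intro dens_sum_shift xy dw)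
    also have "\<dots> \<le> 4 ^ n * (Ct + 2 * C)" using L by (intro mult_left_mono) (auto simp: w1_def l4)
    finally have t: "dens_sum y (level w + 2) (level w1) \<le> 4 ^ n * (Ct + 2 * C)" .
    have "dens_sum y (level s1) (level w1) \<le> dens_sum y (level s) (level w1)" using lev
      by (intro dens_sum_mono) auto
    also have "\<dots> \<le> dens_sum y (level s) (level w) + (dens_sum y (level w) (level w + 2) + dens_sum y (level w + 2) (level w1))"
      using dens_sum_split[of y "level s" "level w1" "level w"] dens_sum_split[of y "level w" "level w1" "level w + 2"]
        by linarith
    also have "\<dots> \<le> K1"
      using mid_y dens_sum_bound2[OF xy(2), of "level w"] t Ct C1 unfolding K1_def by simp
    finally have 2: "dens_sum y (level s1) (level w1) \<le> K1" .
    let ?P = "Cube x w1"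
    have "\<bar>g (Cube x r1) - g ?P\<bar> \<le> C2 * S_coeff \<mu> n (Cube x r1) ?P"
      using N(2) L(1) xy r r1 w w1
        by (intro dd cube_mono) (auto simp: r1_def[symmetric] w1_def[symmetric])
    also have "\<dots> \<le> C2 * (1 + 2 ^ n * (dens_sum x (level r1) (level w1) + 2 * C))"
      using xy r r1 w w1 C2 by (intro mult_left_mono S_le_dens_sum) auto
    also have "\<dots> \<le> C2 * (1 + 2 ^ n * (dens_sum x (level r) (level s) + K1 + 2 * C))"
      using 1 C2 by (intro mult_left_mono add_left_mono) auto
    finally have 3: "\<bar>g (Cube x r1) - g ?P\<bar> \<le> C2 * (1 + 2 ^ n * (dens_sum x (level r) (level s) + K1 + 2 * C))" .
    have "\<bar>g (Cube y s1) - g ?P\<bar> \<le> C2 * S_coeff \<mu> n (Cube y s1) ?P"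
      using M(2) L(1) xy r r1 w w1 rs
        by (intro dd cube_subsetI) (auto simp: s1_def[symmetric] w1_def[symmetric] infnorm_sub[of y x])
    also have "\<dots> \<le> C2 * (1 + 2 ^ n * (dens_sum y (level s1) (level w1) + 2 * C))"
      using xy r r1 w w1 C2 by (intro mult_left_mono S_le_dens_sum) auto
    also have "\<dots> \<le> C2 * (1 + 2 ^ n * (K1 + 2 * C))"
      using 2 C2 by (intro mult_left_mono add_left_mono) auto
    finally have 4: "\<bar>g (Cube y s1) - g ?P\<bar> \<le> C2 * (1 + 2 ^ n * (K1 + 2 * C))" .
    have S1: "1 \<le> S_coeff \<mu> n (Cube x r) (Cube y s)" (is "1 \<le> ?S") using xy r by (intro S_ge_1) auto
    have "\<bar>g (Cube x r1) - g (Cube y s1)\<bar> \<le> C2 * (1 + 2 ^ n * (dens_sum x (level r) (level s) + K1 + 2 * C)) + C2 * (1 + 2 ^ n * (K1 + 2 * C))"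
      using 3 4 by linarith
    also have "\<dots> = C2 * (2 + 2 ^ n * (dens_sum x (level r) (level s) + 2 * K1 + 4 * C))"
      by (simp add: algebra_simps)
    also have "\<dots> \<le> C2 * (2 * ?S + 2 ^ n * (2 ^ n * ?S + 2 * K1 * ?S + 4 * C * ?S))"
    proof (intro mult_left_mono add_mono C2)
      show "dens_sum x (level r) (level s) \<le> 2 ^ n * ?S" using xy r rs by (intro dens_sum_le_S) auto
      show "2 * K1 \<le> 2 * K1 * ?S" using mult_left_mono[OF S1, of "2 * K1"] K1 by simp
      show "4 * C \<le> 4 * C * ?S" using mult_left_mono[OF S1, of "4 * C"] C1 by simp
    qed (use S1 in auto)
    also have "\<dots> = A * ?S" by (simp add: A_def algebra_simps)
    finally show ?thesis using N M by (simp add: r1_def s1_def)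
  qed
  show ?thesis
  proof (intro exI[of _ A], unfold S_lipschitz_def, intro conjI allI impI)
    show "0 \<le> A" using A0 C2 by simp
    fix Q R :: "'a cube" assume QR: "is_cube \<mu> Q \<and> is_cube \<mu> R \<and> cube_set Q \<subseteq> cube_set R"
    show "\<bar>g (cube_tilde \<mu> \<rho> \<beta> Q) - g (cube_tilde \<mu> \<rho> \<beta> R)\<bar> \<le> A * S_coeff \<mu> n Q R"
    proof (cases Q)
      case Whole
      then show ?thesis using QR Whole_subset[of R] A0 C2 by auto
    next
      case Q: (Cube x r)
      show ?thesis
      proof (cases R)
        case (Cube y s)
        then show ?thesis using main Q QR by simp
      next
        case R: Whole
        have xr: "x \<in> msupport \<mu>" "r > 0" "emeasure \<mu> UNIV < \<infinity>" using QR Q R by auto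
        obtain N where N: "cube_tilde \<mu> \<rho> \<beta> (Cube x r) = Cube x (2 ^ N * r)"
           "doubling \<mu> \<rho> \<beta> (Cube x (2 ^ N * r))" using T[of x r] xr by blast
        have "\<bar>g (Cube x (2 ^ N * r)) - g Whole\<bar> \<le> C2 * S_coeff \<mu> n (Cube x (2 ^ N * r)) Whole"
          using N xr doubling_Whole by (intro dd) auto
        also have "S_coeff \<mu> n (Cube x (2 ^ N * r)) Whole \<le> S_coeff \<mu> n (Cube x r) Whole"
        proof -
          have s: "summable (\<lambda>k. dens x (2 ^ Suc k * r))" using xr by (intro summable_dens) auto
          have e: "dens x (2 ^ Suc k * (2 ^ N * r)) = dens x (2 ^ Suc (k + N) * r)" for k
            by (simp add: power_add mult.assoc)
          have "(\<Sum>k. dens x (2 ^ Suc k * (2 ^ N * r))) = (\<Sum>k. dens x (2 ^ Suc (k + N) * r))"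
            by (simp only: e)
          also have "\<dots> = (\<Sum>k. dens x (2 ^ Suc k * r)) - (\<Sum>k<N. dens x (2 ^ Suc k * r))"
            using suminf_minus_initial_segment[OF s, of N] by simp
          also have "\<dots> \<le> (\<Sum>k. dens x (2 ^ Suc k * r))" using xr by (auto intro!: sum_nonneg dens_nonneg)
          finally show ?thesis by (simp only: S_Whole)
        qed
        then have "C2 * S_coeff \<mu> n (Cube x (2 ^ N * r)) Whole \<le> A * S_coeff \<mu> n (Cube x r) Whole"
          using A0 C2 S_ge_1[of "Cube x (2 ^ N * r)" Whole] xr by (intro mult_mono) auto
        finally show ?thesis using N Q R tilde_Whole by simp
      qed
    qed
  qed
qed

text \<open>The dilation factor \<open>\<eta>\<close> of the oscillation condition has to be lowered
  to 4/3. A cube \<open>Q\<close> is covered by cubes \<open>M\<close> times smaller; as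
  \<open>M\<close> is at least \<open>3 * \<eta>\<close>, their \<open>\<eta>\<close>-dilates stay
  inside the 4/3-dilate of \<open>Q\<close>, and their values of \<open>c\<close> differ boundedly
  from \<open>c Q\<close>. The value 4/3 leaves room for a preliminary dilation by 3/2 within the
  double cube, by whose mass atoms are normalised.\<close>

lemma RBMO_osc_family:
  assumes f: "f \<in> RBMO \<mu> n \<rho> \<eta> \<beta>" and \<eta>: "\<eta> > 1"
  shows "\<exists>A. osc_family f (\<lambda>Q. mean \<mu> f (cube_tilde \<mu> \<rho> \<beta> Q)) A"
proof -
  let ?c = "\<lambda>Q. mean \<mu> f (cube_tilde \<mu> \<rho> \<beta> Q)"
  obtain C2 where C2: "C2 \<ge> 0" and osc: "\<And>Q. is_cube \<mu> Q \<Longrightarrow>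
        (\<integral>\<^sup>+x\<in>cube_set Q. ennreal \<bar>f x - ?c Q\<bar> \<partial>\<mu>)
          / emeasure \<mu> (cube_set (cube_scale \<eta> Q)) \<le> ennreal C2"
    and dd: "\<And>Q R. is_cube \<mu> Q \<Longrightarrow> is_cube \<mu> R \<Longrightarrow> cube_set Q \<subseteq> cube_set R \<Longrightarrow>
        doubling \<mu> \<rho> \<beta> Q \<Longrightarrow> doubling \<mu> \<rho> \<beta> R \<Longrightarrow> \<bar>mean \<mu> f Q - mean \<mu> f R\<bar> \<le> C2 * S_coeff \<mu> n Q R"
    and fl: "f \<in> L1loc \<mu>"
    using f unfolding RBMO_def by auto
  have fm [measurable]: "f \<in> borel_measurable borel" using fl by (simp add: L1loc_def measurable_mu)
  obtain A where A: "S_lipschitz ?c A" using RBMO_S_lipschitz[OF dd C2] by blast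
  have A0: "A \<ge> 0" using A by (simp add: S_lipschitz_def)
  have osc': "(\<integral>\<^sup>+x\<in>cube_set Q. ennreal \<bar>f x - ?c Q\<bar> \<partial>\<mu>) \<le> ennreal (C2 * mcube \<mu> (cube_scale \<eta> Q))"
    if Q: "is_cube \<mu> Q" for Q
  proof -
    have e: "emeasure \<mu> (cube_set (cube_scale \<eta> Q)) = ennreal (mcube \<mu> (cube_scale \<eta> Q))"
      using is_cube_scale[OF Q, of \<eta>] \<eta> by (intro emeasure_cube) auto
    have "(\<integral>\<^sup>+x\<in>cube_set Q. ennreal \<bar>f x - ?c Q\<bar> \<partial>\<mu>) \<le> ennreal C2 * emeasure \<mu> (cube_set (cube_scale \<eta> Q))"
      using osc[OF Q] unfolding e
      using C2 by (intro ennreal_le_mult_of_divide) auto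
    then show ?thesis using C2 unfolding e by (simp add: ennreal_mult'')
  qed
  obtain M :: nat where M: "M > 0" "\<eta> \<le> M / 3"
  proof -
    obtain k :: nat where "3 * \<eta> < k" using reals_Archimedean2 by blast
    then show ?thesis using that[of k] \<eta> by (cases k) auto
  qed
  define L where "L = nat (level M + 1)"
  define B where "B = A * (Kc * (1 + C * (2 + level M)))"
  define A' where "A' = max (max A C2) (real ((2 * M + 1) ^ DIM('a)) * (C2 + B))"
  have lM: "level M \<ge> 0" using level_mono[of 1 M] M level_powi[of 0] by simp
  have B0: "B \<ge> 0" using A0 Kc_pos C1 lM by (simp add: B_def)
  have "osc_family f ?c A'"
    unfolding osc_family_def
  proof (intro conjI allI impI fl)
    have "A * S_coeff \<mu> n Q R \<le> A' * S_coeff \<mu> n Q R" if "is_cube \<mu> Q" "is_cube \<mu> R" for Q R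
      using S_ge_1[OF that] by (intro mult_right_mono) (auto simp: A'_def)
    moreover have "0 \<le> A'" using A0 by (simp add: A'_def)
    ultimately show "S_lipschitz ?c A'" using A unfolding S_lipschitz_def by (blast intro: order_trans)
    fix Q assume Q: "is_cube \<mu> Q"
    show "(\<integral>\<^sup>+x\<in>cube_set Q. ennreal \<bar>f x - ?c Q\<bar> \<partial>\<mu>) \<le> ennreal (A' * mcube \<mu> (cube_scale (4/3) Q))"
    proof (cases Q)
      case Whole
      have "(\<integral>\<^sup>+x\<in>cube_set Q. ennreal \<bar>f x - ?c Q\<bar> \<partial>\<mu>) \<le> ennreal (C2 * mcube \<mu> (cube_scale \<eta> Q))"
        by (rule osc'[OF Q])
      also have "\<dots> \<le> ennreal (A' * mcube \<mu> (cube_scale (4/3) Q))"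
        using Whole by (intro ennreal_leI) (auto simp: A'_def intro!: mult_right_mono)
      finally show ?thesis .
    next
      case (Cube x r)
      then have x: "x \<in> msupport \<mu>" and r: "r > 0" using Q by auto
      let ?q = "r / M"
      obtain F where F: "finite F" "F \<subseteq> cube_set (Cube x r) \<inter> msupport \<mu>" "card F \<le> (2 * M + 1) ^ DIM('a)"
        "cube_set (Cube x r) \<inter> msupport \<mu> \<subseteq> (\<Union>y\<in>F. cube_set (Cube y ?q))"
        by (rule grid_cover[of "cube_set (Cube x r) \<inter> msupport \<mu>" x r M]) (use r M in auto)
      have each: "(\<integral>\<^sup>+z\<in>cube_set (Cube y ?q). ennreal \<bar>f z - ?c Q\<bar> \<partial>\<mu>) \<le> ennreal ((C2 + B) * mass x (4/3 * r))"
        if "y \<in> F" for y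
      proof -
        have y: "y \<in> msupport \<mu>" "infnorm (y - x) \<le> r / 2" using that F by (auto simp: mem_cube_set)
        have q: "?q > 0" "?q \<le> r" using r M by (auto simp: divide_le_eq)
        have lq: "level r - level ?q \<le> 2 + level M"
        proof -
          have "r = ?q * M" using M by simp
          also have "\<dots> < 2 powi (level ?q + 1) * 2 powi (level M + 1)"
            using level_bounds[of ?q] level_bounds[of M] q M by (intro mult_strict_mono) auto
          also have "\<dots> = 2 powi (level ?q + level M + 2)" by (simp add: power_int_add)
          finally have "2 powi level r < (2::real) powi (level ?q + level M + 2)"
            using level_bounds(1)[OF r] by linarith
          then show ?thesis unfolding powi_less_iff by linarith
        qed
        have "\<bar>?c (Cube y ?q) - ?c Q\<bar> \<le> A * (Kc * (1 + C * (level r - level ?q)))"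
          using S_lipschitz_compare_levels[OF A y(1) x q] y r Cube by simp
        also have "\<dots> \<le> B" using A0 Kc_pos C1 lq unfolding B_def
          by (intro mult_left_mono add_left_mono) auto
        finally have cc: "\<bar>?c (Cube y ?q) - ?c Q\<bar> \<le> B" .
        have sub: "cube_set (Cube y (\<eta> * ?q)) \<subseteq> cube_set (Cube x (4/3 * r))"
        proof (rule cube_subsetI)
          have "\<eta> * ?q \<le> M / 3 * ?q" using M q by (intro mult_right_mono) auto
          also have "M / 3 * ?q = r / 3" using M by simp
          finally have t: "\<eta> * ?q \<le> r / 3" .
          have "infnorm (y - x) + t / 2 \<le> 4 / 3 * r / 2" if "t \<le> r / 3" for t
            using that y(2) r by (simp add: field_simps)
          then show "infnorm (y - x) + \<eta> * ?q / 2 \<le> 4 / 3 * r / 2" using t .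
        qed
        have "cube_set (Cube y ?q) \<subseteq> cube_set (Cube x (4/3*r))"
        proof -
          have "?q \<le> \<eta> * ?q" using mult_right_mono[of 1 \<eta> ?q] \<eta> q by simp
          then show ?thesis using sub cube_mono by blast
        qed
        then have m2: "mass y ?q \<le> mass x (4/3*r)" by (rule mass_subset)
        have "(\<integral>\<^sup>+z\<in>cube_set (Cube y ?q). ennreal \<bar>f z - ?c Q\<bar> \<partial>\<mu>) \<le>
           ennreal (C2 * mass y (\<eta> * ?q) + \<bar>?c (Cube y ?q) - ?c Q\<bar> * mass y ?q)"
        proof -
          have iq: "is_cube \<mu> (Cube y ?q)" using y q by simp
          show ?thesis using nn_integral_osc[OF _ iq osc'[OF iq], of "?c Q"] C2
            by (simp add: mass_def measurable_mu)
        qed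
        also have "\<dots> \<le> ennreal (C2 * mass x (4/3*r) + B * mass x (4/3*r))"
          by (intro ennreal_leI add_mono mult_mono mass_subset[OF sub] C2 B0 cc m2 mass_nonneg order_refl)
        finally show ?thesis by (simp add: distrib_right)
      qed
      \<comment> \<open>The small cubes cover only the points of the support, hence almost all of
        \<open>Q\<close>.\<close>
      have "(\<integral>\<^sup>+z\<in>cube_set Q. ennreal \<bar>f z - ?c Q\<bar> \<partial>\<mu>) \<le>
         (\<integral>\<^sup>+z. (\<Sum>y\<in>F. ennreal \<bar>f z - ?c Q\<bar> * indicator (cube_set (Cube y ?q)) z) \<partial>\<mu>)"
      proof (intro nn_integral_mono_AE)
        show "AE z in \<mu>. ennreal \<bar>f z - ?c Q\<bar> * indicator (cube_set Q) z
          \<le> (\<Sum>y\<in>F. ennreal \<bar>f z - ?c Q\<bar> * indicator (cube_set (Cube y ?q)) z)"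
          using AE_msupport
        proof eventually_elim
          case (elim z)
          show ?case
          proof (cases "z \<in> cube_set Q")
            case True
            then obtain y where "y \<in> F" "z \<in> cube_set (Cube y ?q)" using F(4) elim Cube by blast
            then have "ennreal \<bar>f z - ?c Q\<bar> * indicator (cube_set (Cube y ?q)) z
                 \<le> (\<Sum>y\<in>F. ennreal \<bar>f z - ?c Q\<bar> * indicator (cube_set (Cube y ?q)) z)"
              using F(1) by (intro member_le_sum) auto
            then show ?thesis using True \<open>z \<in> cube_set (Cube y ?q)\<close> by (simp only: indicator_simps)
          qed simp
        qed
      qed
      also have "\<dots> = (\<Sum>y\<in>F. (\<integral>\<^sup>+z\<in>cube_set (Cube y ?q). ennreal \<bar>f z - ?c Q\<bar> \<partial>\<mu>))"
        by (rule nn_integral_sum) measurable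
      also have "\<dots> \<le> (\<Sum>y\<in>F. ennreal ((C2 + B) * mass x (4/3 * r)))" by (intro sum_mono each)
      also have "\<dots> = ennreal (card F * ((C2 + B) * mass x (4/3 * r)))"
        using C2 B0 by (simp add: ennreal_mult'' ennreal_of_nat_eq_real_of_nat)
      also have "\<dots> \<le> ennreal (real ((2 * M + 1) ^ DIM('a)) * ((C2 + B) * mass x (4/3 * r)))"
        by (intro ennreal_leI mult_right_mono) (use C2 B0 F(3) of_nat_le_iff in \<open>blast, simp\<close>)
      also have "\<dots> \<le> ennreal (A' * mass x (4/3 * r))"
        unfolding A'_def mult.assoc[symmetric] by (intro ennreal_leI mult_right_mono) auto
      finally show ?thesis using Cube by (simp add: mass_def)
    qed
  qed
  then show ?thesis by blast
qed

end

end

section \<open>The product as a distribution\<close>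

text \<open>The bound on the integral of the sum of absolute values gives finiteness of that sum
  almost everywhere, and the sum is the majorant for the remaining claims.\<close>

lemma L1_series:
  fixes f :: "nat \<Rightarrow> 'b \<Rightarrow> real"
  assumes m [measurable]: "\<And>i. f i \<in> borel_measurable M"
    and b: "\<And>i. (\<integral>\<^sup>+x. ennreal \<bar>f i x\<bar> \<partial>M) \<le> ennreal (s i)" and s: "summable s" "\<And>i. 0 \<le> s i"
  shows "AE x in M. summable (\<lambda>i. \<bar>f i x\<bar>)" and "\<And>i. integrable M (f i)"
    and "integrable M (\<lambda>x. \<Sum>i. f i x)"
    and "(\<lambda>i. \<integral>x. f i x \<partial>M) sums (\<integral>x. (\<Sum>i. f i x) \<partial>M)"
    and "(\<integral>\<^sup>+x. (\<Sum>i. ennreal \<bar>f i x\<bar>) \<partial>M) \<le> ennreal (suminf s)"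
proof -
  have "(\<integral>\<^sup>+x. (\<Sum>i. ennreal \<bar>f i x\<bar>) \<partial>M) = (\<Sum>i. \<integral>\<^sup>+x. ennreal \<bar>f i x\<bar> \<partial>M)"
    by (rule nn_integral_suminf) measurable
  also have "\<dots> \<le> (\<Sum>i. ennreal (s i))" using b by (intro suminf_le) auto
  also have "\<dots> = ennreal (suminf s)" using s by (simp add: suminf_ennreal2)
  finally show le: "(\<integral>\<^sup>+x. (\<Sum>i. ennreal \<bar>f i x\<bar>) \<partial>M) \<le> ennreal (suminf s)" .
  then have "(\<integral>\<^sup>+x. (\<Sum>i. ennreal \<bar>f i x\<bar>) \<partial>M) \<noteq> \<infinity>" by (auto simp: top_unique)
  then have "AE x in M. (\<Sum>i. ennreal \<bar>f i x\<bar>) \<noteq> \<infinity>"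
    by (intro nn_integral_PInf_AE) measurable
  then show ae: "AE x in M. summable (\<lambda>i. \<bar>f i x\<bar>)"
    by eventually_elim (auto intro!: summable_suminf_not_top)
  show i: "integrable M (f i)" for i
    using b[of i] by (intro integrableI_bounded) (auto simp: le_less_trans)
  have "(\<integral>x. \<bar>f i x\<bar> \<partial>M) \<le> s i" for i
  proof -
    have "ennreal (\<integral>x. \<bar>f i x\<bar> \<partial>M) = (\<integral>\<^sup>+x. ennreal \<bar>f i x\<bar> \<partial>M)"
      using i by (intro nn_integral_eq_integral[symmetric]) auto
    then show ?thesis using b[of i] s(2)[of i] by (metis ennreal_le_iff)
  qed
  then have sm: "summable (\<lambda>i. \<integral>x. norm (f i x) \<partial>M)"
    using s by (intro summable_comparison_test[OF _ s(1)]) auto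
  show "integrable M (\<lambda>x. \<Sum>i. f i x)" "(\<lambda>i. \<integral>x. f i x \<partial>M) sums (\<integral>x. (\<Sum>i. f i x) \<partial>M)"
    using integrable_suminf[OF i _ sm] sums_integral[OF i _ sm] ae by auto
qed

section \<open>Truncation and test functions\<close>

definition "trunc m (t::real) = max (- real m) (min (real m) t)"

lemma trunc_lip: "\<bar>trunc m s - trunc m t\<bar> \<le> \<bar>s - t\<bar>"
  by (auto simp: trunc_def)

lemma trunc_abs: "\<bar>trunc m t\<bar> \<le> \<bar>t\<bar>" "\<bar>trunc m t\<bar> \<le> m"
  by (auto simp: trunc_def)

lemma trunc_tendsto: "(\<lambda>m. trunc m t) \<longlonglongrightarrow> t"
proof (rule tendsto_eventually)
  obtain N :: nat where "\<bar>t\<bar> < N" using reals_Archimedean2 by blast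
  then have "trunc m t = t" if "m \<ge> N" for m
  proof -
    have "\<bar>t\<bar> \<le> real m" using \<open>\<bar>t\<bar> < N\<close> that by linarith
    then show ?thesis by (auto simp: trunc_def)
  qed
  then show "\<forall>\<^sub>F m in sequentially. trunc m t = t" by (auto simp: eventually_sequentially)
qed

lemma trunc_measurable [measurable]: "trunc m \<in> borel_measurable borel"
  unfolding trunc_def[abs_def] by measurable

text \<open>Collects what the estimates use of a test function. The one number \<open>M\<close>
  controls both the values and the Lipschitz constant, so that bounds linear in \<open>M\<close> are
  continuity estimates for distributions of order one.\<close>

definition lip_test :: "'a::euclidean_space set \<Rightarrow> real \<Rightarrow> ('a \<Rightarrow> real) \<Rightarrow> bool" where
  "lip_test K M \<phi> \<longleftrightarrow> continuous_on UNIV \<phi> \<and> (\<forall>x. \<bar>\<phi> x\<bar> \<le> M) \<and> (\<forall>x. x \<notin> K \<longrightarrow> \<phi> x = 0) \<and>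
     (\<forall>x y. \<bar>\<phi> x - \<phi> y\<bar> \<le> real DIM('a) * M * norm (x - y))"

lemma lip_test_measurable: "lip_test K M \<phi> \<Longrightarrow> \<phi> \<in> borel_measurable borel"
  by (simp add: lip_test_def borel_measurable_continuous_onI)

lemma lip_test_nonneg: "lip_test K M \<phi> \<Longrightarrow> 0 \<le> M"
  unfolding lip_test_def by (meson abs_ge_zero order_trans)

text \<open>Mean value inequality; the factor \<open>DIM('a)\<close> comes from bounding the
  operator norm of the derivative by the sum of the partial derivatives.\<close>

lemma test_lip_test:
  fixes \<phi> :: "'a::euclidean_space \<Rightarrow> real"
  assumes t: "\<phi> \<in> test_functions" and K: "\<And>x. x \<notin> K \<Longrightarrow> \<phi> x = 0"
    and M: "\<And>vs x. vs \<in> lists Basis \<Longrightarrow> length vs \<le> 1 \<Longrightarrow> \<bar>iter_deriv vs \<phi> x\<bar> \<le> M"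
  shows "lip_test K M \<phi>"
proof -
  have d: "\<phi> differentiable (at x)" for x
    using t unfolding test_functions_def by (auto dest!: bspec[of _ _ "[]"])
  have lip: "\<bar>\<phi> x - \<phi> y\<bar> \<le> real DIM('a) * M * norm (x - y)" for x y
  proof -
    have "norm (\<phi> x - \<phi> y) \<le> (real DIM('a) * M) * norm (x - y)"
    proof (rule differentiable_bound[OF convex_UNIV])
      fix z :: 'a
      show hd: "(\<phi> has_derivative frechet_derivative \<phi> (at z)) (at z within UNIV)"
        using d frechet_derivative_works by auto
      then have bl: "bounded_linear (frechet_derivative \<phi> (at z))"
        by (rule has_derivative_bounded_linear)
      show "onorm (frechet_derivative \<phi> (at z)) \<le> real DIM('a) * M"
      proof (rule onorm_le)
        fix v :: 'a
        have "frechet_derivative \<phi> (at z) v = frechet_derivative \<phi> (at z) (\<Sum>i\<in>Basis. (v \<bullet> i) *\<^sub>R i)"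
          by (simp add: euclidean_representation)
        also have "\<dots> = (\<Sum>i\<in>Basis. (v \<bullet> i) * frechet_derivative \<phi> (at z) i)"
          using bounded_linear.linear[OF bl] by (simp add: linear_sum linear_scale)
        finally have "norm (frechet_derivative \<phi> (at z) v) \<le> (\<Sum>i\<in>Basis. \<bar>v \<bullet> i\<bar> * \<bar>frechet_derivative \<phi> (at z) i\<bar>)"
          by (metis (mono_tags, lifting) abs_mult real_norm_def sum_abs sum.cong)
        also have "\<dots> \<le> (\<Sum>i\<in>(Basis::'a set). norm v * M)"
        proof (intro sum_mono mult_mono)
          fix i :: 'a assume i: "i \<in> Basis"
          show "\<bar>v \<bullet> i\<bar> \<le> norm v" using i by (rule Basis_le_norm)
          show "\<bar>frechet_derivative \<phi> (at z) i\<bar> \<le> M" using M[of "[i]" z] i by simp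
        qed auto
        finally show "norm (frechet_derivative \<phi> (at z) v) \<le> real DIM('a) * M * norm v"
          by (simp add: mult.commute mult.left_commute)
      qed
    qed auto
    then show ?thesis by simp
  qed
  have "continuous_on UNIV \<phi>"
    using d by (intro differentiable_imp_continuous_on) (simp add: differentiable_on_def)
  moreover have "\<bar>\<phi> x\<bar> \<le> M" for x using M[of "[]" x] by simp
  ultimately show ?thesis using K lip by (simp add: lip_test_def)
qed

lemma test_lip_test_ex:
  fixes \<phi> :: "'a::euclidean_space \<Rightarrow> real"
  assumes t: "\<phi> \<in> test_functions"
  obtains K M where "compact K" "lip_test K M \<phi>"
proof -
  obtain K where K: "compact K" "\<And>x. x \<notin> K \<Longrightarrow> \<phi> x = 0"
    using t unfolding test_functions_def by auto
  have d: "iter_deriv vs \<phi> differentiable (at x)" if "vs \<in> lists Basis" for vs x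
    using t that unfolding test_functions_def by auto
  have z: "iter_deriv vs \<phi> x = 0" if "vs \<in> lists Basis" "x \<notin> K" for vs x
    using that
  proof (induction vs arbitrary: x)
    case (Cons v vs)
    have "frechet_derivative (iter_deriv vs \<phi>) (at x) = frechet_derivative (\<lambda>x. 0) (at x)"
      using Cons K d[of vs x]
      by (intro frechet_derivative_transform_within_open[of _ _ "- K"]) (auto simp: compact_imp_closed open_Compl)
    then show ?case by simp
  qed (use K in auto)
  have bd: "\<exists>B\<ge>0. \<forall>x. \<bar>iter_deriv vs \<phi> x\<bar> \<le> B" if vs: "vs \<in> lists Basis" for vs
  proof -
    have "continuous_on K (iter_deriv vs \<phi>)"
      using d[OF vs]
        by (intro differentiable_imp_continuous_on) (auto simp: differentiable_on_def intro: differentiable_at_withinI)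
    then have "bounded (iter_deriv vs \<phi> ` K)" using K
      by (intro compact_imp_bounded compact_continuous_image)
    then obtain B where "\<And>x. x \<in> K \<Longrightarrow> \<bar>iter_deriv vs \<phi> x\<bar> \<le> B" by (auto simp: bounded_iff)
    then show ?thesis using z[OF vs]
      by (intro exI[of _ "max B 0"]) (metis abs_zero max.cobounded2 max.coboundedI1)
  qed
  then obtain B where B: "\<And>vs. vs \<in> lists Basis \<Longrightarrow> B vs \<ge> 0 \<and> (\<forall>x. \<bar>iter_deriv vs \<phi> x\<bar> \<le> B vs)" by metis
  let ?V = "insert [] ((\<lambda>i. [i]) ` Basis)"
  have V: "vs \<in> ?V" if "vs \<in> lists Basis" "length vs \<le> 1" for vs :: "'a list"
    using that by (cases vs) auto
  have "lip_test K (\<Sum>vs\<in>?V. B vs) \<phi>"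
  proof (rule test_lip_test[OF t K(2)])
    fix vs :: "'a list" and x assume vs: "vs \<in> lists Basis" "length vs \<le> 1"
    have "B vs \<le> (\<Sum>vs\<in>?V. B vs)" using V[OF vs] B by (intro member_le_sum) auto
    then show "\<bar>iter_deriv vs \<phi> x\<bar> \<le> (\<Sum>vs\<in>?V. B vs)" using B[OF vs(1)] by (meson order_trans)
  qed
  then show ?thesis using that K by blast
qed

context growth_space
begin

text \<open>\<open>trunc\<close> is 1-Lipschitz and is applied to \<open>f\<close> and to
  \<open>c\<close> at the same time. The truncated numbers are in general not the means of the
  truncated function, which is why \<open>c\<close> is kept separate from means.\<close>

lemma osc_family_trunc:
  assumes "osc_family f c A" shows "osc_family (\<lambda>x. trunc m (f x)) (\<lambda>Q. trunc m (c Q)) A"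
proof -
  have fm [measurable]: "f \<in> borel_measurable borel" and fi: "\<And>K. compact K \<Longrightarrow> set_integrable \<mu> K f"
    using assms by (auto simp: osc_family_def L1loc_def measurable_mu)
  have "(\<lambda>x. trunc m (f x)) \<in> L1loc \<mu>"
    unfolding L1loc_def
  proof (intro CollectI conjI allI impI)
    show "(\<lambda>x. trunc m (f x)) \<in> borel_measurable \<mu>" by (simp add: measurable_mu)
    fix K :: "'a set" assume K: "compact K"
    have [measurable]: "K \<in> sets borel" using K by (simp add: borel_compact)
    have "integrable \<mu> (\<lambda>x. indicator K x *\<^sub>R trunc m (f x))"
      using fi[OF K] unfolding set_integrable_def
      by (rule Bochner_Integration.integrable_bound) (auto simp: measurable_mu indicator_def trunc_abs)
    then show "set_integrable \<mu> K (\<lambda>x. trunc m (f x))" by (simp add: set_integrable_def)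
  qed
  moreover have "S_lipschitz (\<lambda>Q. trunc m (c Q)) A"
    using assms unfolding osc_family_def S_lipschitz_def by (meson trunc_lip order_trans)
  moreover have "(\<integral>\<^sup>+x\<in>cube_set Q. ennreal \<bar>trunc m (f x) - trunc m (c Q)\<bar> \<partial>\<mu>)
       \<le> (\<integral>\<^sup>+x\<in>cube_set Q. ennreal \<bar>f x - c Q\<bar> \<partial>\<mu>)" for Q
    by (intro nn_integral_mono mult_right_mono ennreal_leI trunc_lip) auto
  ultimately show ?thesis using assms unfolding osc_family_def by (meson order_trans)
qed

section \<open>Atoms and atomic blocks\<close>

definition "atom R Q a \<longleftrightarrow> a \<in> borel_measurable \<mu> \<and> is_cube \<mu> Q \<and> is_cube \<mu> R \<and> cube_set Q \<subseteq> cube_set R \<and>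
  (AE x in \<mu>. x \<notin> cube_set Q \<longrightarrow> a x = 0) \<and>
  (AE x in \<mu>. \<bar>a x\<bar> \<le> 1 / (mcube \<mu> (cube_scale 2 Q) * S_coeff \<mu> n Q R))"

lemma block_atoms:
  assumes "atomic_block \<mu> n R b s"
  obtains c a Q where "\<And>i::nat. atom R (Q i) (a i)" "AE x in \<mu>. (\<lambda>i. c i * a i x) sums b x"
    "(\<lambda>i. \<bar>c i\<bar>) sums s"
  using assms unfolding atomic_block_def atom_def by blast

lemma atom_bound:
  assumes "atom R Q a"
  shows "AE x in \<mu>. \<bar>a x\<bar> \<le> indicator (cube_set Q) x / (mcube \<mu> (cube_scale 2 Q) * S_coeff \<mu> n Q R)"
proof -
  have "AE x in \<mu>. x \<notin> cube_set Q \<longrightarrow> a x = 0"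
    "AE x in \<mu>. \<bar>a x\<bar> \<le> 1 / (mcube \<mu> (cube_scale 2 Q) * S_coeff \<mu> n Q R)"
    using assms by (auto simp: atom_def)
  then show ?thesis by eventually_elim (auto simp: indicator_def)
qed

lemma cube_sub_scale: "is_cube \<mu> Q \<Longrightarrow> 1 \<le> t \<Longrightarrow> cube_set Q \<subseteq> cube_set (cube_scale t Q)"
  by (cases Q) (auto intro!: cube_mono simp: mult_le_cancel_right1)

text \<open>Reduces a weighted bound for an atom to the integral of the weight over its cube, to be
  compared with the reciprocal of the normalisation.\<close>

lemma atom_weighted:
  assumes a: "atom R Q a" and g [measurable]: "g \<in> borel_measurable borel"
    and le: "(\<integral>\<^sup>+x\<in>cube_set Q. g x \<partial>\<mu>) \<le> ennreal (B * mcube \<mu> (cube_scale 2 Q) * S_coeff \<mu> n Q R)" and B: "0 \<le> B"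
  shows "(\<integral>\<^sup>+x. g x * ennreal \<bar>a x\<bar> \<partial>\<mu>) \<le> ennreal B"
proof -
  let ?k = "mcube \<mu> (cube_scale 2 Q) * S_coeff \<mu> n Q R"
  have S: "1 \<le> S_coeff \<mu> n Q R" using a by (intro S_ge_1) (auto simp: atom_def)
  then have k: "0 \<le> ?k" by simp
  have "(\<integral>\<^sup>+x. g x * ennreal \<bar>a x\<bar> \<partial>\<mu>) \<le> (\<integral>\<^sup>+x. ennreal (1 / ?k) * (g x * indicator (cube_set Q) x) \<partial>\<mu>)"
  proof (intro nn_integral_mono_AE)
    show "AE x in \<mu>. g x * ennreal \<bar>a x\<bar> \<le> ennreal (1 / ?k) * (g x * indicator (cube_set Q) x)"
      using atom_bound[OF a]
    proof eventually_elim
      case (elim x)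
      then have "ennreal \<bar>a x\<bar> \<le> ennreal (1 / ?k) * indicator (cube_set Q) x"
        using ennreal_leI[OF elim] k by (cases "x \<in> cube_set Q") auto
      then have "g x * ennreal \<bar>a x\<bar> \<le> g x * (ennreal (1 / ?k) * indicator (cube_set Q) x)"
        by (intro mult_left_mono) auto
      then show ?case by (simp only: mult_ac)
    qed
  qed
  also have "\<dots> = ennreal (1 / ?k) * (\<integral>\<^sup>+x\<in>cube_set Q. g x \<partial>\<mu>)"
    by (rule nn_integral_cmult) measurable
  also have "\<dots> \<le> ennreal (1 / ?k) * ennreal (B * ?k)" using le
    by (intro mult_left_mono) (auto simp: mult.assoc)
  \<comment> \<open>If the double cube is null, then \<open>1 / ?k\<close> is 0 and so is the
    left-hand side.\<close>
  also have "\<dots> \<le> ennreal B"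
    using k B by (cases "?k = 0") (auto simp: ennreal_mult[symmetric])
  finally show ?thesis .
qed

lemma atom_L1: assumes a: "atom R Q a" shows "(\<integral>\<^sup>+x. ennreal \<bar>a x\<bar> \<partial>\<mu>) \<le> ennreal (1 / S_coeff \<mu> n Q R)"
proof -
  have Q: "is_cube \<mu> Q" and S: "1 \<le> S_coeff \<mu> n Q R" using a by (auto simp: atom_def intro: S_ge_1)
  have "(\<integral>\<^sup>+x. 1 * ennreal \<bar>a x\<bar> \<partial>\<mu>) \<le> ennreal (1 / S_coeff \<mu> n Q R)"
  proof (rule atom_weighted[OF a])
    have "(\<integral>\<^sup>+x\<in>cube_set Q. 1 \<partial>\<mu>) = ennreal (mcube \<mu> Q)" using emeasure_cube[OF Q] by simp
    also have "\<dots> \<le> ennreal (mcube \<mu> (cube_scale 2 Q))"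
      using Q by (intro ennreal_leI mcube_mono is_cube_scale cube_sub_scale) auto
    finally show "(\<integral>\<^sup>+x\<in>cube_set Q. 1 \<partial>\<mu>) \<le> ennreal (1 / S_coeff \<mu> n Q R * mcube \<mu> (cube_scale 2 Q) * S_coeff \<mu> n Q R)"
      using S by simp
  qed (use S in auto)
  then show ?thesis by simp
qed

text \<open>Triangle inequality over the representation by atoms; estimates that do not exploit the
  cancellation of a block go through this lemma.\<close>

lemma block_weighted:
  assumes b: "atomic_block \<mu> n R b s" and g [measurable]: "g \<in> borel_measurable borel" and B: "0 \<le> B"
    and le: "\<And>Q a. atom R Q a \<Longrightarrow> (\<integral>\<^sup>+x. g x * ennreal \<bar>a x\<bar> \<partial>\<mu>) \<le> ennreal B"
  shows "(\<integral>\<^sup>+x. g x * ennreal \<bar>b x\<bar> \<partial>\<mu>) \<le> ennreal (B * s)"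
proof -
  obtain c a Q where at: "\<And>i::nat. atom R (Q i) (a i)" and bs: "AE x in \<mu>. (\<lambda>i. c i * a i x) sums b x"
    and cs: "(\<lambda>i. \<bar>c i\<bar>) sums s" using block_atoms[OF b] by metis
  have am [measurable]: "a i \<in> borel_measurable borel" for i using at[of i]
    by (simp add: atom_def measurable_mu)
  have ms: "\<And>f. f \<in> borel_measurable borel \<longleftrightarrow> f \<in> borel_measurable \<mu>" by (simp add: measurable_mu)
  have "(\<integral>\<^sup>+x. g x * ennreal \<bar>b x\<bar> \<partial>\<mu>) \<le> (\<integral>\<^sup>+x. (\<Sum>i. ennreal \<bar>c i\<bar> * (g x * ennreal \<bar>a i x\<bar>)) \<partial>\<mu>)"
  proof (intro nn_integral_mono_AE)
    show "AE x in \<mu>. g x * ennreal \<bar>b x\<bar> \<le> (\<Sum>i. ennreal \<bar>c i\<bar> * (g x * ennreal \<bar>a i x\<bar>))"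
      using bs
    proof eventually_elim
      case (elim x)
      have "ennreal \<bar>b x\<bar> \<le> (\<Sum>i. ennreal \<bar>c i * a i x\<bar>)"
      \<comment> \<open>The representing series is only known to converge at \<open>x\<close>,
        perhaps conditionally; if it does not converge absolutely, the right-hand side is
        infinite.\<close>
      proof (cases "summable (\<lambda>i. \<bar>c i * a i x\<bar>)")
        case True
        then have "\<bar>b x\<bar> \<le> (\<Sum>i. \<bar>c i * a i x\<bar>)"
          using sums_unique[OF elim] summable_rabs[OF True] by simp
        then show ?thesis using True by (simp add: suminf_ennreal2 ennreal_leI)
      next
        case False
        then have "(\<Sum>i. ennreal \<bar>c i * a i x\<bar>) = \<infinity>"
          by (metis abs_ge_zero infinity_ennreal_def summable_suminf_not_top)
        then show ?thesis by simp
      qed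
      then have "g x * ennreal \<bar>b x\<bar> \<le> g x * (\<Sum>i. ennreal \<bar>c i * a i x\<bar>)" by (rule mult_left_mono) simp
      also have "\<dots> = (\<Sum>i. ennreal \<bar>c i\<bar> * (g x * ennreal \<bar>a i x\<bar>))"
        by (simp add: ennreal_suminf_cmult[symmetric] abs_mult ennreal_mult mult.left_commute del: ennreal_suminf_cmult)
      finally show ?case .
    qed
  qed
  also have "\<dots> = (\<Sum>i. \<integral>\<^sup>+x. ennreal \<bar>c i\<bar> * (g x * ennreal \<bar>a i x\<bar>) \<partial>\<mu>)"
    by (rule nn_integral_suminf) measurable
  also have "\<dots> \<le> (\<Sum>i. ennreal (B * \<bar>c i\<bar>))"
  proof (intro suminf_le)
    fix i
    have "(\<integral>\<^sup>+x. ennreal \<bar>c i\<bar> * (g x * ennreal \<bar>a i x\<bar>) \<partial>\<mu>) = ennreal \<bar>c i\<bar> * (\<integral>\<^sup>+x. g x * ennreal \<bar>a i x\<bar> \<partial>\<mu>)"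
      by (rule nn_integral_cmult) measurable
    also have "\<dots> \<le> ennreal \<bar>c i\<bar> * ennreal B" using le[OF at] by (intro mult_left_mono) auto
    finally show "(\<integral>\<^sup>+x. ennreal \<bar>c i\<bar> * (g x * ennreal \<bar>a i x\<bar>) \<partial>\<mu>) \<le> ennreal (B * \<bar>c i\<bar>)"
      using B by (simp add: ennreal_mult mult.commute)
  qed auto
  also have "\<dots> = ennreal (B * s)"
  proof -
    have "(\<lambda>i. B * \<bar>c i\<bar>) sums (B * s)" using cs by (rule sums_mult)
    then show ?thesis using B by (simp add: suminf_ennreal2 sums_iff)
  qed
  finally show ?thesis .
qed

lemma block_s_nonneg: "atomic_block \<mu> n R b s \<Longrightarrow> 0 \<le> s"
proof -
  assume "atomic_block \<mu> n R b s"
  then obtain c :: "nat \<Rightarrow> real" where c: "(\<lambda>i. \<bar>c i\<bar>) sums s" unfolding atomic_block_def by blast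
  have "0 \<le> (\<Sum>i. \<bar>c i\<bar>)" using c by (intro suminf_nonneg) (auto simp: sums_iff)
  then show "0 \<le> s" using c by (simp add: sums_iff)
qed

lemma block_measurable: "atomic_block \<mu> n R b s \<Longrightarrow> b \<in> borel_measurable borel"
  by (auto simp: atomic_block_def measurable_mu dest: borel_measurable_integrable)

lemma block_L1: "atomic_block \<mu> n R b s \<Longrightarrow> (\<integral>\<^sup>+x. ennreal \<bar>b x\<bar> \<partial>\<mu>) \<le> ennreal s"
proof -
  assume b: "atomic_block \<mu> n R b s"
  have "(\<integral>\<^sup>+x. 1 * ennreal \<bar>b x\<bar> \<partial>\<mu>) \<le> ennreal (1 * s)"
  proof (rule block_weighted[OF b])
    fix Q a assume a: "atom R Q a"
    then have "1 \<le> S_coeff \<mu> n Q R" by (auto simp: atom_def intro: S_ge_1)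
    then have "ennreal (1 / S_coeff \<mu> n Q R) \<le> ennreal 1" by (intro ennreal_leI) simp
    then show "(\<integral>\<^sup>+x. 1 * ennreal \<bar>a x\<bar> \<partial>\<mu>) \<le> ennreal 1" using atom_L1[OF a] order_trans by fastforce
  qed auto
  then show ?thesis by simp
qed

text \<open>On the cube \<open>Q\<close> of an atom the mean of \<open>|f - c Q|\<close> is
  controlled by the mass of the double cube, while \<open>|c Q - c R|\<close> may be as large as
  \<open>A\<close> times S. The factor S in the normalisation of atoms pays for exactly
  this.\<close>

lemma block_osc:
  assumes f: "osc_family f c A" and b: "atomic_block \<mu> n R b s"
  shows "(\<integral>\<^sup>+x. ennreal \<bar>f x - c R\<bar> * ennreal \<bar>b x\<bar> \<partial>\<mu>) \<le> ennreal (2 * A * s)"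
proof (rule block_weighted[OF b])
  have [measurable]: "f \<in> borel_measurable borel" using osc_family_measurable[OF f]
    by (simp add: measurable_mu)
  show "(\<lambda>x. ennreal \<bar>f x - c R\<bar>) \<in> borel_measurable borel" by measurable
  have A: "0 \<le> A" using f by (simp add: osc_family_def S_lipschitz_def)
  then show "0 \<le> 2 * A" by simp
  fix Q a assume a: "atom R Q a"
  then have QR: "is_cube \<mu> Q" "is_cube \<mu> R" "cube_set Q \<subseteq> cube_set R" by (auto simp: atom_def)
  have S: "1 \<le> S_coeff \<mu> n Q R" by (rule S_ge_1[OF QR(1,2)])
  show "(\<integral>\<^sup>+x. ennreal \<bar>f x - c R\<bar> * ennreal \<bar>a x\<bar> \<partial>\<mu>) \<le> ennreal (2 * A)"
  proof (rule atom_weighted[OF a])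
    have "(\<integral>\<^sup>+x\<in>cube_set Q. ennreal \<bar>f x - c R\<bar> \<partial>\<mu>)
        \<le> ennreal (A * mcube \<mu> (cube_scale (4/3) Q) + \<bar>c Q - c R\<bar> * mcube \<mu> Q)"
          by (rule osc_family_osc[OF f QR(1)])
    also have "\<dots> \<le> ennreal (A * (mcube \<mu> (cube_scale 2 Q) * S_coeff \<mu> n Q R) + A * S_coeff \<mu> n Q R * mcube \<mu> (cube_scale 2 Q))"
    proof (intro ennreal_leI add_mono mult_mono mult_left_mono A)
      have "mcube \<mu> (cube_scale (4/3) Q) \<le> mcube \<mu> (cube_scale 2 Q)"
        using QR(1) by (cases Q) (auto simp flip: mass_def intro!: mass_mono)
      also have "\<dots> * 1 \<le> mcube \<mu> (cube_scale 2 Q) * S_coeff \<mu> n Q R" using S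
        by (intro mult_left_mono) auto
      finally show "mcube \<mu> (cube_scale (4/3) Q) \<le> mcube \<mu> (cube_scale 2 Q) * S_coeff \<mu> n Q R" by simp
      show "mcube \<mu> Q \<le> mcube \<mu> (cube_scale 2 Q)"
        using QR(1) by (intro mcube_mono is_cube_scale cube_sub_scale) auto
      show "\<bar>c Q - c R\<bar> \<le> A * S_coeff \<mu> n Q R" using f QR by (auto simp: osc_family_def S_lipschitz_def)
    qed (use A S in auto)
    finally show "(\<integral>\<^sup>+x\<in>cube_set Q. ennreal \<bar>f x - c R\<bar> \<partial>\<mu>) \<le> ennreal (2 * A * mcube \<mu> (cube_scale 2 Q) * S_coeff \<mu> n Q R)"
      by (simp add: algebra_simps)
  qed (use A in auto)
qed


section \<open>Local pairing of blocks with test functions\<close>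

definition "base = (SOME x. x \<in> msupport \<mu>)"

text \<open>\<open>base\<close> serves as origin. If the support is empty, the measure is zero by
  \<open>AE_msupport\<close> and any point will do.\<close>

lemma base: "x \<in> msupport \<mu> \<Longrightarrow> base \<in> msupport \<mu>"
  unfolding base_def by (rule someI)

text \<open>Above scale 1 the masses are bounded by that of the large cube and the denominators grow
  at least geometrically. So the drift of \<open>c\<close> from unit scale up to a large cube is
  bounded by the mass of that cube, which the normalisation of an atom can absorb.\<close>

lemma dens_sum_le_mass:
  assumes "infnorm (y - x) \<le> r / 2" "r > 1"
  shows "dens_sum y 0 (level r - 1) \<le> mass x (2 * r)"
proof -
  let ?N = "nat (level r - 1)"
  have "dens y (2 powi k) \<le> mass x (2 * r) * (1/2) ^ nat k" if k: "k \<in> {0<..level r - 1}" for k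
  proof -
    have "2 * 2 powi k = (2::real) powi (k + 1)" by (simp add: power_int_add)
    also have "\<dots> \<le> 2 powi level r" using k by (simp add: powi_le_iff)
    also have "\<dots> \<le> r" using assms by (intro level_bounds) auto
    finally have "2 powi k \<le> r / 2" by simp
    then have m: "mass y (2 powi k) \<le> mass x (2 * r)"
      using assms by (intro mass_subset cube_subsetI) auto
    have e: "(2::real) powi k = 2 ^ nat k" using k by (simp add: power_int_nonneg_exp)
    have "(2::real) ^ nat k \<le> (2 ^ nat k) ^ n" using n_pos by (intro self_le_power one_le_power) auto
    then have "mass y (2 powi k) / (2 powi k) ^ n \<le> mass x (2 * r) / 2 ^ nat k"
      unfolding e using m[unfolded e] by (intro frac_le) auto
    then show ?thesis by (simp add: dens_def power_one_over field_simps)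
  qed
  then have "dens_sum y 0 (level r - 1) \<le> (\<Sum>k\<in>{0<..level r - 1}. mass x (2 * r) * (1/2) ^ nat k)"
    unfolding dens_sum_def by (rule sum_mono)
  also have "\<dots> = mass x (2 * r) * (\<Sum>k\<in>{0<..level r - 1}. (1/2) ^ nat k)" by (simp add: sum_distrib_left)
  also have "(\<Sum>k\<in>{0<..level r - 1}. (1/2) ^ nat k) = (\<Sum>i=1..?N. (1/2::real) ^ i)"
    by (rule sum.reindex_bij_witness[where i=int and j=nat]) auto
  also have "mass x (2 * r) * \<dots> \<le> mass x (2 * r) * 1"
  proof (intro mult_left_mono)
    have "(\<Sum>i=1..N. (1/2::real) ^ i) = 1 - (1/2) ^ N" for N by (induction N) auto
    then show "(\<Sum>i=1..?N. (1/2::real) ^ i) \<le> 1" by simp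
  qed simp
  finally show ?thesis by simp
qed

text \<open>Here \<open>c R\<close> may be large, but an atom puts little weight on
  \<open>K\<close>. If its cube \<open>Q\<close> has side at most 1 and meets \<open>K\<close>, then
  \<open>|c Q|\<close> is bounded by a multiple of S, because \<open>R\<close> reaches beyond scale
  1. If \<open>Q\<close> is larger, \<open>|c Q|\<close> is bounded by a constant plus a multiple of
  the mass of the double cube, and the normalisation leaves a multiple of the measure of
  \<open>K\<close>. The constant \<open>E\<close> depends on \<open>c\<close> only through
  \<open>A\<close> and \<open>D0\<close>, so it serves all truncations at once.\<close>

lemma atom_local:
  assumes K: "K \<subseteq> cube_set (Cube base k)" "K \<in> sets borel" and k: "k > 0" and A: "0 \<le> A" and D0: "0 \<le> D0"
  shows "\<exists>E\<ge>0. \<forall>c R Q a. S_lipschitz c A \<and> \<bar>c (Cube base (k + 1))\<bar> \<le> D0 \<and> \<bar>c Whole\<bar> \<le> D0 \<and> atom R Q a \<and>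
     (R = Whole \<or> (\<exists>y s. R = Cube y s \<and> 1 < s)) \<longrightarrow>
     (\<integral>\<^sup>+x. ennreal (\<bar>c R\<bar> * indicator K x) * ennreal \<bar>a x\<bar> \<partial>\<mu>) \<le> ennreal E"
proof -
  have KB: "bounded K" using K bounded_cube bounded_subset by blast
  define \<kappa> where "\<kappa> = k + 1"
  define D1 where "D1 = D0 + A * (Kc * (1 + C * level \<kappa>))"
  define D2 where "D2 = D1 + A * (Kc * (1 + C)) + A * (Kc * (1 + 2 * C))"
  define D3 where "D3 = A * Kc"
  define D4 where "D4 = D1 + A * (Kc * (1 + 2 ^ n))"
  define E where "E = A + D0 + D4 + D2 + D3 * measure \<mu> K"
  have l\<kappa>: "level \<kappa> \<ge> 0" using level_mono[of 1 \<kappa>] k level_powi[of 0] by (simp add: \<kappa>_def)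
  have pos: "D1 \<ge> 0" "D2 \<ge> 0" "D3 \<ge> 0" "D4 \<ge> 0" "E \<ge> 0"
    using A D0 Kc_pos C1 l\<kappa> by (auto simp: D1_def D2_def D3_def D4_def E_def)
  show ?thesis
  proof (intro exI[of _ E] conjI pos allI impI, elim conjE)
    fix c R Q a assume c: "S_lipschitz c A" and c0: "\<bar>c (Cube base (k + 1))\<bar> \<le> D0" "\<bar>c Whole\<bar> \<le> D0"
      and a: "atom R Q a" and R: "R = Whole \<or> (\<exists>y s. R = Cube y s \<and> 1 < s)"
    have QR: "is_cube \<mu> Q" "is_cube \<mu> R" "cube_set Q \<subseteq> cube_set R" using a by (auto simp: atom_def)
    let ?S = "S_coeff \<mu> n Q R" and ?q = "mcube \<mu> (cube_scale 2 Q)" and ?m = "measure \<mu> (K \<inter> cube_set Q)"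
    have S: "1 \<le> ?S" by (rule S_ge_1[OF QR(1,2)])
    have mq: "?m \<le> ?q"
    proof -
      have "?m \<le> mcube \<mu> Q" using is_cube_finite[OF QR(1)] K(2)
        by (intro measure_mono_fmeasurable fmeasurableI) auto
      also have "\<dots> \<le> ?q" using QR(1) by (intro mcube_mono is_cube_scale cube_sub_scale) auto
      finally show ?thesis .
    qed
    have mK: "?m \<le> measure \<mu> K" using bounded_finite[OF KB] K(2)
        by (intro measure_mono_fmeasurable fmeasurableI) auto
    have m0: "0 \<le> ?m" "0 \<le> ?q" by auto
    have near: "\<bar>c (Cube y 1)\<bar> \<le> D1" if "y \<in> msupport \<mu>" "infnorm (y - base) \<le> \<kappa>" for y
    proof -
      have "\<bar>c (Cube y 1) - c (Cube base \<kappa>)\<bar> \<le> A * (Kc * (1 + C * (level \<kappa> - level 1)))"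
        using that base k by (intro S_lipschitz_compare_levels c) (auto simp: \<kappa>_def)
      then show ?thesis using c0(1) level_powi[of 0] by (simp add: D1_def \<kappa>_def)
    qed
    have cQ: "\<bar>c Q\<bar> * ?m \<le> (D0 + D4 + D2 + D3 * measure \<mu> K) * (?q * ?S)"
    proof (cases "?m = 0")
      case True then show ?thesis using pos D0 S by auto
    next
      case False
      have fin: "emeasure \<mu> (K \<inter> cube_set Q) \<noteq> 0"
        using False by (auto simp: measure_def)
      have "\<exists>y. y \<in> K \<inter> cube_set Q \<and> y \<in> msupport \<mu>"
      proof (rule ccontr)
        assume "\<nexists>y. y \<in> K \<inter> cube_set Q \<and> y \<in> msupport \<mu>"
        then have "AE x in \<mu>. x \<notin> K \<inter> cube_set Q" using AE_msupport by (auto elim!: eventually_mono)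
        then have "emeasure \<mu> (K \<inter> cube_set Q) = 0"
          using K(2) by (subst (asm) AE_iff_measurable[OF _ refl]) (auto simp: Int_def)
        then show False using fin by simp
      qed
      then obtain y where y: "y \<in> K" "y \<in> cube_set Q" "y \<in> msupport \<mu>" by blast
      have yb: "infnorm (y - base) \<le> k / 2" using y K by (auto simp: mem_cube_set)
      show ?thesis
      proof (cases Q)
        case Whole
        have "\<bar>c Q\<bar> * ?m \<le> D0 * (?q * ?S)"
        proof (intro mult_mono)
          show "?m \<le> ?q * ?S" using mq mult_left_mono[OF S, of ?q] by simp
        qed (use Whole c0 D0 in auto)
        also have "\<dots> \<le> (D0 + D4 + D2 + D3 * measure \<mu> K) * (?q * ?S)"
          using pos S by (intro mult_right_mono) auto
        finally show ?thesis .
      next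
        case (Cube x r)
        have x: "x \<in> msupport \<mu>" "r > 0" "infnorm (y - x) \<le> r / 2" using QR(1) Cube y
          by (auto simp: mem_cube_set)
        have xb: "infnorm (x - base) \<le> r / 2 + k / 2"
          using infnorm_triangle[of "x - y" "y - base"] yb x(3) infnorm_sub[of x y] by simp
        show ?thesis
        proof (cases "r \<le> 1")
          case True
          \<comment> \<open>\<open>R\<close> is the whole space or has side more than 1, so the
            densities from \<open>Q\<close> up to unit scale are part of S.\<close>
          have "dens_sum x (level r) (level 1) \<le> 2 ^ n * ?S"
            using R
          proof (elim disjE exE conjE)
            assume "R = Whole" then show ?thesis using Cube QR x by (auto intro!: dens_sum_le_S_Whole)
          next
            fix z s assume R: "R = Cube z s" "1 < s"
            have "dens_sum x (level r) (level 1) \<le> dens_sum x (level r) (level s)" using R x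
              by (intro dens_sum_mono level_mono) auto
            also have "\<dots> \<le> 2 ^ n * ?S" unfolding Cube R using R True x by (intro dens_sum_le_S) auto
            finally show ?thesis .
          qed
          moreover have "\<bar>c (Cube x r) - c (Cube x 1)\<bar> \<le> A * (Kc * (1 + dens_sum x (level r) (level 1)))"
            using x True by (intro S_lipschitz_compare c) (auto simp: infnorm_0)
          moreover have "\<bar>c (Cube x 1)\<bar> \<le> D1" using xb True k by (intro near x) (simp add: \<kappa>_def)
          moreover have "A * (Kc * (1 + dens_sum x (level r) (level 1))) \<le> A * (Kc * (1 + 2 ^ n * ?S))"
            using A Kc_pos calculation(1) by (intro mult_left_mono add_left_mono) auto
          ultimately have "\<bar>c Q\<bar> \<le> D1 + A * (Kc * (1 + 2 ^ n * ?S))" unfolding Cube by linarith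
          also have "\<dots> \<le> D1 * ?S + A * (Kc * (1 * ?S + 2 ^ n * ?S))"
            using S A Kc_pos mult_left_mono[OF S pos(1)]
            by (intro add_mono mult_left_mono) auto
          also have "\<dots> = D4 * ?S" by (simp add: D4_def algebra_simps)
          finally have "\<bar>c Q\<bar> * ?m \<le> (D4 * ?S) * ?q" using mq S pos by (intro mult_mono) auto
          also have "\<dots> = D4 * (?q * ?S)" by simp
          also have "\<dots> \<le> (D0 + D4 + D2 + D3 * measure \<mu> K) * (?q * ?S)"
            using pos S D0 by (intro mult_right_mono) auto
          finally show ?thesis .
        next
          case False
          have l2: "level (2 * r) = level r + 1" using level_mult_power[of r 1] x by simp
          have 1: "\<bar>c (Cube x r) - c (Cube x (2 * r))\<bar> \<le> A * (Kc * (1 + C))"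
            using S_lipschitz_compare_levels[OF c x(1) x(1) x(2), of "2 * r"] x l2
              by (simp add: infnorm_0)
          have "\<bar>c (Cube y 1) - c (Cube x (2 * r))\<bar> \<le> A * (Kc * (1 + dens_sum y (level 1) (level (2 * r))))"
            using x y False by (intro S_lipschitz_compare c) auto
          also have "dens_sum y (level 1) (level (2 * r)) \<le> mass x (2 * r) + 2 * C"
            using dens_sum_split[of y 0 "level r + 1" "level r - 1"] dens_sum_bound2[OF y(3), of "level r - 1"]
              dens_sum_le_mass[of y x r] x False level_powi[of 0] l2 by (simp add: add.commute)
          finally have "\<bar>c (Cube y 1) - c (Cube x (2 * r))\<bar> \<le> A * (Kc * (1 + (mass x (2 * r) + 2 * C)))"
            using A Kc_pos by (simp add: mult_left_mono)
          moreover have "\<bar>c (Cube y 1)\<bar> \<le> D1" using yb k by (intro near y) (simp add: \<kappa>_def)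
          ultimately have "\<bar>c Q\<bar> \<le> D1 + A * (Kc * (1 + C)) + A * (Kc * (1 + (mass x (2 * r) + 2 * C)))"
            using 1 unfolding Cube by linarith
          also have "\<dots> = D2 + D3 * ?q" by (simp add: D2_def D3_def Cube mass_def algebra_simps)
          finally have "\<bar>c Q\<bar> * ?m \<le> (D2 + D3 * ?q) * ?m" using m0 by (intro mult_right_mono) auto
          also have "\<dots> \<le> D2 * ?q + D3 * ?q * measure \<mu> K"
            unfolding distrib_right using pos mq mK by (intro add_mono mult_left_mono) auto
          also have "\<dots> = (D2 + D3 * measure \<mu> K) * (?q * 1)" by (simp add: algebra_simps)
          also have "\<dots> \<le> (D0 + D4 + D2 + D3 * measure \<mu> K) * (?q * ?S)"
            using pos S D0 by (intro mult_mono mult_left_mono) auto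
          finally show ?thesis .
        qed
      qed
    qed
    show "(\<integral>\<^sup>+x. ennreal (\<bar>c R\<bar> * indicator K x) * ennreal \<bar>a x\<bar> \<partial>\<mu>) \<le> ennreal E"
    proof (rule atom_weighted[OF a])
      show "(\<lambda>x. ennreal (\<bar>c R\<bar> * indicator K x)) \<in> borel_measurable borel" using K(2) by measurable
      have "\<bar>c R\<bar> * ?m \<le> (A * ?S + \<bar>c Q\<bar>) * ?m"
      proof (intro mult_right_mono)
        have "\<bar>c Q - c R\<bar> \<le> A * ?S" using c QR by (auto simp: S_lipschitz_def)
        then show "\<bar>c R\<bar> \<le> A * ?S + \<bar>c Q\<bar>" by linarith
      qed auto
      also have "\<dots> \<le> A * (?q * ?S) + (D0 + D4 + D2 + D3 * measure \<mu> K) * (?q * ?S)"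
      proof -
        have "A * ?S * ?m \<le> A * ?S * ?q" using mq A S by (intro mult_left_mono) auto
        also have "\<dots> = A * (?q * ?S)" by simp
        finally show ?thesis using cQ unfolding distrib_right[of "A * ?S" "\<bar>c Q\<bar>"] by linarith
      qed
      also have "\<dots> = E * ?q * ?S" by (simp add: E_def algebra_simps)
      finally have fin: "\<bar>c R\<bar> * ?m \<le> E * ?q * ?S" .
      have "(\<integral>\<^sup>+x\<in>cube_set Q. ennreal (\<bar>c R\<bar> * indicator K x) \<partial>\<mu>) = (\<integral>\<^sup>+x. ennreal \<bar>c R\<bar> * indicator (K \<inter> cube_set Q) x \<partial>\<mu>)"
        by (intro nn_integral_cong) (auto simp: indicator_def)
      also have "\<dots> = ennreal \<bar>c R\<bar> * emeasure \<mu> (K \<inter> cube_set Q)"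
        using K(2) by (intro nn_integral_cmult_indicator) auto
      also have "emeasure \<mu> (K \<inter> cube_set Q) = ennreal ?m"
      proof (rule emeasure_eq_ennreal_measure)
        have "bounded (K \<inter> cube_set Q)" using KB by (rule bounded_subset) auto
        then show "emeasure \<mu> (K \<inter> cube_set Q) \<noteq> top" using bounded_finite by fastforce
      qed
      also have "ennreal \<bar>c R\<bar> * ennreal ?m = ennreal (\<bar>c R\<bar> * ?m)" by (simp add: ennreal_mult)
      also have "\<dots> \<le> ennreal (E * ?q * ?S)" using fin by (rule ennreal_leI)
      finally show "(\<integral>\<^sup>+x\<in>cube_set Q. ennreal (\<bar>c R\<bar> * indicator K x) \<partial>\<mu>) \<le> ennreal (E * ?q * ?S)" .
    qed (rule pos)
  qed
qed

text \<open>A dyadic form of the boundedness of \<open>r * ln (1 / r)\<close>: in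
  \<open>pairing\<close> the factor \<open>r\<close> comes from cancellation and the logarithm from
  the growth of \<open>c\<close> on small cubes.\<close>

lemma level_times_side:
  assumes "0 < r" "r \<le> 1" shows "r * (- level r) \<le> 2"
proof -
  have l: "level r \<le> 0" using level_mono[of r 1] assms level_powi[of 0] by simp
  have "real (nat (- level r)) < 2 ^ nat (- level r)" by (rule of_nat_less_two_power)
  moreover have "(2::real) ^ nat (- level r) * 2 powi (level r) = 1"
    using l by (simp add: power_int_def field_simps)
  moreover have "r < 2 * 2 powi level r" using level_bounds(2)[OF assms(1)] by (simp add: power_int_add)
  ultimately have "r * real (nat (- level r)) \<le> (2 * 2 powi level r) * 2 ^ nat (- level r)"
    using assms by (intro mult_mono) (linarith, linarith, auto)
  also have "\<dots> = 2" using \<open>(2::real) ^ nat (- level r) * 2 powi (level r) = 1\<close>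
    by (simp add: mult.commute)
  finally show ?thesis using l by simp
qed

text \<open>If \<open>R\<close> is large, the claim follows from \<open>atom_local\<close> without
  cancellation. If \<open>R\<close> has side \<open>r\<close> at most 1 and meets \<open>K\<close>,
  then \<open>\<phi>\<close> may be replaced by \<open>\<phi> - \<phi> y\<close>, of size at most a
  multiple of \<open>M * r\<close> on \<open>R\<close>, while \<open>|c R|\<close> is at most a
  constant plus a multiple of \<open>- level r\<close>. Again \<open>E\<close> is the same for all
  \<open>c\<close> with the given \<open>A\<close> and \<open>D0\<close>.\<close>

lemma pairing:
  assumes K: "K \<subseteq> cube_set (Cube base k)" "K \<in> sets borel" and k: "k > 0" and A: "0 \<le> A" and D0: "0 \<le> D0"
  shows "\<exists>E\<ge>0. \<forall>c R b s \<phi> M. S_lipschitz c A \<and> \<bar>c (Cube base (k + 1))\<bar> \<le> D0 \<and> \<bar>c Whole\<bar> \<le> D0 \<and>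
     atomic_block \<mu> n R b s \<and> lip_test K M \<phi> \<longrightarrow> \<bar>c R * (\<integral>x. \<phi> x * b x \<partial>\<mu>)\<bar> \<le> E * M * s"
proof -
  obtain E where E: "E \<ge> 0" "\<And>c R Q a. S_lipschitz c A \<Longrightarrow> \<bar>c (Cube base (k + 1))\<bar> \<le> D0 \<Longrightarrow> \<bar>c Whole\<bar> \<le> D0 \<Longrightarrow> atom R Q a \<Longrightarrow>
     (R = Whole \<or> (\<exists>y s. R = Cube y s \<and> 1 < s)) \<Longrightarrow>
     (\<integral>\<^sup>+x. ennreal (\<bar>c R\<bar> * indicator K x) * ennreal \<bar>a x\<bar> \<partial>\<mu>) \<le> ennreal E"
    using atom_local[OF assms] by blast
  define d where "d = real DIM('a)"
  define L where "L = D0 + A * (Kc * (1 + C * (level (k + 1) + 2)))"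
  have lk: "level (k + 1) \<ge> 0" using level_mono[of 1 "k + 1"] k level_powi[of 0] by simp
  have L0: "L \<ge> 0" using A D0 Kc_pos C1 lk by (auto simp: L_def)
  define E' where "E' = E + d * d * L"
  have d0: "d \<ge> 1" by (simp add: d_def Suc_leI)
  show ?thesis
  proof (intro exI[of _ E'] conjI allI impI, goal_cases)
    case 1 show ?case using E L0 d0 by (simp add: E'_def)
  next
    case (2 c R b s \<phi> M)
    then have c: "S_lipschitz c A" and c0: "\<bar>c (Cube base (k + 1))\<bar> \<le> D0" "\<bar>c Whole\<bar> \<le> D0"
      and b: "atomic_block \<mu> n R b s" and \<phi>: "lip_test K M \<phi>" by auto
    have [measurable]: "b \<in> borel_measurable borel" by (rule block_measurable[OF b])
    have [measurable]: "K \<in> sets borel" by (rule K(2))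
    have [measurable]: "\<phi> \<in> borel_measurable borel" by (rule lip_test_measurable[OF \<phi>])
    have M: "M \<ge> 0" by (rule lip_test_nonneg[OF \<phi>])
    have s: "s \<ge> 0" by (rule block_s_nonneg[OF b])
    have bi: "integrable \<mu> b" "(\<integral>x. b x \<partial>\<mu>) = 0" "is_cube \<mu> R" "AE x in \<mu>. x \<notin> cube_set R \<longrightarrow> b x = 0"
      using b by (auto simp: atomic_block_def)
    have \<phi>M: "\<bar>\<phi> x\<bar> \<le> M" "x \<notin> K \<Longrightarrow> \<phi> x = 0" "\<bar>\<phi> x - \<phi> y\<bar> \<le> d * M * norm (x - y)" for x y
      using \<phi> by (auto simp: lip_test_def d_def)
    have \<phi>b: "integrable \<mu> (\<lambda>x. \<phi> x * b x)"
      by (rule Bochner_Integration.integrable_bound[OF integrable_mult_right[OF bi(1), of M]])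
         (auto simp: measurable_mu abs_mult intro!: AE_I2 mult_mono \<phi>M(1) order_trans[OF \<phi>M(1)])
    have ub: "\<bar>\<integral>x. g x \<partial>\<mu>\<bar> \<le> X" if "integrable \<mu> g" "(\<integral>\<^sup>+x. ennreal \<bar>g x\<bar> \<partial>\<mu>) \<le> ennreal X" "0 \<le> X" for g X
    proof -
      have "ennreal (\<integral>x. \<bar>g x\<bar> \<partial>\<mu>) \<le> ennreal X"
        using that by (subst nn_integral_eq_integral[symmetric]) auto
      then have "(\<integral>x. \<bar>g x\<bar> \<partial>\<mu>) \<le> X" using that by simp
      then show ?thesis using integral_abs_bound[of \<mu> g] by linarith
    qed
    show ?case
    proof (cases "R = Whole \<or> (\<exists>y s. R = Cube y s \<and> 1 < s)")
      case True
      have "(\<integral>\<^sup>+x. ennreal \<bar>c R * (\<phi> x * b x)\<bar> \<partial>\<mu>) \<le>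
          (\<integral>\<^sup>+x. ennreal M * (ennreal (\<bar>c R\<bar> * indicator K x) * ennreal \<bar>b x\<bar>) \<partial>\<mu>)"
      proof (intro nn_integral_mono)
        fix x
        have "\<bar>\<phi> x\<bar> \<le> M * indicator K x" using \<phi>M[of x] by (auto simp: indicator_def)
        then have "\<bar>c R * (\<phi> x * b x)\<bar> \<le> M * ((\<bar>c R\<bar> * indicator K x) * \<bar>b x\<bar>)"
          using mult_left_mono[of "\<bar>\<phi> x\<bar>" "M * indicator K x" "\<bar>c R\<bar> * \<bar>b x\<bar>"]
            by (simp add: abs_mult mult.commute mult.left_commute)
        then show "ennreal \<bar>c R * (\<phi> x * b x)\<bar> \<le> ennreal M * (ennreal (\<bar>c R\<bar> * indicator K x) * ennreal \<bar>b x\<bar>)"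
          using M by (simp add: ennreal_mult[symmetric] ennreal_leI)
      qed
      also have "\<dots> = ennreal M * (\<integral>\<^sup>+x. ennreal (\<bar>c R\<bar> * indicator K x) * ennreal \<bar>b x\<bar> \<partial>\<mu>)"
        by (rule nn_integral_cmult) measurable
      also have "\<dots> \<le> ennreal M * ennreal (E * s)"
        using K(2) E True c c0 by (intro mult_left_mono block_weighted[OF b]) auto
      also have "\<dots> = ennreal (E * M * s)" using M E s
        by (simp add: ennreal_mult[symmetric] mult.commute mult.left_commute)
      finally have "\<bar>\<integral>x. c R * (\<phi> x * b x) \<partial>\<mu>\<bar> \<le> E * M * s" using \<phi>b E M s by (intro ub) auto
      also have "\<dots> \<le> E' * M * s" using M s L0 d0 by (intro mult_right_mono) (auto simp: E'_def)
      finally show ?thesis by simp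
    next
      case False
      then obtain y r where R: "R = Cube y r" "r \<le> 1" by (cases R) auto
      then have y: "y \<in> msupport \<mu>" "r > 0" using bi(3) by auto
      show ?thesis
      proof (cases "K \<inter> cube_set R = {}")
        case True
        have "AE x in \<mu>. \<phi> x * b x = 0" using bi(4) by eventually_elim (use True \<phi>M(2) in auto)
        then have "(\<integral>x. \<phi> x * b x \<partial>\<mu>) = 0" by (rule integral_eq_zero_AE)
        then show ?thesis using M s E L0 d0 by (simp add: E'_def)
      next
        case False
        then obtain z where z: "z \<in> K" "z \<in> cube_set R" by auto
        have "infnorm (y - base) \<le> k + 1"
          using infnorm_triangle[of "y - z" "z - base"] z R K k infnorm_sub[of y z] y
            by (auto simp: mem_cube_set dest!: subsetD)
        then have "\<bar>c R - c (Cube base (k + 1))\<bar> \<le> A * (Kc * (1 + C * (level (k + 1) - level r)))"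
          unfolding R using R y k base by (intro S_lipschitz_compare_levels c) auto
        then have cR: "\<bar>c R\<bar> \<le> D0 + A * (Kc * (1 + C * (level (k + 1) - level r)))" using c0 by linarith
        have "r * \<bar>c R\<bar> \<le> r * (D0 + A * (Kc * (1 + C * (level (k + 1) - level r))))"
          using cR y by (intro mult_left_mono) auto
        also have "\<dots> = r * D0 + A * (Kc * (r + C * (r * level (k + 1) + r * (- level r))))"
          by (simp add: algebra_simps)
        also have "\<dots> \<le> L"
        proof -
          have "r * D0 \<le> D0" "r * level (k + 1) \<le> level (k + 1)"
            using mult_right_mono[of r 1 D0] mult_right_mono[of r 1 "real_of_int (level (k + 1))"] R D0 lk y
              by auto
          then show ?thesis using level_times_side[of r] y R A Kc_pos C1 unfolding L_def
            by (intro add_mono mult_left_mono) auto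
        qed
        finally have rc: "r * \<bar>c R\<bar> \<le> L" .
        have "(\<integral>x. \<phi> x * b x \<partial>\<mu>) = (\<integral>x. (\<phi> x - \<phi> y) * b x \<partial>\<mu>)"
          using \<phi>b bi by (simp add: left_diff_distrib)
        also have "\<bar>\<dots>\<bar> \<le> d * d * M * r * s"
        proof (rule ub)
          show "integrable \<mu> (\<lambda>x. (\<phi> x - \<phi> y) * b x)" using \<phi>b bi by (simp add: left_diff_distrib)
          have "(\<integral>\<^sup>+x. ennreal \<bar>(\<phi> x - \<phi> y) * b x\<bar> \<partial>\<mu>) \<le> (\<integral>\<^sup>+x. ennreal (d * d * M * r) * ennreal \<bar>b x\<bar> \<partial>\<mu>)"
          proof (intro nn_integral_mono_AE)
            show "AE x in \<mu>. ennreal \<bar>(\<phi> x - \<phi> y) * b x\<bar> \<le> ennreal (d * d * M * r) * ennreal \<bar>b x\<bar>"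
              using bi(4)
            proof eventually_elim
              case (elim x)
              show ?case
              proof (cases "x \<in> cube_set R")
                case True
                have "norm (x - y) \<le> d * r"
                proof -
                  have "sqrt d \<le> d" using d0 real_sqrt_le_mono[of d "d * d"] mult_left_mono[OF d0, of d]
                    by simp
                  then have "sqrt d * infnorm (x - y) \<le> d * (r / 2)" using True R d0
                    by (intro mult_mono) (auto simp: mem_cube_set infnorm_pos_le)
                  moreover have "d * (r / 2) \<le> d * r" using d0 y by simp
                  ultimately show ?thesis using norm_le_infnorm[of "x - y"] unfolding d_def by linarith
                qed
                then have "d * M * norm (x - y) \<le> d * M * (d * r)" using M d0
                  by (intro mult_left_mono) auto
                then have "\<bar>\<phi> x - \<phi> y\<bar> \<le> d * d * M * r" using \<phi>M(3)[of x y]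
                  by (simp add: mult.commute mult.left_commute)
                then have "\<bar>(\<phi> x - \<phi> y) * b x\<bar> \<le> (d * d * M * r) * \<bar>b x\<bar>" unfolding abs_mult
                  by (rule mult_right_mono) simp
                then show ?thesis using d0 M y by (simp add: ennreal_mult[symmetric] ennreal_leI)
              qed (use elim in auto)
            qed
          qed
          also have "\<dots> = ennreal (d * d * M * r) * (\<integral>\<^sup>+x. ennreal \<bar>b x\<bar> \<partial>\<mu>)"
            by (rule nn_integral_cmult) measurable
          also have "\<dots> \<le> ennreal (d * d * M * r) * ennreal s"
            by (intro mult_left_mono block_L1[OF b]) auto
          also have "\<dots> = ennreal (d * d * M * r * s)" using d0 M y s by (simp add: ennreal_mult)
          finally show "(\<integral>\<^sup>+x. ennreal \<bar>(\<phi> x - \<phi> y) * b x\<bar> \<partial>\<mu>) \<le> ennreal (d * d * M * r * s)" .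
        qed (use d0 M y s in auto)
        finally have "\<bar>c R\<bar> * \<bar>\<integral>x. \<phi> x * b x \<partial>\<mu>\<bar> \<le> \<bar>c R\<bar> * (d * d * M * r * s)"
          by (intro mult_left_mono) auto
        also have "\<dots> = (r * \<bar>c R\<bar>) * (d * d * M * s)" by simp
        also have "\<dots> \<le> L * (d * d * M * s)" using rc d0 M s by (intro mult_right_mono) auto
        also have "\<dots> \<le> E' * M * s" using E M s by (simp add: E'_def algebra_simps)
        finally show ?thesis by (simp add: abs_mult)
      qed
    qed
  qed
qed

end

lemma abs_integral_le:
  fixes g :: "'b \<Rightarrow> real"
  assumes "integrable M g" "(\<integral>\<^sup>+x. ennreal \<bar>g x\<bar> \<partial>M) \<le> ennreal X" "0 \<le> X"
  shows "\<bar>\<integral>x. g x \<partial>M\<bar> \<le> X"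
proof -
  have "ennreal (\<integral>x. \<bar>g x\<bar> \<partial>M) \<le> ennreal X"
    using assms by (subst nn_integral_eq_integral[symmetric]) auto
  then have "(\<integral>x. \<bar>g x\<bar> \<partial>M) \<le> X" using assms by simp
  then show ?thesis using integral_abs_bound[of M g] by linarith
qed

context growth_space
begin

section \<open>Series of blocks as distributions\<close>

lemma integrable_L1loc: assumes "integrable \<mu> g" shows "g \<in> L1loc \<mu>"
proof -
  have "set_integrable \<mu> K g" if "compact K" for K
    unfolding set_integrable_def
    by (rule integrable_mult_indicator[OF _ assms]) (simp add: borel_compact that)
  then show ?thesis using assms by (auto simp: L1loc_def)
qed

lemma lip_test_integrable:
  assumes "integrable \<mu> g" "lip_test K M \<phi>" shows "integrable \<mu> (\<lambda>x. g x * \<phi> x)"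
proof (rule Bochner_Integration.integrable_bound[OF integrable_mult_right[OF assms(1), of M]])
  have [measurable]: "\<phi> \<in> borel_measurable borel" "g \<in> borel_measurable borel"
    using lip_test_measurable[OF assms(2)] assms(1)
      by (auto simp: measurable_mu dest: borel_measurable_integrable)
  show "(\<lambda>x. g x * \<phi> x) \<in> borel_measurable \<mu>" by (simp add: measurable_mu)
  have "norm (g x * \<phi> x) \<le> norm (M * g x)" for x
  proof -
    have "\<bar>\<phi> x\<bar> \<le> \<bar>M\<bar>" using assms(2) unfolding lip_test_def by (meson abs_ge_self order_trans)
    then have "\<bar>g x\<bar> * \<bar>\<phi> x\<bar> \<le> \<bar>g x\<bar> * \<bar>M\<bar>" by (intro mult_left_mono) auto
    then show ?thesis by (simp add: abs_mult mult.commute)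
  qed
  then show "AE x in \<mu>. norm (g x * \<phi> x) \<le> norm (M * g x)" by simp
qed

lemma block_products:
  assumes f: "osc_family f c A" and b: "atomic_block \<mu> n R b s"
  shows "integrable \<mu> (\<lambda>x. (f x - c R) * b x)" "integrable \<mu> (\<lambda>x. c R * b x)" "integrable \<mu> (\<lambda>x. f x * b x)"
    "(\<integral>\<^sup>+x. ennreal \<bar>(f x - c R) * b x\<bar> \<partial>\<mu>) \<le> ennreal (2 * A * s)"
proof -
  have [measurable]: "f \<in> borel_measurable borel" "b \<in> borel_measurable borel"
    using osc_family_measurable[OF f] block_measurable[OF b] by (auto simp: measurable_mu)
  show le: "(\<integral>\<^sup>+x. ennreal \<bar>(f x - c R) * b x\<bar> \<partial>\<mu>) \<le> ennreal (2 * A * s)"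
    using block_osc[OF f b] by (simp add: abs_mult ennreal_mult)
  then show 1: "integrable \<mu> (\<lambda>x. (f x - c R) * b x)"
    by (intro integrableI_bounded) (auto simp: measurable_mu le_less_trans)
  show 2: "integrable \<mu> (\<lambda>x. c R * b x)" using b by (simp add: atomic_block_def)
  show "integrable \<mu> (\<lambda>x. f x * b x)"
    using Bochner_Integration.integrable_add[OF 1 2] by (simp add: algebra_simps)
qed

lemma osc_lip_test_bound:
  assumes f: "osc_family f c A" and b: "atomic_block \<mu> n R b s" and \<phi>: "lip_test K M \<phi>"
  shows "\<bar>\<integral>x. (f x - c R) * b x * \<phi> x \<partial>\<mu>\<bar> \<le> 2 * A * M * s"
proof (rule abs_integral_le)
  have M: "0 \<le> M" by (rule lip_test_nonneg[OF \<phi>])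
  have A: "0 \<le> A" using f by (simp add: osc_family_def S_lipschitz_def)
  show "integrable \<mu> (\<lambda>x. (f x - c R) * b x * \<phi> x)"
    by (rule lip_test_integrable[OF block_products(1)[OF f b] \<phi>])
  have [measurable]: "f \<in> borel_measurable borel" "b \<in> borel_measurable borel"
    using osc_family_measurable[OF f] block_measurable[OF b] by (auto simp: measurable_mu)
  have "(\<integral>\<^sup>+x. ennreal \<bar>(f x - c R) * b x * \<phi> x\<bar> \<partial>\<mu>) \<le> (\<integral>\<^sup>+x. ennreal M * ennreal \<bar>(f x - c R) * b x\<bar> \<partial>\<mu>)"
  proof (intro nn_integral_mono)
    fix x
    have "\<bar>(f x - c R) * b x * \<phi> x\<bar> \<le> M * \<bar>(f x - c R) * b x\<bar>"
      using \<phi> mult_left_mono[of "\<bar>\<phi> x\<bar>" M "\<bar>(f x - c R) * b x\<bar>"]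
        by (simp add: lip_test_def abs_mult mult.commute)
    then show "ennreal \<bar>(f x - c R) * b x * \<phi> x\<bar> \<le> ennreal M * ennreal \<bar>(f x - c R) * b x\<bar>"
      using M by (simp add: ennreal_mult[symmetric] ennreal_leI)
  qed
  also have "\<dots> = ennreal M * (\<integral>\<^sup>+x. ennreal \<bar>(f x - c R) * b x\<bar> \<partial>\<mu>)"
    by (rule nn_integral_cmult) (simp add: measurable_mu)
  also have "\<dots> \<le> ennreal M * ennreal (2 * A * s)"
    by (intro mult_left_mono block_products(4)[OF f b]) auto
  also have "\<dots> = ennreal (2 * A * M * s)" using M A block_s_nonneg[OF b]
    by (simp add: ennreal_mult[symmetric] mult.commute mult.left_commute)
  finally show "(\<integral>\<^sup>+x. ennreal \<bar>(f x - c R) * b x * \<phi> x\<bar> \<partial>\<mu>) \<le> ennreal (2 * A * M * s)" .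
  show "0 \<le> 2 * A * M * s" using A M block_s_nonneg[OF b] by simp
qed

text \<open>One constant covers \<open>c\<close> itself and all truncations of \<open>f\<close>;
  this uniformity in \<open>m\<close> is the domination needed in
  \<open>product_limit\<close>.\<close>

lemma pairing_bound:
  assumes f: "osc_family f c A" and K: "compact K"
  shows "\<exists>E\<ge>0. \<forall>R b s M \<phi>. atomic_block \<mu> n R b s \<and> lip_test K M \<phi> \<longrightarrow>
     \<bar>\<integral>x. c R * b x * \<phi> x \<partial>\<mu>\<bar> \<le> E * M * s \<and> (\<forall>m. \<bar>\<integral>x. trunc m (f x) * b x * \<phi> x \<partial>\<mu>\<bar> \<le> E * M * s)"
proof -
  obtain k where k: "k > 0" "K \<subseteq> cube_set (Cube base k)"
    using compact_subset_cube compact_imp_bounded[OF K] by blast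
  have Kb: "K \<in> sets borel" using K by (simp add: borel_compact)
  \<comment> \<open>Truncation does not increase absolute values, so \<open>D0\<close> also bounds
    the truncated numbers at the two reference cubes.\<close>
  define D0 where "D0 = \<bar>c (Cube base (k + 1))\<bar> + \<bar>c Whole\<bar>"
  have A: "A \<ge> 0" and c: "S_lipschitz c A" using f by (auto simp: osc_family_def S_lipschitz_def)
  obtain E where E: "E \<ge> 0" "\<And>c R b s \<phi> M. S_lipschitz c A \<Longrightarrow> \<bar>c (Cube base (k + 1))\<bar> \<le> D0 \<Longrightarrow> \<bar>c Whole\<bar> \<le> D0 \<Longrightarrow>
     atomic_block \<mu> n R b s \<Longrightarrow> lip_test K M \<phi> \<Longrightarrow> \<bar>c R * (\<integral>x. \<phi> x * b x \<partial>\<mu>)\<bar> \<le> E * M * s"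
    using pairing[OF k(2) Kb k(1) A, of D0] by (auto simp: D0_def)
  have E1: "\<bar>\<integral>x. d R * b x * \<phi> x \<partial>\<mu>\<bar> \<le> E * M * s"
    if "S_lipschitz d A" "\<bar>d (Cube base (k + 1))\<bar> \<le> D0" "\<bar>d Whole\<bar> \<le> D0" "atomic_block \<mu> n R b s" "lip_test K M \<phi>" for d R b s \<phi> M
  proof -
    have "(\<integral>x. d R * b x * \<phi> x \<partial>\<mu>) = (\<integral>x. d R * (\<phi> x * b x) \<partial>\<mu>)" by (simp add: mult_ac)
    then show ?thesis using E(2)[OF that] by simp
  qed
  show ?thesis
  proof (intro exI[of _ "E + 2 * A"] conjI allI impI, goal_cases)
    case (2 R b s M \<phi>)
    have "\<bar>\<integral>x. c R * b x * \<phi> x \<partial>\<mu>\<bar> \<le> E * M * s" using 2 c by (intro E1) (auto simp: D0_def)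
    also have "\<dots> \<le> (E + 2 * A) * M * s"
      using A 2 block_s_nonneg lip_test_nonneg by (intro mult_right_mono) auto
    finally show ?case .
  next
    case (3 R b s M \<phi> m)
    then have b: "atomic_block \<mu> n R b s" and \<phi>: "lip_test K M \<phi>" by auto
    let ?f = "\<lambda>x. trunc m (f x)" and ?c = "\<lambda>Q. trunc m (c Q)"
    have ft: "osc_family ?f ?c A" by (rule osc_family_trunc[OF f])
    have c0: "\<bar>trunc m (c (Cube base (k + 1)))\<bar> \<le> D0" "\<bar>trunc m (c Whole)\<bar> \<le> D0"
      using trunc_abs(1)[of m "c (Cube base (k + 1))"] trunc_abs(1)[of m "c Whole"]
        by (auto simp: D0_def)
    have "(\<integral>x. ?f x * b x * \<phi> x \<partial>\<mu>) = (\<integral>x. ((?f x - ?c R) * b x * \<phi> x + ?c R * b x * \<phi> x) \<partial>\<mu>)"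
      by (simp add: algebra_simps)
    also have "\<dots> = (\<integral>x. (?f x - ?c R) * b x * \<phi> x \<partial>\<mu>) + (\<integral>x. ?c R * b x * \<phi> x \<partial>\<mu>)"
      by (intro Bochner_Integration.integral_add lip_test_integrable[OF _ \<phi>] block_products(1,2)[OF ft b])
    finally show ?case
      using osc_lip_test_bound[OF ft b \<phi>] E1[OF _ _ _ b \<phi>, of ?c] ft c0
        by (simp add: osc_family_def distrib_right)
  qed (use E A in auto)
qed

text \<open>After truncation the factor multiplying the blocks is bounded by \<open>m * M\<close>,
  so the convergence of the blocks to \<open>h\<close> in L1 can be used directly.\<close>

lemma trunc_pairing_sums:
  assumes d: "atb_decomposition \<mu> n h b R s" and hm [measurable]: "h \<in> borel_measurable borel"
    and f: "osc_family f c A" and \<phi>: "lip_test K M \<phi>"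
  shows "(\<lambda>j. \<integral>x. trunc m (f x) * b j x * \<phi> x \<partial>\<mu>) sums (\<integral>x. trunc m (f x) * h x * \<phi> x \<partial>\<mu>)"
proof -
  have b: "\<And>j. atomic_block \<mu> n (R j) (b j) (s j)" and s: "summable s" and hs: "AE x in \<mu>. (\<lambda>j. b j x) sums h x"
    using d by (auto simp: atb_decomposition_def)
  have [measurable]: "f \<in> borel_measurable borel" "\<And>j. b j \<in> borel_measurable borel" "\<phi> \<in> borel_measurable borel"
    using osc_family_measurable[OF f] block_measurable[OF b] lip_test_measurable[OF \<phi>]
      by (auto simp: measurable_mu)
  have M: "0 \<le> M" by (rule lip_test_nonneg[OF \<phi>])
  let ?g = "\<lambda>j x. trunc m (f x) * b j x * \<phi> x"
  have "(\<lambda>j. \<integral>x. ?g j x \<partial>\<mu>) sums (\<integral>x. (\<Sum>j. ?g j x) \<partial>\<mu>)"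
  proof (rule L1_series(4))
    show "?g j \<in> borel_measurable \<mu>" for j by (simp add: measurable_mu)
    show "summable (\<lambda>j. m * M * s j)" using s by (rule summable_mult)
    fix j
    have "(\<integral>\<^sup>+x. ennreal \<bar>?g j x\<bar> \<partial>\<mu>) \<le> (\<integral>\<^sup>+x. ennreal (m * M) * ennreal \<bar>b j x\<bar> \<partial>\<mu>)"
    proof (intro nn_integral_mono)
      fix x
      have "\<bar>?g j x\<bar> \<le> (m * M) * \<bar>b j x\<bar>"
      proof -
        have "\<bar>trunc m (f x)\<bar> * \<bar>\<phi> x\<bar> \<le> m * M" using trunc_abs(2) \<phi>
          by (intro mult_mono) (auto simp: lip_test_def)
        then show ?thesis using mult_right_mono[of _ _ "\<bar>b j x\<bar>"] by (fastforce simp: abs_mult mult_ac)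
      qed
      then show "ennreal \<bar>?g j x\<bar> \<le> ennreal (m * M) * ennreal \<bar>b j x\<bar>"
        using M by (simp add: ennreal_mult[symmetric] ennreal_leI)
    qed
    also have "\<dots> = ennreal (m * M) * (\<integral>\<^sup>+x. ennreal \<bar>b j x\<bar> \<partial>\<mu>)"
      by (rule nn_integral_cmult) (simp add: measurable_mu)
    also have "\<dots> \<le> ennreal (m * M) * ennreal (s j)" by (intro mult_left_mono block_L1[OF b]) auto
    finally show "(\<integral>\<^sup>+x. ennreal \<bar>?g j x\<bar> \<partial>\<mu>) \<le> ennreal (m * M * s j)"
      using M block_s_nonneg[OF b] by (simp add: ennreal_mult)
    show "0 \<le> m * M * s j" using M block_s_nonneg[OF b] by simp
  qed
  also have "(\<integral>x. (\<Sum>j. ?g j x) \<partial>\<mu>) = (\<integral>x. trunc m (f x) * h x * \<phi> x \<partial>\<mu>)"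
  proof (intro integral_cong_AE)
    have sm: "AE x in \<mu>. (\<Sum>j. b j x) = h x" using hs by eventually_elim (simp add: sums_iff)
    show ae: "AE x in \<mu>. (\<Sum>j. ?g j x) = trunc m (f x) * h x * \<phi> x"
      using hs
    proof eventually_elim
      case (elim x)
      then have "(\<lambda>j. ?g j x) sums (trunc m (f x) * h x * \<phi> x)" by (intro sums_mult2 sums_mult)
      then show ?case by (simp add: sums_iff)
    qed
    show m1: "(\<lambda>x. \<Sum>j. ?g j x) \<in> borel_measurable \<mu>" by (simp add: measurable_mu)
    show "(\<lambda>x. trunc m (f x) * h x * \<phi> x) \<in> borel_measurable \<mu>"
      by (simp add: measurable_mu)
  qed
  finally show ?thesis .
qed

text \<open>Truncating \<open>f\<close> makes the pairing with \<open>h\<close> an absolutely convergent integral, so the limit on the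
  right does not depend on the decomposition of \<open>h\<close>.\<close>

lemma product_limit:
  assumes d: "atb_decomposition \<mu> n h b R s" and hm: "h \<in> borel_measurable borel"
    and f: "osc_family f c A" and K: "compact K" and \<phi>: "lip_test K M \<phi>"
  shows "(\<lambda>j. \<integral>x. f x * b j x * \<phi> x \<partial>\<mu>) sums lim (\<lambda>m. \<integral>x. trunc m (f x) * h x * \<phi> x \<partial>\<mu>)"
proof -
  have b: "\<And>j. atomic_block \<mu> n (R j) (b j) (s j)" and s: "summable s"
    using d by (auto simp: atb_decomposition_def)
  have [measurable]: "f \<in> borel_measurable borel" "\<And>j. b j \<in> borel_measurable borel" "\<phi> \<in> borel_measurable borel"
    using osc_family_measurable[OF f] block_measurable[OF b] lip_test_measurable[OF \<phi>]
      by (auto simp: measurable_mu)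
  obtain E where E: "\<And>R b s M \<phi> m. atomic_block \<mu> n R b s \<Longrightarrow> lip_test K M \<phi> \<Longrightarrow>
      \<bar>\<integral>x. trunc m (f x) * b x * \<phi> x \<partial>\<mu>\<bar> \<le> E * M * s"
    using pairing_bound[OF f K] by blast
  let ?a = "\<lambda>j m. \<integral>x. trunc m (f x) * b j x * \<phi> x \<partial>\<mu>" and ?B = "\<lambda>j. \<integral>x. f x * b j x * \<phi> x \<partial>\<mu>"
  have lim: "(\<lambda>m. ?a j m) \<longlonglongrightarrow> ?B j" for j
  proof (rule integral_dominated_convergence)
    have i: "integrable \<mu> (\<lambda>x. f x * b j x * \<phi> x)"
      by (rule lip_test_integrable[OF block_products(3)[OF f b] \<phi>])
    show "integrable \<mu> (\<lambda>x. \<bar>f x * b j x * \<phi> x\<bar>)" using i by simp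
    show "(\<lambda>x. f x * b j x * \<phi> x) \<in> borel_measurable \<mu>" "(\<lambda>x. trunc m (f x) * b j x * \<phi> x) \<in> borel_measurable \<mu>" for m
      by (auto simp: measurable_mu)
    show "AE x in \<mu>. (\<lambda>m. trunc m (f x) * b j x * \<phi> x) \<longlonglongrightarrow> f x * b j x * \<phi> x"
      by (intro AE_I2 tendsto_mult tendsto_const trunc_tendsto)
    show "AE x in \<mu>. norm (trunc m (f x) * b j x * \<phi> x) \<le> \<bar>f x * b j x * \<phi> x\<bar>" for m
      by (auto simp: abs_mult intro!: AE_I2 mult_right_mono trunc_abs)
  qed
  have bd: "norm (?a j m) \<le> E * M * s j" for j m using E[OF b \<phi>] by simp
  \<comment> \<open>The bound \<open>E * M * s j\<close> does not involve \<open>m\<close>, which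
    permits exchanging the limit in \<open>m\<close> with the sum over \<open>j\<close>.\<close>
  have "eventually (\<lambda>m. summable (\<lambda>j. norm (?a j m))) sequentially \<and> summable (\<lambda>j. norm (?B j)) \<and>
      ((\<lambda>m. suminf (\<lambda>j. ?a j m)) \<longlongrightarrow> suminf ?B) sequentially"
    using bd s by (intro tannerys_theorem[where M="\<lambda>j. E * M * s j"] lim always_eventually summable_mult) auto
  then have 1: "summable ?B" "(\<lambda>m. suminf (\<lambda>j. ?a j m)) \<longlonglongrightarrow> suminf ?B"
    by (auto intro: summable_norm_cancel)
  have "suminf (\<lambda>j. ?a j m) = (\<integral>x. trunc m (f x) * h x * \<phi> x \<partial>\<mu>)" for m
    using trunc_pairing_sums[OF d hm f \<phi>] by (simp add: sums_iff)
  then have "lim (\<lambda>m. \<integral>x. trunc m (f x) * h x * \<phi> x \<partial>\<mu>) = suminf ?B" using 1(2) by (simp add: limI)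
  then show ?thesis using 1(1) by (simp add: summable_sums)
qed

text \<open>A bound that is linear in \<open>M\<close> and summable in \<open>j\<close> serves
  twice: it makes the series converge on every test function, and summed over \<open>j\<close> it is
  the continuity estimate of the limit.\<close>

lemma dist_sums_series:
  fixes g :: "nat \<Rightarrow> 'a \<Rightarrow> real"
  assumes g: "\<And>j. integrable \<mu> (g j)" and s: "summable s"
    and bd: "\<And>K. compact K \<Longrightarrow> \<exists>E. \<forall>\<phi> M j. lip_test K M \<phi> \<longrightarrow> \<bar>\<integral>x. g j x * \<phi> x \<partial>\<mu>\<bar> \<le> E * M * s j"
  shows "dist_sums \<mu> g (\<lambda>\<phi>. \<Sum>j. \<integral>x. g j x * \<phi> x \<partial>\<mu>)"
proof -
  have sm: "summable (\<lambda>j. \<integral>x. g j x * \<phi> x \<partial>\<mu>)" if K: "compact K" "lip_test K M \<phi>" for K M \<phi>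
  proof -
    obtain E where "\<And>j. \<bar>\<integral>x. g j x * \<phi> x \<partial>\<mu>\<bar> \<le> E * M * s j" using bd[OF K(1)] K(2) by blast
    then show ?thesis using s
      by (intro summable_comparison_test[OF _ summable_mult[OF s, of "E * M"]]) auto
  qed
  have t: "summable (\<lambda>j. \<integral>x. g j x * \<phi> x \<partial>\<mu>)" "integrable \<mu> (\<lambda>x. g j x * \<phi> x)" if p: "\<phi> \<in> test_functions" for \<phi> j
  proof -
    obtain K M where k: "compact K" "lip_test K M \<phi>" by (rule test_lip_test_ex[OF p])
    show "summable (\<lambda>j. \<integral>x. g j x * \<phi> x \<partial>\<mu>)" by (rule sm[OF k])
    show "integrable \<mu> (\<lambda>x. g j x * \<phi> x)" by (rule lip_test_integrable[OF g k(2)])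
  qed
  have "is_distribution (\<lambda>\<phi>. \<Sum>j. \<integral>x. g j x * \<phi> x \<partial>\<mu>)"
    unfolding is_distribution_def
  proof (intro conjI ballI allI impI)
    fix \<phi> \<psi> :: "'a \<Rightarrow> real" and a b :: real assume p: "\<phi> \<in> test_functions" "\<psi> \<in> test_functions"
    have "(\<integral>x. g j x * (a * \<phi> x + b * \<psi> x) \<partial>\<mu>) = a * (\<integral>x. g j x * \<phi> x \<partial>\<mu>) + b * (\<integral>x. g j x * \<psi> x \<partial>\<mu>)" for j
    proof -
      have "(\<integral>x. g j x * (a * \<phi> x + b * \<psi> x) \<partial>\<mu>) = (\<integral>x. a * (g j x * \<phi> x) + b * (g j x * \<psi> x) \<partial>\<mu>)"
        by (simp add: algebra_simps)
      then show ?thesis using t(2)[OF p(1)] t(2)[OF p(2)] by simp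
    qed
    then show "(\<Sum>j. \<integral>x. g j x * (a * \<phi> x + b * \<psi> x) \<partial>\<mu>) =
       a * (\<Sum>j. \<integral>x. g j x * \<phi> x \<partial>\<mu>) + b * (\<Sum>j. \<integral>x. g j x * \<psi> x \<partial>\<mu>)"
      using t(1)[OF p(1)] t(1)[OF p(2)] by (simp add: suminf_add[symmetric] suminf_mult summable_mult)
  next
    fix K :: "'a set" assume K: "compact K"
    obtain E where E: "\<And>\<phi> M j. lip_test K M \<phi> \<Longrightarrow> \<bar>\<integral>x. g j x * \<phi> x \<partial>\<mu>\<bar> \<le> E * M * s j" using bd[OF K]
      by blast
    show "\<exists>C m. \<forall>\<phi>\<in>test_functions. \<forall>M.
        (\<forall>x. x \<notin> K \<longrightarrow> \<phi> x = 0) \<and>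
        (\<forall>vs\<in>lists Basis. length vs \<le> m \<longrightarrow> (\<forall>x. \<bar>iter_deriv vs \<phi> x\<bar> \<le> M)) \<longrightarrow>
        \<bar>\<Sum>j. \<integral>x. g j x * \<phi> x \<partial>\<mu>\<bar> \<le> C * M"
    proof (intro exI[of _ "E * suminf s"] exI[of _ 1] ballI allI impI, elim conjE)
      fix \<phi> :: "'a \<Rightarrow> real" and M assume "\<phi> \<in> test_functions" "\<forall>x. x \<notin> K \<longrightarrow> \<phi> x = 0"
        "\<forall>vs\<in>lists Basis. length vs \<le> 1 \<longrightarrow> (\<forall>x. \<bar>iter_deriv vs \<phi> x\<bar> \<le> M)"
      then have a: "lip_test K M \<phi>" by (intro test_lip_test) auto
      have sE: "summable (\<lambda>j. E * M * s j)" by (rule summable_mult[OF s])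
      have "summable (\<lambda>j. \<bar>\<integral>x. g j x * \<phi> x \<partial>\<mu>\<bar>)"
        using E[OF a] by (intro summable_comparison_test[OF _ sE]) auto
      then have "\<bar>\<Sum>j. \<integral>x. g j x * \<phi> x \<partial>\<mu>\<bar> \<le> (\<Sum>j. E * M * s j)"
        using summable_rabs suminf_le[OF E[OF a] _ sE] by (meson order_trans)
      then show "\<bar>\<Sum>j. \<integral>x. g j x * \<phi> x \<partial>\<mu>\<bar> \<le> E * suminf s * M"
        using suminf_mult[OF s, of "E * M"] by (simp add: mult_ac)
    qed
  qed
  then show ?thesis unfolding dist_sums_def
    using t(1) integrable_L1loc[OF g] by (auto intro: summable_sums)
qed

text \<open>The fourth conclusion expresses the distribution through \<open>f\<close> and
  \<open>h\<close> alone; in \<open>product_decomposition\<close> it gives the independence of the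
  decomposition.\<close>

lemma product_distributions:
  assumes d: "atb_decomposition \<mu> n h b R s" and hm: "h \<in> borel_measurable borel" and f: "osc_family f c A"
  shows "dist_sums \<mu> (\<lambda>j x. (f x - c (R j)) * b j x) (\<lambda>\<phi>. \<Sum>j. \<integral>x. (f x - c (R j)) * b j x * \<phi> x \<partial>\<mu>)" (is "dist_sums _ ?g1 ?T1")
    and "dist_sums \<mu> (\<lambda>j x. c (R j) * b j x) (\<lambda>\<phi>. \<Sum>j. \<integral>x. c (R j) * b j x * \<phi> x \<partial>\<mu>)" (is "dist_sums _ ?g2 ?T2")
    and "is_distribution (\<lambda>\<phi>. \<Sum>j. \<integral>x. f x * b j x * \<phi> x \<partial>\<mu>)" (is "is_distribution ?T")
    and "\<And>\<phi>. \<phi> \<in> test_functions \<Longrightarrow> (\<Sum>j. \<integral>x. f x * b j x * \<phi> x \<partial>\<mu>) = lim (\<lambda>m. \<integral>x. trunc m (f x) * h x * \<phi> x \<partial>\<mu>)"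
    and "\<And>\<phi>. \<phi> \<in> test_functions \<Longrightarrow> (\<Sum>j. \<integral>x. f x * b j x * \<phi> x \<partial>\<mu>) = (\<Sum>j. \<integral>x. (f x - c (R j)) * b j x * \<phi> x \<partial>\<mu>) + (\<Sum>j. \<integral>x. c (R j) * b j x * \<phi> x \<partial>\<mu>)"
proof -
  have b: "\<And>j. atomic_block \<mu> n (R j) (b j) (s j)" and s: "summable s"
    using d by (auto simp: atb_decomposition_def)
  show 1: "dist_sums \<mu> ?g1 ?T1"
    using osc_lip_test_bound[OF f b] by (intro dist_sums_series[OF block_products(1)[OF f b] s]) blast
  show 2: "dist_sums \<mu> ?g2 ?T2"
  proof (intro dist_sums_series[OF block_products(2)[OF f b] s])
    fix K :: "'a set" assume "compact K"
    then show "\<exists>E. \<forall>\<phi> M j. lip_test K M \<phi> \<longrightarrow> \<bar>\<integral>x. c (R j) * b j x * \<phi> x \<partial>\<mu>\<bar> \<le> E * M * s j"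
      using pairing_bound[OF f] b by meson
  qed
  show e1: "?T \<phi> = lim (\<lambda>m. \<integral>x. trunc m (f x) * h x * \<phi> x \<partial>\<mu>)" if p: "\<phi> \<in> test_functions" for \<phi>
  proof -
    obtain K M where k: "compact K" "lip_test K M \<phi>" by (rule test_lip_test_ex[OF p])
    show ?thesis using product_limit[OF d hm f k] by (simp add: sums_iff)
  qed
  show e2: "?T \<phi> = ?T1 \<phi> + ?T2 \<phi>" if t: "\<phi> \<in> test_functions" for \<phi>
  proof -
    obtain K M where \<phi>: "compact K" "lip_test K M \<phi>" by (rule test_lip_test_ex[OF t])
    have "(\<integral>x. f x * b j x * \<phi> x \<partial>\<mu>) = (\<integral>x. ?g1 j x * \<phi> x \<partial>\<mu>) + (\<integral>x. ?g2 j x * \<phi> x \<partial>\<mu>)" for j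
    proof -
      have "(\<integral>x. ?g1 j x * \<phi> x + ?g2 j x * \<phi> x \<partial>\<mu>) = (\<integral>x. ?g1 j x * \<phi> x \<partial>\<mu>) + (\<integral>x. ?g2 j x * \<phi> x \<partial>\<mu>)"
        by (intro Bochner_Integration.integral_add lip_test_integrable[OF _ \<phi>(2)] block_products[OF f b])
      then show ?thesis by (simp add: algebra_simps)
    qed
    moreover have "(\<lambda>j. \<integral>x. ?g1 j x * \<phi> x \<partial>\<mu>) sums ?T1 \<phi>" "(\<lambda>j. \<integral>x. ?g2 j x * \<phi> x \<partial>\<mu>) sums ?T2 \<phi>"
      using 1 2 t by (auto simp: dist_sums_def)
    ultimately show ?thesis by (simp add: sums_iff suminf_add)
  qed
  have dd: "is_distribution ?T1" "is_distribution ?T2" using 1 2 by (auto simp: dist_sums_def)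
  show "is_distribution ?T"
  proof -
    have "dist_sums \<mu> (\<lambda>j x. f x * b j x) ?T"
    proof (rule dist_sums_series[OF block_products(3)[OF f b] s])
      fix K :: "'a set" assume "compact K"
      then obtain E where E: "\<And>R b s M \<phi>. atomic_block \<mu> n R b s \<Longrightarrow> lip_test K M \<phi> \<Longrightarrow> \<bar>\<integral>x. c R * b x * \<phi> x \<partial>\<mu>\<bar> \<le> E * M * s"
        using pairing_bound[OF f \<open>compact K\<close>] by blast
      have "\<bar>\<integral>x. f x * b j x * \<phi> x \<partial>\<mu>\<bar> \<le> (E + 2 * A) * M * s j" if \<phi>: "lip_test K M \<phi>" for \<phi> M j
      proof -
        have "(\<integral>x. ?g1 j x * \<phi> x + ?g2 j x * \<phi> x \<partial>\<mu>) = (\<integral>x. ?g1 j x * \<phi> x \<partial>\<mu>) + (\<integral>x. ?g2 j x * \<phi> x \<partial>\<mu>)"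
          by (intro Bochner_Integration.integral_add lip_test_integrable[OF _ \<phi>] block_products[OF f b])
        then have "(\<integral>x. f x * b j x * \<phi> x \<partial>\<mu>) = (\<integral>x. ?g1 j x * \<phi> x \<partial>\<mu>) + (\<integral>x. ?g2 j x * \<phi> x \<partial>\<mu>)"
          by (simp add: algebra_simps)
        then show ?thesis using osc_lip_test_bound[OF f b \<phi>, of j] E[OF b \<phi>, of j]
          unfolding distrib_right by linarith
      qed
      then show "\<exists>E. \<forall>\<phi> M j. lip_test K M \<phi> \<longrightarrow> \<bar>\<integral>x. f x * b j x * \<phi> x \<partial>\<mu>\<bar> \<le> E * M * s j" by blast
    qed
    then show ?thesis by (simp add: dist_sums_def)
  qed
qed

end

section \<open>Decomposition into blocks carried by two cubes\<close>

lemma sums_prod_decode: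
  fixes s :: "nat \<Rightarrow> nat \<Rightarrow> real"
  assumes s: "\<And>i l. 0 \<le> s i l" "\<And>i. s i sums S i" "S sums T"
  shows "(\<lambda>p. case prod_decode p of (i, l) \<Rightarrow> s i l) sums T"
proof -
  let ?F = "\<lambda>(i, l). s i l"
  have 1: "((\<lambda>l. ?F (i, l)) has_sum S i) UNIV" for i
    using s by (auto intro: sums_nonneg_imp_has_sum)
  have "0 \<le> S i" for i using s(1,2) by (metis sums_iff suminf_nonneg)
  then have 2: "(S has_sum T) UNIV" using s by (intro sums_nonneg_imp_has_sum) auto
  have "?F summable_on Sigma UNIV (\<lambda>_. UNIV)"
    using 1 2 s(1) by (intro summable_on_SigmaI[where g=S]) (auto simp: has_sum_imp_summable)
  then have "(?F has_sum T) (Sigma UNIV (\<lambda>_. UNIV))" using 1 2 by (intro has_sum_SigmaI[where g=S]) auto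
  then have "((\<lambda>p. ?F (prod_decode p)) has_sum T) UNIV"
    using has_sum_reindex_bij_betw[OF bij_prod_decode, of ?F T] by simp
  then show ?thesis by (rule has_sum_imp_sums)
qed

text \<open>Decompositions are indexed by natural numbers, so the double series is enumerated by
  \<open>prod_decode\<close>. Almost everywhere it converges absolutely; its sum may then be
  computed iteratively, which identifies it as \<open>h x\<close>.\<close>

lemma L1_double_series:
  fixes f :: "nat \<Rightarrow> nat \<Rightarrow> 'b \<Rightarrow> real"
  assumes m: "\<And>i l. f i l \<in> borel_measurable M"
    and b: "\<And>i l. (\<integral>\<^sup>+x. ennreal \<bar>f i l x\<bar> \<partial>M) \<le> ennreal (s i l)"
    and s: "\<And>i l. 0 \<le> s i l" "\<And>i. s i sums S i" "S sums T"
    and g: "\<And>i. AE x in M. (\<lambda>l. f i l x) sums g i x" and h: "AE x in M. (\<lambda>i. g i x) sums h x"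
  shows "AE x in M. (\<lambda>p. case prod_decode p of (i, l) \<Rightarrow> f i l x) sums h x"
proof -
  let ?f = "\<lambda>p x. case prod_decode p of (i, l) \<Rightarrow> f i l x" and ?s = "\<lambda>p. case prod_decode p of (i, l) \<Rightarrow> s i l"
  have "AE x in M. summable (\<lambda>p. \<bar>?f p x\<bar>)"
  proof (rule L1_series(1))
    show "?f p \<in> borel_measurable M" for p using m by (simp add: split_beta)
    show "(\<integral>\<^sup>+x. ennreal \<bar>?f p x\<bar> \<partial>M) \<le> ennreal (?s p)" for p using b by (simp add: split_beta)
    show "summable ?s" using sums_prod_decode[OF s] by (simp add: sums_iff)
    show "0 \<le> ?s p" for p using s by (simp add: split_beta)
  qed
  moreover have "AE x in M. \<forall>i. (\<lambda>l. f i l x) sums g i x" using g by (simp add: AE_all_countable)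
  ultimately show ?thesis using h
  proof eventually_elim
    case (elim x)
    let ?F = "\<lambda>(i, l). f i l x" and ?S = "suminf (\<lambda>p. ?f p x)"
    have "summable (\<lambda>p. norm (?f p x))" using elim(1) by simp
    then have "summable (\<lambda>p. ?f p x)" by (rule summable_norm_cancel)
    then have sm: "(\<lambda>p. ?f p x) sums ?S" by (rule summable_sums)
    have hs: "((\<lambda>p. ?F (prod_decode p)) has_sum ?S) UNIV"
      using norm_summable_imp_has_sum[OF _ sm] elim(1) by simp
    then have F: "(?F has_sum ?S) (Sigma UNIV (\<lambda>_. UNIV))"
      using has_sum_reindex_bij_betw[OF bij_prod_decode, of ?F ?S] by simp
    have "((\<lambda>l. ?F (i, l)) has_sum g i x) UNIV" for i
    proof -
      have "(\<lambda>l. ?F (i, l)) summable_on UNIV"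
        by (rule summable_on_SigmaD1[of "\<lambda>i l. ?F (i, l)" UNIV "\<lambda>_. UNIV"]) (use F in \<open>auto simp: has_sum_imp_summable\<close>)
      then have "((\<lambda>l. ?F (i, l)) has_sum infsum (\<lambda>l. ?F (i, l)) UNIV) UNIV" by (rule has_sum_infsum)
      moreover from this have "infsum (\<lambda>l. ?F (i, l)) UNIV = g i x"
        using elim(2) by (auto dest!: has_sum_imp_sums intro: sums_unique2)
      ultimately show ?thesis by simp
    qed
    then have "((\<lambda>i. g i x) has_sum ?S) UNIV" by (rule has_sum_SigmaD[OF F])
    then have "?S = h x" using elim(3) by (auto dest!: has_sum_imp_sums intro: sums_unique2)
    then show ?case using sm by simp
  qed
qed

context growth_space
begin

text \<open>The blocks of the new decomposition, essentially one atom on \<open>P\<close> and one on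
  \<open>R\<close>, with \<open>t\<close> as size. Since the coefficient of the pair is at most
  \<open>D\<close>, it is not repeated in the normalisation.\<close>

definition "simple_block D P R t b \<longleftrightarrow> is_cube \<mu> P \<and> is_cube \<mu> R \<and> cube_set P \<subseteq> cube_set R \<and>
  S_coeff \<mu> n P R \<le> D \<and> 0 \<le> t \<and> b \<in> borel_measurable borel \<and> integrable \<mu> b \<and> (\<integral>x. b x \<partial>\<mu>) = 0 \<and>
  (AE x in \<mu>. \<bar>b x\<bar> \<le> t * (indicator (cube_set P) x / mcube \<mu> (cube_scale 2 P) +
     indicator (cube_set R) x / mcube \<mu> (cube_scale 2 R)))"

lemma nn_integral_normalized:
  assumes "is_cube \<mu> P"
  shows "(\<integral>\<^sup>+x. ennreal (indicator (cube_set P) x / mcube \<mu> (cube_scale 2 P)) \<partial>\<mu>) \<le> 1"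
proof -
  have le: "mcube \<mu> P \<le> mcube \<mu> (cube_scale 2 P)"
    using assms by (intro mcube_mono is_cube_scale cube_sub_scale) auto
  have "(\<integral>\<^sup>+x. ennreal (indicator (cube_set P) x / mcube \<mu> (cube_scale 2 P)) \<partial>\<mu>) =
     (\<integral>\<^sup>+x. ennreal (1 / mcube \<mu> (cube_scale 2 P)) * indicator (cube_set P) x \<partial>\<mu>)"
    by (intro nn_integral_cong) (auto simp: indicator_def)
  also have "\<dots> = ennreal (1 / mcube \<mu> (cube_scale 2 P)) * ennreal (mcube \<mu> P)"
    by (subst nn_integral_cmult_indicator) (auto simp: emeasure_cube[OF assms])
  also have "\<dots> = ennreal (mcube \<mu> P / mcube \<mu> (cube_scale 2 P))" by (simp add: ennreal_mult[symmetric])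
  also have "\<dots> \<le> 1" using le by (cases "mcube \<mu> (cube_scale 2 P) = 0") (auto simp: divide_le_eq less_le)
  finally show ?thesis .
qed

lemma simple_block_L1:
  assumes "simple_block D P R t b"
  shows "(\<integral>\<^sup>+x. ennreal \<bar>b x\<bar> \<partial>\<mu>) \<le> ennreal (2 * t)"
proof -
  let ?I = "\<lambda>P x. indicator (cube_set P) x / mcube \<mu> (cube_scale 2 P)"
  have t: "0 \<le> t" and P: "is_cube \<mu> P" "is_cube \<mu> R" using assms by (auto simp: simple_block_def)
  have "(\<integral>\<^sup>+x. ennreal \<bar>b x\<bar> \<partial>\<mu>) \<le> (\<integral>\<^sup>+x. ennreal t * (ennreal (?I P x) + ennreal (?I R x)) \<partial>\<mu>)"
  proof (rule nn_integral_mono_AE)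
    have "AE x in \<mu>. \<bar>b x\<bar> \<le> t * (?I P x + ?I R x)" using assms by (simp add: simple_block_def)
    then show "AE x in \<mu>. ennreal \<bar>b x\<bar> \<le> ennreal t * (ennreal (?I P x) + ennreal (?I R x))"
      by eventually_elim (use t in \<open>simp add: ennreal_plus[symmetric] ennreal_mult[symmetric] ennreal_leI del: ennreal_plus\<close>)
  qed
  also have "\<dots> = ennreal t * ((\<integral>\<^sup>+x. ennreal (?I P x) \<partial>\<mu>) + (\<integral>\<^sup>+x. ennreal (?I R x) \<partial>\<mu>))"
    by (subst nn_integral_cmult, measurable, subst nn_integral_add, measurable)
  also have "\<dots> \<le> ennreal t * (1 + 1)" by (intro mult_left_mono add_mono nn_integral_normalized P) auto
  also have "\<dots> = ennreal (2 * t)" using t by (simp add: ennreal_mult mult.commute)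
  finally show ?thesis .
qed

lemma S_self: "is_cube \<mu> R \<Longrightarrow> S_coeff \<mu> n R R \<le> 1 + 2 ^ n * (2 * C)"
proof (cases R)
  case (Cube x r)
  assume "is_cube \<mu> R"
  then have "S_coeff \<mu> n (Cube x r) (Cube x r) \<le> 1 + 2 ^ n * (dens_sum x (level r) (level r) + 2 * C)"
    using Cube by (intro S_le_dens_sum) auto
  then show ?thesis using Cube by (simp add: dens_sum_def)
qed (use C1 in simp)

text \<open>The function is clipped at the height \<open>u\<close> that its bound allows on
  \<open>P\<close>; the excess then fits under the part of the bound that lives on \<open>R\<close>,
  and the two pieces are multiples of atoms.\<close>

lemma simple_block_atomic:
  assumes sb: "simple_block D P R t b"
  shows "\<exists>s. atomic_block \<mu> n R b s \<and> s \<le> t * (D + (1 + 2 ^ n * (2 * C)))"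
proof -
  have P: "is_cube \<mu> P" "is_cube \<mu> R" "cube_set P \<subseteq> cube_set R" and t: "0 \<le> t"
    and bm [measurable]: "b \<in> borel_measurable borel" and bi: "integrable \<mu> b" "(\<integral>x. b x \<partial>\<mu>) = 0"
    and bb: "AE x in \<mu>. \<bar>b x\<bar> \<le> t * (indicator (cube_set P) x / mcube \<mu> (cube_scale 2 P) +
     indicator (cube_set R) x / mcube \<mu> (cube_scale 2 R))" and SD: "S_coeff \<mu> n P R \<le> D"
    using sb by (auto simp: simple_block_def)
  let ?m = "\<lambda>Q. mcube \<mu> (cube_scale 2 Q)"
  define u where "u x = t * (indicator (cube_set P) x / ?m P)" for x
  define b1 where "b1 x = max (- u x) (min (u x) (b x))" for x
  define b2 where "b2 x = b x - b1 x" for x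
  have u0: "0 \<le> u x" for x using t by (simp add: u_def)
  have um [measurable]: "u \<in> borel_measurable borel" unfolding u_def[abs_def] by measurable
  have b1m [measurable]: "b1 \<in> borel_measurable borel" unfolding b1_def[abs_def] by measurable
  have b2m [measurable]: "b2 \<in> borel_measurable borel" unfolding b2_def[abs_def] by measurable
  have b1u: "\<bar>b1 x\<bar> \<le> u x" for x using u0[of x] by (auto simp: b1_def)
  have b2u: "AE x in \<mu>. \<bar>b2 x\<bar> \<le> t * (indicator (cube_set R) x / ?m R)"
    using bb
  proof eventually_elim
    case (elim x)
    then have "\<bar>b x\<bar> \<le> u x + t * (indicator (cube_set R) x / ?m R)" by (simp add: u_def distrib_left)
    moreover have "0 \<le> t * (indicator (cube_set R) x / ?m R)" using t by simp
    ultimately show ?case using u0[of x] unfolding b2_def b1_def by linarith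
  qed
  let ?S1 = "S_coeff \<mu> n P R" and ?S2 = "S_coeff \<mu> n R R"
  have S: "1 \<le> ?S1" "1 \<le> ?S2" using P by (auto intro: S_ge_1)
  define c :: "nat \<Rightarrow> real" where "c i = (if i = 0 then t * ?S1 else if i = 1 then t * ?S2 else 0)" for i
  define a :: "nat \<Rightarrow> 'a \<Rightarrow> real" where
    "a i x = (if i = 0 then b1 x / (t * ?S1) else if i = 1 then b2 x / (t * ?S2) else 0)" for i x
  define Q :: "nat \<Rightarrow> 'a cube" where "Q i = (if i = 0 then P else R)" for i
  have at: "a i \<in> borel_measurable \<mu> \<and> is_cube \<mu> (Q i) \<and> cube_set (Q i) \<subseteq> cube_set R \<and>
             (AE x in \<mu>. x \<notin> cube_set (Q i) \<longrightarrow> a i x = 0) \<and>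
             (AE x in \<mu>. \<bar>a i x\<bar> \<le> 1 / (mcube \<mu> (cube_scale 2 (Q i)) * S_coeff \<mu> n (Q i) R))" for i
  proof -
    have gen: "AE x in \<mu>. (x \<notin> cube_set Q' \<longrightarrow> g x / (t * S') = 0) \<and> \<bar>g x / (t * S')\<bar> \<le> 1 / (?m Q' * S')"
      if "AE x in \<mu>. \<bar>g x\<bar> \<le> t * (indicator (cube_set Q') x / ?m Q')" "1 \<le> S'" for g S' and Q' :: "'a cube"
      using that(1)
    proof eventually_elim
      case (elim x)
      have "\<bar>g x\<bar> \<le> t * (1 / ?m Q')" using elim t by (cases "x \<in> cube_set Q'") auto
      then have "\<bar>g x\<bar> / (t * S') \<le> t * (1 / ?m Q') / (t * S')" using t that(2)
        by (intro divide_right_mono) auto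
      also have "\<dots> \<le> 1 / (?m Q' * S')" using that(2) by (cases "t = 0") auto
      finally show ?case using elim t that(2) by (auto simp: abs_divide abs_mult)
    qed
    have m: "a i \<in> borel_measurable \<mu>" unfolding a_def[abs_def] by (simp add: measurable_mu)
    have "AE x in \<mu>. (x \<notin> cube_set (Q i) \<longrightarrow> a i x = 0) \<and> \<bar>a i x\<bar> \<le> 1 / (?m (Q i) * S_coeff \<mu> n (Q i) R)"
    proof -
      consider "i = 0" | "i = 1" | "i > 1" by linarith
      then show ?thesis
      proof cases
        case 1 then show ?thesis using gen[OF AE_I2[OF b1u[unfolded u_def]] S(1)]
          by (simp add: a_def Q_def)
      next
        case 2 then show ?thesis using gen[OF b2u S(2)] by (simp add: a_def Q_def)
      next
        case 3 then show ?thesis using S by (simp add: a_def Q_def)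
      qed
    qed
    then show ?thesis using m P by (auto simp: Q_def elim: eventually_mono)
  qed
  have "AE x in \<mu>. (\<lambda>i. c i * a i x) sums b x"
    using b2u
  proof eventually_elim
    case (elim x)
    have "(\<lambda>i. c i * a i x) sums (\<Sum>i\<in>{0,1}. c i * a i x)"
      by (rule sums_finite) (auto simp: c_def)
    \<comment> \<open>For \<open>t = 0\<close> the quotients in \<open>a\<close> are 0 by
      convention, but then \<open>b1\<close> and \<open>b2\<close> vanish at \<open>x\<close>
      too.\<close>
    moreover have "(\<Sum>i\<in>{0,1}. c i * a i x) = b x"
      using elim b1u[of x] S by (cases "t = 0") (auto simp: c_def a_def b2_def u_def)
    ultimately show ?case by simp
  qed
  moreover have cs: "(\<lambda>i. \<bar>c i\<bar>) sums (t * ?S1 + t * ?S2)"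
  proof -
    have "(\<lambda>i. \<bar>c i\<bar>) sums (\<Sum>i\<in>{0,1}. \<bar>c i\<bar>)" by (rule sums_finite) (auto simp: c_def)
    then show ?thesis using t S by (simp add: c_def abs_mult)
  qed
  moreover have "AE x in \<mu>. x \<notin> cube_set R \<longrightarrow> b x = 0"
    using bb
  proof eventually_elim
    case (elim x)
    then show ?case using P(3) by (cases "x \<in> cube_set P"; cases "x \<in> cube_set R") auto
  qed
  ultimately have "atomic_block \<mu> n R b (t * ?S1 + t * ?S2)"
    unfolding atomic_block_def
    by (intro conjI bi integrable_L1loc P(2) exI[of _ c] exI[of _ a] exI[of _ Q] allI) (use at in auto)
  moreover have "t * ?S1 + t * ?S2 \<le> t * (D + (1 + 2 ^ n * (2 * C)))"
    unfolding distrib_left[of t D] using t SD S_self[OF P(2)] by (intro add_mono mult_left_mono) auto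
  ultimately show ?thesis by blast
qed


section \<open>Chains of doubling cubes\<close>

definition "dbl x r \<longleftrightarrow> mass x (2 * r) \<le> 2 ^ (n + 1) * mass x r"

text \<open>The constant \<open>2 ^ (n + 1)\<close> in \<open>dbl\<close> is chosen for this: it
  exceeds the growth \<open>2 ^ n\<close> of the denominator by a factor 2. The notion involves
  neither \<open>\<rho>\<close> nor \<open>\<beta>\<close>; it compares a cube with the double cube
  used to normalise atoms.\<close>

lemma not_dbl: "r > 0 \<Longrightarrow> \<not> dbl x (2 ^ k * r) \<Longrightarrow> 2 * dens x (2 ^ k * r) \<le> dens x (2 ^ (k + 1) * r)"
  by (simp add: dbl_def dens_def field_simps power_mult_distrib)

definition "nxt x r k = (LEAST k'. k \<le> k' \<and> dbl x (2 ^ k' * r))"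

lemma nxt:
  assumes x: "x \<in> msupport \<mu>" and r: "r > 0"
  shows "k \<le> nxt x r k" "dbl x (2 ^ nxt x r k * r)" "(\<Sum>i\<in>{k<..nxt x r k}. dens x (2 ^ i * r)) \<le> 2 * C"
proof -
  let ?v = "\<lambda>i. dens x (2 ^ (k + i) * r)"
  have "\<exists>k'. k \<le> k' \<and> dbl x (2 ^ k' * r)"
  proof (rule ccontr)
    assume "\<not> ?thesis"
    then have nd: "2 * ?v i \<le> ?v (i + 1)" for i using not_dbl[OF r, of x "k + i"] by simp
    have "0 < ?v 0" using x r mass_pos[of x "2 ^ k * r"] by (simp add: dens_def)
    then show False
      by (rule nondoubling_unbounded[where v="?v" and \<gamma>=2 and m=1 and V=C]) (use nd x r in \<open>auto simp: dens_le dens_nonneg\<close>)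
  qed
  from LeastI_ex[OF this] show 1: "k \<le> nxt x r k" "dbl x (2 ^ nxt x r k * r)" unfolding nxt_def by auto
  have nd: "\<not> dbl x (2 ^ j * r)" if "k \<le> j" "j < nxt x r k" for j
    using not_less_Least[of j "\<lambda>k'. k \<le> k' \<and> dbl x (2 ^ k' * r)"] that unfolding nxt_def by blast
  have "(\<Sum>i\<in>{k<..nxt x r k}. dens x (2 ^ i * r)) \<le> (\<Sum>i\<in>insert (nxt x r k) {k..<nxt x r k}. dens x (2 ^ i * r))"
    using r by (intro sum_mono2) (auto intro: dens_nonneg)
  also have "\<dots> = dens x (2 ^ nxt x r k * r) + (\<Sum>i\<in>{k..<nxt x r k}. dens x (2 ^ i * r))" by simp
  also have "(\<Sum>i\<in>{k..<nxt x r k}. dens x (2 ^ i * r)) = (\<Sum>i<nxt x r k - k. ?v i)"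
    by (rule sum.reindex_bij_witness[where i="\<lambda>i. k + i" and j="\<lambda>i. i - k"]) auto
  also have "\<dots> \<le> real 1 * C / (2 - 1)"
  proof (rule nondoubling_sum)
    fix i assume "i < nxt x r k - k"
    then show "2 * ?v i \<le> ?v (i + 1)" using not_dbl[OF r, of x "k + i"] nd[of "k + i"] by simp
  qed (use x r in \<open>auto simp: dens_le dens_nonneg\<close>)
  finally show "(\<Sum>i\<in>{k<..nxt x r k}. dens x (2 ^ i * r)) \<le> 2 * C"
    using x r dens_le[of x "2 ^ nxt x r k * r"] by simp
qed

lemma nxt_mono: "x \<in> msupport \<mu> \<Longrightarrow> r > 0 \<Longrightarrow> j \<le> k \<Longrightarrow> nxt x r j \<le> nxt x r k"
  unfolding nxt_def[of x r j] using nxt[of x r k] by (intro Least_le) auto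

text \<open>The terminal cube of the chains joining the cubes \<open>Q\<close> of the atoms of a block to its cube \<open>R\<close>;
  it depends on \<open>R\<close> only.\<close>

fun top_cube :: "'a cube \<Rightarrow> 'a cube" where
  "top_cube (Cube y s) = Cube y (2 ^ nxt y (8 * s) 0 * (8 * s))"
| "top_cube Whole = Whole"

definition "avg Q x = indicator (cube_set Q) x / mcube \<mu> Q"

lemma avg_measurable [measurable]: "avg Q \<in> borel_measurable borel"
  unfolding avg_def[abs_def] by measurable

lemma avg_integral:
  assumes "is_cube \<mu> Q" "mcube \<mu> Q \<noteq> 0"
  shows "integrable \<mu> (avg Q)" "(\<integral>x. avg Q x \<partial>\<mu>) = 1"
  using assms is_cube_finite[of Q] unfolding avg_def[abs_def] by (auto simp: less_top)

lemma top_cube: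
  assumes R: "is_cube \<mu> R"
  shows "is_cube \<mu> (top_cube R)" "cube_set R \<subseteq> cube_set (top_cube R)"
    "mcube \<mu> (cube_scale 2 (top_cube R)) \<le> 2 ^ (n + 1) * mcube \<mu> (top_cube R)"
proof -
  show "is_cube \<mu> (top_cube R)" using R by (cases R) auto
  show "cube_set R \<subseteq> cube_set (top_cube R)"
  proof (cases R)
    case (Cube y s)
    have "1 * s \<le> (2 ^ nxt y (8 * s) 0 * 8) * s"
      using R Cube one_le_power[of "2::real" "nxt y (8 * s) 0"]
        by (intro mult_right_mono) (linarith, auto)
    then show ?thesis using Cube by (auto intro!: cube_mono simp: mult.assoc)
  qed simp
  show "mcube \<mu> (cube_scale 2 (top_cube R)) \<le> 2 ^ (n + 1) * mcube \<mu> (top_cube R)"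
  proof (cases R)
    case (Cube y s)
    then show ?thesis using R nxt(2)[of y "8 * s" 0] by (simp add: dbl_def mass_def)
  next
    case Whole
    then show ?thesis
      using mult_right_mono[of 1 "2 ^ (n+1)" "measure \<mu> UNIV"] one_le_power[of "2::real" "n + 1"] by simp
  qed
qed

lemma sum_Ioc_split:
  fixes v :: "nat \<Rightarrow> real"
  assumes "\<And>i. 0 \<le> v i"
  shows "(\<Sum>i\<in>{a<..c}. v i) \<le> (\<Sum>i\<in>{a<..b}. v i) + (\<Sum>i\<in>{b<..c}. v i)"
proof -
  have "(\<Sum>i\<in>{a<..c}. v i) \<le> (\<Sum>i\<in>{a<..b} \<union> {b<..c}. v i)" using assms by (intro sum_mono2) auto
  also have "\<dots> \<le> (\<Sum>i\<in>{a<..b}. v i) + (\<Sum>i\<in>{b<..c}. v i)"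
    using assms by (subst sum_Un) (auto intro!: sum_nonneg)
  finally show ?thesis .
qed

text \<open>At most one scale beyond \<open>l\<close> enters the coefficient; it costs the summand
  \<open>C\<close>.\<close>

lemma S_link:
  assumes x: "x \<in> msupport \<mu>" and r: "r > 0" and w: "2 ^ k * r \<le> w" "w \<le> 2 ^ (l + 1) * r" "k \<le> l"
    and X: "(\<Sum>i\<in>{k<..l}. dens x (2 ^ i * r)) \<le> X"
  shows "S_coeff \<mu> n (Cube x (2 ^ k * r)) (Cube y w) \<le> 1 + X + C"
proof -
  let ?N = "Nst (2 ^ k * r) w"
  have N: "?N \<le> l + 1 - k"
  proof (rule Nst(3))
    show "0 < 2 ^ k * r" using r by simp
    show "w \<le> 2 ^ (l + 1 - k) * (2 ^ k * r)" using w
      by (simp add: mult.assoc[symmetric] power_add[symmetric])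
  qed (use w in auto)
  have e: "2 ^ i * (2 ^ k * r) = 2 ^ (k + i) * r" for i by (simp add: power_add mult_ac)
  have "(\<Sum>i=1..?N. dens x (2 ^ i * (2 ^ k * r))) = (\<Sum>i\<in>{k<..k + ?N}. dens x (2 ^ i * r))"
    unfolding e by (rule sum.reindex_bij_witness[where i="\<lambda>i. i - k" and j="\<lambda>i. k + i"]) auto
  also have "\<dots> \<le> (\<Sum>i\<in>insert (l + 1) {k<..l}. dens x (2 ^ i * r))"
    using N w r by (intro sum_mono2) (auto intro: dens_nonneg)
  also have "\<dots> \<le> C + X" using X dens_le[OF x, of "2 ^ (l + 1) * r"] r by simp
  finally show ?thesis by (simp add: S_Cube)
qed

lemma S_link_Whole:
  assumes r: "r > 0" and fin: "emeasure \<mu> UNIV < \<infinity>"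
    and X: "\<And>l. (\<Sum>i\<in>{k<..l}. dens x (2 ^ i * r)) \<le> X"
  shows "S_coeff \<mu> n (Cube x (2 ^ k * r)) Whole \<le> 1 + X"
proof -
  have "(\<Sum>i. dens x (2 ^ Suc i * (2 ^ k * r))) \<le> X"
  proof (rule suminf_le_const)
    show "summable (\<lambda>i. dens x (2 ^ Suc i * (2 ^ k * r)))" using r fin by (intro summable_dens) auto
    fix N
    have "(\<Sum>i<N. dens x (2 ^ Suc i * (2 ^ k * r))) = (\<Sum>i\<in>{k<..k + N}. dens x (2 ^ i * r))"
      by (rule sum.reindex_bij_witness[where i="\<lambda>i. i - k - 1" and j="\<lambda>i. k + i + 1"]) (auto simp: power_add mult_ac)
    then show "(\<Sum>i<N. dens x (2 ^ Suc i * (2 ^ k * r))) \<le> X" using X[of "k + N"] by simp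
  qed
  then show ?thesis by (simp only: S_Whole)
qed

text \<open>The largest coefficient of a link in \<open>chain\<close>: it is
  \<open>1 + X + C\<close> from \<open>S_link\<close> with \<open>X = 1 + 3 * C\<close>.\<close>

definition "Dc = 2 + 4 * C"

text \<open>A chain of doubling cubes \<open>U j\<close> from \<open>Cube x r\<close> to the top cube. The \<open>j\<close>-th cube is the first
  doubling one at which the partial sums of \<open>dens\<close> have reached \<open>j\<close>, so consecutive cubes are
  at bounded \<open>S\<close>-distance and the number of links is controlled by \<open>S\<close>.\<close>

lemma chain:
  assumes Q: "Q = Cube x r" "is_cube \<mu> Q" and R: "is_cube \<mu> R" and QR: "cube_set Q \<subseteq> cube_set R"
  shows "\<exists>U. (\<forall>j. is_cube \<mu> (U j) \<and> cube_set (U j) \<subseteq> cube_set (U (Suc j)) \<and> cube_set Q \<subseteq> cube_set (U j) \<and>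
      mcube \<mu> (cube_scale 2 (U j)) \<le> 2 ^ (n + 1) * mcube \<mu> (U j) \<and>
      S_coeff \<mu> n (U j) (U (Suc j)) \<le> Dc) \<and> S_coeff \<mu> n Q (U 0) \<le> Dc \<and>
     (\<forall>j. U j \<noteq> top_cube R \<longrightarrow> real j \<le> S_coeff \<mu> n Q (top_cube R)) \<and> (\<forall>j. U j = top_cube R \<longrightarrow> U (Suc j) = top_cube R)"
proof -
  have x: "x \<in> msupport \<mu>" "r > 0" using Q by auto
  let ?v = "\<lambda>i. dens x (2 ^ i * r)"
  let ?T = "top_cube R"
  have v0: "0 \<le> ?v i" and vC: "?v i \<le> C" for i using x by (auto simp: dens_le dens_nonneg)
  define sk where "sk k = (\<Sum>i\<in>{0<..k}. ?v i)" for k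
  define ok where "ok j \<longleftrightarrow> (\<exists>k. sk k \<ge> real j)" for j :: nat
  define kk where "kk j = (LEAST k. sk k \<ge> real j)" for j :: nat
  define p where "p j = nxt x r (kk j)" for j
  define P where "P j = Cube x (2 ^ p j * r)" for j
  have skmono: "sk a \<le> sk b" if "a \<le> b" for a b unfolding sk_def using that v0 by (intro sum_mono2) auto
  have kk: "real j \<le> sk (kk j)" if "ok j" for j using that unfolding ok_def kk_def by (rule LeastI_ex)
  have kk_le: "kk j \<le> k" if "real j \<le> sk k" for j k unfolding kk_def using that by (rule Least_le)
  have kk0: "kk 0 = 0" using kk_le[of 0 0] by (simp add: sk_def)
  have kk_up: "sk (kk j) \<le> real j + C" if "ok j" for j
  proof (cases "kk j")
    case 0 then show ?thesis using C1 by (simp add: sk_def)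
  next
    case (Suc k)
    then have "sk k < real j" using kk_le[of j k] by linarith
    moreover have "sk (Suc k) = sk k + ?v (Suc k)"
    proof -
      have "{0<..Suc k} = insert (Suc k) {0<..k}" by auto
      then show ?thesis by (simp add: sk_def)
    qed
    ultimately show ?thesis using vC[of "Suc k"] unfolding Suc by linarith
  qed
  have ok_mono: "ok j \<Longrightarrow> i \<le> j \<Longrightarrow> ok i" for i j unfolding ok_def by (meson of_nat_mono order_trans)
  have kk_mono: "kk i \<le> kk j" if "ok j" "i \<le> j" for i j using kk[OF that(1)] that(2)
    by (intro kk_le) linarith
  have p_ge: "kk j \<le> p j" and p_sum: "(\<Sum>i\<in>{kk j<..p j}. ?v i) \<le> 2 * C" and pd: "dbl x (2 ^ p j * r)" for j
    unfolding p_def using nxt[OF x] by auto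
  have p_mono: "p i \<le> p j" if "ok j" "i \<le> j" for i j
    unfolding p_def using kk_mono[OF that] by (rule nxt_mono[OF x])
  have sk_diff: "(\<Sum>i\<in>{a<..b}. ?v i) = sk b - sk a" if "a \<le> b" for a b
  proof -
    have "{0<..b} = {0<..a} \<union> {a<..b}" using that by auto
    then have "sk b = sk a + (\<Sum>i\<in>{a<..b}. ?v i)" unfolding sk_def by (simp add: sum.union_disjoint)
    then show ?thesis by simp
  qed
  \<comment> \<open>The threshold advances by 1, the partial sum may overshoot it by
    \<open>C\<close>, and waiting for the next doubling cube adds at most
    \<open>2 * C\<close>.\<close>
  have link: "(\<Sum>i\<in>{p j<..p (Suc j)}. ?v i) \<le> 1 + 3 * C" if "ok (Suc j)" for j
  proof -
    have oj: "ok j" using ok_mono[OF that] by simp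
    have "(\<Sum>i\<in>{p j<..p (Suc j)}. ?v i) \<le> (\<Sum>i\<in>{kk j<..p (Suc j)}. ?v i)"
      using p_ge[of j] v0 by (intro sum_mono2) auto
    also have "\<dots> \<le> (\<Sum>i\<in>{kk j<..kk (Suc j)}. ?v i) + (\<Sum>i\<in>{kk (Suc j)<..p (Suc j)}. ?v i)"
      using v0 by (rule sum_Ioc_split)
    also have "(\<Sum>i\<in>{kk j<..kk (Suc j)}. ?v i) = sk (kk (Suc j)) - sk (kk j)"
      using kk_mono[OF that, of j] by (intro sk_diff) auto
    finally show ?thesis using p_sum[of "Suc j"] kk_up[OF that] kk[OF oj] by simp
  qed
  \<comment> \<open>If the partial sums never reach the next integer, all densities beyond
    \<open>P j\<close> add up to at most 1, however far away the top cube is.\<close>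
  have tail: "(\<Sum>i\<in>{p j<..l}. ?v i) \<le> 1" if "ok j" "\<not> ok (Suc j)" for j l
  proof (cases "p j \<le> l")
    case True
    have "sk l < real (Suc j)" using that unfolding ok_def by (meson not_le)
    then show ?thesis using sk_diff[OF True] kk[OF that(1)] skmono[OF p_ge[of j]] by simp
  qed simp
  have ok0: "ok 0" unfolding ok_def by (intro exI[of _ 0]) (simp add: sk_def)
  have T: "is_cube \<mu> ?T" "cube_set R \<subseteq> cube_set ?T" "mcube \<mu> (cube_scale 2 ?T) \<le> 2 ^ (n + 1) * mcube \<mu> ?T"
    using top_cube[OF R] by auto
  have Qs: "cube_set Q \<subseteq> cube_set (P j)" for j
    unfolding Q P_def using x mult_right_mono[of 1 "2 ^ p j" r] one_le_power[of "2::real" "p j"]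
      by (intro cube_mono) auto
  have Ps: "cube_set (P i) \<subseteq> cube_set (P j)" if "ok j" "i \<le> j" for i j
    unfolding P_def using p_mono[OF that] x by (intro cube_mono mult_right_mono power_increasing) auto
  \<comment> \<open>This is the reason for the factor 8 in \<open>top_cube\<close>: the side
    \<open>w\<close> of the top cube is at least \<open>8 * s\<close>, so the offset
    \<open>s / 2\<close> of the centres is small against it, and a dilate about \<open>x\<close>
    that sticks out of the top cube has more than half of its side length.\<close>
  have out: "\<exists>y w. ?T = Cube y w \<and> w \<le> 2 ^ (k + 1) * r" if "\<not> cube_set (Cube x (2 ^ k * r)) \<subseteq> cube_set ?T" for k
  proof (cases R)
    case Whole then show ?thesis using that by simp
  next
    case (Cube y s)
    define w where "w = 2 ^ nxt y (8 * s) 0 * (8 * s)"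
    have s: "s > 0" using R Cube by simp
    have w8: "8 * s \<le> w" unfolding w_def
      using s mult_right_mono[of 1 "2 ^ nxt y (8 * s) 0" "8 * s"] one_le_power[of "2::real" "nxt y (8 * s) 0"]
      by auto
    have "infnorm (x - y) \<le> s / 2" using QR x cube_subset_side(2)[of x r y s] Q Cube by auto
    moreover have "\<not> infnorm (x - y) + 2 ^ k * r / 2 \<le> w / 2"
      using that cube_subsetI[of x y "2 ^ k * r" w] Cube by (auto simp: w_def)
    ultimately have "w \<le> 2 * (2 ^ k * r)" using w8 s by linarith
    then show ?thesis using Cube by (simp add: w_def)
  qed
  have S_out: "S_coeff \<mu> n (Cube x (2 ^ k * r)) ?T \<le> 1 + X + C"
    if kT: "cube_set (Cube x (2 ^ k * r)) \<subseteq> cube_set ?T" and kl: "k \<le> l" and nT: "\<not> cube_set (Cube x (2 ^ l * r)) \<subseteq> cube_set ?T"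
     and "(\<Sum>i\<in>{k<..l}. ?v i) \<le> X" for k l X
  proof -
    obtain y w where yw: "?T = Cube y w" "w \<le> 2 ^ (l + 1) * r" using out[OF nT] by blast
    have "2 ^ k * r \<le> w" using cube_subset_side(1)[of x "2 ^ k * r" y w] kT yw(1) x by auto
    then show ?thesis unfolding yw(1) using that yw x by (intro S_link) auto
  qed
  have S_in: "S_coeff \<mu> n (Cube x (2 ^ k * r)) (Cube x (2 ^ l * r)) \<le> 1 + X + C"
    if "k \<le> l" "(\<Sum>i\<in>{k<..l}. ?v i) \<le> X" for k l X
  proof (intro S_link[OF x _ _ that])
    show "2 ^ k * r \<le> 2 ^ l * r" using that(1) x by (intro mult_right_mono power_increasing) auto
    show "2 ^ l * r \<le> 2 ^ (l + 1) * r" using x by (intro mult_right_mono power_increasing) auto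
  qed
  \<comment> \<open>The chain switches to the top cube once \<open>P j\<close> sticks out of it or
    no further threshold is reached by the partial sums.\<close>
  define U where "U j = (if ok j \<and> cube_set (P j) \<subseteq> cube_set ?T then P j else ?T)" for j
  have Ustep: "U (Suc j) = ?T" if True: "U j = ?T" for j
    proof (cases "ok (Suc j) \<and> cube_set (P (Suc j)) \<subseteq> cube_set ?T")
      case t: True
      then have "ok j" "cube_set (P j) \<subseteq> cube_set ?T" "cube_set (P j) \<subseteq> cube_set (P (Suc j))"
        using ok_mono[of "Suc j" j] Ps[of "Suc j" j] by auto
      then have e: "P j = ?T" using True by (simp add: U_def)
      then have "cube_set (Cube x (2 ^ p (Suc j) * r)) \<subseteq> cube_set (Cube x (2 ^ p j * r))" using t
        by (simp add: P_def)
      then have "2 ^ p (Suc j) * r \<le> 2 ^ p j * r" by (rule cube_subset_side(1)) (use x in auto)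
      moreover have "2 ^ p j * r \<le> 2 ^ p (Suc j) * r"
        using p_mono[of "Suc j" j] t x by (intro mult_right_mono power_increasing) auto
      ultimately have "P (Suc j) = P j" by (simp add: P_def)
      then show ?thesis using t e by (simp add: U_def)
    qed (auto simp: U_def)
  have S0: "S_coeff \<mu> n Q (U 0) \<le> Dc"
  proof -
    have s: "(\<Sum>i\<in>{0<..p 0}. ?v i) \<le> 2 * C" using p_sum[of 0] kk0 by simp
    have QT: "cube_set (Cube x (2 ^ 0 * r)) \<subseteq> cube_set ?T" using QR T(2) Q by auto
    have "S_coeff \<mu> n Q (U 0) \<le> 1 + 2 * C + C"
      using S_in[OF _ s] S_out[OF QT _ _ s] ok0 Q by (auto simp: U_def P_def)
    then show ?thesis using C1 by (simp add: Dc_def)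
  qed
  have Sj: "S_coeff \<mu> n (U j) (U (Suc j)) \<le> Dc" for j
  proof (cases "U j = ?T")
    case True
    then have US: "U (Suc j) = ?T" by (rule Ustep)
    show ?thesis
    proof -
      have "S_coeff \<mu> n ?T ?T \<le> 1 + 0 + C"
      proof (cases ?T)
        case (Cube y w)
        then have "y \<in> msupport \<mu>" "w > 0" using T(1) by auto
        then show ?thesis using S_link[of y w 0 w 0 0 y] Cube by simp
      qed (use C1 in simp)
      then show ?thesis using True US C1 by (simp add: Dc_def)
    qed
  next
    case False
    then have Uj: "ok j" "cube_set (P j) \<subseteq> cube_set ?T" "U j = P j"
      by (auto simp: U_def split: if_splits)
    show ?thesis
    proof (cases "ok (Suc j)")
      case True
      have "p j \<le> p (Suc j)" using p_mono[OF True] by simp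
      then have "S_coeff \<mu> n (U j) (U (Suc j)) \<le> 1 + (1 + 3 * C) + C"
        using S_in[OF _ link[OF True]] S_out[OF _ _ _ link[OF True]] Uj True by (auto simp: U_def P_def)
      then show ?thesis by (simp add: Dc_def)
    next
      case n: False
      then have U': "U (Suc j) = ?T" by (simp add: U_def)
      have "S_coeff \<mu> n (P j) ?T \<le> 2 + C"
      proof (cases ?T)
        case Whole
        then have fin: "emeasure \<mu> UNIV < \<infinity>" using T(1) by simp
        show ?thesis unfolding Whole P_def using S_link_Whole[OF x(2) fin tail[OF Uj(1) n]] C1 by simp
      next
        case (Cube y w)
        obtain N where N: "w / r < 2 ^ N" using real_arch_pow[of 2 "w/r"] by auto
        let ?l = "max N (p j)"
        have "w \<le> 2 ^ (?l + 1) * r"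
        proof -
          have "w \<le> 2 ^ N * r" using N x by (simp add: field_simps)
          also have "\<dots> \<le> 2 ^ (?l + 1) * r" using x by (intro mult_right_mono power_increasing) auto
          finally show ?thesis .
        qed
        moreover have "2 ^ p j * r \<le> w"
          using cube_subset_side(1)[of x "2 ^ p j * r" y w] Uj(2) x unfolding Cube P_def by simp
        ultimately have "S_coeff \<mu> n (P j) (Cube y w) \<le> 1 + 1 + C"
          unfolding P_def using tail[OF Uj(1) n] by (intro S_link[OF x]) auto
        then show ?thesis using Cube by simp
      qed
      then show ?thesis unfolding U' Uj(3) using C1 by (simp add: Dc_def)
    qed
  qed
  \<comment> \<open>While the chain is below the top cube, its \<open>j\<close>-th cube has been
    reached after densities adding up to at least \<open>j\<close>, and these are among the terms of
    the coefficient of \<open>Q\<close> in the top cube.\<close>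
  have cnt: "real j \<le> S_coeff \<mu> n Q ?T" if "U j \<noteq> ?T" for j
  proof -
    have Uj: "ok j" "cube_set (P j) \<subseteq> cube_set ?T" using that by (auto simp: U_def split: if_splits)
    have "real j \<le> sk (p j)" using kk[OF Uj(1)] skmono[OF p_ge[of j]] by simp
    also have "\<dots> \<le> S_coeff \<mu> n Q ?T"
    proof (cases ?T)
      case Whole
      then have fin: "emeasure \<mu> UNIV < \<infinity>" using T(1) by simp
      have "sk (p j) = (\<Sum>i<p j. ?v (Suc i))" unfolding sk_def
        by (rule sum.reindex_bij_witness[where i=Suc and j="\<lambda>i. i - 1"]) auto
      also have "\<dots> \<le> (\<Sum>i. ?v (Suc i))" using summable_dens[OF fin x(2), of x] v0
        by (intro sum_le_suminf) (auto simp del: power_Suc)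
      finally show ?thesis unfolding Whole Q(1) S_Whole by simp
    next
      case (Cube y w)
      have le: "2 ^ p j * r \<le> w"
          using cube_subset_side(1)[of x "2 ^ p j * r" y w] Uj(2) x unfolding Cube P_def by simp
      have rw: "r \<le> w" using mult_right_mono[of 1 "2 ^ p j" r] one_le_power[of "2::real" "p j"] x le
        by linarith
      have "p j \<le> Nst r w"
      proof (rule ccontr)
        assume "\<not> p j \<le> Nst r w"
        then have "2 ^ Nst r w * r < 2 ^ p j * r" using x
          by (intro mult_strict_right_mono power_strict_increasing) auto
        then show False using Nst(2)[OF x(2) rw] le by linarith
      qed
      then have "sk (p j) \<le> (\<Sum>i\<in>{1..Nst r w}. ?v i)" unfolding sk_def using v0 by (intro sum_mono2) auto
      then show ?thesis unfolding Cube Q(1) S_Cube by simp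
    qed
    finally show ?thesis .
  qed
  show ?thesis
  proof (intro exI[of _ U] conjI allI impI S0 Sj Ustep cnt)
    fix j
    show "is_cube \<mu> (U j)" using T(1) x by (auto simp: U_def P_def)
    show "cube_set Q \<subseteq> cube_set (U j)" using Qs QR T(2) by (auto simp: U_def)
    show "mcube \<mu> (cube_scale 2 (U j)) \<le> 2 ^ (n + 1) * mcube \<mu> (U j)"
      using T(3) pd[of j] by (auto simp: U_def P_def dbl_def mass_def)
    show "cube_set (U j) \<subseteq> cube_set (U (Suc j))"
      using Ps[of "Suc j" j] ok_mono[of "Suc j" j] by (auto simp: U_def)
  qed auto
qed

lemma chain_all:
  assumes Q: "is_cube \<mu> Q" and R: "is_cube \<mu> R" and QR: "cube_set Q \<subseteq> cube_set R"
  shows "\<exists>U. (\<forall>j. is_cube \<mu> (U j) \<and> cube_set (U j) \<subseteq> cube_set (U (Suc j)) \<and> cube_set Q \<subseteq> cube_set (U j) \<and>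
      mcube \<mu> (cube_scale 2 (U j)) \<le> 2 ^ (n + 1) * mcube \<mu> (U j) \<and>
      S_coeff \<mu> n (U j) (U (Suc j)) \<le> Dc) \<and> S_coeff \<mu> n Q (U 0) \<le> Dc \<and>
     (\<forall>j. U j \<noteq> top_cube R \<longrightarrow> real j \<le> S_coeff \<mu> n Q (top_cube R)) \<and> (\<forall>j. U j = top_cube R \<longrightarrow> U (Suc j) = top_cube R)"
proof (cases Q)
  case (Cube x r)
  then show ?thesis using chain[OF _ Q R QR] by blast
next
  case Whole
  then have RW: "R = Whole" using QR Whole_subset[of R] by simp
  show ?thesis using top_cube[OF R] Whole C1 R RW
    by (intro exI[of _ "\<lambda>_. Whole"]) (auto simp: Dc_def)
qed

definition "K2 = 1 + 2 ^ n * (2 ^ n + 4 ^ n * (3 * C + 2 ^ n * (2 * C) + 2 * C) + 2 * C)"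

lemma K2_ge: "1 \<le> K2" using C1 by (simp add: K2_def)

text \<open>Between \<open>R\<close> and its top cube lie three levels and a stretch of non-doubling
  cubes, whose densities have a bounded sum. Replacing \<open>R\<close> by the top cube therefore
  changes the coefficient by a bounded factor only.\<close>

lemma S_top:
  assumes Q: "is_cube \<mu> Q" and R: "is_cube \<mu> R" and QR: "cube_set Q \<subseteq> cube_set R"
  shows "S_coeff \<mu> n Q (top_cube R) \<le> K2 * S_coeff \<mu> n Q R"
proof -
  have S1: "1 \<le> S_coeff \<mu> n Q R" by (rule S_ge_1[OF Q R])
  show ?thesis
  proof (cases "Q = Whole \<or> R = Whole")
    case True
    then have "S_coeff \<mu> n Q (top_cube R) = S_coeff \<mu> n Q R" by auto
    then show ?thesis using K2_ge S1 mult_right_mono[of 1 K2 "S_coeff \<mu> n Q R"] by simp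
  next
    case False
    then obtain x r y s where c: "Q = Cube x r" "R = Cube y s" by (cases Q; cases R) auto
    have x: "x \<in> msupport \<mu>" "r > 0" "y \<in> msupport \<mu>" "s > 0" using Q R c by auto
    have rs: "r \<le> s" "infnorm (x - y) \<le> s / 2" using cube_subset_side[of x r y s] QR c x by auto
    define N where "N = nxt y (8 * s) 0"
    define w where "w = 2 ^ N * (8 * s)"
    have l8: "level (8 * s) = level s + 3" using level_mult_power[of s 3] x by simp
    have lw: "level w = level (8 * s) + int N" unfolding w_def using x by (intro level_mult_power) auto
    have ws: "s \<le> w" unfolding w_def
      using x mult_right_mono[of 1 "2 ^ N" "8 * s"] one_le_power[of "2::real" N] by linarith
    have "dens_sum y (level (8 * s)) (level w) \<le> 2 ^ n * (\<Sum>k=1..N. dens y (2 ^ k * (8 * s)))"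
      unfolding lw using x by (intro dens_sum_dens_sum) auto
    also have "\<dots> \<le> 2 ^ n * (2 * C)"
      using nxt(3)[of y "8 * s" 0] x unfolding N_def
      by (intro mult_left_mono) (auto simp: atLeastSucAtMost_greaterThanAtMost)
    finally have a: "dens_sum y (level (8 * s)) (level w) \<le> 2 ^ n * (2 * C)" .
    have "dens_sum y (level s) (level w) \<le> 3 * C + 2 ^ n * (2 * C)"
      using dens_sum_split[of y "level s" "level w" "level (8 * s)"] dens_sum_bound[OF x(3), of "level s" "level (8 * s)"] a l8
        by simp
    moreover have "dens_sum x (level s) (level w) \<le> 4 ^ n * (dens_sum y (level s) (level w) + 2 * C)"
    proof (rule dens_sum_shift[OF x(3)])
      have "s < 2 * 2 powi level s" using level_bounds(2)[OF x(4)] by (simp add: power_int_add)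
      then show "infnorm (x - y) \<le> 2 powi level s" using rs by linarith
    qed
    ultimately have b: "dens_sum x (level s) (level w) \<le> 4 ^ n * (3 * C + 2 ^ n * (2 * C) + 2 * C)"
      by (smt (verit) mult_left_mono zero_le_power)
    have "S_coeff \<mu> n (Cube x r) (Cube y w) \<le> 1 + 2 ^ n * (dens_sum x (level r) (level w) + 2 * C)"
      using x rs ws by (intro S_le_dens_sum) auto
    also have "\<dots> \<le> 1 + 2 ^ n * ((2 ^ n * S_coeff \<mu> n Q R + 4 ^ n * (3 * C + 2 ^ n * (2 * C) + 2 * C)) + 2 * C)"
      using dens_sum_split[of x "level r" "level w" "level s"] b dens_sum_le_S[of x r s y] x rs c
      by (intro add_left_mono mult_left_mono add_right_mono) auto
    also have "\<dots> \<le> S_coeff \<mu> n Q R + 2 ^ n * ((2 ^ n * S_coeff \<mu> n Q R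
        + 4 ^ n * (3 * C + 2 ^ n * (2 * C) + 2 * C) * S_coeff \<mu> n Q R) + 2 * C * S_coeff \<mu> n Q R)"
    proof (intro add_mono mult_left_mono S1)
      show "4 ^ n * (3 * C + 2 ^ n * (2 * C) + 2 * C) \<le> 4 ^ n * (3 * C + 2 ^ n * (2 * C) + 2 * C) * S_coeff \<mu> n Q R"
        using mult_left_mono[OF S1, of "4 ^ n * (3 * C + 2 ^ n * (2 * C) + 2 * C)"] C1 by simp
      show "2 * C \<le> 2 * C * S_coeff \<mu> n Q R" using mult_left_mono[OF S1, of "2 * C"] C1 by simp
    qed auto
    also have "\<dots> = K2 * S_coeff \<mu> n Q R" unfolding K2_def
      by (simp add: distrib_left distrib_right mult_ac)
    finally show ?thesis using c by (simp add: w_def N_def)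
  qed
qed

section \<open>Transport of the mean of an atom along a chain\<close>

lemma avg_le:
  assumes U: "is_cube \<mu> U" and d: "mcube \<mu> (cube_scale 2 U) \<le> 2 ^ (n + 1) * mcube \<mu> U"
  shows "\<bar>avg U x\<bar> \<le> 2 ^ (n + 1) * (indicator (cube_set U) x / mcube \<mu> (cube_scale 2 U))"
proof (cases "mcube \<mu> U = 0")
  case False
  then have p: "mcube \<mu> U > 0" by (simp add: less_le)
  have "mcube \<mu> U \<le> mcube \<mu> (cube_scale 2 U)" using U
    by (intro mcube_mono is_cube_scale cube_sub_scale) auto
  then have "1 / mcube \<mu> U \<le> 2 ^ (n + 1) / mcube \<mu> (cube_scale 2 U)" using p d by (simp add: field_simps)
  then show ?thesis using p by (cases "x \<in> cube_set U") (auto simp: avg_def)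
qed (simp add: avg_def)

text \<open>At most \<open>(K2 + 2) * S\<close> blocks of size at most
  \<open>2 ^ (n + 1) / S\<close> arise from one atom; the factor S cancels.\<close>

definition "B0 = 2 ^ (n + 1) * (K2 + 2)"

text \<open>A telescoping sum: the mean of the atom is moved from \<open>Q\<close> to the first cube
  of the chain, then from each cube to the next. Each difference has integral 0 and is carried by
  two neighbouring cubes of the chain. What remains is the mean spread over the top cube.\<close>

lemma atom_decomposition:
  assumes a: "atom R Q a"
  shows "\<exists>\<beta> P R' t. (\<forall>l. simple_block Dc (P l) (R' l) (t l) (\<beta> l)) \<and> summable t \<and> suminf t \<le> B0 \<and>
    (\<forall>x. (\<lambda>l::nat. \<beta> l x) sums (a x - (\<integral>x. a x \<partial>\<mu>) * avg (top_cube R) x))"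
proof -
  have Q: "is_cube \<mu> Q" and R: "is_cube \<mu> R" and QR: "cube_set Q \<subseteq> cube_set R"
    using a by (auto simp: atom_def)
  have am [measurable]: "a \<in> borel_measurable borel" using a by (simp add: atom_def measurable_mu)
  obtain U where U: "\<And>j. is_cube \<mu> (U j)" "\<And>j. cube_set (U j) \<subseteq> cube_set (U (Suc j))" "\<And>j. cube_set Q \<subseteq> cube_set (U j)"
      "\<And>j. mcube \<mu> (cube_scale 2 (U j)) \<le> 2 ^ (n + 1) * mcube \<mu> (U j)"
      "\<And>j. S_coeff \<mu> n (U j) (U (Suc j)) \<le> Dc" "S_coeff \<mu> n Q (U 0) \<le> Dc"
     "\<And>j. U j \<noteq> top_cube R \<Longrightarrow> real j \<le> S_coeff \<mu> n Q (top_cube R)" "\<And>j. U j = top_cube R \<Longrightarrow> U (Suc j) = top_cube R"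
    using chain_all[OF Q R QR] by blast
  let ?S = "S_coeff \<mu> n Q R" and ?A = "\<integral>x. a x \<partial>\<mu>" and ?T = "top_cube R"
  let ?I = "\<lambda>P x. indicator (cube_set P) x / mcube \<mu> (cube_scale 2 P)"
  have S: "1 \<le> ?S" by (rule S_ge_1[OF Q R])
  have ai: "integrable \<mu> a"
    using atom_L1[OF a] by (intro integrableI_bounded) (auto simp: measurable_mu le_less_trans)
  have A: "\<bar>?A\<bar> \<le> 1 / ?S" using S by (intro abs_integral_le[OF ai atom_L1[OF a]]) auto
  have Aavg: "integrable \<mu> (\<lambda>x. ?A * avg (U j) x)" "(\<integral>x. ?A * avg (U j) x \<partial>\<mu>) = ?A" for j
  proof -
    have "integrable \<mu> (\<lambda>x. ?A * avg (U j) x) \<and> (\<integral>x. ?A * avg (U j) x \<partial>\<mu>) = ?A"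
    \<comment> \<open>On a null cube \<open>avg\<close> is 0 by the convention for division, but
      then the atom is 0 almost everywhere and \<open>?A\<close> is 0 as well.\<close>
    proof (cases "mcube \<mu> (U j) = 0")
      case True
      have "AE x in \<mu>. x \<notin> cube_set (U j)"
        using emeasure_cube[OF U(1)[of j]] True by (intro AE_not_in) (auto simp: null_sets_def)
      moreover have "AE x in \<mu>. x \<notin> cube_set Q \<longrightarrow> a x = 0" using a by (simp add: atom_def)
      ultimately have "AE x in \<mu>. a x = 0" by eventually_elim (use U(3)[of j] in auto)
      then have "?A = 0" by (rule integral_eq_zero_AE)
      then show ?thesis by simp
    next
      case False
      then show ?thesis using avg_integral[OF U(1) False] by simp
    qed
    then show "integrable \<mu> (\<lambda>x. ?A * avg (U j) x)" "(\<integral>x. ?A * avg (U j) x \<partial>\<mu>) = ?A" by auto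
  qed
  have Ab: "\<bar>?A * avg (U j) x\<bar> \<le> 2 ^ (n + 1) / ?S * ?I (U j) x" for j x
  proof -
    have "\<bar>?A * avg (U j) x\<bar> \<le> (1 / ?S) * (2 ^ (n + 1) * ?I (U j) x)"
      unfolding abs_mult using A avg_le[OF U(1,4), of j x] S by (intro mult_mono) auto
    then show ?thesis by simp
  qed
  define \<beta> where "\<beta> l = (case l of 0 \<Rightarrow> (\<lambda>x. a x - ?A * avg (U 0) x) | Suc j \<Rightarrow> (\<lambda>x. ?A * avg (U j) x - ?A * avg (U (Suc j)) x))" for l
  define P where "P l = (case l of 0 \<Rightarrow> Q | Suc j \<Rightarrow> U j)" for l
  \<comment> \<open>Once the chain has reached the top cube the differences vanish; their sizes must
    be set to 0 to keep the sum of all sizes bounded.\<close>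
  define t where "t l = (case l of 0 \<Rightarrow> 2 ^ (n + 1) / ?S | Suc j \<Rightarrow> if U j = ?T then 0 else 2 ^ (n + 1) / ?S)" for l
  have t0: "0 \<le> t l" "t l \<le> 2 ^ (n + 1) / ?S" for l using S by (auto simp: t_def split: nat.split)
  have sb: "simple_block Dc (P l) (U l) (t l) (\<beta> l)" for l
  proof (cases l)
    case 0
    have "AE x in \<mu>. \<bar>\<beta> 0 x\<bar> \<le> t 0 * (?I Q x + ?I (U 0) x)"
      using atom_bound[OF a]
    proof eventually_elim
      case (elim x)
      have "\<bar>a x\<bar> \<le> 2 ^ (n + 1) / ?S * ?I Q x"
      proof -
        have "\<bar>a x\<bar> \<le> (1 / ?S) * ?I Q x" using elim by (simp add: mult.commute)
        also have "\<dots> \<le> (2 ^ (n + 1) / ?S) * ?I Q x"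
          using S one_le_power[of "2::real" "n + 1"]
            by (intro mult_right_mono divide_right_mono) (auto simp del: power_Suc)
        finally show ?thesis .
      qed
      then have "\<bar>a x - ?A * avg (U 0) x\<bar> \<le> 2 ^ (n + 1) / ?S * ?I Q x + 2 ^ (n + 1) / ?S * ?I (U 0) x"
        using Ab[of 0 x] by linarith
      then show ?case by (simp add: \<beta>_def t_def distrib_left)
    qed
    then show ?thesis using 0 Q U(1)[of 0] U(3)[of 0] U(6) t0(1)[of 0] ai Aavg[of 0]
      unfolding simple_block_def by (simp add: P_def \<beta>_def)
  next
    case (Suc j)
    have "AE x in \<mu>. \<bar>\<beta> (Suc j) x\<bar> \<le> t (Suc j) * (?I (U j) x + ?I (U (Suc j)) x)"
    proof (rule AE_I2)
      fix x
      show "\<bar>\<beta> (Suc j) x\<bar> \<le> t (Suc j) * (?I (U j) x + ?I (U (Suc j)) x)"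
      proof (cases "U j = ?T")
        case True then show ?thesis using U(8)[of j] by (simp add: \<beta>_def t_def)
      next
        case False
        then show ?thesis using Ab[of j x] Ab[of "Suc j" x] by (simp add: \<beta>_def t_def distrib_left)
      qed
    qed
    moreover have "integrable \<mu> (\<beta> (Suc j))" "(\<integral>x. \<beta> (Suc j) x \<partial>\<mu>) = 0"
      using Bochner_Integration.integrable_diff[OF Aavg(1)[of j] Aavg(1)[of "Suc j"]]
        Bochner_Integration.integral_diff[OF Aavg(1)[of j] Aavg(1)[of "Suc j"]] Aavg(2)
      by (simp_all only: \<beta>_def nat.case diff_self)
    moreover have "\<beta> (Suc j) \<in> borel_measurable borel" by (simp add: \<beta>_def)
    ultimately show ?thesis using Suc U(1,2,5)[of j] U(1)[of "Suc j"] t0(1)[of "Suc j"]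
      unfolding simple_block_def by (simp add: P_def)
  qed
  \<comment> \<open>A cube \<open>U j\<close> other than the top cube forces \<open>j\<close> to be
    at most the coefficient of \<open>Q\<close> in the top cube, hence at most
    \<open>K2 * ?S\<close>.\<close>
  define N where "N = nat \<lfloor>K2 * ?S\<rfloor> + 1"
  have KS: "1 \<le> K2 * ?S" using K2_ge S mult_mono[of 1 K2 1 ?S] by simp
  have UT: "U j = ?T" if "N \<le> j" for j
  proof (rule ccontr)
    assume "U j \<noteq> ?T"
    then have "real j \<le> K2 * ?S" using U(7)[of j] S_top[OF Q R QR] by linarith
    then show False using that unfolding N_def by linarith
  qed
  have tz: "t l = 0" "\<beta> l = (\<lambda>x. 0)" if "N < l" for l
    using that UT[of "l - 1"] UT[of l] by (cases l; simp add: t_def \<beta>_def)+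
  have "t sums (\<Sum>l\<in>{..N}. t l)" using tz by (intro sums_finite) auto
  then have "summable t" "suminf t = (\<Sum>l\<in>{..N}. t l)" by (auto simp: sums_iff)
  moreover have "(\<Sum>l\<in>{..N}. t l) \<le> B0"
  proof -
    have "(\<Sum>l\<in>{..N}. t l) \<le> (N + 1) * (2 ^ (n + 1) / ?S)"
      using sum_bounded_above[of "{..N}" t "2 ^ (n + 1) / ?S"] t0 by simp
    also have "\<dots> \<le> (K2 * ?S + 2 * ?S) * (2 ^ (n + 1) / ?S)"
    proof (intro mult_right_mono)
      have "real N \<le> K2 * ?S + 1" unfolding N_def using KS by linarith
      then show "real (N + 1) \<le> K2 * ?S + 2 * ?S" using S by simp
    qed (use S in auto)
    also have "\<dots> = B0" using S by (simp add: B0_def field_simps)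
    finally show ?thesis .
  qed
  moreover have "(\<lambda>l. \<beta> l x) sums (a x - ?A * avg ?T x)" for x
  proof -
    have "(\<Sum>l\<in>{..k}. \<beta> l x) = a x - ?A * avg (U k) x" for k by (induction k) (auto simp: \<beta>_def)
    then have "(\<Sum>l\<in>{..N}. \<beta> l x) = a x - ?A * avg ?T x" using UT[of N] by simp
    moreover have "(\<lambda>l. \<beta> l x) sums (\<Sum>l\<in>{..N}. \<beta> l x)" using tz by (intro sums_finite) auto
    ultimately show ?thesis by simp
  qed
  ultimately show ?thesis using sb by (intro exI[of _ \<beta>] exI[of _ P] exI[of _ U] exI[of _ t]) auto
qed

lemma simple_block_scale:
  assumes "simple_block D P R t b" shows "simple_block D P R (\<bar>c\<bar> * t) (\<lambda>x. c * b x)"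
proof -
  have "AE x in \<mu>. \<bar>b x\<bar> \<le> t * (indicator (cube_set P) x / mcube \<mu> (cube_scale 2 P) +
     indicator (cube_set R) x / mcube \<mu> (cube_scale 2 R))" using assms by (simp add: simple_block_def)
  then have "AE x in \<mu>. \<bar>c * b x\<bar> \<le> \<bar>c\<bar> * t * (indicator (cube_set P) x / mcube \<mu> (cube_scale 2 P) +
     indicator (cube_set R) x / mcube \<mu> (cube_scale 2 R))"
    by eventually_elim (simp add: abs_mult mult_left_mono mult.assoc)
  then show ?thesis using assms by (auto simp: simple_block_def)
qed

text \<open>The remainders of all atoms sit on the same top cube, and their coefficients
  \<open>c i * ?A i\<close> sum to the integral of \<open>b\<close>, which is 0. This is where the
  cancellation of the block is used.\<close>

lemma block_decomposition:
  assumes b: "atomic_block \<mu> n R b s"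
  shows "\<exists>\<beta> P R' t. (\<forall>l. simple_block Dc (P l) (R' l) (t l) (\<beta> l)) \<and> summable t \<and> suminf t \<le> B0 * s \<and>
    (AE x in \<mu>. (\<lambda>l::nat. \<beta> l x) sums b x)"
proof -
  obtain c a Q where at: "\<And>i::nat. atom R (Q i) (a i)" and bs: "AE x in \<mu>. (\<lambda>i. c i * a i x) sums b x"
    and cs: "(\<lambda>i. \<bar>c i\<bar>) sums s" using block_atoms[OF b] by metis
  have bi: "(\<integral>x. b x \<partial>\<mu>) = 0" "is_cube \<mu> R" using b by (auto simp: atomic_block_def)
  let ?A = "\<lambda>i. \<integral>x. a i x \<partial>\<mu>" and ?T = "top_cube R"
  have B0: "0 \<le> B0" using K2_ge by (simp add: B0_def)
  have "\<forall>i. \<exists>\<beta> P R' t. (\<forall>l. simple_block Dc (P l) (R' l) (t l) (\<beta> l)) \<and> summable t \<and> suminf t \<le> B0 \<and>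
    (\<forall>x. (\<lambda>l::nat. \<beta> l x) sums (a i x - ?A i * avg ?T x))" using atom_decomposition[OF at] by blast
  then obtain \<beta> P R' t where d: "\<And>i l. simple_block Dc (P i l) (R' i l) (t i l) (\<beta> i l)" "\<And>i. summable (t i)"
     "\<And>i. suminf (t i) \<le> B0" "\<And>i x. (\<lambda>l::nat. \<beta> i l x) sums (a i x - ?A i * avg ?T x)"
    by metis
  have t0: "0 \<le> t i l" for i l using d(1)[of i l] by (simp add: simple_block_def)
  let ?t = "\<lambda>i l. \<bar>c i\<bar> * t i l" and ?\<beta> = "\<lambda>i l x. c i * \<beta> i l x"
  have sb: "simple_block Dc (P i l) (R' i l) (?t i l) (?\<beta> i l)" for i l
    by (rule simple_block_scale[OF d(1)])
  have st: "?t i sums (\<bar>c i\<bar> * suminf (t i))" for i using d(2) by (intro sums_mult summable_sums)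
  have s0: "0 \<le> suminf (t i)" for i using d(2) t0 by (intro suminf_nonneg)
  have sm: "summable (\<lambda>i. \<bar>c i\<bar> * suminf (t i))"
  proof (rule summable_comparison_test[of _ "\<lambda>i. \<bar>c i\<bar> * B0"])
    show "summable (\<lambda>i. \<bar>c i\<bar> * B0)" using cs by (auto intro: summable_mult2 simp: sums_iff)
    have "norm (\<bar>c i\<bar> * suminf (t i)) \<le> \<bar>c i\<bar> * B0" for i
      using d(3)[of i] s0[of i] by (simp add: abs_mult mult_left_mono)
    then show "\<exists>N. \<forall>i\<ge>N. norm (\<bar>c i\<bar> * suminf (t i)) \<le> \<bar>c i\<bar> * B0" by blast
  qed
  define T where "T = (\<Sum>i. \<bar>c i\<bar> * suminf (t i))"
  have TS: "(\<lambda>i. \<bar>c i\<bar> * suminf (t i)) sums T" unfolding T_def using sm by (rule summable_sums)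
  have TB: "T \<le> B0 * s"
  proof -
    have "T \<le> (\<Sum>i. \<bar>c i\<bar> * B0)" unfolding T_def
      using sm d(3) cs by (intro suminf_le mult_left_mono) (auto intro: summable_mult2 simp: sums_iff)
    also have "\<dots> = B0 * s" using sums_mult2[OF cs, of B0] by (simp add: sums_iff mult.commute)
    finally show ?thesis .
  qed
  have L1c: "AE x in \<mu>. (\<lambda>i. c i * a i x - c i * ?A i * avg ?T x) sums b x"
  proof -
    have am: "a i \<in> borel_measurable \<mu>" for i using at[of i] by (simp add: atom_def)
    have le: "(\<integral>\<^sup>+x. ennreal \<bar>c i * a i x\<bar> \<partial>\<mu>) \<le> ennreal \<bar>c i\<bar>" for i
    proof -
      have "(\<integral>\<^sup>+x. ennreal \<bar>c i * a i x\<bar> \<partial>\<mu>) = ennreal \<bar>c i\<bar> * (\<integral>\<^sup>+x. ennreal \<bar>a i x\<bar> \<partial>\<mu>)"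
        unfolding abs_mult using am by (simp add: ennreal_mult nn_integral_cmult)
      also have "\<dots> \<le> ennreal \<bar>c i\<bar> * 1"
      proof (rule mult_left_mono)
        have "1 \<le> S_coeff \<mu> n (Q i) R" using at[of i] by (auto simp: atom_def intro: S_ge_1)
        then have "ennreal (1 / S_coeff \<mu> n (Q i) R) \<le> ennreal 1" by (intro ennreal_leI) auto
        then show "(\<integral>\<^sup>+x. ennreal \<bar>a i x\<bar> \<partial>\<mu>) \<le> 1" using atom_L1[OF at[of i]]
          by (auto intro: order_trans)
      qed simp
      finally show ?thesis by simp
    qed
    have "(\<lambda>i. \<integral>x. c i * a i x \<partial>\<mu>) sums (\<integral>x. (\<Sum>i. c i * a i x) \<partial>\<mu>)"
      using am le cs by (intro L1_series(4)[where s="\<lambda>i. \<bar>c i\<bar>"]) (auto simp: sums_iff)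
    also have "(\<integral>x. (\<Sum>i. c i * a i x) \<partial>\<mu>) = (\<integral>x. b x \<partial>\<mu>)"
    proof (rule integral_cong_AE)
      show "AE x in \<mu>. (\<Sum>i. c i * a i x) = b x" using bs by eventually_elim (simp add: sums_iff)
    qed (use am block_measurable[OF b] in \<open>auto simp: measurable_mu\<close>)
    finally have A0: "(\<lambda>i. c i * ?A i) sums 0" using bi by simp
    show ?thesis using bs
    proof eventually_elim
      case (elim x)
      have "(\<lambda>i. c i * a i x - c i * ?A i * avg ?T x) sums (b x - 0 * avg ?T x)"
        by (intro sums_diff elim sums_mult2 A0)
      then show ?case by simp
    qed
  qed
  let ?d = "\<lambda>p. prod_decode p"
  have "AE x in \<mu>. (\<lambda>p. case prod_decode p of (i, l) \<Rightarrow> ?\<beta> i l x) sums b x"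
  proof (rule L1_double_series[where s="\<lambda>i l. 2 * ?t i l" and S="\<lambda>i. 2 * (\<bar>c i\<bar> * suminf (t i))" and T="2 * T"])
    show "?\<beta> i l \<in> borel_measurable \<mu>" for i l using sb[of i l]
      by (simp add: simple_block_def measurable_mu)
    show "(\<integral>\<^sup>+x. ennreal \<bar>?\<beta> i l x\<bar> \<partial>\<mu>) \<le> ennreal (2 * ?t i l)" for i l by (rule simple_block_L1[OF sb])
    show "0 \<le> 2 * ?t i l" for i l using t0 by simp
    show "(\<lambda>l. 2 * ?t i l) sums (2 * (\<bar>c i\<bar> * suminf (t i)))" for i by (rule sums_mult[OF st])
    show "(\<lambda>i. 2 * (\<bar>c i\<bar> * suminf (t i))) sums (2 * T)" by (rule sums_mult[OF TS])
    show "AE x in \<mu>. (\<lambda>l. ?\<beta> i l x) sums (c i * a i x - c i * ?A i * avg ?T x)" for i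
      using sums_mult[OF d(4)[of i], of "c i"] by (auto simp: right_diff_distrib mult.assoc)
  qed (rule L1c)
  moreover have "(\<lambda>p. case prod_decode p of (i, l) \<Rightarrow> ?t i l) sums T"
    using t0 by (intro sums_prod_decode[OF _ st TS]) auto
  ultimately show ?thesis using TB sb
    by (intro exI[of _ "\<lambda>p x. case prod_decode p of (i, l) \<Rightarrow> ?\<beta> i l x"] exI[of _ "\<lambda>p. case prod_decode p of (i, l) \<Rightarrow> P i l"]
       exI[of _ "\<lambda>p. case prod_decode p of (i, l) \<Rightarrow> R' i l"] exI[of _ "\<lambda>p. case prod_decode p of (i, l) \<Rightarrow> ?t i l"])
      (auto simp: sums_iff split: prod.splits)
qed

text \<open>The new blocks are also atomic blocks with summable sizes, so the results on
  distributions and the estimates of the maximal function apply to one and the same series.\<close>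

lemma simple_decomposition:
  assumes d: "atb_decomposition \<mu> n h b R s"
  shows "\<exists>\<beta> P R' t s'. (\<forall>l. simple_block Dc (P l) (R' l) (t l) (\<beta> l)) \<and> summable t \<and>
    atb_decomposition \<mu> n h \<beta> R' s'"
proof -
  have b: "\<And>j. atomic_block \<mu> n (R j) (b j) (s j)" and s: "summable s" and hs: "AE x in \<mu>. (\<lambda>j. b j x) sums h x"
    using d by (auto simp: atb_decomposition_def)
  have B0: "0 \<le> B0" using K2_ge by (simp add: B0_def)
  have "\<forall>j. \<exists>\<beta> P R' t. (\<forall>l. simple_block Dc (P l) (R' l) (t l) (\<beta> l)) \<and> summable t \<and> suminf t \<le> B0 * s j \<and>
    (AE x in \<mu>. (\<lambda>l::nat. \<beta> l x) sums b j x)" using block_decomposition[OF b] by blast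
  then have "\<exists>\<beta> P R' t. \<forall>j. (\<forall>l. simple_block Dc (P j l) (R' j l) (t j l) (\<beta> j l)) \<and> summable (t j) \<and> suminf (t j) \<le> B0 * s j \<and>
    (AE x in \<mu>. (\<lambda>l::nat. \<beta> j l x) sums b j x)" unfolding choice_iff .
  then obtain \<beta> P R' t where sb: "\<And>i l. simple_block Dc (P i l) (R' i l) (t i l) (\<beta> i l)" and t: "\<And>i. summable (t i)"
     "\<And>i. suminf (t i) \<le> B0 * s i" and \<beta>: "\<And>i. AE x in \<mu>. (\<lambda>l::nat. \<beta> i l x) sums b i x"
    by blast
  have t0: "0 \<le> t i l" for i l using sb[of i l] by (simp add: simple_block_def)
  have s0: "0 \<le> suminf (t i)" for i using t(1) t0 by (intro suminf_nonneg)
  have sm: "summable (\<lambda>i. suminf (t i))"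
  proof (rule summable_comparison_test[of _ "\<lambda>i. B0 * s i"])
    have "norm (suminf (t i)) \<le> B0 * s i" for i using t(2)[of i] s0[of i]
      by (simp only: real_norm_def abs_of_nonneg)
    then show "\<exists>N. \<forall>i\<ge>N. norm (suminf (t i)) \<le> B0 * s i" by blast
    show "summable (\<lambda>i. B0 * s i)" by (rule summable_mult[OF s])
  qed
  define T where "T = (\<Sum>i. suminf (t i))"
  have TS: "(\<lambda>i. suminf (t i)) sums T" unfolding T_def using sm by (rule summable_sums)
  have st: "t i sums suminf (t i)" for i using t(1) by (rule summable_sums)
  let ?\<beta> = "\<lambda>p x. case prod_decode p of (i, l) \<Rightarrow> \<beta> i l x" and ?P = "\<lambda>p. case prod_decode p of (i, l) \<Rightarrow> P i l"
   and ?R = "\<lambda>p. case prod_decode p of (i, l) \<Rightarrow> R' i l" and ?t = "\<lambda>p. case prod_decode p of (i, l) \<Rightarrow> t i l"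
  have h: "AE x in \<mu>. (\<lambda>p. ?\<beta> p x) sums h x"
  proof (rule L1_double_series[where s="\<lambda>i l. 2 * t i l" and S="\<lambda>i. 2 * suminf (t i)" and T="2 * T"])
    show "\<beta> i l \<in> borel_measurable \<mu>" for i l using sb[of i l]
      by (simp add: simple_block_def measurable_mu)
    show "(\<integral>\<^sup>+x. ennreal \<bar>\<beta> i l x\<bar> \<partial>\<mu>) \<le> ennreal (2 * t i l)" for i l by (rule simple_block_L1[OF sb])
    show "0 \<le> 2 * t i l" for i l using t0 by simp
    show "(\<lambda>l. 2 * t i l) sums (2 * suminf (t i))" for i by (rule sums_mult[OF st])
    show "(\<lambda>i. 2 * suminf (t i)) sums (2 * T)" by (rule sums_mult[OF TS])
  qed (rule \<beta>, rule hs)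
  have tT: "?t sums T" using t0 by (intro sums_prod_decode[OF _ st TS]) auto
  have sbp: "simple_block Dc (?P p) (?R p) (?t p) (?\<beta> p)" for p using sb by (simp split: prod.split)
  obtain s' where s': "\<And>p. atomic_block \<mu> n (?R p) (?\<beta> p) (s' p)" "\<And>p. s' p \<le> ?t p * (Dc + (1 + 2 ^ n * (2 * C)))"
    using simple_block_atomic[OF sbp] by metis
  have "summable s'"
  proof (rule summable_comparison_test[of _ "\<lambda>p. ?t p * (Dc + (1 + 2 ^ n * (2 * C)))"])
    have "norm (s' p) \<le> ?t p * (Dc + (1 + 2 ^ n * (2 * C)))" for p
      using s'(2)[of p] block_s_nonneg[OF s'(1)[of p]] by (simp only: real_norm_def abs_of_nonneg)
    then show "\<exists>N. \<forall>p\<ge>N. norm (s' p) \<le> ?t p * (Dc + (1 + 2 ^ n * (2 * C)))" by blast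
    show "summable (\<lambda>p. ?t p * (Dc + (1 + 2 ^ n * (2 * C))))"
      using tT by (intro summable_mult2) (simp add: sums_iff)
  qed
  then have "atb_decomposition \<mu> n h ?\<beta> ?R s'" unfolding atb_decomposition_def using s'(1) h by auto
  moreover have "summable ?t" using tT by (simp only: sums_iff)
  ultimately show ?thesis using sbp
    by (intro exI[of _ ?\<beta>] exI[of _ ?P] exI[of _ ?R] exI[of _ ?t] exI[of _ s'] conjI allI) assumption+
qed

end

section \<open>The maximal function of a block\<close>

lemma convex_cube: "convex (cube_set Q)"
  by (cases Q) (auto simp: cube_set.simps)

context growth_space
begin

section \<open>The class F and measurability of the maximal function\<close>

lemma F_class_props:
  assumes "\<phi> \<in> F_class \<mu> n x"
  shows "integrable \<mu> \<phi>" "(\<integral>y. \<phi> y \<partial>\<mu>) \<le> 1" "\<And>y. 0 \<le> \<phi> y" "\<And>y. y \<noteq> x \<Longrightarrow> \<phi> y \<le> 1 / norm (y - x) ^ n"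
    "continuous_on UNIV \<phi>" "\<phi> \<in> borel_measurable borel" "\<exists>B. \<forall>y. \<phi> y \<le> B"
    "(\<integral>\<^sup>+y. ennreal (\<phi> y) \<partial>\<mu>) \<le> 1"
proof -
  show 1: "integrable \<mu> \<phi>" "\<And>y. 0 \<le> \<phi> y" "\<And>y. y \<noteq> x \<Longrightarrow> \<phi> y \<le> 1 / norm (y - x) ^ n"
    using assms unfolding F_class_def by blast+
  have a: "(\<integral>y. \<bar>\<phi> y\<bar> \<partial>\<mu>) \<le> 1" using assms unfolding F_class_def by blast
  then show i: "(\<integral>y. \<phi> y \<partial>\<mu>) \<le> 1" using 1(2) by simp
  show c: "continuous_on UNIV \<phi>"
    using assms unfolding F_class_def gderiv_def
    by (auto simp: continuous_on_eq_continuous_at intro: has_derivative_continuous)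
  then show "\<phi> \<in> borel_measurable borel" by (rule borel_measurable_continuous_onI)
  \<comment> \<open>The bound by \<open>1 / norm (y - x) ^ n\<close> is useless near
    \<open>x\<close>; there continuity on the unit ball replaces it. So \<open>\<phi>\<close> is
    bounded and can be paired with any integrable function.\<close>
  have "compact (\<phi> ` cball x 1)" using c
    by (intro compact_continuous_image) (auto intro: continuous_on_subset)
  then obtain B where B: "\<And>y. y \<in> cball x 1 \<Longrightarrow> \<bar>\<phi> y\<bar> \<le> B"
    using compact_imp_bounded by (metis bounded_iff imageI real_norm_def)
  have "\<phi> y \<le> max B 1" for y
  proof (cases "y \<in> cball x 1")
    case True then show ?thesis using B[of y] by auto
  next
    case False
    then have d: "norm (y - x) > 1" by (simp add: dist_norm norm_minus_commute)
    then have "1 \<le> norm (y - x) ^ n" by (intro one_le_power) simp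
    then have "1 / norm (y - x) ^ n \<le> 1" by simp
    moreover have "y \<noteq> x" using d by auto
    ultimately show ?thesis using 1(3)[of y] by linarith
  qed
  then show "\<exists>B. \<forall>y. \<phi> y \<le> B" by blast
  have "(\<integral>\<^sup>+y. ennreal (\<phi> y) \<partial>\<mu>) = ennreal (\<integral>y. \<phi> y \<partial>\<mu>)" using 1 by (intro nn_integral_eq_integral) auto
  also have "\<dots> \<le> ennreal 1" using i by (rule ennreal_leI)
  finally show "(\<integral>\<^sup>+y. ennreal (\<phi> y) \<partial>\<mu>) \<le> 1" by simp
qed

lemma F_class_integrable:
  assumes \<phi>: "\<phi> \<in> F_class \<mu> n x" and g: "integrable \<mu> g"
  shows "integrable \<mu> (\<lambda>y. g y * \<phi> y)"
proof -
  obtain B where B: "\<And>y. \<phi> y \<le> B" using F_class_props(7)[OF \<phi>] by blast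
  note p = F_class_props[OF \<phi>]
  have [measurable]: "\<phi> \<in> borel_measurable borel" "g \<in> borel_measurable borel"
    using p(6) g by (auto simp: measurable_mu dest: borel_measurable_integrable)
  show ?thesis
  proof (rule Bochner_Integration.integrable_bound[OF integrable_mult_right[OF g, of B]])
    show "AE y in \<mu>. norm (g y * \<phi> y) \<le> norm (B * g y)"
    proof (rule AE_I2)
      fix y
      have "\<bar>\<phi> y\<bar> \<le> \<bar>B\<bar>" using p(3)[of y] B[of y] by linarith
      then have "\<bar>g y\<bar> * \<bar>\<phi> y\<bar> \<le> \<bar>g y\<bar> * \<bar>B\<bar>" by (intro mult_left_mono) auto
      then show "norm (g y * \<phi> y) \<le> norm (B * g y)" by (simp add: abs_mult mult.commute)
    qed
  qed (simp add: measurable_mu)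
qed

text \<open>Multiplication by \<open>c < 1\<close> leaves room to move the pole of the two bounds.
  Away from \<open>x\<close> the ratio of the distances to \<open>x'\<close> and \<open>x\<close> is
  close to 1; near \<open>x\<close> the bounds with pole \<open>x'\<close> exceed the finite suprema
  of \<open>\<phi>\<close> and of its gradient.\<close>

lemma F_class_shift:
  assumes \<phi>: "\<phi> \<in> F_class \<mu> n x" and c: "0 < c" "c < 1"
  shows "\<exists>\<delta>>0. \<forall>x'. dist x' x < \<delta> \<longrightarrow> (\<lambda>y. c * \<phi> y) \<in> F_class \<mu> n x'"
proof -
  note p = F_class_props[OF \<phi>]
  obtain D where D: "continuous_on UNIV D" "\<And>y. GDERIV \<phi> y :> D y" "\<And>y. y \<noteq> x \<Longrightarrow> norm (D y) \<le> 1 / norm (y - x) ^ (n + 1)"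
    using \<phi> by (auto simp: F_class_def)
  obtain B where B: "\<And>y. \<phi> y \<le> B" using p(7) by blast
  have "compact (D ` cball x 1)" using D(1)
    by (intro compact_continuous_image) (auto intro: continuous_on_subset)
  then obtain B' where B': "\<And>y. y \<in> cball x 1 \<Longrightarrow> norm (D y) \<le> B'"
    using compact_imp_bounded by (metis bounded_iff imageI)
  define E where "E = max (max B B') 1"
  have E: "E \<ge> 1" "\<And>y. \<phi> y \<le> E" "\<And>y. y \<in> cball x 1 \<Longrightarrow> norm (D y) \<le> E"
    using B B' by (auto simp: E_def le_max_iff_disj)
  \<comment> \<open>Within distance \<open>2 * r = 1 / E\<close> of \<open>x'\<close>, which is at
    most 1, both bounds with pole \<open>x'\<close> are at least \<open>E\<close>.\<close>
  define r where "r = 1 / (2 * E)"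
  have r: "0 < r" "r \<le> 1/2" using E by (auto simp: r_def divide_le_eq)
  \<comment> \<open>A root of order \<open>n + 1\<close>, so that \<open>q ^ k\<close> is at least
    \<open>c\<close> for both exponents that occur, \<open>n\<close> and
    \<open>n + 1\<close>.\<close>
  define q where "q = root (n + 1) c"
  have q: "0 < q" "q < 1" "q ^ (n + 1) = c"
    using c real_root_pow_pos2[of "n + 1" c] by (auto simp: q_def simp del: power_Suc)
  define \<delta> where "\<delta> = min r (r * (1 / q - 1))"
  have \<delta>: "0 < \<delta>" "\<delta> \<le> r" "\<delta> \<le> r * (1 / q - 1)" using r q by (auto simp: \<delta>_def)
  have qn: "c \<le> q ^ k" if "k \<le> n + 1" for k
    using q power_decreasing[OF that, of q] by simp
  show ?thesis
  proof (intro exI[of _ \<delta>] conjI \<delta>(1) allI impI)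
    fix x' assume x': "dist x' x < \<delta>"
    have tri: "norm (y - x') \<le> norm (y - x) + \<delta>" for y
      using x' norm_triangle_ineq[of "y - x" "x - x'"] by (simp add: dist_norm norm_minus_commute)
    have key: "c * v \<le> 1 / norm (y - x') ^ k"
      if k: "k \<le> n + 1" "1 \<le> k" and y: "y \<noteq> x'" and v: "0 \<le> v" "y \<noteq> x \<Longrightarrow> v \<le> 1 / norm (y - x) ^ k" "y \<in> cball x 1 \<Longrightarrow> v \<le> E" for v y k
    proof (cases "norm (y - x) < r")
      case True
      then have "norm (y - x') \<le> 2 * r" using tri[of y] \<delta> by linarith
      then have "norm (y - x') ^ k \<le> (2 * r) ^ k" by (intro power_mono) auto
      also have "\<dots> \<le> (2 * r) ^ 1" using r k by (intro power_decreasing) auto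
      also have "\<dots> = 1 / E" by (simp add: r_def)
      finally have "E * norm (y - x') ^ k \<le> 1" using E(1) by (simp add: field_simps)
      then have "E \<le> 1 / norm (y - x') ^ k" using y by (simp add: le_divide_eq)
      moreover have "v \<le> E" using True r by (intro v) (auto simp: dist_norm norm_minus_commute)
      moreover have "c * v \<le> 1 * v" using c v by (intro mult_right_mono) auto
      ultimately show ?thesis by linarith
    next
      case False
      then have yx: "y \<noteq> x" "norm (y - x) > 0" using r by auto
      have "\<delta> \<le> norm (y - x) * (1 / q - 1)" using \<delta>(3) False q
        by (intro order_trans[OF \<delta>(3)] mult_right_mono) auto
      then have "norm (y - x') \<le> norm (y - x) / q" using tri[of y] by (simp add: right_diff_distrib)
      then have "norm (y - x') ^ k \<le> (norm (y - x) / q) ^ k" by (intro power_mono) auto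
      then have "q ^ k * norm (y - x') ^ k \<le> norm (y - x) ^ k" using q
        by (simp add: power_divide field_simps)
      moreover have "c * norm (y - x') ^ k \<le> q ^ k * norm (y - x') ^ k" using qn[OF k(1)]
        by (intro mult_right_mono) auto
      ultimately have "c * norm (y - x') ^ k \<le> norm (y - x) ^ k" by linarith
      then have "c * (1 / norm (y - x) ^ k) \<le> 1 / norm (y - x') ^ k" using y yx
        by (simp add: field_simps)
      moreover have "c * v \<le> c * (1 / norm (y - x) ^ k)" using v(2)[OF yx(1)] c
        by (intro mult_left_mono) auto
      ultimately show ?thesis by linarith
    qed
    show "(\<lambda>y. c * \<phi> y) \<in> F_class \<mu> n x'"
      unfolding F_class_def
    proof (intro CollectI conjI allI impI)
      show "integrable \<mu> (\<lambda>y. c * \<phi> y)" using p(1) by simp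
      have "(\<integral>y. \<bar>c * \<phi> y\<bar> \<partial>\<mu>) = c * (\<integral>y. \<phi> y \<partial>\<mu>)" using c p(3) by (simp add: abs_mult)
      also have "\<dots> \<le> 1 * 1" using c p(2,3) by (intro mult_mono) auto
      finally show "(\<integral>y. \<bar>c * \<phi> y\<bar> \<partial>\<mu>) \<le> 1" by simp
      show "0 \<le> c * \<phi> y" for y using c p(3) by simp
      show "c * \<phi> y \<le> 1 / norm (y - x') ^ n" if "y \<noteq> x'" for y
        using that n_pos p(3,4) E by (intro key) auto
      show "\<exists>D. continuous_on UNIV D \<and> (\<forall>y. GDERIV (\<lambda>y. c * \<phi> y) y :> D y) \<and>
          (\<forall>y. y \<noteq> x' \<longrightarrow> norm (D y) \<le> 1 / norm (y - x') ^ (n + 1))"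
      proof (intro exI[of _ "\<lambda>y. c *\<^sub>R D y"] conjI allI impI)
        show "continuous_on UNIV (\<lambda>y. c *\<^sub>R D y)" using D(1) by (intro continuous_intros)
        show "GDERIV (\<lambda>y. c * \<phi> y) y :> c *\<^sub>R D y" for y
          using D(2)[of y] unfolding gderiv_def
          by (auto dest!: has_derivative_mult_right[of _ _ _ c])
        show "norm (c *\<^sub>R D y) \<le> 1 / norm (y - x') ^ (n + 1)" if "y \<noteq> x'" for y
          using key[of "n + 1" y "norm (D y)"] that D(3) E(3) c by simp
      qed
    qed
  qed
qed

text \<open>Lower semicontinuity: a competitor at \<open>x\<close>, slightly shrunk, still gives a
  value above \<open>t\<close> and competes at all nearby points. Measurability of the maximal
  function rests on this.\<close>

lemma maximal_open: "open {x. t < maximal_fun \<mu> n g x}"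
  unfolding open_contains_ball
proof
  fix x assume "x \<in> {x. t < maximal_fun \<mu> n g x}"
  then obtain \<phi> where \<phi>: "\<phi> \<in> F_class \<mu> n x"
      and t: "t < (if integrable \<mu> (\<lambda>y. g y * \<phi> y) then ennreal \<bar>\<integral>y. g y * \<phi> y \<partial>\<mu>\<bar> else \<infinity>)"
    unfolding maximal_fun_def mem_Collect_eq less_SUP_iff by blast
  have "\<exists>c>0. c < 1 \<and> (integrable \<mu> (\<lambda>y. g y * \<phi> y) \<longrightarrow> t < ennreal (c * \<bar>\<integral>y. g y * \<phi> y \<partial>\<mu>\<bar>))"
  proof (cases "integrable \<mu> (\<lambda>y. g y * \<phi> y)")
    case True
    let ?I = "\<bar>\<integral>y. g y * \<phi> y \<partial>\<mu>\<bar>"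
    have t': "t < ennreal ?I" using t True by simp
    then have "t \<noteq> \<infinity>" by auto
    then obtain s where s: "t = ennreal s" "0 \<le> s" by (cases t) auto
    have sI: "s < ?I" using t' s by (simp add: ennreal_less_iff)
    define c where "c = (s / ?I + 1) / 2"
    have "0 < c" "c < 1" using sI s by (auto simp: c_def divide_less_eq add_nonneg_pos)
    moreover have "s < c * ?I"
    proof -
      have "c * ?I = (s + ?I) / 2" using sI s by (simp add: c_def field_simps)
      then show ?thesis using sI by simp
    qed
    ultimately show ?thesis using s by (intro exI[of _ c]) (auto simp: ennreal_less_iff)
  qed (intro exI[of _ "1/2"], simp)
  then obtain c where c: "0 < c" "c < 1" "integrable \<mu> (\<lambda>y. g y * \<phi> y) \<Longrightarrow> t < ennreal (c * \<bar>\<integral>y. g y * \<phi> y \<partial>\<mu>\<bar>)"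
    by blast
  obtain \<delta> where \<delta>: "\<delta> > 0" "\<And>x'. dist x' x < \<delta> \<Longrightarrow> (\<lambda>y. c * \<phi> y) \<in> F_class \<mu> n x'"
    using F_class_shift[OF \<phi> c(1,2)] by blast
  have "t < maximal_fun \<mu> n g x'" if "dist x' x < \<delta>" for x'
  proof -
    let ?\<psi> = "\<lambda>y. c * \<phi> y"
    have e: "(\<lambda>y. g y * ?\<psi> y) = (\<lambda>y. c * (g y * \<phi> y))" by (simp add: mult.left_commute)
    have "t < (if integrable \<mu> (\<lambda>y. g y * ?\<psi> y) then ennreal \<bar>\<integral>y. g y * ?\<psi> y \<partial>\<mu>\<bar> else \<infinity>)"
      using c t unfolding e by (auto simp: abs_mult)
    then show ?thesis unfolding maximal_fun_def less_SUP_iff using \<delta>(2)[OF that] by (intro bexI[of _ ?\<psi>])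
  qed
  then show "\<exists>e>0. ball x e \<subseteq> {x. t < maximal_fun \<mu> n g x}"
    using \<delta>(1) by (intro exI[of _ \<delta>]) (auto simp: dist_commute)
qed

lemma maximal_measurable [measurable]: "maximal_fun \<mu> n g \<in> borel_measurable borel"
  by (rule borel_measurableI_greater) (use maximal_open in simp)

lemma maximal_le:
  assumes "integrable \<mu> g" "\<And>\<phi>. \<phi> \<in> F_class \<mu> n x \<Longrightarrow> \<bar>\<integral>y. g y * \<phi> y \<partial>\<mu>\<bar> \<le> X"
  shows "maximal_fun \<mu> n g x \<le> ennreal X"
  unfolding maximal_fun_def using assms F_class_integrable by (intro SUP_least) (auto intro: ennreal_leI)

lemma le_maximal:
  assumes "integrable \<mu> g" "\<phi> \<in> F_class \<mu> n x"
  shows "ennreal \<bar>\<integral>y. g y * \<phi> y \<partial>\<mu>\<bar> \<le> maximal_fun \<mu> n g x"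
  unfolding maximal_fun_def using F_class_integrable[OF assms(2,1)] assms(2)
    by (intro SUP_upper2[of \<phi>]) auto

lemma maximal_sum:
  assumes "finite J" "\<And>j. j \<in> J \<Longrightarrow> integrable \<mu> (b j)"
  shows "maximal_fun \<mu> n (\<lambda>x. \<Sum>j\<in>J. c j * b j x) x \<le> (\<Sum>j\<in>J. ennreal \<bar>c j\<bar> * maximal_fun \<mu> n (b j) x)"
  unfolding maximal_fun_def[of \<mu> n "\<lambda>x. \<Sum>j\<in>J. c j * b j x"]
proof (rule SUP_least)
  fix \<phi> assume \<phi>: "\<phi> \<in> F_class \<mu> n x"
  have i: "integrable \<mu> (\<lambda>y. c j * (b j y * \<phi> y))" if "j \<in> J" for j
    using F_class_integrable[OF \<phi> assms(2)[OF that]] by simp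
  have e: "(\<lambda>y. (\<Sum>j\<in>J. c j * b j y) * \<phi> y) = (\<lambda>y. \<Sum>j\<in>J. c j * (b j y * \<phi> y))"
    by (simp add: sum_distrib_right mult.assoc)
  have "integrable \<mu> (\<lambda>y. (\<Sum>j\<in>J. c j * b j y) * \<phi> y)" unfolding e using i
    by (rule Bochner_Integration.integrable_sum)
  moreover have "ennreal \<bar>\<integral>y. (\<Sum>j\<in>J. c j * b j y) * \<phi> y \<partial>\<mu>\<bar> \<le> (\<Sum>j\<in>J. ennreal \<bar>c j\<bar> * maximal_fun \<mu> n (b j) x)"
  proof -
    have "(\<integral>y. (\<Sum>j\<in>J. c j * b j y) * \<phi> y \<partial>\<mu>) = (\<Sum>j\<in>J. c j * (\<integral>y. b j y * \<phi> y \<partial>\<mu>))"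
      unfolding e using i by (subst Bochner_Integration.integral_sum) auto
    then have "\<bar>\<integral>y. (\<Sum>j\<in>J. c j * b j y) * \<phi> y \<partial>\<mu>\<bar> \<le> (\<Sum>j\<in>J. \<bar>c j\<bar> * \<bar>\<integral>y. b j y * \<phi> y \<partial>\<mu>\<bar>)"
      by (metis (no_types, lifting) abs_mult sum.cong sum_abs)
    then have "ennreal \<bar>\<integral>y. (\<Sum>j\<in>J. c j * b j y) * \<phi> y \<partial>\<mu>\<bar> \<le> ennreal (\<Sum>j\<in>J. \<bar>c j\<bar> * \<bar>\<integral>y. b j y * \<phi> y \<partial>\<mu>\<bar>)"
      by (rule ennreal_leI)
    also have "\<dots> = (\<Sum>j\<in>J. ennreal \<bar>c j\<bar> * ennreal \<bar>\<integral>y. b j y * \<phi> y \<partial>\<mu>\<bar>)"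
      by (simp add: ennreal_mult sum_ennreal[symmetric])
    also have "\<dots> \<le> (\<Sum>j\<in>J. ennreal \<bar>c j\<bar> * maximal_fun \<mu> n (b j) x)"
      using assms(2) by (intro sum_mono mult_left_mono le_maximal \<phi>) auto
    finally show ?thesis .
  qed
  ultimately show "(if integrable \<mu> (\<lambda>y. (\<Sum>j\<in>J. c j * b j y) * \<phi> y) then ennreal \<bar>\<integral>y. (\<Sum>j\<in>J. c j * b j y) * \<phi> y \<partial>\<mu>\<bar> else \<infinity>)
      \<le> (\<Sum>j\<in>J. ennreal \<bar>c j\<bar> * maximal_fun \<mu> n (b j) x)" by simp
qed

text \<open>An upper bound for the maximal function of the indicator of a cube.\<close>

fun cube_max :: "'a cube \<Rightarrow> 'a \<Rightarrow> real" where
  "cube_max (Cube y r) x = (if infnorm (x - y) \<le> 3 / 4 * r then 1 else 3 ^ n * mass y r / infnorm (x - y) ^ n)"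
| "cube_max Whole x = 1"

lemma cube_max_nonneg: "0 \<le> cube_max P x" by (cases P) (auto simp: infnorm_pos_le)

lemma infnorm_measurable [measurable]: "(\<lambda>x::'a. infnorm (x - y)) \<in> borel_measurable borel"
  by (intro borel_measurable_continuous_onI continuous_intros)

lemma cube_max_measurable [measurable]: "cube_max P \<in> borel_measurable borel"
proof (cases P)
  case (Cube y r)
  have "cube_max P = (\<lambda>x. if infnorm (x - y) \<le> 3 / 4 * r then 1 else 3 ^ n * mass y r / infnorm (x - y) ^ n)"
    using Cube by (auto simp: fun_eq_iff)
  then show ?thesis by simp
next
  case Whole
  then have "cube_max P = (\<lambda>x. 1)" by (auto simp: fun_eq_iff)
  then show ?thesis by simp
qed

text \<open>Explains the threshold 3/4: for points \<open>x\<close> beyond it the half side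
  \<open>r / 2\<close> is at most two thirds of the distance to the centre, so every point of the
  cube keeps at least one third of that distance from \<open>x\<close>.\<close>

lemma far_norm:
  fixes x y z :: 'a
  assumes "3 / 4 * r < infnorm (x - y)" "infnorm (z - y) \<le> r / 2" "0 < r"
  shows "infnorm (x - y) / 3 \<le> norm (z - x)" "0 < infnorm (x - y)" "z \<noteq> x"
proof -
  have "infnorm (x - y) \<le> infnorm (x - z) + infnorm (z - y)" using infnorm_triangle[of "x - z" "z - y"]
    by simp
  moreover have "infnorm (x - z) \<le> norm (z - x)" using infnorm_le_norm[of "z - x"] infnorm_sub[of x z]
    by simp
  ultimately show "infnorm (x - y) / 3 \<le> norm (z - x)" "0 < infnorm (x - y)" using assms by linarith+
  then show "z \<noteq> x" by auto
qed

text \<open>Near the cube the L1 normalisation of \<open>\<phi>\<close> gives the bound, far from it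
  the pointwise decay.\<close>

lemma F_class_cube:
  assumes \<phi>: "\<phi> \<in> F_class \<mu> n x" and P: "is_cube \<mu> P"
  shows "(\<integral>\<^sup>+z. ennreal (indicator (cube_set P) z * \<phi> z) \<partial>\<mu>) \<le> ennreal (cube_max P x)"
proof -
  note p = F_class_props[OF \<phi>]
  have 1: "(\<integral>\<^sup>+z. ennreal (indicator (cube_set P) z * \<phi> z) \<partial>\<mu>) \<le> ennreal 1"
  proof -
    have "(\<integral>\<^sup>+z. ennreal (indicator (cube_set P) z * \<phi> z) \<partial>\<mu>) \<le> (\<integral>\<^sup>+z. ennreal (\<phi> z) \<partial>\<mu>)"
      using p(3) by (intro nn_integral_mono ennreal_leI) (auto simp: indicator_def)
    then show ?thesis using p(8) by (auto intro: order_trans)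
  qed
  show ?thesis
  proof (cases P)
    case Whole then show ?thesis using 1 by simp
  next
    case (Cube y r)
    then have r: "r > 0" using P by simp
    show ?thesis
    proof (cases "infnorm (x - y) \<le> 3 / 4 * r")
      case True then show ?thesis using 1 Cube by simp
    next
      case False
      let ?k = "3 ^ n / infnorm (x - y) ^ n"
      have "(\<integral>\<^sup>+z. ennreal (indicator (cube_set P) z * \<phi> z) \<partial>\<mu>) \<le> (\<integral>\<^sup>+z. ennreal ?k * indicator (cube_set P) z \<partial>\<mu>)"
      proof (intro nn_integral_mono)
        fix z
        show "ennreal (indicator (cube_set P) z * \<phi> z) \<le> ennreal ?k * indicator (cube_set P) z"
        proof (cases "z \<in> cube_set P")
          case True
          then have "infnorm (z - y) \<le> r / 2" using Cube by (simp add: mem_cube_set)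
          note f = far_norm[OF _ this r, of x]
          have f': "infnorm (x - y) / 3 \<le> norm (z - x)" "0 < infnorm (x - y)" "z \<noteq> x" using f False
            by auto
          have "\<phi> z \<le> 1 / norm (z - x) ^ n" using p(4) f' by simp
          also have "\<dots> \<le> 1 / (infnorm (x - y) / 3) ^ n" using f'
            by (intro divide_left_mono power_mono) auto
          also have "\<dots> = ?k" by (simp add: power_divide)
          finally show ?thesis using True by (simp add: ennreal_leI)
        qed simp
      qed
      also have "\<dots> = ennreal ?k * ennreal (mass y r)"
        using Cube by (subst nn_integral_cmult_indicator) (auto simp: emeasure_mass)
      also have "\<dots> = ennreal (cube_max P x)" using Cube False infnorm_pos_le[of "x - y"]
        by (simp add: ennreal_mult[symmetric])
      finally show ?thesis .
    qed
  qed
qed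

section \<open>Pointwise bounds for the maximal function of a block\<close>

lemma simple_block_near:
  assumes sb: "simple_block D P R t b"
  shows "maximal_fun \<mu> n b x \<le> ennreal (t * (cube_max P x / mcube \<mu> (cube_scale 2 P) + cube_max R x / mcube \<mu> (cube_scale 2 R)))"
proof -
  let ?I = "\<lambda>P x. indicator (cube_set P) x / mcube \<mu> (cube_scale 2 P)"
  have t: "0 \<le> t" and P: "is_cube \<mu> P" "is_cube \<mu> R" and bi: "integrable \<mu> b"
    and bb: "AE x in \<mu>. \<bar>b x\<bar> \<le> t * (?I P x + ?I R x)" using sb by (auto simp: simple_block_def)
  show ?thesis
  proof (rule maximal_le[OF bi])
    fix \<phi> assume \<phi>: "\<phi> \<in> F_class \<mu> n x"
    note p = F_class_props[OF \<phi>]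
    have [measurable]: "\<phi> \<in> borel_measurable borel" by (rule p(6))
    show "\<bar>\<integral>y. b y * \<phi> y \<partial>\<mu>\<bar> \<le> t * (cube_max P x / mcube \<mu> (cube_scale 2 P) + cube_max R x / mcube \<mu> (cube_scale 2 R))"
    proof (rule abs_integral_le[OF F_class_integrable[OF \<phi> bi]])
      have "(\<integral>\<^sup>+y. ennreal \<bar>b y * \<phi> y\<bar> \<partial>\<mu>) \<le> (\<integral>\<^sup>+y. ennreal (t / mcube \<mu> (cube_scale 2 P)) * ennreal (indicator (cube_set P) y * \<phi> y) +
           ennreal (t / mcube \<mu> (cube_scale 2 R)) * ennreal (indicator (cube_set R) y * \<phi> y) \<partial>\<mu>)"
      proof (rule nn_integral_mono_AE)
        show "AE y in \<mu>. ennreal \<bar>b y * \<phi> y\<bar> \<le> ennreal (t / mcube \<mu> (cube_scale 2 P)) * ennreal (indicator (cube_set P) y * \<phi> y) +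
           ennreal (t / mcube \<mu> (cube_scale 2 R)) * ennreal (indicator (cube_set R) y * \<phi> y)"
          using bb
        proof eventually_elim
          case (elim y)
          have "\<bar>b y * \<phi> y\<bar> \<le> t * (?I P y + ?I R y) * \<phi> y"
            using elim p(3)[of y] by (simp add: abs_mult mult_right_mono)
          also have "\<dots> = t / mcube \<mu> (cube_scale 2 P) * (indicator (cube_set P) y * \<phi> y) + t / mcube \<mu> (cube_scale 2 R) * (indicator (cube_set R) y * \<phi> y)"
            by (simp add: distrib_left distrib_right)
          finally have "ennreal \<bar>b y * \<phi> y\<bar> \<le> ennreal (\<dots>)" by (rule ennreal_leI)
          also have "\<dots> = ennreal (t / mcube \<mu> (cube_scale 2 P) * (indicator (cube_set P) y * \<phi> y)) + ennreal (t / mcube \<mu> (cube_scale 2 R) * (indicator (cube_set R) y * \<phi> y))"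
            using t p(3)[of y] by (intro ennreal_plus) auto
          also have "\<dots> = ennreal (t / mcube \<mu> (cube_scale 2 P)) * ennreal (indicator (cube_set P) y * \<phi> y) +
             ennreal (t / mcube \<mu> (cube_scale 2 R)) * ennreal (indicator (cube_set R) y * \<phi> y)"
            using t p(3)[of y] by (intro arg_cong2[where f="(+)"] ennreal_mult) auto
          finally show ?case .
        qed
      qed
      also have "\<dots> = ennreal (t / mcube \<mu> (cube_scale 2 P)) * (\<integral>\<^sup>+y. ennreal (indicator (cube_set P) y * \<phi> y) \<partial>\<mu>) +
           ennreal (t / mcube \<mu> (cube_scale 2 R)) * (\<integral>\<^sup>+y. ennreal (indicator (cube_set R) y * \<phi> y) \<partial>\<mu>)"
        by (subst nn_integral_add, measurable, subst nn_integral_cmult, measurable, subst nn_integral_cmult, measurable)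
      also have "\<dots> \<le> ennreal (t / mcube \<mu> (cube_scale 2 P)) * ennreal (cube_max P x) + ennreal (t / mcube \<mu> (cube_scale 2 R)) * ennreal (cube_max R x)"
        by (intro add_mono mult_left_mono F_class_cube[OF \<phi>] P) auto
      also have "\<dots> = ennreal (t * (cube_max P x / mcube \<mu> (cube_scale 2 P) + cube_max R x / mcube \<mu> (cube_scale 2 R)))"
        using t cube_max_nonneg[of P x] cube_max_nonneg[of R x]
          by (simp add: ennreal_mult[symmetric] ennreal_plus[symmetric] distrib_left del: ennreal_plus)
      finally show "(\<integral>\<^sup>+y. ennreal \<bar>b y * \<phi> y\<bar> \<partial>\<mu>) \<le> ennreal (t * (cube_max P x / mcube \<mu> (cube_scale 2 P) + cube_max R x / mcube \<mu> (cube_scale 2 R)))" .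
    qed (use t cube_max_nonneg in auto)
  qed
qed

text \<open>Since \<open>b\<close> has integral 0, \<open>\<phi>\<close> may be replaced by
  \<open>\<phi> - \<phi> y\<close>, and the gradient bound gains a factor
  \<open>r / infnorm (x - y)\<close>. In the constant, \<open>3 ^ (n + 1)\<close> comes from
  \<open>far_norm\<close>, \<open>DIM('a)\<close> from comparing the two norms, and
  \<open>2 * t\<close> is the bound for the L1 norm of \<open>b\<close>.\<close>

lemma simple_block_far:
  fixes r t :: real
  assumes sb: "simple_block D P (Cube y r) t b" and x: "3 / 4 * r < infnorm (x - y)"
  shows "maximal_fun \<mu> n b x \<le> ennreal (2 * real DIM('a) * 3 ^ (n + 1) * t * r / infnorm (x - y) ^ (n + 1))"
proof -
  let ?R = "Cube y r"
  have t: "0 \<le> t" and R: "is_cube \<mu> ?R" "cube_set P \<subseteq> cube_set ?R" and bi: "integrable \<mu> b" "(\<integral>x. b x \<partial>\<mu>) = 0"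
    using sb by (auto simp: simple_block_def)
  have r: "r > 0" using R by simp
  have bm [measurable]: "b \<in> borel_measurable borel" using sb by (simp add: simple_block_def)
  have bz: "AE z in \<mu>. z \<notin> cube_set ?R \<longrightarrow> b z = 0"
  proof -
    have "AE z in \<mu>. \<bar>b z\<bar> \<le> t * (indicator (cube_set P) z / mcube \<mu> (cube_scale 2 P) + indicator (cube_set ?R) z / mcube \<mu> (cube_scale 2 ?R))"
      using sb by (simp add: simple_block_def)
    then show ?thesis
    proof eventually_elim
      case (elim z)
      then show ?case using R(2) by (cases "z \<in> cube_set P"; cases "z \<in> cube_set ?R") auto
    qed
  qed
  have pos: "0 < infnorm (x - y)" using x r by linarith
  let ?k = "real DIM('a) * 3 ^ (n + 1) * r / infnorm (x - y) ^ (n + 1)"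
  show ?thesis
  proof (rule maximal_le[OF bi(1)])
    fix \<phi> assume \<phi>: "\<phi> \<in> F_class \<mu> n x"
    note p = F_class_props[OF \<phi>]
    have [measurable]: "\<phi> \<in> borel_measurable borel" by (rule p(6))
    obtain D where D: "\<And>y. GDERIV \<phi> y :> D y" "\<And>y. y \<noteq> x \<Longrightarrow> norm (D y) \<le> 1 / norm (y - x) ^ (n + 1)"
      using \<phi> by (auto simp: F_class_def)
    have lip: "\<bar>\<phi> z - \<phi> y\<bar> \<le> ?k" if z: "z \<in> cube_set ?R" for z
    proof -
      let ?B = "3 ^ (n + 1) / infnorm (x - y) ^ (n + 1)"
      have "norm (\<phi> z - \<phi> y) \<le> ?B * norm (z - y)"
      proof (rule differentiable_bound[OF convex_cube[of ?R]])
        fix w assume w: "w \<in> cube_set ?R"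
        show "(\<phi> has_derivative (\<lambda>h. h \<bullet> D w)) (at w within cube_set ?R)"
          using D(1)[of w] unfolding gderiv_def by (rule has_derivative_at_withinI)
        have "infnorm (w - y) \<le> r / 2" using w by (simp add: mem_cube_set)
        note f = far_norm[OF x this r]
        have "norm (D w) \<le> 1 / norm (w - x) ^ (n + 1)" using D(2) f by simp
        also have "\<dots> \<le> 1 / (infnorm (x - y) / 3) ^ (n + 1)" using f
          by (intro divide_left_mono power_mono mult_pos_pos zero_less_power) auto
        also have "\<dots> = ?B" by (simp add: power_divide)
        finally have "norm (D w) \<le> ?B" .
        show "onorm (\<lambda>h. h \<bullet> D w) \<le> ?B"
        proof (rule onorm_le)
          fix h :: 'a
          have "norm (h \<bullet> D w) \<le> norm h * norm (D w)" by (simp add: Cauchy_Schwarz_ineq2)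
          also have "\<dots> \<le> norm h * ?B" using \<open>norm (D w) \<le> ?B\<close> by (intro mult_left_mono) auto
          finally show "norm (h \<bullet> D w) \<le> ?B * norm h" by (simp only: mult.commute)
        qed
      qed (use z r in \<open>auto intro: centre_in_cube\<close>)
      also have "\<dots> \<le> ?B * (DIM('a) * r)"
      proof (intro mult_left_mono)
        have "norm (z - y) \<le> sqrt DIM('a) * infnorm (z - y)" by (rule norm_le_infnorm)
        also have "\<dots> \<le> DIM('a) * r"
        proof (rule mult_mono)
          have "sqrt (real DIM('a)) \<le> sqrt (real DIM('a) * real DIM('a))"
            by (intro real_sqrt_le_mono) (simp add: Suc_leI)
          then show "sqrt (real DIM('a)) \<le> real DIM('a)" by simp
          show "infnorm (z - y) \<le> r" using z r by (simp add: mem_cube_set)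
        qed (use infnorm_pos_le in auto)
        finally show "norm (z - y) \<le> DIM('a) * r" .
      qed (use pos in auto)
      also have "\<dots> = ?k" by simp
      finally show ?thesis by simp
    qed
    have i: "integrable \<mu> (\<lambda>z. b z * \<phi> z)" by (rule F_class_integrable[OF \<phi> bi(1)])
    have e: "(\<integral>z. b z * \<phi> z \<partial>\<mu>) = (\<integral>z. b z * (\<phi> z - \<phi> y) \<partial>\<mu>)" using i bi
      by (simp add: right_diff_distrib)
    have "\<bar>\<integral>z. b z * (\<phi> z - \<phi> y) \<partial>\<mu>\<bar> \<le> ?k * (2 * t)"
    proof (rule abs_integral_le)
      show "integrable \<mu> (\<lambda>z. b z * (\<phi> z - \<phi> y))" using i bi by (simp add: right_diff_distrib)
      have k0: "0 \<le> ?k" using r pos by simp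
      have "(\<integral>\<^sup>+z. ennreal \<bar>b z * (\<phi> z - \<phi> y)\<bar> \<partial>\<mu>) \<le> (\<integral>\<^sup>+z. ennreal ?k * ennreal \<bar>b z\<bar> \<partial>\<mu>)"
      proof (rule nn_integral_mono_AE)
        show "AE z in \<mu>. ennreal \<bar>b z * (\<phi> z - \<phi> y)\<bar> \<le> ennreal ?k * ennreal \<bar>b z\<bar>"
          using bz
        proof eventually_elim
          case (elim z)
          show ?case
          proof (cases "z \<in> cube_set ?R")
            case True
            have "\<bar>b z * (\<phi> z - \<phi> y)\<bar> \<le> ?k * \<bar>b z\<bar>"
              unfolding abs_mult using mult_left_mono[OF lip[OF True], of "\<bar>b z\<bar>"]
                by (simp only: mult.commute[of ?k] abs_ge_zero simp_thms)
            then have "ennreal \<bar>b z * (\<phi> z - \<phi> y)\<bar> \<le> ennreal (?k * \<bar>b z\<bar>)" by (rule ennreal_leI)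
            then show ?thesis using k0 by (simp only: ennreal_mult abs_ge_zero)
          qed (use elim in auto)
        qed
      qed
      also have "\<dots> = ennreal ?k * (\<integral>\<^sup>+z. ennreal \<bar>b z\<bar> \<partial>\<mu>)" by (rule nn_integral_cmult) measurable
      also have "\<dots> \<le> ennreal ?k * ennreal (2 * t)" by (intro mult_left_mono simple_block_L1[OF sb]) auto
      also have "\<dots> = ennreal (?k * (2 * t))" using k0 t
        by (simp only: ennreal_mult mult_nonneg_nonneg zero_le_numeral)
      finally show "(\<integral>\<^sup>+z. ennreal \<bar>b z * (\<phi> z - \<phi> y)\<bar> \<partial>\<mu>) \<le> ennreal (?k * (2 * t))" .
      show "0 \<le> ?k * (2 * t)" using k0 t by (intro mult_nonneg_nonneg) auto
    qed
    then show "\<bar>\<integral>z. b z * \<phi> z \<partial>\<mu>\<bar> \<le> 2 * real DIM('a) * 3 ^ (n + 1) * t * r / infnorm (x - y) ^ (n + 1)"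
      unfolding e by (simp add: mult_ac)
  qed
qed

end

section \<open>Integrals over dyadic shells\<close>

lemma geometric_shell:
  fixes t u :: real
  assumes "u < t" "t \<le> 2 ^ J * u"
  obtains j where "j < J" "2 ^ j * u < t" "t \<le> 2 ^ Suc j * u"
proof -
  define k where "k = (LEAST k. t \<le> 2 ^ k * u)"
  have k: "t \<le> 2 ^ k * u" unfolding k_def using assms(2) by (rule LeastI)
  have kJ: "k \<le> J" unfolding k_def using assms(2) by (rule Least_le)
  have "k \<noteq> 0" using k assms(1) by (intro notI) simp
  then obtain j where j: "k = Suc j" by (cases k) auto
  have "\<not> t \<le> 2 ^ j * u" using not_less_Least[of j "\<lambda>k. t \<le> 2 ^ k * u"] j by (simp add: k_def)
  then show ?thesis using that[of j] k kJ j by simp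
qed

context growth_space
begin

text \<open>On the \<open>j\<close>-th shell \<open>cube_max\<close> is at most a multiple of
  \<open>mass x r\<close> divided by the \<open>n\<close>-th power of the scale, and the integral of
  \<open>|f - k|\<close> is at most \<open>A + D1\<close> times the mass of a comparable cube. The
  product is \<open>mass x r\<close> times a density, so the sum over the shells is governed by
  \<open>D2\<close>. The factor \<open>24 ^ n\<close> is \<open>3 ^ n\<close> from
  \<open>cube_max\<close> times \<open>8 ^ n\<close>, because \<open>6 * r\<close> is 8 times
  \<open>3/4 * r\<close>.\<close>

lemma near_shells:
  assumes f: "osc_family f c A" and x: "x \<in> msupport \<mu>" and r: "r > 0"
    and D1: "\<bar>c (Cube x (3/2 * r)) - k\<bar> \<le> D1" "\<And>j. j < J \<Longrightarrow> \<bar>c (Cube x (2 ^ j * (3 * r))) - k\<bar> \<le> D1"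
    and D2: "(\<Sum>j<J. dens x (2 ^ j * (6 * r))) \<le> D2"
  shows "(\<integral>\<^sup>+z. ennreal \<bar>f z - k\<bar> * ennreal (cube_max (Cube x r) z) * indicator {z. infnorm (z - x) \<le> 2 ^ J * (3/4 * r)} z \<partial>\<mu>)
    \<le> ennreal ((A + D1) * (1 + 24 ^ n * D2) * mass x (2 * r))"
proof -
  have A: "0 \<le> A" using f by (simp add: osc_family_def S_lipschitz_def)
  have [measurable]: "f \<in> borel_measurable borel" using osc_family_measurable[OF f]
    by (simp add: measurable_mu)
  have D10: "0 \<le> D1" using D1(1) by linarith
  let ?u = "3/4 * r"
  let ?k = "\<lambda>j. 3 ^ n * mass x r / (2 ^ j * ?u) ^ n"
  have k0: "0 \<le> ?k j" for j using r by simp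
  have pt: "ennreal \<bar>f z - k\<bar> * ennreal (cube_max (Cube x r) z) * indicator {z. infnorm (z - x) \<le> 2 ^ J * ?u} z
     \<le> ennreal \<bar>f z - k\<bar> * indicator (cube_set (Cube x (3/2 * r))) z +
        (\<Sum>j<J. ennreal (?k j) * (ennreal \<bar>f z - k\<bar> * indicator (cube_set (Cube x (2 ^ j * (3 * r)))) z))" for z
  proof (cases "infnorm (z - x) \<le> ?u")
    case True
    then have m: "z \<in> cube_set (Cube x (3/2 * r))" by (simp add: mem_cube_set)
    have "ennreal \<bar>f z - k\<bar> * ennreal (cube_max (Cube x r) z) * indicator {z. infnorm (z - x) \<le> 2 ^ J * ?u} z
        \<le> ennreal \<bar>f z - k\<bar> * indicator (cube_set (Cube x (3/2 * r))) z"
      using True m by (simp add: indicator_def)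
    then show ?thesis by (simp add: add_increasing2)
  next
    case False
    show ?thesis
    proof (cases "infnorm (z - x) \<le> 2 ^ J * ?u")
      case True
      obtain j where j: "j < J" "2 ^ j * ?u < infnorm (z - x)" "infnorm (z - x) \<le> 2 ^ Suc j * ?u"
        by (rule geometric_shell[OF _ True]) (use False in auto)
      have m: "z \<in> cube_set (Cube x (2 ^ j * (3 * r)))" using j(3)
        by (simp add: mem_cube_set algebra_simps)
      have p: "0 < 2 ^ j * ?u" using r by simp
      have "cube_max (Cube x r) z = 3 ^ n * mass x r / infnorm (z - x) ^ n" using False by simp
      also have "\<dots> \<le> ?k j" using j(2) p r order.strict_trans[OF p j(2)]
        by (intro divide_left_mono power_mono mult_pos_pos zero_less_power) auto
      finally have "ennreal (cube_max (Cube x r) z) \<le> ennreal (?k j)" by (rule ennreal_leI)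
      then have "ennreal \<bar>f z - k\<bar> * ennreal (cube_max (Cube x r) z) \<le> ennreal \<bar>f z - k\<bar> * ennreal (?k j)"
        by (intro mult_left_mono) auto
      also have "\<dots> = ennreal (?k j) * (ennreal \<bar>f z - k\<bar> * indicator (cube_set (Cube x (2 ^ j * (3 * r)))) z)"
        using m by (simp add: mult.commute)
      also have "\<dots> \<le> (\<Sum>j<J. ennreal (?k j) * (ennreal \<bar>f z - k\<bar> * indicator (cube_set (Cube x (2 ^ j * (3 * r)))) z))"
        using j(1) by (intro member_le_sum) auto
      finally show ?thesis using True by (simp add: add_increasing)
    qed simp
  qed
  have bd: "(\<integral>\<^sup>+z\<in>cube_set (Cube x s). ennreal \<bar>f z - k\<bar> \<partial>\<mu>) \<le> ennreal ((A + D1) * mass x s')"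
    if "s > 0" "\<bar>c (Cube x s) - k\<bar> \<le> D1" "4/3 * s \<le> s'" for s s'
    using osc_family_osc_cube[OF f x that] .
  have "(\<integral>\<^sup>+z. ennreal \<bar>f z - k\<bar> * ennreal (cube_max (Cube x r) z) * indicator {z. infnorm (z - x) \<le> 2 ^ J * ?u} z \<partial>\<mu>) \<le>
     (\<integral>\<^sup>+z. ennreal \<bar>f z - k\<bar> * indicator (cube_set (Cube x (3/2 * r))) z +
        (\<Sum>j<J. ennreal (?k j) * (ennreal \<bar>f z - k\<bar> * indicator (cube_set (Cube x (2 ^ j * (3 * r)))) z)) \<partial>\<mu>)"
    by (intro nn_integral_mono pt)
  also have "\<dots> = (\<integral>\<^sup>+z\<in>cube_set (Cube x (3/2 * r)). ennreal \<bar>f z - k\<bar> \<partial>\<mu>) +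
        (\<Sum>j<J. ennreal (?k j) * (\<integral>\<^sup>+z\<in>cube_set (Cube x (2 ^ j * (3 * r))). ennreal \<bar>f z - k\<bar> \<partial>\<mu>))"
    by (subst nn_integral_add, measurable, subst nn_integral_sum, measurable, subst nn_integral_cmult, measurable)
  also have "\<dots> \<le> ennreal ((A + D1) * mass x (2 * r)) + (\<Sum>j<J. ennreal (?k j) * ennreal ((A + D1) * mass x (2 ^ j * (6 * r))))"
    using r D1 by (intro add_mono sum_mono mult_left_mono bd) auto
  also have "\<dots> = ennreal ((A + D1) * mass x (2 * r) + (\<Sum>j<J. ?k j * ((A + D1) * mass x (2 ^ j * (6 * r)))))"
  proof -
    have nn: "0 \<le> ?k j * ((A + D1) * mass x (2 ^ j * (6 * r)))" for j
      by (intro mult_nonneg_nonneg k0) (use A D10 in auto)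
    have "(\<Sum>j<J. ennreal (?k j) * ennreal ((A + D1) * mass x (2 ^ j * (6 * r)))) = (\<Sum>j<J. ennreal (?k j * ((A + D1) * mass x (2 ^ j * (6 * r)))))"
      using k0 A D10 by (intro sum.cong refl ennreal_mult[symmetric]) auto
    also have "\<dots> = ennreal (\<Sum>j<J. ?k j * ((A + D1) * mass x (2 ^ j * (6 * r))))"
      by (intro sum_ennreal nn)
    moreover have "0 \<le> (A + D1) * mass x (2 * r)" using A D10 by simp
    ultimately show ?thesis by (simp only: ennreal_plus[OF _ sum_nonneg[OF nn]])
  qed
  also have "\<dots> \<le> ennreal ((A + D1) * (1 + 24 ^ n * D2) * mass x (2 * r))"
  proof (rule ennreal_leI)
    have e: "?k j * ((A + D1) * mass x (2 ^ j * (6 * r))) = (A + D1) * 24 ^ n * mass x r * dens x (2 ^ j * (6 * r))" for j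
    proof -
      have "(24::real) ^ n = 3 ^ n * 8 ^ n" by (simp add: power_mult_distrib[symmetric])
      moreover have "(2 ^ j * (6 * r)) ^ n = 8 ^ n * (2 ^ j * ?u) ^ n"
      proof -
        have "2 ^ j * (6 * r) = 8 * (2 ^ j * ?u)" by simp
        then show ?thesis by (simp only: power_mult_distrib)
      qed
      ultimately show ?thesis using r by (simp add: dens_def)
    qed
    have "(\<Sum>j<J. ?k j * ((A + D1) * mass x (2 ^ j * (6 * r)))) = (A + D1) * 24 ^ n * mass x r * (\<Sum>j<J. dens x (2 ^ j * (6 * r)))"
      unfolding e by (simp add: sum_distrib_left)
    also have "\<dots> \<le> (A + D1) * 24 ^ n * mass x (2 * r) * D2"
    proof (intro mult_mono mult_left_mono D2)
      show "mass x r \<le> mass x (2 * r)" using r by (intro mass_mono) auto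
      show "0 \<le> (\<Sum>j<J. dens x (2 ^ j * (6 * r)))" using r by (intro sum_nonneg dens_nonneg) auto
    qed (use A D10 in auto)
    finally show "(A + D1) * mass x (2 * r) + (\<Sum>j<J. ?k j * ((A + D1) * mass x (2 ^ j * (6 * r)))) \<le> (A + D1) * (1 + 24 ^ n * D2) * mass x (2 * r)"
      by (simp add: algebra_simps)
  qed
  finally show ?thesis .
qed

text \<open>The region where \<open>cube_max R\<close> equals 1; inside it size estimates are used,
  outside it the cancellation of the block.\<close>

fun wide :: "'a cube \<Rightarrow> 'a set" where
  "wide (Cube y r) = {z. infnorm (z - y) \<le> 3/4 * r}"
| "wide Whole = UNIV"

lemma wide_sets [measurable]: "wide R \<in> sets borel"
  by (cases R) auto

lemma nn_integral_exhaust: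
  fixes g :: "'a \<Rightarrow> ennreal"
  assumes [measurable]: "g \<in> borel_measurable borel" and r: "r > 0"
    and X: "\<And>J. (\<integral>\<^sup>+z. g z * indicator {z. infnorm (z - x) \<le> 2 ^ J * r} z \<partial>\<mu>) \<le> X"
  shows "(\<integral>\<^sup>+z. g z \<partial>\<mu>) \<le> X"
proof -
  let ?h = "\<lambda>J z. g z * indicator {z. infnorm (z - x) \<le> 2 ^ J * r} z"
  have inc: "incseq ?h"
  proof (intro incseq_SucI le_funI mult_left_mono)
    fix J z
    have "2 ^ J * r \<le> 2 ^ Suc J * r" using r by simp
    then show "indicator {z. infnorm (z - x) \<le> 2 ^ J * r} z \<le> (indicator {z. infnorm (z - x) \<le> 2 ^ Suc J * r} z :: ennreal)"
      by (cases "infnorm (z - x) \<le> 2 ^ J * r") (auto simp: indicator_def simp del: power_Suc)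
  qed simp
  have s: "(SUP J. ?h J z) = g z" for z
  proof (rule antisym)
    show "(SUP J. ?h J z) \<le> g z" by (intro SUP_least) (auto simp: indicator_def)
    obtain J where "infnorm (z - x) / r < 2 ^ J" using real_arch_pow[of 2 "infnorm (z - x) / r"] by auto
    then have "infnorm (z - x) \<le> 2 ^ J * r" using r by (simp add: field_simps)
    then show "g z \<le> (SUP J. ?h J z)" by (intro SUP_upper2[of J]) auto
  qed
  have "(\<integral>\<^sup>+z. g z \<partial>\<mu>) = (\<integral>\<^sup>+z. (SUP J. ?h J z) \<partial>\<mu>)" by (simp only: s)
  also have "\<dots> = (SUP J. (\<integral>\<^sup>+z. ?h J z \<partial>\<mu>))"
    by (rule nn_integral_monotone_convergence_SUP[OF inc]) measurable
  also have "\<dots> \<le> X" by (intro SUP_least X)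
  finally show ?thesis .
qed

text \<open>The constant of \<open>near_shells\<close>, with \<open>D1\<close> and \<open>D2\<close>
  expressed through a bound \<open>D\<close> for the coefficient of the pair.\<close>

definition "Bn A D = (A + A * (Kc * (2 + 2 ^ n * D + 6 * C)) + A * D) * (1 + 24 ^ n * (2 ^ n * (2 ^ n * D + 5 * C)))"

lemma dens_sum_shifted:
  assumes x: "x \<in> msupport \<mu>" and r: "r > 0"
  shows "(\<Sum>j<J. dens x (2 ^ j * (6 * r))) \<le> 2 ^ n * dens_sum x (level r) (level r + int J + 3)"
proof -
  have l: "level r \<le> level (3 * r)" "level (3 * r) \<le> level r + 2"
    using r level_mono[of r "3 * r"] level_mono[of "3 * r" "2 ^ 2 * r"] level_mult_power[of r 2] by auto
  have "(\<Sum>j<J. dens x (2 ^ j * (6 * r))) = (\<Sum>k=1..J. dens x (2 ^ k * (3 * r)))"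
  proof (rule sum.reindex_bij_witness[where i="\<lambda>k. k - 1" and j="\<lambda>j. j + 1"])
    fix j show "dens x (2 ^ (j + 1) * (3 * r)) = dens x (2 ^ j * (6 * r))" by (simp add: mult_ac)
  qed auto
  also have "\<dots> \<le> 2 ^ n * dens_sum x (level (3 * r)) (level (3 * r) + int J + 1)" using x r
    by (intro dens_sum_dens_sum) auto
  also have "\<dots> \<le> 2 ^ n * dens_sum x (level r) (level r + int J + 3)" using l
    by (intro mult_left_mono dens_sum_mono) auto
  finally show ?thesis .
qed

text \<open>This is where a bounded coefficient is essential. Between \<open>P\<close> and
  \<open>R\<close> it bounds both the drift of \<open>c\<close> and the sum of the densities, whose
  product would otherwise be quadratic in S.\<close>

lemma near_integral:
  assumes f: "osc_family f c A" and P: "is_cube \<mu> P" and R: "is_cube \<mu> R" and PR: "cube_set P \<subseteq> cube_set R"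
    and S: "S_coeff \<mu> n P R \<le> D"
  shows "(\<integral>\<^sup>+z. ennreal \<bar>f z - c R\<bar> * ennreal (cube_max P z) * indicator (wide R) z \<partial>\<mu>) \<le> ennreal (Bn A D * mcube \<mu> (cube_scale 2 P))"
proof -
  have A: "0 \<le> A" and c: "S_lipschitz c A" using f by (auto simp: osc_family_def S_lipschitz_def)
  have [measurable]: "f \<in> borel_measurable borel" using osc_family_measurable[OF f]
    by (simp add: measurable_mu)
  have D1: "1 \<le> D" using S_ge_1[OF P R] S by linarith
  let ?D1 = "A * (Kc * (2 + 2 ^ n * D + 6 * C)) + A * D" and ?D2 = "2 ^ n * (2 ^ n * D + 5 * C)"
  have Bn: "Bn A D = (A + ?D1) * (1 + 24 ^ n * ?D2)" by (simp add: Bn_def add.assoc)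
  have D0: "0 \<le> ?D1" "0 \<le> ?D2" using A Kc_pos C1 D1 by auto
  have cP: "\<bar>c P - c R\<bar> \<le> A * D"
  proof -
    have "\<bar>c P - c R\<bar> \<le> A * S_coeff \<mu> n P R" using c P R PR by (auto simp: S_lipschitz_def)
    also have "\<dots> \<le> A * D" using S A by (intro mult_left_mono) auto
    finally show ?thesis .
  qed
  show ?thesis
  proof (cases P)
    case Whole
    then have RW: "R = Whole" using PR Whole_subset[of R] by simp
    have "(\<integral>\<^sup>+z. ennreal \<bar>f z - c R\<bar> * ennreal (cube_max P z) * indicator (wide R) z \<partial>\<mu>) = (\<integral>\<^sup>+z\<in>cube_set P. ennreal \<bar>f z - c P\<bar> \<partial>\<mu>)"
      using Whole RW by simp
    also have "\<dots> \<le> ennreal (A * mcube \<mu> (cube_scale (4/3) P))" using f P by (simp add: osc_family_def)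
    also have "\<dots> \<le> ennreal (Bn A D * mcube \<mu> (cube_scale 2 P))"
    proof (intro ennreal_leI mult_mono)
      have "A * 1 \<le> (A + ?D1) * (1 + 24 ^ n * ?D2)" using A D0 by (intro mult_mono) auto
      then show "A \<le> Bn A D" "0 \<le> Bn A D" using A unfolding Bn by auto
    qed (use Whole in auto)
    finally show ?thesis .
  next
    case (Cube x r)
    then have x: "x \<in> msupport \<mu>" "r > 0" using P by auto
    show ?thesis
    proof (cases R)
      case Whole
      then have fin: "emeasure \<mu> UNIV < \<infinity>" using R by simp
      have sgD: "dens_sum x (level r) q \<le> 2 ^ n * D" for q
      proof -
        have "2 ^ n * S_coeff \<mu> n P R \<le> 2 ^ n * D" by (intro mult_left_mono S) simp
        then show ?thesis using dens_sum_le_S_Whole[OF x fin, of q] unfolding Cube Whole by linarith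
      qed
      have cc: "\<bar>c (Cube x s) - c R\<bar> \<le> ?D1" if "r \<le> s" for s
      proof -
        have "\<bar>c (Cube x r) - c (Cube x s)\<bar> \<le> A * (Kc * (1 + dens_sum x (level r) (level s)))"
          using x that by (intro S_lipschitz_compare c) (auto simp: infnorm_0)
        also have "\<dots> \<le> A * (Kc * (2 + 2 ^ n * D + 6 * C))" using sgD[of "level s"] A Kc_pos C1
          by (intro mult_left_mono) auto
        finally show ?thesis using cP unfolding Cube by linarith
      qed
      have "(\<integral>\<^sup>+z. ennreal \<bar>f z - c R\<bar> * ennreal (cube_max P z) \<partial>\<mu>) \<le> ennreal (Bn A D * mcube \<mu> (cube_scale 2 P))"
      proof (rule nn_integral_exhaust[where r="3/4 * r" and x=x])
        fix J
        have "(\<Sum>j<J. dens x (2 ^ j * (6 * r))) \<le> 2 ^ n * dens_sum x (level r) (level r + int J + 3)"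
          by (rule dens_sum_shifted[OF x])
        also have "\<dots> \<le> ?D2" using sgD[of "level r + int J + 3"] C1 by (intro mult_left_mono) auto
        finally have d2: "(\<Sum>j<J. dens x (2 ^ j * (6 * r))) \<le> ?D2" .
        have "r \<le> 2 ^ j * (3 * r)" for j
          using x mult_right_mono[of 1 "2 ^ j" "3 * r"] one_le_power[of "2::real" j] by linarith
        then show "(\<integral>\<^sup>+z. ennreal \<bar>f z - c R\<bar> * ennreal (cube_max P z) * indicator {z. infnorm (z - x) \<le> 2 ^ J * (3/4 * r)} z \<partial>\<mu>) \<le> ennreal (Bn A D * mcube \<mu> (cube_scale 2 P))"
          using near_shells[OF f x cc cc d2] x unfolding Bn Cube by (simp add: mass_def)
      qed (use x in auto)
      then show ?thesis using Whole by simp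
    next
      case R': (Cube y s)
      have s: "s > 0" "y \<in> msupport \<mu>" using R R' by auto
      have rs: "r \<le> s" "infnorm (x - y) \<le> s / 2" using cube_subset_side[of x r y s] PR Cube R' x by auto
      define N where "N = Nst r s"
      note N = Nst[OF x(2) rs(1), folded N_def]
      \<comment> \<open>One shell more than \<open>N\<close>: a point of \<open>wide R\<close> has
        distance at most \<open>3/4 * s + s / 2\<close> from \<open>x\<close>, hence at most
        \<open>3/2 * 2 ^ N * r\<close>, which is \<open>2 ^ (N + 1)\<close> times
        \<open>3/4 * r\<close>.\<close>
      define J where "J = N + 1"
      have sgD: "dens_sum x (level r) (level s) \<le> 2 ^ n * D"
      proof -
        have "2 ^ n * S_coeff \<mu> n P R \<le> 2 ^ n * D" by (intro mult_left_mono S) simp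
        then show ?thesis using dens_sum_le_S[OF x rs(1), of y] unfolding Cube R' by linarith
      qed
      have Nr: "2 ^ N * r \<le> 2 * s"
      proof (cases "N = 1")
        case False
        then have "\<not> s \<le> 2 ^ (N - 1) * r" using N(1) N(3)[of "N - 1"] by auto
        moreover have "(2::real) ^ N = 2 * 2 ^ (N - 1)" using N(1) by (cases N) auto
        ultimately show ?thesis by simp
      qed (use rs in simp)
      have l8: "level (8 * s) = level s + 3" using level_mult_power[of s 3] s by simp
      have cc: "\<bar>c (Cube x r') - c R\<bar> \<le> ?D1" if "r \<le> r'" "r' \<le> 8 * s" for r'
      proof -
        have "\<bar>c (Cube x r') - c (Cube y (8 * s))\<bar> \<le> A * (Kc * (1 + dens_sum x (level r') (level (8 * s))))"
          using x that s rs by (intro S_lipschitz_compare c) auto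
        also have "\<dots> \<le> A * (Kc * (1 + (2 ^ n * D + 3 * C)))"
        proof -
          have "dens_sum x (level r') (level (8 * s)) \<le> dens_sum x (level r) (level (8 * s))"
            using that x by (intro dens_sum_mono level_mono) auto
          also have "\<dots> \<le> 2 ^ n * D + 3 * C"
            using dens_sum_split[of x "level r" "level (8 * s)" "level s"] sgD dens_sum_bound[OF x(1), of "level s" "level (8 * s)"] l8
              by simp
          finally show ?thesis using A Kc_pos by (intro mult_left_mono add_left_mono) auto
        qed
        finally have 1: "\<bar>c (Cube x r') - c (Cube y (8 * s))\<bar> \<le> A * (Kc * (1 + (2 ^ n * D + 3 * C)))" .
        have 2: "\<bar>c (Cube y s) - c (Cube y (8 * s))\<bar> \<le> A * (Kc * (1 + C * 3))"
          using S_lipschitz_compare_levels[OF c s(2) s(2) s(1), of "8 * s"] s l8 by (simp add: infnorm_0)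
        have "A * (Kc * (1 + (2 ^ n * D + 3 * C))) + A * (Kc * (1 + C * 3)) = A * (Kc * (2 + 2 ^ n * D + 6 * C))"
          by (simp add: algebra_simps)
        moreover have "0 \<le> A * D" using A D1 by simp
        ultimately show ?thesis using 1 2 unfolding R' by linarith
      qed
      have "(\<Sum>j<J. dens x (2 ^ j * (6 * r))) \<le> 2 ^ n * dens_sum x (level r) (level r + int J + 3)"
        by (rule dens_sum_shifted[OF x])
      also have "\<dots> \<le> ?D2"
      proof (intro mult_left_mono)
        have "dens_sum x (level r) (level r + int J + 3) \<le> dens_sum x (level r) (level s + 5)" using N(4)
          by (intro dens_sum_mono) (auto simp: J_def)
        also have "\<dots> \<le> 2 ^ n * D + 5 * C"
          using dens_sum_split[of x "level r" "level s + 5" "level s"] sgD dens_sum_bound[OF x(1), of "level s" "level s + 5"]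
          by simp
        finally show "dens_sum x (level r) (level r + int J + 3) \<le> 2 ^ n * D + 5 * C" .
      qed simp
      finally have d2: "(\<Sum>j<J. dens x (2 ^ j * (6 * r))) \<le> ?D2" .
      have c1: "\<bar>c (Cube x (3/2 * r)) - c R\<bar> \<le> ?D1" using rs x by (intro cc) auto
      have c2: "\<bar>c (Cube x (2 ^ j * (3 * r))) - c R\<bar> \<le> ?D1" if "j < J" for j
      proof (rule cc)
        show "r \<le> 2 ^ j * (3 * r)"
          using x mult_right_mono[of 1 "2 ^ j" "3 * r"] one_le_power[of "2::real" j] by linarith
        have "2 ^ j * r \<le> 2 ^ N * r" using that x
          by (intro mult_right_mono power_increasing) (auto simp: J_def)
        then show "2 ^ j * (3 * r) \<le> 8 * s" using Nr s by linarith
      qed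
      have "(\<integral>\<^sup>+z. ennreal \<bar>f z - c R\<bar> * ennreal (cube_max P z) * indicator (wide R) z \<partial>\<mu>) \<le>
         (\<integral>\<^sup>+z. ennreal \<bar>f z - c R\<bar> * ennreal (cube_max P z) * indicator {z. infnorm (z - x) \<le> 2 ^ J * (3/4 * r)} z \<partial>\<mu>)"
      proof (intro nn_integral_mono mult_left_mono)
        fix z
        have "infnorm (z - x) \<le> 2 ^ J * (3/4 * r)" if "infnorm (z - y) \<le> 3/4 * s"
        proof -
          have "infnorm (z - x) \<le> 3/4 * s + s / 2"
            using infnorm_triangle[of "z - y" "y - x"] that rs(2) infnorm_sub[of x y] by simp
          also have "\<dots> \<le> 3/2 * s" using s by simp
          also have "\<dots> \<le> 3/2 * (2 ^ N * r)" using N(2) by simp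
          finally show ?thesis by (simp add: J_def algebra_simps)
        qed
        then show "indicator (wide R) z \<le> (indicator {z. infnorm (z - x) \<le> 2 ^ J * (3/4 * r)} z :: ennreal)"
          using R' by (auto simp: indicator_def)
      qed simp
      also have "\<dots> \<le> ennreal (Bn A D * mcube \<mu> (cube_scale 2 P))"
        using near_shells[OF f x c1 c2 d2] unfolding Bn Cube by (simp add: mass_def)
      finally show ?thesis .
    qed
  qed
qed

text \<open>The leading 4 is the sum of \<open>(j + 1) / 2 ^ j\<close> over all shells: the linear
  factor is the drift of \<open>c\<close>, the geometric one the gain from cancellation.\<close>

definition "Bf A = 4 * ((A + A * (Kc * (1 + 2 * C))) * C * 8 ^ n * (4 / 3))"

text \<open>Outside \<open>wide R\<close> the power \<open>n + 1\<close> exceeds the growth of the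
  measure by one, so each doubling of the distance gains a factor 2. The drift of \<open>c\<close>
  is at most linear in the number of doublings.\<close>

lemma far_integral:
  assumes f: "osc_family f c A" and y: "y \<in> msupport \<mu>" and s: "s > 0"
  shows "(\<integral>\<^sup>+z. ennreal \<bar>f z - c (Cube y s)\<bar> * ennreal (s / infnorm (z - y) ^ (n + 1)) * indicator (- wide (Cube y s)) z \<partial>\<mu>)
    \<le> ennreal (Bf A)"
proof (rule nn_integral_exhaust[where x=y and r="3/4 * s"])
  have A: "0 \<le> A" and c: "S_lipschitz c A" using f by (auto simp: osc_family_def S_lipschitz_def)
  have [measurable]: "f \<in> borel_measurable borel" using osc_family_measurable[OF f]
    by (simp add: measurable_mu)
  let ?g = "\<lambda>z. ennreal \<bar>f z - c (Cube y s)\<bar> * ennreal (s / infnorm (z - y) ^ (n + 1)) * indicator (- wide (Cube y s)) z"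
  show "?g \<in> borel_measurable borel" by measurable
  show "0 < 3/4 * s" using s by simp
  fix J :: nat
  let ?u = "3/4 * s" and ?k = "c (Cube y s)"
  let ?\<kappa> = "\<lambda>j. s / (2 ^ j * ?u) ^ (n + 1)"
  define Q where "Q = (A + A * (Kc * (1 + 2 * C))) * C * 8 ^ n * (4 / 3)"
  have Q0: "0 \<le> Q" using A Kc_pos C1 by (simp add: Q_def)
  have pt: "?g z * indicator {z. infnorm (z - y) \<le> 2 ^ J * ?u} z
     \<le> (\<Sum>j<J. ennreal (?\<kappa> j) * (ennreal \<bar>f z - ?k\<bar> * indicator (cube_set (Cube y (2 ^ j * (3 * s)))) z))" for z
  proof (cases "?u < infnorm (z - y) \<and> infnorm (z - y) \<le> 2 ^ J * ?u")
    case True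
    obtain j where j: "j < J" "2 ^ j * ?u < infnorm (z - y)" "infnorm (z - y) \<le> 2 ^ Suc j * ?u"
      by (rule geometric_shell[of ?u "infnorm (z - y)" J]) (use True in auto)
    have m: "z \<in> cube_set (Cube y (2 ^ j * (3 * s)))" using j(3)
      by (simp add: mem_cube_set algebra_simps)
    have p: "0 < 2 ^ j * ?u" using s by simp
    have "s / infnorm (z - y) ^ (n + 1) \<le> ?\<kappa> j" using j(2) p s order.strict_trans[OF p j(2)]
      by (intro divide_left_mono power_mono mult_pos_pos zero_less_power) auto
    then have "ennreal (s / infnorm (z - y) ^ (n + 1)) \<le> ennreal (?\<kappa> j)" by (rule ennreal_leI)
    then have "ennreal \<bar>f z - ?k\<bar> * ennreal (s / infnorm (z - y) ^ (n + 1)) \<le> ennreal \<bar>f z - ?k\<bar> * ennreal (?\<kappa> j)"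
      by (intro mult_left_mono) auto
    also have "\<dots> = ennreal (?\<kappa> j) * (ennreal \<bar>f z - ?k\<bar> * indicator (cube_set (Cube y (2 ^ j * (3 * s)))) z)"
      using m by (simp add: mult.commute)
    also have "\<dots> \<le> (\<Sum>j<J. ennreal (?\<kappa> j) * (ennreal \<bar>f z - ?k\<bar> * indicator (cube_set (Cube y (2 ^ j * (3 * s)))) z))"
      using j(1) by (intro member_le_sum) auto
    finally show ?thesis using True by (simp add: indicator_def)
  next
    case False
    then have "?g z * indicator {z. infnorm (z - y) \<le> 2 ^ J * ?u} z = 0" by (auto simp: indicator_def)
    then show ?thesis by (simp only: zero_le)
  qed
  have each: "ennreal (?\<kappa> j) * (\<integral>\<^sup>+z\<in>cube_set (Cube y (2 ^ j * (3 * s))). ennreal \<bar>f z - ?k\<bar> \<partial>\<mu>) \<le> ennreal (Q * ((real j + 1) * (1/2) ^ j))" for j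
  proof -
    have p: "0 < 2 ^ j * s" using s by simp
    have sj: "s \<le> 2 ^ j * (3 * s)"
      using s mult_right_mono[of 1 "2 ^ j" "3 * s"] one_le_power[of "2::real" j] by linarith
    have l: "level (2 ^ j * (3 * s)) - level s \<le> j + 2"
    proof -
      have "level (2 ^ j * (3 * s)) \<le> level (2 ^ (j + 2) * s)" using s by (intro level_mono) auto
      then show ?thesis using level_mult_power[OF s, of "j + 2"] by simp
    qed
    have "\<bar>?k - c (Cube y (2 ^ j * (3 * s)))\<bar> \<le> A * (Kc * (1 + C * (level (2 ^ j * (3 * s)) - level s)))"
      using y s sj by (intro S_lipschitz_compare_levels c) (auto simp: infnorm_0)
    also have "\<dots> \<le> A * (Kc * (1 + C * (real j + 2)))"
      using A Kc_pos C1 l by (intro mult_left_mono add_left_mono) linarith+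
    also have "\<dots> \<le> A * (Kc * ((1 + 2 * C) * (j + 1)))"
      using A Kc_pos C1 by (intro mult_left_mono) (auto simp: algebra_simps)
    finally have "\<bar>c (Cube y (2 ^ j * (3 * s))) - ?k\<bar> \<le> A * (Kc * ((1 + 2 * C) * (j + 1)))"
      by (simp add: abs_minus_commute)
    then have "(\<integral>\<^sup>+z\<in>cube_set (Cube y (2 ^ j * (3 * s))). ennreal \<bar>f z - ?k\<bar> \<partial>\<mu>) \<le>
      ennreal ((A + A * (Kc * ((1 + 2 * C) * (j + 1)))) * mass y (2 ^ j * (6 * s)))"
      using s by (intro osc_family_osc_cube[OF f y]) auto
    also have "\<dots> \<le> ennreal ((A + A * (Kc * (1 + 2 * C))) * (j + 1) * (C * (2 ^ j * (6 * s)) ^ n))"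
    proof (intro ennreal_leI mult_mono)
      show "A + A * (Kc * ((1 + 2 * C) * (j + 1))) \<le> (A + A * (Kc * (1 + 2 * C))) * (j + 1)"
        using A by (simp add: algebra_simps)
      show "mass y (2 ^ j * (6 * s)) \<le> C * (2 ^ j * (6 * s)) ^ n" using s by (intro mass_le y) auto
    qed (use A Kc_pos C1 in auto)
    finally have "ennreal (?\<kappa> j) * (\<integral>\<^sup>+z\<in>cube_set (Cube y (2 ^ j * (3 * s))). ennreal \<bar>f z - ?k\<bar> \<partial>\<mu>) \<le>
      ennreal (?\<kappa> j) * ennreal ((A + A * (Kc * (1 + 2 * C))) * (j + 1) * (C * (2 ^ j * (6 * s)) ^ n))"
      by (rule mult_left_mono) simp
    also have "\<dots> = ennreal (?\<kappa> j * ((A + A * (Kc * (1 + 2 * C))) * (j + 1) * (C * (2 ^ j * (6 * s)) ^ n)))"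
      using s A Kc_pos C1 by (intro ennreal_mult[symmetric]) auto
    also have "?\<kappa> j * ((A + A * (Kc * (1 + 2 * C))) * (j + 1) * (C * (2 ^ j * (6 * s)) ^ n)) = Q * ((j + 1) * (1/2) ^ j)"
    proof -
      have "(2 ^ j * (6 * s)) ^ n = 8 ^ n * (2 ^ j * ?u) ^ n"
      proof -
        have "2 ^ j * (6 * s) = 8 * (2 ^ j * ?u)" by simp
        then show ?thesis by (simp only: power_mult_distrib)
      qed
      then have h: "?\<kappa> j * (2 ^ j * (6 * s)) ^ n = 8 ^ n * (4/3) * (1/2) ^ j"
        using s by (simp add: power_one_over)
      let ?X = "A + A * (Kc * (1 + 2 * C))"
      have "?\<kappa> j * (?X * (j + 1) * (C * (2 ^ j * (6 * s)) ^ n)) = ?X * (j + 1) * C * (?\<kappa> j * (2 ^ j * (6 * s)) ^ n)"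
        by (simp only: mult_ac)
      also have "\<dots> = ?X * (j + 1) * C * (8 ^ n * (4/3) * (1/2) ^ j)" by (simp only: h)
      also have "\<dots> = Q * ((j + 1) * (1/2) ^ j)" unfolding Q_def by (simp only: mult_ac)
      finally show ?thesis .
    qed
    finally show ?thesis by (simp only: of_nat_add of_nat_1)
  qed
  have "(\<integral>\<^sup>+z. ?g z * indicator {z. infnorm (z - y) \<le> 2 ^ J * ?u} z \<partial>\<mu>) \<le>
      (\<integral>\<^sup>+z. (\<Sum>j<J. ennreal (?\<kappa> j) * (ennreal \<bar>f z - ?k\<bar> * indicator (cube_set (Cube y (2 ^ j * (3 * s)))) z)) \<partial>\<mu>)"
    by (intro nn_integral_mono pt)
  also have "\<dots> = (\<Sum>j<J. ennreal (?\<kappa> j) * (\<integral>\<^sup>+z\<in>cube_set (Cube y (2 ^ j * (3 * s))). ennreal \<bar>f z - ?k\<bar> \<partial>\<mu>))"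
    by (subst nn_integral_sum, measurable, subst nn_integral_cmult, measurable)
  also have "\<dots> \<le> (\<Sum>j<J. ennreal (Q * ((real j + 1) * (1/2) ^ j)))" by (intro sum_mono each)
  also have "\<dots> = ennreal (\<Sum>j<J. Q * ((real j + 1) * (1/2) ^ j))" using Q0 by (intro sum_ennreal) auto
  also have "\<dots> \<le> ennreal (Bf A)"
  proof (rule ennreal_leI)
    have "(\<Sum>j<J. (real j + 1) * (1/2) ^ j) = 4 - (2 * J + 4) * (1/2) ^ J"
    proof (induction J)
      case (Suc J)
      have "4 - (2 * real J + 4) * h + (real J + 1) * h = 4 - (2 * real (Suc J) + 4) * (1/2 * h)" for h :: real
        by (simp add: algebra_simps)
      then show ?case using Suc by simp
    qed simp
    also have "\<dots> \<le> 4" by simp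
    finally have "Q * (\<Sum>j<J. (real j + 1) * (1/2) ^ j) \<le> Q * 4" using Q0 by (intro mult_left_mono)
    moreover have "Bf A = Q * 4" unfolding Bf_def Q_def by (simp only: mult_ac)
    ultimately show "(\<Sum>j<J. Q * ((real j + 1) * (1/2) ^ j)) \<le> Bf A" by (simp only: sum_distrib_left)
  qed
  finally show "(\<integral>\<^sup>+z. ?g z * indicator {z. infnorm (z - y) \<le> 2 ^ J * ?u} z \<partial>\<mu>) \<le> ennreal (Bf A)" .
qed

lemma Bn_nonneg: "0 \<le> A \<Longrightarrow> 0 \<le> D \<Longrightarrow> 0 \<le> Bn A D"
  using Kc_pos C1 by (simp add: Bn_def)

lemma Bf_nonneg: "0 \<le> A \<Longrightarrow> 0 \<le> Bf A"
  using Kc_pos C1 by (simp add: Bf_def)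

definition "Bs A D = Bn A D + Bn A (1 + 2 ^ n * (2 * C)) + 2 * real DIM('a) * 3 ^ (n + 1) * Bf A"

text \<open>On \<open>wide R\<close> the maximal function is bounded through the two cubes of the
  block, and \<open>near_integral\<close> is applied to the pairs \<open>P\<close>, \<open>R\<close>
  and \<open>R\<close>, \<open>R\<close>; off \<open>wide R\<close> the decay from
  \<open>simple_block_far\<close> makes \<open>far_integral\<close> applicable.\<close>

lemma simple_block_osc:
  assumes f: "osc_family f c A" and sb: "simple_block D P R t b"
  shows "(\<integral>\<^sup>+z. ennreal \<bar>f z - c R\<bar> * maximal_fun \<mu> n b z \<partial>\<mu>) \<le> ennreal (Bs A D * t)"
proof -
  have A: "0 \<le> A" using f by (auto simp: osc_family_def S_lipschitz_def)
  have [measurable]: "f \<in> borel_measurable borel" using osc_family_measurable[OF f]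
    by (simp add: measurable_mu)
  have t: "0 \<le> t" and P: "is_cube \<mu> P" "is_cube \<mu> R" "cube_set P \<subseteq> cube_set R" and S: "S_coeff \<mu> n P R \<le> D"
    using sb by (auto simp: simple_block_def)
  have D0: "0 \<le> D" using S_ge_1[OF P(1,2)] S by linarith
  let ?F = "\<lambda>z. ennreal \<bar>f z - c R\<bar>" and ?m = "\<lambda>Q. mcube \<mu> (cube_scale 2 Q)" and ?D = "1 + 2 ^ n * (2 * C)"
  let ?B1 = "Bn A D" and ?B2 = "Bn A ?D" and ?B3 = "2 * real DIM('a) * 3 ^ (n + 1) * Bf A"
  have B: "0 \<le> ?B1" "0 \<le> ?B2" "0 \<le> ?B3" using A D0 C1 Bf_nonneg[OF A]
    by (auto intro!: Bn_nonneg mult_nonneg_nonneg)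
  have one: "ennreal (t / ?m Q) * (\<integral>\<^sup>+z. ?F z * ennreal (cube_max Q z) * indicator (wide R) z \<partial>\<mu>) \<le> ennreal (Bn A D' * t)"
    if Q: "is_cube \<mu> Q" "cube_set Q \<subseteq> cube_set R" "S_coeff \<mu> n Q R \<le> D'" for Q D'
  proof -
    have D': "0 \<le> D'" using S_ge_1[OF Q(1) P(2)] Q(3) by linarith
    have "ennreal (t / ?m Q) * (\<integral>\<^sup>+z. ?F z * ennreal (cube_max Q z) * indicator (wide R) z \<partial>\<mu>) \<le> ennreal (t / ?m Q) * ennreal (Bn A D' * ?m Q)"
      by (intro mult_left_mono near_integral[OF f Q(1) P(2) Q(2,3)]) auto
    also have "\<dots> = ennreal (t / ?m Q * (Bn A D' * ?m Q))" using t Bn_nonneg[OF A D']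
      by (intro ennreal_mult[symmetric]) auto
    also have "\<dots> \<le> ennreal (Bn A D' * t)" using t Bn_nonneg[OF A D']
      by (intro ennreal_leI) (cases "?m Q = 0", auto)
    finally show ?thesis .
  qed
  have near: "(\<integral>\<^sup>+z. ?F z * maximal_fun \<mu> n b z * indicator (wide R) z \<partial>\<mu>) \<le> ennreal (?B1 * t) + ennreal (?B2 * t)"
  proof -
    have "(\<integral>\<^sup>+z. ?F z * maximal_fun \<mu> n b z * indicator (wide R) z \<partial>\<mu>) \<le>
       (\<integral>\<^sup>+z. ennreal (t / ?m P) * (?F z * ennreal (cube_max P z) * indicator (wide R) z) + ennreal (t / ?m R) * (?F z * ennreal (cube_max R z) * indicator (wide R) z) \<partial>\<mu>)"
    proof (rule nn_integral_mono)
      fix z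
      have "t * (cube_max P z / ?m P + cube_max R z / ?m R) = t / ?m P * cube_max P z + t / ?m R * cube_max R z"
        by (simp add: distrib_left)
      then have "maximal_fun \<mu> n b z \<le> ennreal (t / ?m P) * ennreal (cube_max P z) + ennreal (t / ?m R) * ennreal (cube_max R z)"
        using simple_block_near[OF sb, of z] t cube_max_nonneg[of P z] cube_max_nonneg[of R z]
        by (simp add: ennreal_mult[symmetric] ennreal_plus[symmetric] del: ennreal_plus)
      then have "?F z * indicator (wide R) z * maximal_fun \<mu> n b z \<le> ?F z * indicator (wide R) z * (ennreal (t / ?m P) * ennreal (cube_max P z) + ennreal (t / ?m R) * ennreal (cube_max R z))"
        by (rule mult_left_mono) simp
      then show "?F z * maximal_fun \<mu> n b z * indicator (wide R) z \<le>
        ennreal (t / ?m P) * (?F z * ennreal (cube_max P z) * indicator (wide R) z) + ennreal (t / ?m R) * (?F z * ennreal (cube_max R z) * indicator (wide R) z)"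
        by (simp only: distrib_left mult_ac)
    qed
    also have "\<dots> = ennreal (t / ?m P) * (\<integral>\<^sup>+z. ?F z * ennreal (cube_max P z) * indicator (wide R) z \<partial>\<mu>) +
         ennreal (t / ?m R) * (\<integral>\<^sup>+z. ?F z * ennreal (cube_max R z) * indicator (wide R) z \<partial>\<mu>)"
      by (subst nn_integral_add, measurable, subst nn_integral_cmult, measurable, subst nn_integral_cmult, measurable)
    also have "\<dots> \<le> ennreal (?B1 * t) + ennreal (?B2 * t)"
      by (intro add_mono one P S S_self order_refl)
    finally show ?thesis .
  qed
  have far: "(\<integral>\<^sup>+z. ?F z * maximal_fun \<mu> n b z * indicator (- wide R) z \<partial>\<mu>) \<le> ennreal (?B3 * t)"
  proof (cases R)
    case Whole then show ?thesis by simp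
  next
    case (Cube y s)
    have y: "y \<in> msupport \<mu>" "s > 0" using P Cube by auto
    let ?k = "2 * real DIM('a) * 3 ^ (n + 1) * t"
    have k0: "0 \<le> ?k" using t by simp
    have "(\<integral>\<^sup>+z. ?F z * maximal_fun \<mu> n b z * indicator (- wide R) z \<partial>\<mu>) \<le>
       (\<integral>\<^sup>+z. ennreal ?k * (?F z * ennreal (s / infnorm (z - y) ^ (n + 1)) * indicator (- wide R) z) \<partial>\<mu>)"
    proof (rule nn_integral_mono)
      fix z
      show "?F z * maximal_fun \<mu> n b z * indicator (- wide R) z \<le> ennreal ?k * (?F z * ennreal (s / infnorm (z - y) ^ (n + 1)) * indicator (- wide R) z)"
      proof (cases "z \<in> wide R")
        case False
        then have "3/4 * s < infnorm (z - y)" using Cube by simp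
        then have "maximal_fun \<mu> n b z \<le> ennreal (?k * s / infnorm (z - y) ^ (n + 1))"
          using simple_block_far[OF sb[unfolded Cube]] by simp
        also have "\<dots> = ennreal (?k * (s / infnorm (z - y) ^ (n + 1)))" by simp
        also have "\<dots> = ennreal ?k * ennreal (s / infnorm (z - y) ^ (n + 1))"
          using k0 y infnorm_pos_le[of "z - y"] by (intro ennreal_mult) auto
        finally have "?F z * maximal_fun \<mu> n b z \<le> ?F z * (ennreal ?k * ennreal (s / infnorm (z - y) ^ (n + 1)))"
          by (rule mult_left_mono) simp
        then show ?thesis using False by (simp add: mult_ac)
      qed simp
    qed
    also have "\<dots> = ennreal ?k * (\<integral>\<^sup>+z. ?F z * ennreal (s / infnorm (z - y) ^ (n + 1)) * indicator (- wide R) z \<partial>\<mu>)"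
      by (rule nn_integral_cmult) measurable
    also have "\<dots> \<le> ennreal ?k * ennreal (Bf A)"
      using far_integral[OF f y] unfolding Cube by (intro mult_left_mono) auto
    also have "\<dots> = ennreal (?k * Bf A)" using k0 Bf_nonneg[OF A] by (intro ennreal_mult[symmetric]) auto
    finally show ?thesis by (simp add: mult_ac)
  qed
  have "(\<integral>\<^sup>+z. ?F z * maximal_fun \<mu> n b z \<partial>\<mu>) = (\<integral>\<^sup>+z. ?F z * maximal_fun \<mu> n b z * indicator (wide R) z + ?F z * maximal_fun \<mu> n b z * indicator (- wide R) z \<partial>\<mu>)"
    by (intro nn_integral_cong) (auto simp: indicator_def)
  also have "\<dots> = (\<integral>\<^sup>+z. ?F z * maximal_fun \<mu> n b z * indicator (wide R) z \<partial>\<mu>) + (\<integral>\<^sup>+z. ?F z * maximal_fun \<mu> n b z * indicator (- wide R) z \<partial>\<mu>)"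
    by (rule nn_integral_add) measurable
  also have "\<dots> \<le> (ennreal (?B1 * t) + ennreal (?B2 * t)) + ennreal (?B3 * t)"
    by (intro add_mono near far)
  also have "\<dots> = ennreal (Bs A D * t)"
    using B t unfolding Bs_def distrib_right by (subst ennreal_plus, simp, simp, subst ennreal_plus) auto
  finally show ?thesis .
qed

text \<open>The choice \<open>f = 0\<close>, \<open>c = 1\<close> turns the oscillation estimate into an \<open>L\<^sup>1\<close> estimate.\<close>

lemma simple_block_maximal_L1:
  assumes sb: "simple_block D P R t b"
  shows "(\<integral>\<^sup>+z. maximal_fun \<mu> n b z \<partial>\<mu>) \<le> ennreal (Bs 1 D * t)"
proof -
  have "osc_family (\<lambda>_. 0) (\<lambda>_. 1) 1"
    unfolding osc_family_def
  proof (intro conjI allI impI)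
    show "(\<lambda>_. 0) \<in> L1loc \<mu>" by (intro integrable_L1loc) simp
    show "S_lipschitz (\<lambda>_. 1) 1" unfolding S_lipschitz_def using S_ge_1
      by (auto intro: order_trans[of 0 1])
    fix Q assume Q: "is_cube \<mu> Q"
    have "mcube \<mu> Q \<le> mcube \<mu> (cube_scale (4/3) Q)" using Q
      by (intro mcube_mono is_cube_scale cube_sub_scale) auto
    then show "(\<integral>\<^sup>+x\<in>cube_set Q. ennreal \<bar>0 - 1\<bar> \<partial>\<mu>) \<le> ennreal (1 * mcube \<mu> (cube_scale (4/3) Q))"
      by (simp add: emeasure_cube[OF Q] ennreal_leI)
  qed
  from simple_block_osc[OF this sb] show ?thesis by simp
qed

end

section \<open>Covering and differentiation\<close>

text \<open>The covering lemma for Euclidean balls is applied with radius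
  \<open>DIM('a) * l x / 2\<close>: this ball contains the cube of side \<open>l x\<close>, and its
  fivefold dilate lies in the cube of side \<open>5 * DIM('a) * l x\<close>. Indexing by numbers
  turns sums over the family into series.\<close>

lemma vitali_cubes:
  fixes A :: "'a::euclidean_space set"
  assumes l: "\<And>x. x \<in> A \<Longrightarrow> 0 < l x \<and> l x \<le> B"
  obtains I :: "nat set" and z where "\<And>i. i \<in> I \<Longrightarrow> z i \<in> A"
    "disjoint_family_on (\<lambda>i. cube_set (Cube (z i) (l (z i)))) I"
    "A \<subseteq> (\<Union>i\<in>I. cube_set (Cube (z i) (5 * real DIM('a) * l (z i))))"
proof -
  let ?d = "real DIM('a)"
  have d: "1 \<le> ?d" by (simp add: Suc_leI)
  let ?r = "\<lambda>x. ?d * l x / 2"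
  have r: "0 < ?r x \<and> ?r x \<le> ?d * B / 2" if "x \<in> A" for x using l[OF that] d
    by (simp add: mult_left_mono)
  have cov: "A \<subseteq> (\<Union>x\<in>A. cball x (?r x))" using r by (fastforce simp: less_imp_le)
  obtain F where F: "countable F" "F \<subseteq> A"
     "pairwise (\<lambda>i j. disjnt (cball i (?r i)) (cball j (?r j))) F" "A \<subseteq> (\<Union>i\<in>F. cball i (5 * ?r i))"
    by (rule Vitali_covering_lemma_cballs[of A "\<lambda>x. x" ?r A "?d * B / 2"]) (use cov r in auto)
  let ?I = "to_nat_on F ` F" and ?z = "from_nat_into F"
  have z: "?z i \<in> F" if "i \<in> ?I" for i using that F(1) by auto
  have inj: "i = j" if "i \<in> ?I" "j \<in> ?I" "?z i = ?z j" for i j using that F(1) by auto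
  have cb: "cube_set (Cube x (l x)) \<subseteq> cball x (?r x)" if x: "x \<in> A" for x
  proof
    fix y assume "y \<in> cube_set (Cube x (l x))"
    then have "infnorm (y - x) \<le> l x / 2" by (simp add: mem_cube_set)
    moreover have "sqrt ?d \<le> ?d" using d real_sqrt_le_mono[of ?d "?d * ?d"] mult_left_mono[OF d, of ?d]
      by simp
    ultimately have "sqrt ?d * infnorm (y - x) \<le> ?d * (l x / 2)" using d infnorm_pos_le
      by (intro mult_mono) auto
    then show "y \<in> cball x (?r x)" using norm_le_infnorm[of "y - x"]
      by (simp add: dist_norm norm_minus_commute)
  qed
  have bc: "cball x (5 * ?r x) \<subseteq> cube_set (Cube x (5 * ?d * l x))" for x
  proof
    fix y assume "y \<in> cball x (5 * ?r x)"
    then have "norm (y - x) \<le> 5 * ?r x" by (simp add: dist_norm norm_minus_commute)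
    then have "infnorm (y - x) \<le> 5 * ?r x" using infnorm_le_norm[of "y - x"] by linarith
    then show "y \<in> cube_set (Cube x (5 * ?d * l x))" by (simp add: mem_cube_set)
  qed
  show ?thesis
  proof (rule that[of ?I ?z])
    show "?z i \<in> A" if "i \<in> ?I" for i using z[OF that] F(2) by blast
    show "disjoint_family_on (\<lambda>i. cube_set (Cube (?z i) (l (?z i)))) ?I"
      unfolding disjoint_family_on_def
    proof (intro ballI impI)
      fix i j assume ij: "i \<in> ?I" "j \<in> ?I" "i \<noteq> j"
      then have "disjnt (cball (?z i) (?r (?z i))) (cball (?z j) (?r (?z j)))"
        using F(3) z inj unfolding pairwise_def by blast
      then show "cube_set (Cube (?z i) (l (?z i))) \<inter> cube_set (Cube (?z j) (l (?z j))) = {}"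
        using cb[of "?z i"] cb[of "?z j"] z ij F(2) unfolding disjnt_def by blast
    qed
    show "A \<subseteq> (\<Union>i\<in>?I. cube_set (Cube (?z i) (5 * ?d * l (?z i))))"
    proof
      fix y assume "y \<in> A"
      then obtain x where x: "x \<in> F" "y \<in> cball x (5 * ?r x)" using F(4) by blast
      have "?z (to_nat_on F x) = x" using x(1) F(1) by simp
      then show "y \<in> (\<Union>i\<in>?I. cube_set (Cube (?z i) (5 * ?d * l (?z i))))" using x(1) subsetD[OF bc x(2)]
        by (intro UN_I[of "to_nat_on F x"]) auto
    qed
  qed
qed

lemma null_cover:
  assumes "\<And>e. e > 0 \<Longrightarrow> \<exists>U\<in>sets M. Z \<subseteq> U \<and> emeasure M U \<le> ennreal e"
  shows "\<exists>N\<in>null_sets M. Z \<subseteq> N"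
proof -
  have "\<forall>i::nat. \<exists>U\<in>sets M. Z \<subseteq> U \<and> emeasure M U \<le> ennreal (1 / Suc i)" using assms by simp
  then obtain U where U: "\<And>i::nat. U i \<in> sets M" "\<And>i. Z \<subseteq> U i" "\<And>i. emeasure M (U i) \<le> ennreal (1 / Suc i)"
    by metis
  have m: "(\<Inter>i. U i) \<in> sets M" using U(1) by (intro sets.countable_INT) auto
  have le: "emeasure M (\<Inter>i. U i) \<le> ennreal e" if e: "e > 0" for e
  proof -
    obtain i where i: "1 / real (Suc i) < e" using e nat_approx_posE by metis
    have "emeasure M (\<Inter>i. U i) \<le> emeasure M (U i)" using U(1) by (intro emeasure_mono) auto
    also have "\<dots> \<le> ennreal e" using U(3)[of i] i by (meson ennreal_leI less_imp_le order_trans)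
    finally show ?thesis .
  qed
  have "emeasure M (\<Inter>i. U i) \<le> 0"
  proof (rule ennreal_le_epsilon)
    fix e :: real assume "0 < e"
    then show "emeasure M (\<Inter>i. U i) \<le> 0 + ennreal e" using le by simp
  qed
  then show ?thesis using m U(2) by (intro bexI[of _ "\<Inter>i. U i"]) auto
qed

context growth_space
begin

text \<open>Dilation by \<open>2 ^ Mg\<close> absorbs the enlargement in the covering lemma. As \<open>bg\<close> exceeds
  \<open>2 ^ (Mg * DIM('a))\<close>, a cube with bad scales only would have too little mass, which gives \<open>AE_good\<close>;
  as it is at least \<open>2 * (2 ^ Mg) ^ n\<close>, densities double along bad scales.\<close>

definition "Mg = 4 + DIM('a)"
definition "bg = (2::real) ^ (Mg * DIM('a) + 1)"
definition "good x l \<longleftrightarrow> mass x (2 ^ Mg * l) \<le> bg * mass x l"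

lemma Mg: "10 * real DIM('a) \<le> 2 ^ Mg"
proof -
  have "real DIM('a) < 2 ^ DIM('a)" by (rule of_nat_less_two_power)
  moreover have "(2::real) ^ Mg = 16 * 2 ^ DIM('a)" by (simp add: Mg_def power_add)
  ultimately show ?thesis by linarith
qed

lemma bg: "1 \<le> bg" "2 * (2 ^ Mg) ^ n \<le> bg"
proof -
  show "1 \<le> bg" unfolding bg_def by (rule one_le_power) simp
  have "(2::real) ^ (Mg * n + 1) \<le> 2 ^ (Mg * DIM('a) + 1)" using n_le by (intro power_increasing) auto
  then show "2 * (2 ^ Mg) ^ n \<le> bg" by (simp add: bg_def power_mult)
qed

lemma not_good:
  assumes "l > 0" "\<not> good x l" shows "2 * dens x l \<le> dens x (2 ^ Mg * l)"
proof -
  have "2 * (2 ^ Mg) ^ n * mass x l \<le> bg * mass x l" by (intro mult_right_mono bg) simp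
  also have "\<dots> \<le> mass x (2 ^ Mg * l)" using assms by (simp add: good_def)
  finally show ?thesis using assms by (simp add: dens_def field_simps power_mult_distrib)
qed

lemma good_scales:
  assumes l: "l > 0" "good x l"
  shows "mass x (5 * real DIM('a) * l) \<le> bg * mass x l" "mass x (2 * (5 * real DIM('a) * l)) \<le> bg * mass x l" "mass x (4/3 * l) \<le> bg * mass x l"
proof -
  have d: "1 \<le> real DIM('a)" by (simp add: Suc_leI)
  have m: "10 * real DIM('a) * l \<le> 2 ^ Mg * l" using Mg l by (intro mult_right_mono) auto
  have "1 * l \<le> real DIM('a) * l" using d l by (intro mult_right_mono) auto
  then have le: "5 * real DIM('a) * l \<le> 2 ^ Mg * l" "2 * (5 * real DIM('a) * l) \<le> 2 ^ Mg * l" "4/3 * l \<le> 2 ^ Mg * l"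
    using m l by linarith+
  have "mass x s \<le> bg * mass x l" if "s \<le> 2 ^ Mg * l" for s
    using mass_mono[OF that, of x] l(2) unfolding good_def by linarith
  then show "mass x (5 * real DIM('a) * l) \<le> bg * mass x l" "mass x (2 * (5 * real DIM('a) * l)) \<le> bg * mass x l" "mass x (4/3 * l) \<le> bg * mass x l"
    using le by blast+
qed

text \<open>If all scales from \<open>L\<close> downwards are bad, the bound for the mass drops by
  the factor \<open>bg\<close> whenever the side drops by \<open>2 ^ Mg\<close>. A bounded set is
  covered by a multiple of \<open>2 ^ (Mg * i * DIM('a))\<close> cubes of side at most
  \<open>L / 2 ^ (Mg * i)\<close>, and \<open>bg\<close> is twice \<open>2 ^ (Mg * DIM('a))\<close>,
  so the exceptional set has measure at most a multiple of \<open>1 / 2 ^ i\<close>.\<close>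

lemma AE_good:
  assumes r: "r > 0"
  shows "AE x in \<mu>. \<forall>N. \<exists>k\<ge>N. good x (r / 2 ^ k)"
proof -
  have "AE x in \<mu>. \<exists>k\<ge>N. good x (r / 2 ^ k)" for N :: nat
  proof -
    define Z where "Z s = {x \<in> msupport \<mu> \<inter> cube_set (Cube 0 s). \<forall>k\<ge>N. \<not> good x (r / 2 ^ k)}" for s
    have "\<exists>W\<in>null_sets \<mu>. Z s \<subseteq> W" if s: "s > 0" for s
    proof (rule null_cover)
      fix e :: real assume e: "e > 0"
      define L where "L = r / 2 ^ N"
      have L: "L > 0" using r by (simp add: L_def)
      have dec: "mass x (L / 2 ^ (Mg * i)) \<le> C * L ^ n / bg ^ i" if x: "x \<in> Z s" for x i
      proof (induction i)
        case 0
        then show ?case using mass_le[of x L] x L by (simp add: Z_def)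
      next
        case (Suc i)
        have "\<not> good x (r / 2 ^ (N + Mg * Suc i))" using x by (simp add: Z_def)
        moreover have "r / 2 ^ (N + Mg * Suc i) = L / 2 ^ (Mg * Suc i)" by (simp add: L_def power_add)
        moreover have "2 ^ Mg * (L / 2 ^ (Mg * Suc i)) = L / 2 ^ (Mg * i)" by (simp add: power_add)
        ultimately have "bg * mass x (L / 2 ^ (Mg * Suc i)) \<le> mass x (L / 2 ^ (Mg * i))"
          unfolding good_def by (metis not_le less_imp_le)
        then have "mass x (L / 2 ^ (Mg * Suc i)) \<le> mass x (L / 2 ^ (Mg * i)) / bg" using bg(1)
          by (simp add: field_simps)
        also have "\<dots> \<le> (C * L ^ n / bg ^ i) / bg" using Suc bg(1) by (intro divide_right_mono) auto
        finally show ?case by (simp add: mult.commute)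
      qed
      obtain M0 :: nat where M0: "s / L < M0" using reals_Archimedean2 by blast
      then have M0p: "M0 > 0" using s L by (metis divide_pos_pos less_trans of_nat_0_less_iff)
      define K where "K = (3 * real M0) ^ DIM('a) * (C * L ^ n)"
      obtain i :: nat where i: "K / e < 2 ^ i" using real_arch_pow[of 2 "K / e"] by auto
      define M where "M = 2 ^ (Mg * i) * M0"
      have M: "M > 0" using M0p by (simp add: M_def)
      obtain F where F: "finite F" "F \<subseteq> Z s" "card F \<le> (2 * M + 1) ^ DIM('a)" "Z s \<subseteq> (\<Union>y\<in>F. cube_set (Cube y (s / M)))"
        by (rule grid_cover[of "Z s" 0 s M]) (use s M in \<open>auto simp: Z_def\<close>)
      have sM: "s / M \<le> L / 2 ^ (Mg * i)"
      proof -
        have "s \<le> L * M0" using M0 L by (simp add: field_simps)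
        then show ?thesis using M0p by (simp add: M_def field_simps)
      qed
      have "emeasure \<mu> (\<Union>y\<in>F. cube_set (Cube y (s / M))) \<le> (\<Sum>y\<in>F. emeasure \<mu> (cube_set (Cube y (s / M))))"
        using F(1) by (intro emeasure_subadditive_finite) auto
      also have "\<dots> \<le> (\<Sum>y\<in>F. ennreal (C * L ^ n / bg ^ i))"
      proof (intro sum_mono)
        fix y assume "y \<in> F"
        then have "mass y (L / 2 ^ (Mg * i)) \<le> C * L ^ n / bg ^ i" using dec F(2) by blast
        then have "mass y (s / M) \<le> C * L ^ n / bg ^ i" using mass_mono[OF sM, of y] by linarith
        then show "emeasure \<mu> (cube_set (Cube y (s / M))) \<le> ennreal (C * L ^ n / bg ^ i)"
          by (simp add: emeasure_mass ennreal_leI)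
      qed
      also have "\<dots> = ennreal (card F * (C * L ^ n / bg ^ i))"
        using C1 L bg(1) by (subst ennreal_mult) (auto simp: ennreal_of_nat_eq_real_of_nat)
      also have "\<dots> \<le> ennreal e"
      proof (rule ennreal_leI)
        have "real (card F) \<le> real ((2 * M + 1) ^ DIM('a))" using F(3) by (simp only: of_nat_le_iff)
        also have "\<dots> \<le> (3 * real M) ^ DIM('a)" unfolding of_nat_power using M by (intro power_mono) auto
        finally have c: "real (card F) \<le> (3 * real M) ^ DIM('a)" .
        have "card F * (C * L ^ n / bg ^ i) \<le> (3 * real M) ^ DIM('a) * (C * L ^ n / bg ^ i)"
          using c C1 L bg(1) by (intro mult_right_mono) auto
        also have "(3 * real M) ^ DIM('a) = (3 * real M0) ^ DIM('a) * (2 ^ (Mg * i)) ^ DIM('a)"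
          by (simp add: M_def power_mult_distrib)
        also have "\<dots> * (C * L ^ n / bg ^ i) = K * ((2 ^ (Mg * i)) ^ DIM('a) / bg ^ i)"
          by (simp add: K_def)
        also have "(2 ^ (Mg * i)) ^ DIM('a) / bg ^ i = 1 / (2::real) ^ i"
        proof -
          have "bg ^ i = (2 ^ (Mg * i)) ^ DIM('a) * 2 ^ i"
            by (simp add: bg_def power_mult_distrib power_mult[symmetric] mult_ac)
          then show ?thesis by simp
        qed
        also have "K * (1 / 2 ^ i) \<le> e" using i e by (simp add: field_simps)
        finally show "card F * (C * L ^ n / bg ^ i) \<le> e" .
      qed
      finally show "\<exists>U\<in>sets \<mu>. Z s \<subseteq> U \<and> emeasure \<mu> U \<le> ennreal e"
        using F(1,4)
          by (intro bexI[of _ "\<Union>y\<in>F. cube_set (Cube y (s / M))"]) (auto intro!: sets.finite_UN)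
    qed
    then have "AE x in \<mu>. x \<notin> Z (real (Suc j))" for j
    proof -
      obtain W where "W \<in> null_sets \<mu>" "Z (real (Suc j)) \<subseteq> W"
        using \<open>\<And>s. s > 0 \<Longrightarrow> \<exists>W\<in>null_sets \<mu>. Z s \<subseteq> W\<close>[of "real (Suc j)"] by auto
      then show ?thesis by (intro AE_I'[of W]) auto
    qed
    then have "AE x in \<mu>. \<forall>j. x \<notin> Z (real (Suc j))" by (simp add: AE_all_countable)
    then show ?thesis using AE_msupport
    proof eventually_elim
      case (elim x)
      obtain j :: nat where "2 * infnorm x < j" using reals_Archimedean2 by blast
      then have "x \<in> cube_set (Cube 0 (real (Suc j)))" by (simp add: mem_cube_set)
      then show ?case using elim by (auto simp: Z_def)
    qed
  qed
  then show ?thesis by (simp add: AE_all_countable)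
qed

text \<open>The covering lemma is applied to the points of a level set of \<open>f\<close>, where \<open>f\<close> is nearly constant;
  the rest of \<open>f\<close> contributes a measure vanishing on that set, hence small on a neighbourhood of it.\<close>

lemma AE_differentiation:
  assumes f: "f \<in> L1loc \<mu>" and r: "r > 0"
  shows "AE x in \<mu>. \<exists>N. \<forall>k\<ge>N. good x (r / 2 ^ k) \<longrightarrow>
     (\<integral>\<^sup>+z\<in>cube_set (Cube x (r / 2 ^ k)). ennreal \<bar>f z - f x\<bar> \<partial>\<mu>) \<le> ennreal (mass x (r / 2 ^ k))"
proof -
  have fm [measurable]: "f \<in> borel_measurable borel" using f by (simp add: L1loc_def measurable_mu)
  let ?l = "\<lambda>k. r / 2 ^ k"
  let ?ok = "\<lambda>x k. good x (?l k) \<longrightarrow> (\<integral>\<^sup>+z\<in>cube_set (Cube x (?l k)). ennreal \<bar>f z - f x\<bar> \<partial>\<mu>) \<le> ennreal (mass x (?l k))"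
  have main: "AE x in \<mu>. (real_of_int q / 2 \<le> f x \<and> f x < (real_of_int q + 1) / 2 \<and> norm x < real R) \<longrightarrow> (\<exists>N. \<forall>k\<ge>N. ?ok x k)"
    for q :: int and R :: nat
  proof -
    define a where "a = real_of_int q / 2"
    define E where "E = {x. a \<le> f x \<and> f x < a + 1/2 \<and> norm x < real R}"
    define O1 where "O1 = ball (0::'a) (real R + 1)"
    \<comment> \<open>The part of \<open>|f - a|\<close> that lives off the level set, cut down to a
      bounded neighbourhood. The measure with this density is finite and vanishes on
      \<open>E\<close>, so outer regularity yields an open set around \<open>E\<close> on which it
      is small.\<close>
    define g where "g x = ennreal \<bar>f x - a\<bar> * indicator (- {x. a \<le> f x \<and> f x < a + 1/2}) x * indicator O1 x" for x
    have cbm [measurable]: "cball (0::'a) (real R + 1) \<in> sets borel" by simp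
    have E [measurable]: "E \<in> sets borel" unfolding E_def by measurable
    have O1: "open O1" "O1 \<in> sets borel" by (auto simp: O1_def)
    have gm [measurable]: "g \<in> borel_measurable borel" unfolding g_def using O1 by measurable
    define \<nu> where "\<nu> = density \<mu> g"
    have sn: "sets \<nu> = sets borel" by (simp add: \<nu>_def)
    have fin: "emeasure \<nu> (space \<nu>) \<noteq> \<infinity>"
    proof -
      have "set_integrable \<mu> (cball 0 (real R + 1)) f" using f by (simp add: L1loc_def)
      then have fi: "(\<integral>\<^sup>+x. ennreal \<bar>indicator (cball 0 (real R + 1)) x * f x\<bar> \<partial>\<mu>) < \<infinity>"
        unfolding set_integrable_def by (simp add: integrable_iff_bounded)
      have "emeasure \<nu> (space \<nu>) = (\<integral>\<^sup>+x. g x \<partial>\<mu>)" unfolding \<nu>_def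
        by (subst emeasure_density) (auto simp: measurable_mu)
      also have "\<dots> \<le> (\<integral>\<^sup>+x. ennreal \<bar>indicator (cball 0 (real R + 1)) x * f x\<bar> + ennreal \<bar>a\<bar> * indicator (cball 0 (real R + 1)) x \<partial>\<mu>)"
        by (intro nn_integral_mono) (auto simp: g_def O1_def indicator_def ennreal_plus[symmetric] ennreal_leI simp del: ennreal_plus)
      also have "\<dots> = (\<integral>\<^sup>+x. ennreal \<bar>indicator (cball 0 (real R + 1)) x * f x\<bar> \<partial>\<mu>) + ennreal \<bar>a\<bar> * emeasure \<mu> (cball 0 (real R + 1))"
        by (subst nn_integral_add, unfold measurable_mu, measurable) (simp add: nn_integral_cmult_indicator)
      also have "\<dots> < \<infinity>" using fi bounded_finite[of "cball 0 (real R + 1)"]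
        by (simp add: ennreal_mult_less_top)
      finally show ?thesis by simp
    qed
    define Z where "Z = {x \<in> E \<inter> msupport \<mu>. \<forall>N. \<exists>k\<ge>N. \<not> ?ok x k}"
    have "\<exists>W\<in>null_sets \<mu>. Z \<subseteq> W"
    proof (rule null_cover)
      fix e :: real assume e: "e > 0"
      have E0: "emeasure \<nu> E = 0"
      proof -
        have "emeasure \<nu> E = (\<integral>\<^sup>+x. g x * indicator E x \<partial>\<mu>)" unfolding \<nu>_def
          by (subst emeasure_density) (auto simp: measurable_mu)
        also have "\<dots> = (\<integral>\<^sup>+x. 0 \<partial>\<mu>)" by (intro nn_integral_cong) (auto simp: g_def E_def indicator_def)
        finally show ?thesis by simp
      qed
      have "emeasure \<nu> E = (INF U\<in>{U. E \<subseteq> U \<and> open U}. emeasure \<nu> U)" using fin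
        by (intro outer_regular sn E)
      then have "(INF U\<in>{U. E \<subseteq> U \<and> open U}. emeasure \<nu> U) < ennreal (e / (2 * bg))" using E0 e bg(1)
        by simp
      then obtain U where U: "E \<subseteq> U" "open U" "emeasure \<nu> U < ennreal (e / (2 * bg))"
        unfolding INF_less_iff by blast
      have "\<exists>k. cube_set (Cube x (?l k)) \<subseteq> U \<inter> O1 \<and> \<not> ?ok x k" if x: "x \<in> Z" for x
      proof -
        have "x \<in> U \<inter> O1" using x U(1) by (auto simp: Z_def E_def O1_def)
        moreover have "open (U \<inter> O1)" using U(2) O1 by auto
        ultimately obtain \<delta> where \<delta>: "\<delta> > 0" "ball x \<delta> \<subseteq> U \<inter> O1" by (meson open_contains_ball)
        let ?d = "real DIM('a)"
        obtain N where N: "?d * r / \<delta> < 2 ^ N" using real_arch_pow[of 2 "?d * r / \<delta>"] by auto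
        obtain k where k: "k \<ge> N" "\<not> ?ok x k" using x unfolding Z_def by blast
        have "cube_set (Cube x (?l k)) \<subseteq> ball x \<delta>"
        proof
          fix y assume "y \<in> cube_set (Cube x (?l k))"
          then have y: "infnorm (y - x) \<le> ?l k / 2" by (simp add: mem_cube_set)
          have d1: "1 \<le> ?d" by (simp add: Suc_leI)
          have "sqrt ?d \<le> ?d" using d1 real_sqrt_le_mono[of ?d "?d * ?d"] mult_left_mono[OF d1, of ?d]
            by simp
          then have "norm (y - x) \<le> ?d * (?l k / 2)"
            using norm_le_infnorm[of "y - x"] y d1 infnorm_pos_le[of "y - x"] mult_mono[of "sqrt ?d" ?d "infnorm (y - x)" "?l k / 2"]
              by linarith
          also have "\<dots> < \<delta>"
          proof -
            have "?d * r < \<delta> * 2 ^ N" using N \<delta>(1) by (simp add: field_simps)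
            also have "\<dots> \<le> \<delta> * 2 ^ k" using k(1) \<delta>(1) by (intro mult_left_mono power_increasing) auto
            finally have "?d * ?l k < \<delta>" by (simp add: field_simps)
            moreover have "0 < ?d * ?l k" using r d1 by simp
            moreover have "z / 2 < \<delta>" if "z < \<delta>" "0 < z" for z :: real using that by linarith
            ultimately have "?d * ?l k / 2 < \<delta>" by blast
            then show ?thesis unfolding times_divide_eq_right .
          qed
          finally show "y \<in> ball x \<delta>" by (simp add: dist_norm norm_minus_commute)
        qed
        then show ?thesis using \<delta>(2) k(2) by blast
      qed
      then have "\<forall>x\<in>Z. \<exists>k. cube_set (Cube x (?l k)) \<subseteq> U \<inter> O1 \<and> \<not> ?ok x k" by (intro ballI)
      from bchoice[OF this] obtain kk where kk0: "\<forall>x\<in>Z. cube_set (Cube x (?l (kk x))) \<subseteq> U \<inter> O1 \<and> \<not> ?ok x (kk x)"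
        by (rule exE)
      note kk = bspec[OF kk0]
      have lb: "0 < ?l (kk x) \<and> ?l (kk x) \<le> r" for x
        using r one_le_power[of "2::real" "kk x"] by (simp add: divide_le_eq)
      obtain I :: "nat set" and z where I: "\<And>i. i \<in> I \<Longrightarrow> z i \<in> Z"
        "disjoint_family_on (\<lambda>i. cube_set (Cube (z i) (?l (kk (z i))))) I"
        "Z \<subseteq> (\<Union>i\<in>I. cube_set (Cube (z i) (5 * real DIM('a) * ?l (kk (z i)))))"
        by (rule vitali_cubes[of Z "\<lambda>x. ?l (kk x)" r]) (use lb in blast)+
      let ?Q = "\<lambda>i. cube_set (Cube (z i) (?l (kk (z i))))" and ?K = "\<lambda>i. cube_set (Cube (z i) (5 * real DIM('a) * ?l (kk (z i))))"
      \<comment> \<open>On the selected cube the integral of \<open>|f - f x|\<close> exceeds the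
        mass of the cube. The level set has width 1/2 and can account for at most half of the mass,
        so \<open>\<nu>\<close> of the cube is at least the other half; goodness extends this to the
        enlarged cube.\<close>
      have key: "emeasure \<mu> (?K i) \<le> ennreal (2 * bg) * emeasure \<nu> (?Q i)" if i: "i \<in> I" for i
      proof -
        let ?x = "z i" and ?k = "kk (z i)"
        have x: "?x \<in> Z" "?x \<in> E" using I(1)[OF i] by (auto simp: Z_def)
        have nok: "good ?x (?l ?k)" "\<not> (\<integral>\<^sup>+y\<in>?Q i. ennreal \<bar>f y - f ?x\<bar> \<partial>\<mu>) \<le> ennreal (mass ?x (?l ?k))" and sub: "?Q i \<subseteq> O1"
          using kk[OF x(1)] by auto
        have "(\<integral>\<^sup>+y\<in>?Q i. ennreal \<bar>f y - f ?x\<bar> \<partial>\<mu>) \<le> (\<integral>\<^sup>+y. g y * indicator (?Q i) y + ennreal (1/2) * indicator (?Q i) y \<partial>\<mu>)"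
        proof (rule nn_integral_mono)
          fix y
          show "ennreal \<bar>f y - f ?x\<bar> * indicator (?Q i) y \<le> g y * indicator (?Q i) y + ennreal (1/2) * indicator (?Q i) y"
          proof (cases "y \<in> ?Q i")
            case True
            have fx: "a \<le> f ?x" "f ?x < a + 1/2" using x(2) by (auto simp: E_def)
            show ?thesis
            proof (cases "a \<le> f y \<and> f y < a + 1/2")
              case t: True
              then have "\<bar>f y - f ?x\<bar> \<le> 1/2" using fx by linarith
              then show ?thesis using True by (simp add: ennreal_leI add_increasing del: ennreal_half)
            next
              case f: False
              then have "g y = ennreal \<bar>f y - a\<bar>" using True sub by (auto simp: g_def indicator_def)
              moreover have "\<bar>f y - f ?x\<bar> \<le> \<bar>f y - a\<bar> + 1/2" using fx by linarith
              from ennreal_leI[OF this] have "ennreal \<bar>f y - f ?x\<bar> \<le> ennreal \<bar>f y - a\<bar> + ennreal (1/2)"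
                by (simp del: ennreal_half)
              ultimately show ?thesis using True by simp
            qed
          qed simp
        qed
        also have "\<dots> = emeasure \<nu> (?Q i) + ennreal (1/2) * ennreal (mass ?x (?l ?k))"
          unfolding \<nu>_def
            by (subst nn_integral_add, measurable, subst emeasure_density) (auto simp: measurable_mu nn_integral_cmult_indicator emeasure_mass)
        finally have "ennreal (mass ?x (?l ?k)) \<le> emeasure \<nu> (?Q i) + ennreal (1/2) * ennreal (mass ?x (?l ?k))"
          using nok(2) by (meson less_imp_le not_le order_trans)
        moreover have "emeasure \<nu> (?Q i) \<noteq> \<infinity>" using fin
          by (metis emeasure_space infinity_ennreal_def top.extremum_uniqueI)
        then obtain v where v: "emeasure \<nu> (?Q i) = ennreal v" "0 \<le> v"
          by (cases "emeasure \<nu> (?Q i)") auto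
        ultimately have "mass ?x (?l ?k) \<le> v + 1/2 * mass ?x (?l ?k)"
          by (simp add: ennreal_mult[symmetric] ennreal_plus[symmetric] del: ennreal_plus ennreal_half)
        then have "mass ?x (?l ?k) \<le> 2 * v" by simp
        then have "bg * mass ?x (?l ?k) \<le> bg * (2 * v)" using bg(1) by (intro mult_left_mono) auto
        then have "mass ?x (5 * real DIM('a) * ?l ?k) \<le> 2 * bg * v"
          using good_scales(1)[OF _ nok(1)] lb[of ?x] by simp
        then have "ennreal (mass ?x (5 * real DIM('a) * ?l ?k)) \<le> ennreal (2 * bg * v)"
          by (rule ennreal_leI)
        also have "\<dots> = ennreal (2 * bg) * ennreal v" using bg(1) v by (intro ennreal_mult) auto
        finally show ?thesis unfolding emeasure_mass v(1) .
      qed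
      let ?K' = "\<lambda>i. if i \<in> I then ?K i else {}" and ?Q' = "\<lambda>i. if i \<in> I then ?Q i else {}"
      have dis: "disjoint_family ?Q'" using I(2) unfolding disjoint_family_on_def by auto
      have "emeasure \<mu> (\<Union>i. ?K' i) \<le> (\<Sum>i. emeasure \<mu> (?K' i))"
        by (intro emeasure_subadditive_countably) auto
      also have "\<dots> \<le> (\<Sum>i. ennreal (2 * bg) * emeasure \<nu> (?Q' i))" using key by (intro suminf_le) auto
      also have "\<dots> = ennreal (2 * bg) * (\<Sum>i. emeasure \<nu> (?Q' i))" by (rule ennreal_suminf_cmult)
      also have "(\<Sum>i. emeasure \<nu> (?Q' i)) = emeasure \<nu> (\<Union>i. ?Q' i)" using dis
        by (intro suminf_emeasure) (auto simp: sn)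
      also have "\<dots> \<le> emeasure \<nu> U" using kk I(1) U(2)
        by (intro emeasure_mono) (auto simp: sn split: if_splits)
      also have "\<dots> \<le> ennreal (e / (2 * bg))" using U(3) by simp
      also have "ennreal (2 * bg) * ennreal (e / (2 * bg)) = ennreal e" using bg(1) e
        by (simp add: ennreal_mult[symmetric])
      finally have fin: "emeasure \<mu> (\<Union>i. ?K' i) \<le> ennreal e" by (simp add: mult_left_mono)
      show "\<exists>U\<in>sets \<mu>. Z \<subseteq> U \<and> emeasure \<mu> U \<le> ennreal e"
      proof (intro bexI[of _ "\<Union>i. ?K' i"] conjI fin)
        show "Z \<subseteq> (\<Union>i. ?K' i)" using I(3) by auto
        show "(\<Union>i. ?K' i) \<in> sets \<mu>" by (intro sets.countable_UN) auto
      qed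
    qed
    then obtain W where W: "W \<in> null_sets \<mu>" "Z \<subseteq> W" by blast
    then have "AE x in \<mu>. x \<notin> Z" by (intro AE_I'[of W]) auto
    then show ?thesis using AE_msupport
    proof eventually_elim
      case (elim x)
      have "(real_of_int q + 1) / 2 = a + 1/2" by (simp add: a_def)
      then show ?case using elim unfolding Z_def E_def a_def by auto
    qed
  qed
  then have "AE x in \<mu>. \<forall>q R. (real_of_int q / 2 \<le> f x \<and> f x < (real_of_int q + 1) / 2 \<and> norm x < real R) \<longrightarrow> (\<exists>N. \<forall>k\<ge>N. ?ok x k)"
    unfolding AE_all_countable using main by blast
  then show ?thesis
  proof eventually_elim
    case (elim x)
    obtain R :: nat where "norm x < R" using reals_Archimedean2 by blast
    moreover have "real_of_int \<lfloor>2 * f x\<rfloor> \<le> 2 * f x" "2 * f x < real_of_int \<lfloor>2 * f x\<rfloor> + 1" by linarith+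
    then have "real_of_int \<lfloor>2 * f x\<rfloor> / 2 \<le> f x" "f x < (real_of_int \<lfloor>2 * f x\<rfloor> + 1) / 2"
      by (simp_all add: field_simps)
    ultimately show ?case using elim by blast
  qed
qed

end

section \<open>The John--Nirenberg inequality\<close>

lemma ennreal_le_suminf: "(g :: nat \<Rightarrow> ennreal) i \<le> suminf g"
  using sum_le_suminf[of g "{i}"] by simp

context growth_space
begin

lemma osc_family_cubeD:
  assumes "osc_family f c A" "x \<in> msupport \<mu>" "r > 0"
  shows "(\<integral>\<^sup>+y\<in>cube_set (Cube x r). ennreal \<bar>f y - c (Cube x r)\<bar> \<partial>\<mu>) \<le> ennreal (A * mass x (4/3 * r))"
proof -
  have Q: "is_cube \<mu> (Cube x r)" using assms by simp
  have "\<forall>Q. is_cube \<mu> Q \<longrightarrow> (\<integral>\<^sup>+y\<in>cube_set Q. ennreal \<bar>f y - c Q\<bar> \<partial>\<mu>) \<le> ennreal (A * mcube \<mu> (cube_scale (4/3) Q))"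
    using assms(1) unfolding osc_family_def by (elim conjE)
  from this[rule_format, OF Q] show ?thesis unfolding mass_def cube_scale.simps .
qed

text \<open>Along bad scales the density doubles every \<open>Mg\<close> steps, so
  \<open>nondoubling_sum\<close> applies. The last scale \<open>N\<close> may be good; it costs the
  extra \<open>C\<close>.\<close>

lemma bad_scales_dens_sum:
  assumes z: "z \<in> msupport \<mu>" and u: "u > 0" and N: "N \<ge> 1"
    and bad: "\<And>j. 1 \<le> j \<Longrightarrow> j < N \<Longrightarrow> \<not> good z (2 ^ j * u)"
  shows "dens_sum z (level u) (level u + int N) \<le> 2 ^ n * (Mg * C + C)"
proof -
  let ?v = "\<lambda>j. dens z (2 ^ Suc j * u)"
  have "(\<Sum>j<N - 1. ?v j) \<le> Mg * C / (2 - 1)"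
  proof (rule nondoubling_sum)
    show "0 \<le> ?v j" "?v j \<le> C" for j using dens_le[OF z, of "2 ^ Suc j * u"] u
      by (auto intro: dens_nonneg)
    show "2 * ?v j \<le> ?v (j + Mg)" if "j < N - 1" for j
    proof -
      have "2 * dens z (2 ^ Suc j * u) \<le> dens z (2 ^ Mg * (2 ^ Suc j * u))"
        by (rule not_good) (use u bad[of "Suc j"] that in auto)
      also have "2 ^ Mg * (2 ^ Suc j * u) = 2 ^ Suc (j + Mg) * u" by (simp add: power_add)
      finally show ?thesis .
    qed
  qed simp
  moreover have "?v (N - 1) \<le> C" by (rule dens_le[OF z]) (use u in simp)
  moreover have "(\<Sum>j=1..N. dens z (2 ^ j * u)) = (\<Sum>j<N - 1. ?v j) + ?v (N - 1)"
  proof -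
    have "(\<Sum>j=1..N. dens z (2 ^ j * u)) = (\<Sum>j<Suc (N - 1). ?v j)"
      using N by (intro sum.reindex_bij_witness[of _ Suc "\<lambda>j. j - 1"]) auto
    then show ?thesis by simp
  qed
  ultimately have "(\<Sum>j=1..N. dens z (2 ^ j * u)) \<le> Mg * C / (2 - 1) + C" by (simp only: add_mono)
  then have "(\<Sum>j=1..N. dens z (2 ^ j * u)) \<le> Mg * C + C" by simp
  then have "2 ^ n * (\<Sum>j=1..N. dens z (2 ^ j * u)) \<le> 2 ^ n * (Mg * C + C)" by (intro mult_left_mono) auto
  then show ?thesis using dens_sum_dens_sum(2)[OF u z, of N] by linarith
qed

text \<open>\<open>J1\<close> is the stopping threshold, so large that the stopping cubes have total mass at most
  \<open>mass x (2 * r) / (4 * bg)\<close>; on them \<open>c\<close> has moved by at most \<open>J1 + J2\<close>, and on their enlargements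
  by \<open>J1 + J2 + J3\<close>. With \<open>J\<tau>\<close> the latter costs a factor 2 in the exponential integral, which leaves
  the contraction \<open>X \<mapsto> exp (J\<tau> * JB) + X / 2\<close> in \<open>john_nirenberg_step\<close>.\<close>

definition "J0 A = A + A * (Kc * (1 + C))"
definition "J1 A = A * bg + 4 * bg * J0 A + 1"
definition "J2 A = A * (Kc * (1 + 2 ^ n * (Mg * C + C)))"
definition "J3 A = A * (Kc * (1 + C * Mg))"
definition "JB A = J1 A + 1 + A * bg"
definition "J\<tau> A = ln 2 / (J1 A + J2 A + J3 A)"

lemma J_pos: assumes "0 \<le> A" shows "0 \<le> J0 A" "1 \<le> J1 A" "0 \<le> J2 A" "0 \<le> J3 A" "0 \<le> JB A" "0 < J\<tau> A"
proof -
  show "0 \<le> J0 A" using assms Kc_pos C1 by (simp add: J0_def)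
  then show 1: "1 \<le> J1 A" using assms bg(1) by (simp add: J1_def)
  show 2: "0 \<le> J2 A" "0 \<le> J3 A" using assms Kc_pos C1 by (simp_all add: J2_def J3_def)
  show "0 \<le> JB A" using 1 assms bg(1) by (simp add: JB_def)
  show "0 < J\<tau> A" using 1 2 by (simp add: J\<tau>_def)
qed

text \<open>The first good scale at which \<open>c\<close> has moved by more than \<open>J1 A\<close>. The upper bound holds because
  densities grow geometrically along the bad scales in between, so that \<open>c\<close> cannot move much there.\<close>

lemma stopping_scale:
  assumes F: "osc_family f c A" and x: "x \<in> msupport \<mu>" and r: "r > 0"
  shows "AE z in \<mu>. z \<in> cube_set (Cube x r) \<and> JB A < \<bar>f z - c (Cube x r)\<bar> \<longrightarrow>
    (\<exists>\<rho>. 0 < \<rho> \<and> \<rho> \<le> r / 2 \<and> good z \<rho> \<and> J1 A < \<bar>c (Cube z \<rho>) - c (Cube x r)\<bar> \<and>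
       \<bar>c (Cube z \<rho>) - c (Cube x r)\<bar> \<le> J1 A + J2 A)"
proof -
  let ?l = "\<lambda>k. r / 2 ^ k" and ?a = "c (Cube x r)"
  have L: "S_lipschitz c A" and fl: "f \<in> L1loc \<mu>" using F by (auto simp: osc_family_def)
  have A: "0 \<le> A" using L by (simp add: S_lipschitz_def)
  show ?thesis using AE_msupport AE_good[OF r] AE_differentiation[OF fl r]
  proof eventually_elim
    case (elim z)
    show ?case
    proof (intro impI, elim conjE)
      assume zQ: "z \<in> cube_set (Cube x r)" and big: "JB A < \<bar>f z - ?a\<bar>"
      let ?P = "\<lambda>k. 1 \<le> k \<and> good z (?l k) \<and> J1 A < \<bar>c (Cube z (?l k)) - ?a\<bar>"
      obtain N where N: "\<And>k. k \<ge> N \<Longrightarrow> good z (?l k) \<Longrightarrow>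
         (\<integral>\<^sup>+y\<in>cube_set (Cube z (?l k)). ennreal \<bar>f y - f z\<bar> \<partial>\<mu>) \<le> ennreal (mass z (?l k))" using elim(3)
           by blast
      obtain k0 where k0: "k0 \<ge> max 1 N" "good z (?l k0)" using elim(2) by blast
      \<comment> \<open>At a small good scale \<open>|f - f z|\<close> has mean at most 1 by
        differentiation, and \<open>|f - c|\<close> has mean at most \<open>A * bg\<close>. As
        \<open>JB A\<close> is \<open>J1 A + 1 + A * bg\<close>, a deviation of \<open>f z\<close>
        beyond \<open>JB A\<close> forces \<open>c\<close> to deviate there by more than
        \<open>J1 A\<close>.\<close>
      have "\<bar>f z - c (Cube z (?l k0))\<bar> \<le> 1 + A * bg"
      proof -
        let ?Q = "Cube z (?l k0)"
        have Q: "is_cube \<mu> ?Q" using elim(1) r by simp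
        have fm [measurable]: "f \<in> borel_measurable borel" using fl
          by (simp add: L1loc_def measurable_mu)
        have "(\<integral>\<^sup>+y\<in>cube_set ?Q. ennreal \<bar>f y - c ?Q\<bar> \<partial>\<mu>) \<le> ennreal (A * mass z (4/3 * ?l k0))"
          using r by (intro osc_family_cubeD F elim) simp
        also have "\<dots> \<le> ennreal (A * (bg * mass z (?l k0)))" using good_scales(3)[OF _ k0(2)] r A
          by (intro ennreal_leI mult_left_mono) auto
        finally have c: "(\<integral>\<^sup>+y\<in>cube_set ?Q. ennreal \<bar>f y - c ?Q\<bar> \<partial>\<mu>) \<le> ennreal (A * (bg * mass z (?l k0)))" .
        have "ennreal \<bar>f z - c ?Q\<bar> * ennreal (mass z (?l k0)) = (\<integral>\<^sup>+y. ennreal \<bar>f z - c ?Q\<bar> * indicator (cube_set ?Q) y \<partial>\<mu>)"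
          by (simp add: nn_integral_cmult_indicator emeasure_mass del: cube_set.simps)
        also have "\<dots> \<le> (\<integral>\<^sup>+y. ennreal \<bar>f y - f z\<bar> * indicator (cube_set ?Q) y + ennreal \<bar>f y - c ?Q\<bar> * indicator (cube_set ?Q) y \<partial>\<mu>)"
          by (intro nn_integral_mono) (auto simp: indicator_def ennreal_plus[symmetric] simp del: ennreal_plus)
        also have "\<dots> \<le> ennreal (mass z (?l k0)) + ennreal (A * (bg * mass z (?l k0)))"
          using N[OF _ k0(2)] k0(1) c
          by (subst nn_integral_add, unfold measurable_mu, measurable) (intro add_mono, auto simp del: cube_set.simps)
        also have "\<dots> = ennreal ((1 + A * bg) * mass z (?l k0))"
          using A bg(1) by (subst ennreal_plus[symmetric]) (auto simp: algebra_simps)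
        finally have "\<bar>f z - c ?Q\<bar> * mass z (?l k0) \<le> (1 + A * bg) * mass z (?l k0)"
          using A bg(1) by (simp add: ennreal_mult[symmetric])
        then show ?thesis using mass_pos[OF elim(1), of "?l k0"] r by (simp add: mult_le_cancel_right)
      qed
      then have "?P k0" using k0 big by (auto simp: JB_def)
      then obtain k where k: "?P k" and kmin: "\<And>i. i < k \<Longrightarrow> \<not> ?P i" using exists_least_iff[of ?P] by blast
      let ?G = "{i. 1 \<le> i \<and> i < k \<and> good z (?l i)}"
      \<comment> \<open>The scale \<open>r / 2 ^ i\<close> is the last good one before
        \<open>k\<close>, or \<open>r\<close> itself if there is none. There \<open>c\<close> has
        moved by at most \<open>J1 A\<close>, and all scales strictly in between are bad.\<close>
      define i where "i = (if ?G = {} then 0 else Max ?G)"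
      have fG: "finite ?G" by (rule finite_subset[of _ "{..<k}"]) auto
      have ik: "i < k" and bad: "\<And>j. i < j \<Longrightarrow> j < k \<Longrightarrow> \<not> good z (?l j)"
      proof -
        show "i < k" using Max_in[OF fG] k by (auto simp: i_def)
        show "\<not> good z (?l j)" if "i < j" "j < k" for j
        proof
          assume "good z (?l j)"
          then have j: "j \<in> ?G" using that by auto
          then have "j \<le> Max ?G" using fG by (intro Max_ge)
          moreover have "i = Max ?G" using j unfolding i_def by (metis (no_types, lifting) empty_iff)
          ultimately show False using that by simp
        qed
      qed
      have ci: "\<bar>c (Cube z (?l i)) - ?a\<bar> \<le> J1 A"
      proof (cases "?G = {}")
        case True
        have "\<bar>c (Cube z r) - ?a\<bar> \<le> A * (Kc * (1 + C * (level r - level r)))"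
          using infnorm_pos_le[of "z - x"] zQ r
            by (intro S_lipschitz_compare_levels L elim x) (auto simp: mem_cube_set)
        also have "\<dots> \<le> A * (Kc * (1 + C))" using A Kc_pos C1 by (intro mult_left_mono) auto
        also have "\<dots> \<le> J0 A" using A by (simp add: J0_def)
        also have "\<dots> \<le> 4 * bg * J0 A" using bg(1) J_pos(1)[OF A] mult_right_mono[of 1 "4 * bg" "J0 A"]
          by simp
        also have "\<dots> \<le> J1 A" using A bg(1) by (simp add: J1_def)
        finally show ?thesis using True by (simp add: i_def)
      next
        case False
        then have "i \<in> ?G" using Max_in[OF fG] by (auto simp: i_def)
        then show ?thesis using kmin[of i] by auto
      qed
      have li: "?l i = 2 ^ (k - i) * ?l k" using ik by (simp add: power_diff)
      have "\<bar>c (Cube z (?l k)) - c (Cube z (?l i))\<bar> \<le> A * (Kc * (1 + dens_sum z (level (?l k)) (level (?l i))))"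
        using r ik by (intro S_lipschitz_compare L elim) (auto simp: infnorm_0 field_simps power_increasing)
      also have "level (?l i) = level (?l k) + int (k - i)" unfolding li
        by (rule level_mult_power) (use r in simp)
      also have "A * (Kc * (1 + dens_sum z (level (?l k)) (level (?l k) + int (k - i)))) \<le> J2 A"
        unfolding J2_def
      proof (intro mult_left_mono add_left_mono bad_scales_dens_sum elim(1) A)
        show "\<not> good z (2 ^ j * ?l k)" if "1 \<le> j" "j < k - i" for j
        proof -
          have "2 ^ j * ?l k = ?l (k - j)" using that by (simp add: power_diff)
          then show ?thesis using bad[of "k - j"] that by auto
        qed
      qed (use r ik Kc_pos in auto)
      finally have "\<bar>c (Cube z (?l k)) - ?a\<bar> \<le> J1 A + J2 A" using ci by linarith
      moreover have "?l k \<le> r / 2" "0 < ?l k"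
        using r k power_increasing[of 1 k "2::real"] divide_left_mono[of 2 "2 ^ k" r] by auto
      ultimately show "\<exists>\<rho>. 0 < \<rho> \<and> \<rho> \<le> r / 2 \<and> good z \<rho> \<and> J1 A < \<bar>c (Cube z \<rho>) - ?a\<bar> \<and> \<bar>c (Cube z \<rho>) - ?a\<bar> \<le> J1 A + J2 A"
        using k by blast
    qed
  qed
qed

text \<open>On a stopping cube \<open>c\<close> is more than \<open>J1 A\<close> away from its
  initial value, while \<open>f\<close> is on average within \<open>A * bg\<close> of
  \<open>c\<close>. So the integral of \<open>|f - c (Cube x r)|\<close> over the cube is at least
  the difference of these numbers times its mass. The stopping cubes are disjoint and lie in the
  3/2-dilate of the original cube, where that integral is at most
  \<open>J0 A * mass x (2 * r)\<close>.\<close>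

lemma stopping_cubes:
  assumes F: "osc_family f c A" and x: "x \<in> msupport \<mu>" and r: "r > 0"
  obtains I :: "nat set" and z \<rho> where
    "\<And>i. i \<in> I \<Longrightarrow> z i \<in> msupport \<mu> \<and> 0 < \<rho> i \<and> good (z i) (\<rho> i) \<and> \<bar>c (Cube (z i) (\<rho> i)) - c (Cube x r)\<bar> \<le> J1 A + J2 A"
    "(\<Sum>i. if i \<in> I then ennreal (mass (z i) (\<rho> i)) else 0) \<le> ennreal (mass x (2 * r) / (4 * bg))"
    "AE y in \<mu>. y \<in> cube_set (Cube x r) \<and> JB A < \<bar>f y - c (Cube x r)\<bar> \<longrightarrow>
       (\<exists>i\<in>I. y \<in> cube_set (Cube (z i) (5 * real DIM('a) * \<rho> i)))"
proof -
  let ?a = "c (Cube x r)"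
  have L: "S_lipschitz c A" and fl: "f \<in> L1loc \<mu>" using F by (auto simp: osc_family_def)
  have fm [measurable]: "f \<in> borel_measurable borel" using fl by (simp add: L1loc_def measurable_mu)
  have A: "0 \<le> A" using L by (simp add: S_lipschitz_def)
  let ?S = "\<lambda>z \<rho>. 0 < \<rho> \<and> \<rho> \<le> r / 2 \<and> good z \<rho> \<and> J1 A < \<bar>c (Cube z \<rho>) - ?a\<bar> \<and> \<bar>c (Cube z \<rho>) - ?a\<bar> \<le> J1 A + J2 A"
  define Z where "Z = {z \<in> msupport \<mu> \<inter> cube_set (Cube x r). \<exists>\<rho>. ?S z \<rho>}"
  define l where "l z = (SOME \<rho>. ?S z \<rho>)" for z
  have l: "?S z (l z)" if "z \<in> Z" for z
  proof -
    have "\<exists>\<rho>. ?S z \<rho>" using that by (simp add: Z_def)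
    then show ?thesis unfolding l_def by (rule someI_ex)
  qed
  obtain I :: "nat set" and z where I: "\<And>i. i \<in> I \<Longrightarrow> z i \<in> Z"
    "disjoint_family_on (\<lambda>i. cube_set (Cube (z i) (l (z i)))) I"
    "Z \<subseteq> (\<Union>i\<in>I. cube_set (Cube (z i) (5 * real DIM('a) * l (z i))))"
    by (rule vitali_cubes[of Z l "r / 2"]) (use l in blast)+
  let ?Q = "\<lambda>i. Cube (z i) (l (z i))"
  have supp: "z i \<in> msupport \<mu>" if "i \<in> I" for i using I(1)[OF that] by (simp add: Z_def)
  show ?thesis
  proof (rule that[of I z "\<lambda>i. l (z i)"])
    show "z i \<in> msupport \<mu> \<and> 0 < l (z i) \<and> good (z i) (l (z i)) \<and> \<bar>c (?Q i) - ?a\<bar> \<le> J1 A + J2 A" if "i \<in> I" for i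
      using l[OF I(1)[OF that]] supp[OF that] by blast
    show "AE y in \<mu>. y \<in> cube_set (Cube x r) \<and> JB A < \<bar>f y - ?a\<bar> \<longrightarrow>
       (\<exists>i\<in>I. y \<in> cube_set (Cube (z i) (5 * real DIM('a) * l (z i))))"
      using AE_msupport stopping_scale[OF F x r]
    proof eventually_elim
      case (elim y)
      show ?case
      proof (intro impI, elim conjE)
        assume "y \<in> cube_set (Cube x r)" "JB A < \<bar>f y - ?a\<bar>"
        then have "y \<in> Z" using elim unfolding Z_def by blast
        then show "\<exists>i\<in>I. y \<in> cube_set (Cube (z i) (5 * real DIM('a) * l (z i)))" using I(3) by blast
      qed
    qed
    let ?Q' = "\<lambda>i. if i \<in> I then cube_set (?Q i) else {}"
    \<comment> \<open>\<open>J1 A\<close> was chosen so that \<open>D\<close> is at least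
      \<open>4 * bg * J0 A\<close>, which produces the factor \<open>1 / (4 * bg)\<close>.\<close>
    define D where "D = J1 A - A * bg"
    have D: "D > 0" "4 * bg * J0 A \<le> D" using J_pos(1)[OF A] bg(1)
      by (auto simp: D_def J1_def add_nonneg_pos)
    have one: "ennreal D * ennreal (mass (z i) (l (z i))) \<le> (\<integral>\<^sup>+y\<in>cube_set (?Q i). ennreal \<bar>f y - ?a\<bar> \<partial>\<mu>)" if i: "i \<in> I" for i
    proof -
      note li = l[OF I(1)[OF i]]
      define m where "m = mass (z i) (l (z i))"
      have "(\<integral>\<^sup>+y\<in>cube_set (?Q i). ennreal \<bar>f y - c (?Q i)\<bar> \<partial>\<mu>) \<le> ennreal (A * mass (z i) (4/3 * l (z i)))"
        using li by (intro osc_family_cubeD F supp i) simp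
      also have "\<dots> \<le> ennreal (A * (bg * m))" unfolding m_def
        using good_scales(3)[of "l (z i)" "z i"] li A by (intro ennreal_leI mult_left_mono) auto
      finally have u: "(\<integral>\<^sup>+y\<in>cube_set (?Q i). ennreal \<bar>f y - c (?Q i)\<bar> \<partial>\<mu>) \<le> ennreal (A * (bg * m))" .
      have "ennreal (J1 A) * ennreal m = (\<integral>\<^sup>+y. ennreal (J1 A) * indicator (cube_set (?Q i)) y \<partial>\<mu>)"
        by (simp add: nn_integral_cmult_indicator emeasure_mass m_def del: cube_set.simps)
      also have "\<dots> \<le> (\<integral>\<^sup>+y. ennreal \<bar>f y - c (?Q i)\<bar> * indicator (cube_set (?Q i)) y + ennreal \<bar>f y - ?a\<bar> * indicator (cube_set (?Q i)) y \<partial>\<mu>)"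
        using li by (intro nn_integral_mono) (auto simp: indicator_def ennreal_plus[symmetric] intro!: ennreal_leI simp del: ennreal_plus)
      also have "\<dots> = (\<integral>\<^sup>+y\<in>cube_set (?Q i). ennreal \<bar>f y - c (?Q i)\<bar> \<partial>\<mu>) + (\<integral>\<^sup>+y\<in>cube_set (?Q i). ennreal \<bar>f y - ?a\<bar> \<partial>\<mu>)"
        by (subst nn_integral_add, unfold measurable_mu, measurable)
      also have "\<dots> \<le> ennreal (A * (bg * m)) + (\<integral>\<^sup>+y\<in>cube_set (?Q i). ennreal \<bar>f y - ?a\<bar> \<partial>\<mu>)" using u
        by (rule add_right_mono)
      finally have le: "ennreal (J1 A) * ennreal m \<le> ennreal (A * (bg * m)) + (\<integral>\<^sup>+y\<in>cube_set (?Q i). ennreal \<bar>f y - ?a\<bar> \<partial>\<mu>)" .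
      have m0: "0 \<le> m" by (simp add: m_def)
      have "J1 A * m = A * (bg * m) + D * m" by (simp add: D_def algebra_simps)
      then have "ennreal (J1 A) * ennreal m = ennreal (A * (bg * m) + D * m)"
        using J_pos(2)[OF A] m0 by (subst ennreal_mult[symmetric]) auto
      also have "\<dots> = ennreal (A * (bg * m)) + ennreal (D * m)" using A bg(1) D m0
        by (intro ennreal_plus) auto
      also have "ennreal (D * m) = ennreal D * ennreal m" using D m0 by (intro ennreal_mult) auto
      finally have "ennreal (J1 A) * ennreal m = ennreal (A * (bg * m)) + ennreal D * ennreal m" .
      with le show ?thesis unfolding m_def[symmetric] by (simp add: ennreal_add_left_cancel_le)
    qed
    have "ennreal D * (\<Sum>i. if i \<in> I then ennreal (mass (z i) (l (z i))) else 0)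
        = (\<Sum>i. ennreal D * (if i \<in> I then ennreal (mass (z i) (l (z i))) else 0))"
          by (rule ennreal_suminf_cmult[symmetric])
    also have "\<dots> \<le> (\<Sum>i. \<integral>\<^sup>+y\<in>?Q' i. ennreal \<bar>f y - ?a\<bar> \<partial>\<mu>)" using one by (intro suminf_le) auto
    also have "\<dots> = (\<integral>\<^sup>+y\<in>(\<Union>i. ?Q' i). ennreal \<bar>f y - ?a\<bar> \<partial>\<mu>)"
      by (rule nn_integral_disjoint_family[symmetric]) (use I(2) in \<open>auto simp: measurable_mu disjoint_family_on_def\<close>)
    also have "\<dots> \<le> (\<integral>\<^sup>+y\<in>cube_set (Cube x (3/2 * r)). ennreal \<bar>f y - ?a\<bar> \<partial>\<mu>)"
    proof (intro nn_set_integral_set_mono)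
      have "cube_set (?Q i) \<subseteq> cube_set (Cube x (3/2 * r))" if i: "i \<in> I" for i
      proof (rule cube_subsetI)
        have "infnorm (z i - x) \<le> r / 2" using I(1)[OF i] by (simp add: Z_def mem_cube_set)
        then show "infnorm (z i - x) + l (z i) / 2 \<le> 3/2 * r / 2" using l[OF I(1)[OF i]] by linarith
      qed
      then show "(\<Union>i. ?Q' i) \<subseteq> cube_set (Cube x (3/2 * r))" by (auto split: if_splits)
    qed
    also have "\<dots> \<le> ennreal ((A + A * (Kc * (1 + C))) * mass x (2 * r))"
    proof (rule osc_family_osc_cube[OF F x])
      have "\<bar>c (Cube x r) - c (Cube x (3/2 * r))\<bar> \<le> A * (Kc * (1 + C * (level (3/2 * r) - level r)))"
        using r by (intro S_lipschitz_compare_levels L x) (auto simp: infnorm_0)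
      also have "level (3/2 * r) \<le> level r + 1"
        using level_mono[of "3/2 * r" "2 ^ 1 * r"] level_mult_power[OF r, of 1] r by simp
      then have "A * (Kc * (1 + C * (level (3/2 * r) - level r))) \<le> A * (Kc * (1 + C * 1))"
        using A Kc_pos C1 by (intro mult_left_mono add_left_mono) auto
      finally show "\<bar>c (Cube x (3/2 * r)) - ?a\<bar> \<le> A * (Kc * (1 + C))" by (simp add: abs_minus_commute)
    qed (use r in auto)
    finally have le: "ennreal D * (\<Sum>i. if i \<in> I then ennreal (mass (z i) (l (z i))) else 0) \<le> ennreal (J0 A * mass x (2 * r))"
      by (simp add: J0_def)
    define \<Sigma> where "\<Sigma> = (\<Sum>i. if i \<in> I then ennreal (mass (z i) (l (z i))) else 0)"
    have "\<Sigma> < \<infinity>" using le D unfolding \<Sigma>_def[symmetric]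
      by (metis ennreal_mult_eq_top_iff ennreal_less_top infinity_ennreal_def ennreal_0 ennreal_eq_0_iff leD less_top linorder_not_less top.not_eq_extremum)
    then obtain v where v: "\<Sigma> = ennreal v" "0 \<le> v" by (cases \<Sigma>) auto
    then have "D * v \<le> J0 A * mass x (2 * r)" using le D J_pos(1)[OF A] unfolding \<Sigma>_def[symmetric]
      by (simp add: ennreal_mult[symmetric])
    then have "4 * bg * (D * v) \<le> 4 * bg * (J0 A * mass x (2 * r))" using bg(1)
      by (intro mult_left_mono) auto
    also have "\<dots> = (4 * bg * J0 A) * mass x (2 * r)" by simp
    also have "\<dots> \<le> D * mass x (2 * r)" using D by (intro mult_right_mono) auto
    finally have "v \<le> mass x (2 * r) / (4 * bg)" using D bg(1) by (simp add: field_simps)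
    then show "(\<Sum>i. if i \<in> I then ennreal (mass (z i) (l (z i))) else 0) \<le> ennreal (mass x (2 * r) / (4 * bg))"
      using v unfolding \<Sigma>_def[symmetric] by (simp add: ennreal_leI)
  qed
qed

text \<open>Off the enlarged stopping cubes the deviation is at most \<open>JB A\<close>. On each of
  them \<open>H\<close> applies with the local value of \<open>c\<close>; changing to the initial
  value costs a factor 2, and the double of the enlarged cube has mass at most \<open>bg\<close>
  times that of the stopping cube. Summation gives
  \<open>2 * X * bg / (4 * bg) = X / 2\<close>.\<close>

lemma john_nirenberg_step:
  assumes F: "osc_family f c A" and X: "0 \<le> X"
    and H: "\<And>x r. x \<in> msupport \<mu> \<Longrightarrow> r > 0 \<Longrightarrow>
       (\<integral>\<^sup>+z\<in>cube_set (Cube x r). ennreal (exp (J\<tau> A * \<bar>f z - c (Cube x r)\<bar>)) \<partial>\<mu>) \<le> ennreal (X * mass x (2 * r))"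
    and x: "x \<in> msupport \<mu>" and r: "r > 0"
  shows "(\<integral>\<^sup>+z\<in>cube_set (Cube x r). ennreal (exp (J\<tau> A * \<bar>f z - c (Cube x r)\<bar>)) \<partial>\<mu>) \<le> ennreal ((exp (J\<tau> A * JB A) + X / 2) * mass x (2 * r))"
proof -
  let ?a = "c (Cube x r)" and ?d = "5 * real DIM('a)"
  have L: "S_lipschitz c A" and fl: "f \<in> L1loc \<mu>" using F by (auto simp: osc_family_def)
  have fm [measurable]: "f \<in> borel_measurable borel" using fl by (simp add: L1loc_def measurable_mu)
  have A: "0 \<le> A" using L by (simp add: S_lipschitz_def)
  define \<tau> where "\<tau> = J\<tau> A"
  have \<tau>: "\<tau> > 0" using J_pos(6)[OF A] by (simp add: \<tau>_def)
  note H = H[folded \<tau>_def]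
  obtain I :: "nat set" and z \<rho> where I:
    "\<And>i. i \<in> I \<Longrightarrow> z i \<in> msupport \<mu> \<and> 0 < \<rho> i \<and> good (z i) (\<rho> i) \<and> \<bar>c (Cube (z i) (\<rho> i)) - ?a\<bar> \<le> J1 A + J2 A"
    "(\<Sum>i. if i \<in> I then ennreal (mass (z i) (\<rho> i)) else 0) \<le> ennreal (mass x (2 * r) / (4 * bg))"
    "AE y in \<mu>. y \<in> cube_set (Cube x r) \<and> JB A < \<bar>f y - ?a\<bar> \<longrightarrow> (\<exists>i\<in>I. y \<in> cube_set (Cube (z i) (?d * \<rho> i)))"
    by (rule stopping_cubes[OF F x r]) blast
  let ?e = "\<lambda>y. ennreal (exp (\<tau> * \<bar>f y - ?a\<bar>))"
  let ?R = "\<lambda>i. if i \<in> I then cube_set (Cube (z i) (?d * \<rho> i)) else {}"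
  have piece: "(\<integral>\<^sup>+y\<in>?R i. ?e y \<partial>\<mu>) \<le> ennreal (2 * X * bg) * (if i \<in> I then ennreal (mass (z i) (\<rho> i)) else 0)" for i
  proof (cases "i \<in> I")
    case True
    note i = I(1)[OF True]
    let ?c = "c (Cube (z i) (?d * \<rho> i))"
    have d: "1 \<le> real DIM('a)" by (simp add: Suc_leI)
    then have "1 \<le> ?d" by linarith
    from mult_right_mono[OF this, of "\<rho> i"] have dl: "\<rho> i \<le> ?d * \<rho> i" using i by simp
    have "?d * \<rho> i \<le> 2 ^ Mg * \<rho> i" using Mg i by (intro mult_right_mono) auto
    then have "level (?d * \<rho> i) \<le> level (\<rho> i) + int Mg"
      using level_mono[of "?d * \<rho> i" "2 ^ Mg * \<rho> i"] level_mult_power[of "\<rho> i" Mg] i dl by linarith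
    then have "A * (Kc * (1 + C * (level (?d * \<rho> i) - level (\<rho> i)))) \<le> J3 A"
      unfolding J3_def using A Kc_pos C1 by (intro mult_left_mono add_left_mono) auto
    moreover have "\<bar>c (Cube (z i) (\<rho> i)) - ?c\<bar> \<le> A * (Kc * (1 + C * (level (?d * \<rho> i) - level (\<rho> i))))"
      using i dl by (intro S_lipschitz_compare_levels L) (auto simp: infnorm_0)
    ultimately have cc: "\<bar>?c - ?a\<bar> \<le> J1 A + J2 A + J3 A" using i by linarith
    have "exp (\<tau> * \<bar>?c - ?a\<bar>) \<le> exp (ln 2)"
    proof -
      have "\<tau> * \<bar>?c - ?a\<bar> \<le> \<tau> * (J1 A + J2 A + J3 A)" using cc \<tau> by (intro mult_left_mono) auto
      also have "\<dots> = ln 2" using J_pos[OF A] by (simp add: \<tau>_def J\<tau>_def)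
      finally show ?thesis unfolding exp_le_cancel_iff .
    qed
    then have two: "exp (\<tau> * \<bar>?c - ?a\<bar>) \<le> 2" by simp
    have "(\<integral>\<^sup>+y\<in>?R i. ?e y \<partial>\<mu>) \<le> (\<integral>\<^sup>+y. 2 * (ennreal (exp (\<tau> * \<bar>f y - ?c\<bar>)) * indicator (cube_set (Cube (z i) (?d * \<rho> i))) y) \<partial>\<mu>)"
    proof (rule nn_integral_mono)
      fix y
      have "exp (\<tau> * \<bar>f y - ?a\<bar>) \<le> exp (\<tau> * \<bar>?c - ?a\<bar> + \<tau> * \<bar>f y - ?c\<bar>)"
        using \<tau> mult_left_mono[of "\<bar>f y - ?a\<bar>" "\<bar>?c - ?a\<bar> + \<bar>f y - ?c\<bar>" \<tau>] by (simp add: distrib_left)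
      also have "\<dots> \<le> 2 * exp (\<tau> * \<bar>f y - ?c\<bar>)" unfolding exp_add using two
        by (intro mult_right_mono) auto
      finally have "?e y \<le> ennreal (2 * exp (\<tau> * \<bar>f y - ?c\<bar>))" by (rule ennreal_leI)
      then have "?e y \<le> 2 * ennreal (exp (\<tau> * \<bar>f y - ?c\<bar>))" by (simp add: ennreal_mult)
      then show "?e y * indicator (?R i) y \<le> 2 * (ennreal (exp (\<tau> * \<bar>f y - ?c\<bar>)) * indicator (cube_set (Cube (z i) (?d * \<rho> i))) y)"
        using True by (simp add: indicator_def)
    qed
    also have "\<dots> = 2 * (\<integral>\<^sup>+y\<in>cube_set (Cube (z i) (?d * \<rho> i)). ennreal (exp (\<tau> * \<bar>f y - ?c\<bar>)) \<partial>\<mu>)"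
      by (rule nn_integral_cmult, unfold measurable_mu, measurable)
    also have "\<dots> \<le> 2 * ennreal (X * mass (z i) (2 * (?d * \<rho> i)))" using i dl
      by (intro mult_left_mono H) auto
    also have "\<dots> \<le> 2 * ennreal (X * (bg * mass (z i) (\<rho> i)))"
      using good_scales(2)[of "\<rho> i" "z i"] i X by (intro mult_left_mono ennreal_leI) auto
    also have "\<dots> = ennreal (2 * X * bg) * ennreal (mass (z i) (\<rho> i))"
      using X bg(1) by (simp add: ennreal_mult mult_ac)
    finally show ?thesis using True by simp
  qed simp
  have "(\<integral>\<^sup>+y\<in>cube_set (Cube x r). ?e y \<partial>\<mu>) \<le> (\<integral>\<^sup>+y. ennreal (exp (\<tau> * JB A)) * indicator (cube_set (Cube x r)) y + (\<Sum>i. ?e y * indicator (?R i) y) \<partial>\<mu>)"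
  proof (rule nn_integral_mono_AE, use I(3) in eventually_elim)
    case (elim y)
    show ?case
    proof (cases "y \<in> cube_set (Cube x r) \<and> JB A < \<bar>f y - ?a\<bar>")
      case True
      then obtain i where i: "i \<in> I" "y \<in> cube_set (Cube (z i) (?d * \<rho> i))" using elim by blast
      have "?e y * indicator (cube_set (Cube x r)) y \<le> ?e y * indicator (?R i) y" using True i by simp
      also have "\<dots> \<le> (\<Sum>i. ?e y * indicator (?R i) y)" by (rule ennreal_le_suminf)
      finally show ?thesis by (simp add: add_increasing)
    next
      case False
      then have "?e y * indicator (cube_set (Cube x r)) y \<le> ennreal (exp (\<tau> * JB A)) * indicator (cube_set (Cube x r)) y"
        using \<tau> by (auto simp: indicator_def intro!: ennreal_leI)
      then show ?thesis by (simp add: add_increasing2)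
    qed
  qed
  also have "\<dots> = ennreal (exp (\<tau> * JB A)) * ennreal (mass x r) + (\<Sum>i. \<integral>\<^sup>+y\<in>?R i. ?e y \<partial>\<mu>)"
  proof -
    have Rm [measurable]: "?R i \<in> sets borel" for i by simp
    have [measurable]: "(\<lambda>y. ?e y * indicator (?R i) y) \<in> borel_measurable borel" for i by measurable
    show ?thesis
      by (subst nn_integral_add, unfold measurable_mu, measurable, subst nn_integral_suminf, unfold measurable_mu, measurable)
        (simp add: nn_integral_cmult_indicator emeasure_mass del: cube_set.simps)
  qed
  also have "(\<Sum>i. \<integral>\<^sup>+y\<in>?R i. ?e y \<partial>\<mu>) \<le> (\<Sum>i. ennreal (2 * X * bg) * (if i \<in> I then ennreal (mass (z i) (\<rho> i)) else 0))"
    by (intro suminf_le piece) auto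
  also have "\<dots> = ennreal (2 * X * bg) * (\<Sum>i. if i \<in> I then ennreal (mass (z i) (\<rho> i)) else 0)"
    by (rule ennreal_suminf_cmult)
  also have "\<dots> \<le> ennreal (2 * X * bg) * ennreal (mass x (2 * r) / (4 * bg))" using I(2)
    by (intro mult_left_mono) auto
  also have "\<dots> = ennreal (X / 2 * mass x (2 * r))" using X bg(1) by (simp add: ennreal_mult[symmetric])
  also have "ennreal (exp (\<tau> * JB A)) * ennreal (mass x r) \<le> ennreal (exp (\<tau> * JB A) * mass x (2 * r))"
    using mass_mono[of r "2 * r" x] r by (subst ennreal_mult[symmetric]) (auto intro!: ennreal_leI)
  also have "\<dots> + ennreal (X / 2 * mass x (2 * r)) = ennreal ((exp (\<tau> * JB A) + X / 2) * mass x (2 * r))"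
    using X by (subst ennreal_plus[symmetric]) (auto simp: algebra_simps)
  finally show ?thesis unfolding \<tau>_def by (simp add: add_left_mono add_right_mono)
qed

text \<open>Boundedness of \<open>f\<close> only serves to start the iteration; the resulting bound does not depend on \<open>M\<close>.\<close>

lemma john_nirenberg_bounded:
  assumes F: "osc_family f c A" and b: "\<And>x. \<bar>f x\<bar> \<le> M" "\<And>Q. \<bar>c Q\<bar> \<le> M"
    and x: "x \<in> msupport \<mu>" and r: "r > 0"
  shows "(\<integral>\<^sup>+z\<in>cube_set (Cube x r). ennreal (exp (J\<tau> A * \<bar>f z - c (Cube x r)\<bar>)) \<partial>\<mu>)
     \<le> ennreal ((2 * exp (J\<tau> A * JB A) + 1) * mass x (2 * r))"
proof -
  have A: "0 \<le> A" using F by (simp add: osc_family_def S_lipschitz_def)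
  define X0 where "X0 = exp (J\<tau> A * (2 * M))"
  define E where "E = exp (J\<tau> A * JB A)"
  have it: "(\<integral>\<^sup>+z\<in>cube_set (Cube x r). ennreal (exp (J\<tau> A * \<bar>f z - c (Cube x r)\<bar>)) \<partial>\<mu>)
     \<le> ennreal ((2 * E + X0 / 2 ^ j) * mass x (2 * r))" if "x \<in> msupport \<mu>" "r > 0" for j x r
    using that
  proof (induction j arbitrary: x r)
    case 0
    have "(\<integral>\<^sup>+z\<in>cube_set (Cube x r). ennreal (exp (J\<tau> A * \<bar>f z - c (Cube x r)\<bar>)) \<partial>\<mu>)
      \<le> (\<integral>\<^sup>+z. ennreal X0 * indicator (cube_set (Cube x r)) z \<partial>\<mu>)"
    proof (intro nn_integral_mono mult_right_mono ennreal_leI)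
      fix z
      have "\<bar>f z - c (Cube x r)\<bar> \<le> 2 * M" using b(1)[of z] b(2)[of "Cube x r"] by linarith
      then show "exp (J\<tau> A * \<bar>f z - c (Cube x r)\<bar>) \<le> X0"
        using J_pos(6)[OF A] unfolding X0_def exp_le_cancel_iff by (intro mult_left_mono) auto
    qed simp
    also have "\<dots> = ennreal (X0 * mass x r)"
      by (simp add: nn_integral_cmult_indicator emeasure_mass ennreal_mult X0_def del: cube_set.simps)
    also have "\<dots> \<le> ennreal ((2 * E + X0 / 2 ^ 0) * mass x (2 * r))"
      using mass_mono[of r "2 * r" x] 0 by (intro ennreal_leI mult_mono) (auto simp: E_def X0_def)
    finally show ?case .
  next
    case (Suc j)
    have "(\<integral>\<^sup>+z\<in>cube_set (Cube x r). ennreal (exp (J\<tau> A * \<bar>f z - c (Cube x r)\<bar>)) \<partial>\<mu>)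
      \<le> ennreal ((exp (J\<tau> A * JB A) + (2 * E + X0 / 2 ^ j) / 2) * mass x (2 * r))"
      by (rule john_nirenberg_step[OF F _ Suc.IH Suc.prems]) (auto simp: E_def X0_def)
    also have "exp (J\<tau> A * JB A) + (2 * E + X0 / 2 ^ j) / 2 = 2 * E + X0 / 2 ^ Suc j"
      unfolding E_def[symmetric] by (simp add: field_simps)
    finally show ?case .
  qed
  obtain j where j: "X0 < 2 ^ j" using real_arch_pow[of 2 X0] by auto
  have "(2 * E + X0 / 2 ^ j) * mass x (2 * r) \<le> (2 * E + 1) * mass x (2 * r)"
    using j by (intro mult_right_mono) auto
  then show ?thesis using it[OF x r, of j] unfolding E_def[symmetric] by (meson ennreal_leI order_trans)
qed

text \<open>The bound for bounded families is the same for all truncations, so Fatou's lemma removes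
  the truncation.\<close>

theorem john_nirenberg:
  assumes F: "osc_family f c A" and x: "x \<in> msupport \<mu>" and r: "r > 0"
  shows "(\<integral>\<^sup>+z\<in>cube_set (Cube x r). ennreal (exp (J\<tau> A * \<bar>f z - c (Cube x r)\<bar>)) \<partial>\<mu>)
     \<le> ennreal ((2 * exp (J\<tau> A * JB A) + 1) * mass x (2 * r))"
proof -
  have fm [measurable]: "f \<in> borel_measurable borel" using osc_family_measurable[OF F]
    by (simp add: measurable_mu)
  let ?g = "\<lambda>m z. ennreal (exp (J\<tau> A * \<bar>trunc m (f z) - trunc m (c (Cube x r))\<bar>)) * indicator (cube_set (Cube x r)) z"
  have "(\<integral>\<^sup>+z\<in>cube_set (Cube x r). ennreal (exp (J\<tau> A * \<bar>f z - c (Cube x r)\<bar>)) \<partial>\<mu>) = (\<integral>\<^sup>+z. liminf (\<lambda>m. ?g m z) \<partial>\<mu>)"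
  proof (intro nn_integral_cong)
    fix z
    have "(\<lambda>m. ?g m z) \<longlonglongrightarrow> ennreal (exp (J\<tau> A * \<bar>f z - c (Cube x r)\<bar>)) * indicator (cube_set (Cube x r)) z"
      by (cases "z \<in> cube_set (Cube x r)") (auto simp del: cube_set.simps intro!: tendsto_intros trunc_tendsto)
    then show "ennreal (exp (J\<tau> A * \<bar>f z - c (Cube x r)\<bar>)) * indicator (cube_set (Cube x r)) z = liminf (\<lambda>m. ?g m z)"
      by (intro lim_imp_Liminf[symmetric]) auto
  qed
  also have "\<dots> \<le> liminf (\<lambda>m. \<integral>\<^sup>+z. ?g m z \<partial>\<mu>)"
    by (intro nn_integral_liminf) (unfold measurable_mu, measurable)
  also have "\<dots> \<le> ennreal ((2 * exp (J\<tau> A * JB A) + 1) * mass x (2 * r))"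
  proof -
    have "(\<integral>\<^sup>+z. ?g m z \<partial>\<mu>) \<le> ennreal ((2 * exp (J\<tau> A * JB A) + 1) * mass x (2 * r))" for m
      by (rule john_nirenberg_bounded[OF osc_family_trunc[OF F] trunc_abs(2) trunc_abs(2) x r])
    then have "liminf (\<lambda>m. \<integral>\<^sup>+z. ?g m z \<partial>\<mu>) \<le> liminf (\<lambda>m::nat. ennreal ((2 * exp (J\<tau> A * JB A) + 1) * mass x (2 * r)))"
      by (intro Liminf_mono always_eventually allI)
    then show ?thesis by (simp add: Liminf_const)
  qed
  finally show ?thesis .
qed

text \<open>Along the cubes of side \<open>2 ^ k\<close> about \<open>base\<close> the numbers
  \<open>c\<close> grow at most linearly in \<open>k\<close>, so the exponential integrals grow at
  most like \<open>q ^ k\<close>. A sufficiently high power of the norm as weight compensates for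
  this.\<close>

theorem exp_integrable:
  assumes F: "osc_family f c A"
  shows "\<exists>\<tau>>0. \<exists>N::nat. (\<integral>\<^sup>+x. ennreal (exp (\<tau> * \<bar>f x\<bar>) / (exp 1 + norm x) ^ N) \<partial>\<mu>) < \<infinity>"
\<comment> \<open>If \<open>base\<close> is not in the support, the support is empty and
  \<open>\<mu>\<close> is zero.\<close>
proof (cases "base \<in> msupport \<mu>")
  case False
  then have "AE x in \<mu>. False" using AE_msupport base by (auto elim: eventually_mono)
  then have "(\<integral>\<^sup>+x. ennreal (exp (1 * \<bar>f x\<bar>) / (exp 1 + norm x) ^ 0) \<partial>\<mu>) = (\<integral>\<^sup>+x. 0 \<partial>\<mu>)"
    by (intro nn_integral_cong_AE) (auto elim: eventually_mono)
  then show ?thesis by (intro exI[of _ "1::real"] conjI exI[of _ "0::nat"]) auto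
next
  case x0: True
  have fm [measurable]: "f \<in> borel_measurable borel" using osc_family_measurable[OF F]
    by (simp add: measurable_mu)
  have L: "S_lipschitz c A" using F by (simp add: osc_family_def)
  have A: "0 \<le> A" using L by (simp add: S_lipschitz_def)
  define \<tau> where "\<tau> = J\<tau> A"
  have \<tau>: "\<tau> > 0" using J_pos(6)[OF A] by (simp add: \<tau>_def)
  define E where "E = 2 * exp (J\<tau> A * JB A) + 1"
  have E: "E > 0" by (simp add: E_def add_pos_pos)
  define R where "R k = Cube base (2 ^ k)" for k :: nat
  define K where "K = \<bar>c (R 0)\<bar> + A * Kc"
  define q where "q = exp (\<tau> * (A * Kc * C)) * 2 ^ n"
  define D where "D = exp (\<tau> * K) * E * (C * 2 ^ n)"
  have D: "0 \<le> D" using E C1 by (simp add: D_def)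
  have q: "0 < q" by (simp add: q_def)
  have onR: "(\<integral>\<^sup>+x\<in>cube_set (R k). ennreal (exp (\<tau> * \<bar>f x\<bar>)) \<partial>\<mu>) \<le> ennreal (D * q ^ k)" for k
  proof -
    have "\<bar>c (R 0) - c (R k)\<bar> \<le> A * (Kc * (1 + C * (level (2 ^ k) - level 1)))"
      unfolding R_def power_0 by (intro S_lipschitz_compare_levels L x0) (auto simp: infnorm_0)
    also have "level (2 ^ k) = level 1 + int k" using level_mult_power[of 1 k] by simp
    finally have "\<bar>c (R k)\<bar> \<le> K + A * Kc * C * k" by (simp add: K_def algebra_simps)
    then have "\<tau> * \<bar>c (R k)\<bar> \<le> \<tau> * (K + A * Kc * C * k)" using \<tau> by (intro mult_left_mono) auto
    then have "exp (\<tau> * \<bar>c (R k)\<bar>) \<le> exp (\<tau> * K + real k * (\<tau> * (A * Kc * C)))"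
      unfolding exp_le_cancel_iff by (simp add: algebra_simps)
    also have "\<dots> = exp (\<tau> * K) * exp (\<tau> * (A * Kc * C)) ^ k" by (simp add: exp_add exp_of_nat_mult)
    finally have ec: "exp (\<tau> * \<bar>c (R k)\<bar>) \<le> exp (\<tau> * K) * exp (\<tau> * (A * Kc * C)) ^ k" .
    have "(\<integral>\<^sup>+x\<in>cube_set (R k). ennreal (exp (\<tau> * \<bar>f x\<bar>)) \<partial>\<mu>)
      \<le> (\<integral>\<^sup>+x. ennreal (exp (\<tau> * \<bar>c (R k)\<bar>)) * (ennreal (exp (\<tau> * \<bar>f x - c (R k)\<bar>)) * indicator (cube_set (R k)) x) \<partial>\<mu>)"
    proof (intro nn_integral_mono)
      fix x
      have "exp (\<tau> * \<bar>f x\<bar>) \<le> exp (\<tau> * \<bar>c (R k)\<bar> + \<tau> * \<bar>f x - c (R k)\<bar>)"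
        unfolding exp_le_cancel_iff distrib_left[symmetric] using \<tau> by (intro mult_left_mono) auto
      then have "ennreal (exp (\<tau> * \<bar>f x\<bar>)) \<le> ennreal (exp (\<tau> * \<bar>c (R k)\<bar>)) * ennreal (exp (\<tau> * \<bar>f x - c (R k)\<bar>))"
        by (simp add: exp_add ennreal_mult[symmetric] ennreal_leI)
      then show "ennreal (exp (\<tau> * \<bar>f x\<bar>)) * indicator (cube_set (R k)) x
        \<le> ennreal (exp (\<tau> * \<bar>c (R k)\<bar>)) * (ennreal (exp (\<tau> * \<bar>f x - c (R k)\<bar>)) * indicator (cube_set (R k)) x)"
        by (simp add: indicator_def)
    qed
    also have "\<dots> = ennreal (exp (\<tau> * \<bar>c (R k)\<bar>)) * (\<integral>\<^sup>+x\<in>cube_set (R k). ennreal (exp (\<tau> * \<bar>f x - c (R k)\<bar>)) \<partial>\<mu>)"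
      by (rule nn_integral_cmult, unfold measurable_mu, measurable)
    also have "\<dots> \<le> ennreal (exp (\<tau> * \<bar>c (R k)\<bar>)) * ennreal (E * mass base (2 * 2 ^ k))"
      unfolding R_def \<tau>_def E_def by (intro mult_left_mono john_nirenberg F x0) auto
    also have "\<dots> = ennreal (exp (\<tau> * \<bar>c (R k)\<bar>) * (E * mass base (2 * 2 ^ k)))" using E
      by (subst ennreal_mult) auto
    also have "\<dots> \<le> ennreal (D * q ^ k)"
    proof (rule ennreal_leI)
      have "exp (\<tau> * \<bar>c (R k)\<bar>) * (E * mass base (2 * 2 ^ k)) \<le> (exp (\<tau> * K) * exp (\<tau> * (A * Kc * C)) ^ k) * (E * (C * (2 * 2 ^ k) ^ n))"
        using mass_le[OF x0, of "2 * 2 ^ k"] E by (intro mult_mono ec mult_left_mono) auto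
      also have "(2 * 2 ^ k) ^ n = (2::real) ^ n * (2 ^ n) ^ k"
        by (simp only: power_mult_distrib power_mult[symmetric] mult.commute[of k])
      also have "(exp (\<tau> * K) * exp (\<tau> * (A * Kc * C)) ^ k) * (E * (C * (2 ^ n * (2 ^ n) ^ k))) = D * q ^ k"
        unfolding D_def q_def power_mult_distrib by (simp only: mult_ac)
      finally show "exp (\<tau> * \<bar>c (R k)\<bar>) * (E * mass base (2 * 2 ^ k)) \<le> D * q ^ k" .
    qed
    finally show ?thesis .
  qed
  \<comment> \<open>Each dyadic step gains \<open>2 ^ N\<close> from the weight and loses
    \<open>q\<close>, so the terms of the series decay at least like
    \<open>(1/2) ^ k\<close>.\<close>
  obtain N where N: "2 * q < 2 ^ N" using real_arch_pow[of 2 "2 * q"] by auto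
  define B where "B = 4 * (1 + norm (base :: 'a))"
  have B: "4 \<le> B" by (simp add: B_def)
  have w: "2 ^ k \<le> B * (exp 1 + norm x)" if "k = 0 \<or> x \<notin> cube_set (R (k - 1))" for k x
  proof (cases k)
    case 0
    then show ?thesis using B mult_mono[of 1 B 1 "exp 1 + norm x"] by (simp add: add_increasing2)
  next
    case (Suc j)
    then have "2 ^ j / 2 < infnorm (x - base)" using that
      by (simp add: R_def mem_cube_set del: cube_set.simps)
    also have "\<dots> \<le> norm x + norm base"
      using infnorm_le_norm[of "x - base"] norm_triangle_ineq4[of x base] by linarith
    finally have "2 ^ k \<le> 4 * (norm x + norm base)" using Suc by simp
    also have "\<dots> \<le> 4 * (1 * norm x + norm base * norm x + 1 + norm base)" by (simp add: algebra_simps)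
    also have "\<dots> = B * (1 + norm x)" by (simp add: B_def algebra_simps)
    also have "\<dots> \<le> B * (exp 1 + norm x)" using B by (intro mult_left_mono) auto
    finally show ?thesis .
  qed
  have "(\<integral>\<^sup>+x. ennreal (exp (\<tau> * \<bar>f x\<bar>) / (exp 1 + norm x) ^ N) \<partial>\<mu>)
    \<le> (\<integral>\<^sup>+x. (\<Sum>k. ennreal (B ^ N / 2 ^ (k * N)) * (ennreal (exp (\<tau> * \<bar>f x\<bar>)) * indicator (cube_set (R k)) x)) \<partial>\<mu>)"
  proof (intro nn_integral_mono)
    fix x
    let ?g = "\<lambda>k. ennreal (B ^ N / 2 ^ (k * N)) * (ennreal (exp (\<tau> * \<bar>f x\<bar>)) * indicator (cube_set (R k)) x)"
    have "\<exists>k. x \<in> cube_set (R k)"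
    proof -
      obtain k where "2 * infnorm (x - base) < 2 ^ k" using real_arch_pow[of 2 "2 * infnorm (x - base)"]
        by auto
      then show ?thesis by (auto simp: R_def mem_cube_set simp del: cube_set.simps intro!: exI[of _ k])
    qed
    then obtain k where k: "x \<in> cube_set (R k)" "\<And>j. j < k \<Longrightarrow> x \<notin> cube_set (R j)"
      using exists_least_iff[of "\<lambda>k. x \<in> cube_set (R k)"] by blast
    have e: "exp 1 + norm x > 0" by (simp add: add_pos_nonneg)
    have "2 ^ k \<le> B * (exp 1 + norm x)" using k(2)[of "k - 1"] by (intro w) (cases k, auto)
    then have "(2 ^ k) ^ N \<le> (B * (exp 1 + norm x)) ^ N" by (intro power_mono) auto
    then have "1 / (exp 1 + norm x) ^ N \<le> B ^ N / 2 ^ (k * N)"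
      using e by (simp only: power_mult_distrib power_mult) (simp add: field_simps)
    then have "exp (\<tau> * \<bar>f x\<bar>) * (1 / (exp 1 + norm x) ^ N) \<le> exp (\<tau> * \<bar>f x\<bar>) * (B ^ N / 2 ^ (k * N))"
      by (intro mult_left_mono) auto
    then have "ennreal (exp (\<tau> * \<bar>f x\<bar>) / (exp 1 + norm x) ^ N) \<le> ennreal (B ^ N / 2 ^ (k * N) * exp (\<tau> * \<bar>f x\<bar>))"
      by (intro ennreal_leI) (simp add: mult.commute)
    also have "\<dots> = ?g k" using k(1) B by (subst ennreal_mult) (auto simp del: cube_set.simps)
    also have "\<dots> \<le> suminf ?g" by (rule ennreal_le_suminf)
    finally show "ennreal (exp (\<tau> * \<bar>f x\<bar>) / (exp 1 + norm x) ^ N) \<le> suminf ?g" .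
  qed
  also have "\<dots> = (\<Sum>k. ennreal (B ^ N / 2 ^ (k * N)) * (\<integral>\<^sup>+x\<in>cube_set (R k). ennreal (exp (\<tau> * \<bar>f x\<bar>)) \<partial>\<mu>))"
    by (subst nn_integral_suminf, unfold measurable_mu, measurable, subst nn_integral_cmult, unfold measurable_mu, measurable)
  also have "\<dots> \<le> (\<Sum>k. ennreal (B ^ N * D * (1/2) ^ k))"
  proof (intro suminf_le)
    fix k
    have "ennreal (B ^ N / 2 ^ (k * N)) * (\<integral>\<^sup>+x\<in>cube_set (R k). ennreal (exp (\<tau> * \<bar>f x\<bar>)) \<partial>\<mu>)
      \<le> ennreal (B ^ N / 2 ^ (k * N)) * ennreal (D * q ^ k)" by (intro mult_left_mono onR) auto
    also have "\<dots> = ennreal (B ^ N / 2 ^ (k * N) * (D * q ^ k))" using B D q by (subst ennreal_mult) auto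
    also have "\<dots> \<le> ennreal (B ^ N * D * (1/2) ^ k)"
    proof (rule ennreal_leI)
      have "(2 * q) ^ k \<le> (2 ^ N) ^ k" using N q by (intro power_mono) auto
      then have "q ^ k / 2 ^ (k * N) \<le> (1/2) ^ k"
        by (simp only: power_mult_distrib power_mult[symmetric] mult.commute[of N] power_one_over) (simp add: field_simps)
      then have "(B ^ N * D) * (q ^ k / 2 ^ (k * N)) \<le> (B ^ N * D) * (1/2) ^ k" using B D
        by (intro mult_left_mono) auto
      then show "B ^ N / 2 ^ (k * N) * (D * q ^ k) \<le> B ^ N * D * (1/2) ^ k" by (simp add: mult_ac)
    qed
    finally show "ennreal (B ^ N / 2 ^ (k * N)) * (\<integral>\<^sup>+x\<in>cube_set (R k). ennreal (exp (\<tau> * \<bar>f x\<bar>)) \<partial>\<mu>) \<le> ennreal (B ^ N * D * (1/2) ^ k)" .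
  qed auto
  also have "\<dots> = ennreal (\<Sum>k. B ^ N * D * (1/2) ^ k)"
    using B D by (intro suminf_ennreal2 summable_mult summable_geometric) auto
  also have "\<dots> < \<infinity>" by simp
  finally show ?thesis using \<tau> by blast
qed

end

section \<open>The Hardy--Orlicz estimate\<close>

lemma wp_ennreal: "0 \<le> t \<Longrightarrow> wp (ennreal t) = ennreal (t / ln (exp 1 + t))"
  by (simp add: wp_def)

lemma ln_exp1_ge: "0 \<le> (t::real) \<Longrightarrow> 1 \<le> ln (exp 1 + t)"
  using ln_mono[of "exp 1" "exp 1 + t"] by (simp add: add_pos_nonneg)

lemma wp_real_mono:
  assumes "0 \<le> s" "s \<le> t" shows "s / ln (exp 1 + s) \<le> t / ln (exp 1 + (t::real))"
proof -
  have p: "exp 1 + s > 0" "exp 1 + t > 0" using assms by (simp_all add: add_pos_nonneg)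
  have l: "1 \<le> ln (exp 1 + s)" "1 \<le> ln (exp 1 + t)" using assms by (simp_all add: ln_exp1_ge)
  have "ln (exp 1 + t) - ln (exp 1 + s) \<le> (t - s) / (exp 1 + s)"
  proof -
    have "ln (exp 1 + t) - ln (exp 1 + s) = ln ((exp 1 + t) / (exp 1 + s))" using p by (simp add: ln_div)
    also have "(exp 1 + t) / (exp 1 + s) = 1 + (t - s) / (exp 1 + s)" using p by (simp add: field_simps)
    also have "ln (1 + (t - s) / (exp 1 + s)) \<le> (t - s) / (exp 1 + s)" using p assms
      by (intro ln_add_one_self_le_self) auto
    finally show ?thesis .
  qed
  then have "s * (ln (exp 1 + t) - ln (exp 1 + s)) \<le> s * ((t - s) / (exp 1 + s))" using assms
    by (intro mult_left_mono) auto
  also have "\<dots> = (t - s) * (s / (exp 1 + s))" by simp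
  also have "\<dots> \<le> (t - s) * 1" using assms p by (intro mult_left_mono) (auto simp: field_simps)
  also have "\<dots> \<le> (t - s) * ln (exp 1 + s)" using assms l by (intro mult_left_mono) auto
  finally have "s * ln (exp 1 + t) \<le> t * ln (exp 1 + s)" by (simp add: algebra_simps)
  then show ?thesis using l by (simp add: field_simps)
qed

lemma wp_mono: assumes "s \<le> t" shows "wp s \<le> wp t"
proof (cases t)
  case (real t')
  then obtain s' where "s = ennreal s'" "0 \<le> s'" using assms by (cases s) (auto simp: top_unique)
  then show ?thesis using real assms wp_real_mono[of s' t'] by (simp add: wp_ennreal ennreal_leI)
qed (simp add: wp_def)

lemma wp_le: "wp t \<le> t"
proof (cases t)
  case (real r)
  then have "r / ln (exp 1 + r) \<le> r / 1" using ln_exp1_ge[of r] by (intro divide_left_mono) auto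
  then show ?thesis using real by (simp add: wp_ennreal ennreal_leI)
qed simp

text \<open>The ratio of \<open>wp t\<close> to \<open>t\<close> decreases, so each summand only
  gains when its own argument replaces the sum in the logarithm.\<close>

lemma wp_add: "wp (s + t) \<le> wp s + wp t"
proof (cases s)
  case s: (real s')
  show ?thesis
  proof (cases t)
    case t: (real t')
    have "s' / ln (exp 1 + (s' + t')) \<le> s' / ln (exp 1 + s')" "t' / ln (exp 1 + (s' + t')) \<le> t' / ln (exp 1 + t')"
      using s t ln_exp1_ge[of s'] ln_exp1_ge[of t']
        by (auto intro!: divide_left_mono ln_mono mult_pos_pos simp: add_pos_nonneg ln_exp1_ge less_le_trans[OF zero_less_one])
    then have "(s' + t') / ln (exp 1 + (s' + t')) \<le> s' / ln (exp 1 + s') + t' / ln (exp 1 + t')"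
      by (simp add: add_divide_distrib)
    then show ?thesis using s t ln_exp1_ge[of s'] ln_exp1_ge[of t']
      by (simp add: wp_ennreal ennreal_plus[symmetric] ennreal_leI del: ennreal_plus)
  qed (simp add: wp_def)
qed (simp add: wp_def)

lemma wp_scale: assumes "1 \<le> c" shows "wp (ennreal c * t) \<le> ennreal c * wp t"
proof (cases t)
  case (real r)
  have "r \<le> c * r" using real assms mult_right_mono[of 1 c r] by simp
  then have "ln (exp 1 + r) \<le> ln (exp 1 + c * r)" using real by (simp add: add_pos_nonneg)
  then have "c * r / ln (exp 1 + c * r) \<le> c * r / ln (exp 1 + r)"
    using real assms ln_exp1_ge[of r] by (intro divide_left_mono mult_pos_pos) auto
  then show ?thesis using real assms ln_exp1_ge[of r]
    by (simp add: wp_ennreal ennreal_mult[symmetric] ennreal_leI)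
next
  case top
  then show ?thesis using assms by (simp add: wp_def ennreal_mult_top)
qed

lemma wp_measurable [measurable]: "wp \<in> borel_measurable borel"
  unfolding wp_def[abs_def] by measurable

lemma wp_norm_le:
  assumes "0 < \<kappa>" "(\<integral>\<^sup>+x. wp (G x / ennreal \<kappa>) \<partial>m) \<le> 1" shows "wp_norm m G \<le> ennreal \<kappa>"
  unfolding wp_norm_def using assms by (intro Inf_lower) auto

context growth_space
begin

lemma nn_integral_log_weighted:
  assumes [measurable]: "g \<in> borel_measurable borel"
  shows "(\<integral>\<^sup>+x. g x \<partial>log_weighted \<mu>) = (\<integral>\<^sup>+x. ennreal (1 / ln (exp 1 + norm x)) * g x \<partial>\<mu>)"
  unfolding log_weighted_def by (subst nn_integral_density) (auto simp: measurable_mu)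

lemma log_weighted_le:
  assumes [measurable]: "g \<in> borel_measurable borel"
  shows "(\<integral>\<^sup>+x. g x \<partial>log_weighted \<mu>) \<le> (\<integral>\<^sup>+x. g x \<partial>\<mu>)"
proof -
  have "ennreal (1 / ln (exp 1 + norm x)) * g x \<le> 1 * g x" for x :: 'a
    using ln_exp1_ge[of "norm x"] by (intro mult_right_mono) (auto simp: ennreal_le_1)
  then show ?thesis by (subst nn_integral_log_weighted) (auto intro!: nn_integral_mono)
qed

lemma measurable_log_weighted: "g \<in> measurable (log_weighted \<mu>) N \<longleftrightarrow> g \<in> measurable borel N"
  unfolding log_weighted_def by (simp add: measurable_mu)

text \<open>Either \<open>f\<close> is at most \<open>K\<close> times one of the two logarithms, which then cancels it, or both
  \<open>f * g\<close> and \<open>y\<close> are dominated by powers of \<open>exp f\<close>.\<close>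

lemma wp_product_bound:
  fixes f g y \<tau> :: real and N :: nat
  assumes "0 \<le> g" "0 \<le> y" "0 \<le> f" "\<tau> > 0"
  defines "K \<equiv> (real N + 1) / \<tau>"
  shows "f * g / ln (exp 1 + f * g) / ln (exp 1 + y) \<le> K * g + exp (\<tau> * f) / (exp 1 + y) ^ N"
proof -
  have K: "K > 0" using assms by (simp add: K_def)
  define p q where "p = ln (exp 1 + f * g)" and "q = ln (exp 1 + y)"
  have pq: "1 \<le> p" "1 \<le> q" using assms by (simp_all add: p_def q_def ln_exp1_ge)
  have pos: "exp 1 + f * g > 0" "exp 1 + y > 0" using assms by (simp_all add: add_pos_nonneg)
  have lhs: "f * g / p / q = f * g / (p * q)" by simp
  show ?thesis
  proof (cases "f \<le> K * p \<or> f \<le> K * q")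
    case True
    have "f \<le> K * (p * q)"
    proof -
      have "K * p * 1 \<le> K * p * q" "K * q * 1 \<le> K * q * p" using K pq by (intro mult_left_mono; simp)+
      then show ?thesis using True by (auto simp: mult_ac)
    qed
    then have "f * g \<le> K * (p * q) * g" using assms by (intro mult_right_mono) auto
    then have "f * g / (p * q) \<le> K * g" using pq by (simp add: divide_le_eq mult_ac)
    moreover have "0 \<le> exp (\<tau> * f) / (exp 1 + y) ^ N" using pos by simp
    ultimately show ?thesis unfolding p_def[symmetric] q_def[symmetric] lhs by linarith
  next
    case False
    then have pK: "p < f / K" and qK: "q < f / K" using K by (simp_all add: field_simps)
    have "f * g * (exp 1 + y) ^ N \<le> exp p * exp q ^ N"
      using pos assms by (intro mult_mono) (auto simp: p_def q_def)
    also have "\<dots> \<le> exp (f / K) * exp (f / K) ^ N" using pK qK by (intro mult_mono power_mono) auto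
    also have "\<dots> = exp ((real N + 1) * (f / K))"
      by (simp add: exp_of_nat_mult[symmetric] exp_add[symmetric] algebra_simps)
    also have "(real N + 1) * (f / K) = \<tau> * f" using assms by (simp add: K_def)
    finally have fg: "f * g \<le> exp (\<tau> * f) / (exp 1 + y) ^ N" using pos by (simp add: le_divide_eq)
    have "1 * 1 \<le> p * q" using pq by (intro mult_mono) auto
    then have "f * g / (p * q) \<le> f * g / 1" using assms pq
      by (intro divide_left_mono mult_nonneg_nonneg) auto
    moreover have "0 \<le> K * g" using K assms by simp
    ultimately show ?thesis unfolding p_def[symmetric] q_def[symmetric] lhs using fg by linarith
  qed
qed

lemma product_orlicz:
  assumes [measurable]: "f \<in> borel_measurable borel" "G \<in> borel_measurable borel"
    and \<tau>: "\<tau> > 0" and e: "(\<integral>\<^sup>+x. ennreal (exp (\<tau> * \<bar>f x\<bar>) / (exp 1 + norm x) ^ N) \<partial>\<mu>) < \<infinity>"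
    and G: "(\<integral>\<^sup>+x. G x \<partial>\<mu>) < \<infinity>"
  shows "(\<integral>\<^sup>+x. wp (ennreal \<bar>f x\<bar> * G x) \<partial>log_weighted \<mu>) < \<infinity>"
proof -
  define K where "K = (real N + 1) / \<tau>"
  have K: "K > 0" using \<tau> by (simp add: K_def)
  have "(\<integral>\<^sup>+x. wp (ennreal \<bar>f x\<bar> * G x) \<partial>log_weighted \<mu>) = (\<integral>\<^sup>+x. ennreal (1 / ln (exp 1 + norm x)) * wp (ennreal \<bar>f x\<bar> * G x) \<partial>\<mu>)"
    by (rule nn_integral_log_weighted) measurable
  also have "\<dots> \<le> (\<integral>\<^sup>+x. ennreal K * G x + ennreal (exp (\<tau> * \<bar>f x\<bar>) / (exp 1 + norm x) ^ N) \<partial>\<mu>)"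
  proof (rule nn_integral_mono)
    fix x
    show "ennreal (1 / ln (exp 1 + norm x)) * wp (ennreal \<bar>f x\<bar> * G x) \<le> ennreal K * G x + ennreal (exp (\<tau> * \<bar>f x\<bar>) / (exp 1 + norm x) ^ N)"
    proof (cases "G x")
      case (real g)
      have n: "exp 1 + norm x > 0" "1 \<le> ln (exp 1 + norm x)" "1 \<le> ln (exp 1 + \<bar>f x\<bar> * g)"
        using real by (simp_all add: add_pos_nonneg ln_exp1_ge)
      have "ennreal (1 / ln (exp 1 + norm x)) * wp (ennreal \<bar>f x\<bar> * G x) = ennreal (1 / ln (exp 1 + norm x)) * wp (ennreal (\<bar>f x\<bar> * g))"
        using real by (simp add: ennreal_mult)
      also have "\<dots> = ennreal (1 / ln (exp 1 + norm x)) * ennreal (\<bar>f x\<bar> * g / ln (exp 1 + \<bar>f x\<bar> * g))"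
        using real by (subst wp_ennreal) auto
      also have "\<dots> = ennreal (\<bar>f x\<bar> * g / ln (exp 1 + \<bar>f x\<bar> * g) / ln (exp 1 + norm x))"
      proof -
        have "0 \<le> 1 / ln (exp 1 + norm x)" "0 \<le> \<bar>f x\<bar> * g / ln (exp 1 + \<bar>f x\<bar> * g)" using n real
          by (intro divide_nonneg_nonneg; linarith | simp)+
        from ennreal_mult[OF this, symmetric]
        have "ennreal (1 / ln (exp 1 + norm x)) * ennreal (\<bar>f x\<bar> * g / ln (exp 1 + \<bar>f x\<bar> * g))
          = ennreal (1 / ln (exp 1 + norm x) * (\<bar>f x\<bar> * g / ln (exp 1 + \<bar>f x\<bar> * g)))" .
        then show ?thesis by (simp add: mult.commute[of "ln (exp 1 + norm x)"])
      qed
      also have "\<dots> \<le> ennreal (K * g + exp (\<tau> * \<bar>f x\<bar>) / (exp 1 + norm x) ^ N)"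
        unfolding K_def using real \<tau> by (intro ennreal_leI wp_product_bound) auto
      also have "\<dots> = ennreal K * G x + ennreal (exp (\<tau> * \<bar>f x\<bar>) / (exp 1 + norm x) ^ N)"
        using real K n by (subst ennreal_plus) (auto simp: ennreal_mult)
      finally show ?thesis .
    qed (use K in \<open>simp add: ennreal_mult_top\<close>)
  qed
  also have "\<dots> = ennreal K * (\<integral>\<^sup>+x. G x \<partial>\<mu>) + (\<integral>\<^sup>+x. ennreal (exp (\<tau> * \<bar>f x\<bar>) / (exp 1 + norm x) ^ N) \<partial>\<mu>)"
    by (subst nn_integral_add, unfold measurable_mu, measurable, subst nn_integral_cmult, unfold measurable_mu, measurable)
  also have "\<dots> < \<infinity>" using e G by (simp add: ennreal_mult_less_top)
  finally show ?thesis .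
qed

text \<open>Finiteness and smallness of the norm are both read off from integrals of
  \<open>wp\<close>: dominated convergence brings the integral below 1, with \<open>U i\<close>
  being either \<open>V\<close> divided by growing constants or rescaled tails of a series.\<close>

lemma wp_dominated:
  fixes U :: "nat \<Rightarrow> 'a \<Rightarrow> ennreal"
  assumes [measurable]: "\<And>i. U i \<in> borel_measurable borel" "V \<in> borel_measurable borel"
    and V: "(\<integral>\<^sup>+x. wp (V x) \<partial>log_weighted \<mu>) < \<infinity>"
    and le: "\<And>i x. U i x \<le> V x" and lim: "\<And>x. V x < \<infinity> \<Longrightarrow> (\<lambda>i. U i x) \<longlonglongrightarrow> 0"
  shows "\<exists>i. (\<integral>\<^sup>+x. wp (U i x) \<partial>log_weighted \<mu>) \<le> 1"
proof -
  have "(\<lambda>i. \<integral>\<^sup>+x. wp (U i x) \<partial>log_weighted \<mu>) \<longlonglongrightarrow> (\<integral>\<^sup>+x. 0 \<partial>log_weighted \<mu>)"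
  proof (rule nn_integral_dominated_convergence[where w = "\<lambda>x. wp (V x)"])
    have "AE x in log_weighted \<mu>. wp (V x) \<noteq> \<infinity>"
      using V by (intro nn_integral_PInf_AE) (auto simp: measurable_log_weighted)
    then show "AE x in log_weighted \<mu>. (\<lambda>i. wp (U i x)) \<longlonglongrightarrow> 0"
    proof eventually_elim
      case (elim x)
      then have "(\<lambda>i. U i x) \<longlonglongrightarrow> 0" by (intro lim) (auto simp: wp_def less_top split: if_splits)
      with tendsto_const show ?case
        by (rule tendsto_sandwich[rotated 2]) (auto intro: wp_le always_eventually)
    qed
  qed (use V le in \<open>auto simp: measurable_log_weighted intro!: wp_mono\<close>)
  then have "eventually (\<lambda>i. (\<integral>\<^sup>+x. wp (U i x) \<partial>log_weighted \<mu>) < 1) sequentially"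
    by (intro order_tendstoD(2)) auto
  then show ?thesis by (auto simp: eventually_sequentially intro: less_imp_le)
qed

lemma wp_div_finite:
  assumes [measurable]: "V \<in> borel_measurable borel" and V: "(\<integral>\<^sup>+x. wp (V x) \<partial>log_weighted \<mu>) < \<infinity>" and \<kappa>: "\<kappa> > 0"
  shows "(\<integral>\<^sup>+x. wp (V x / ennreal \<kappa>) \<partial>log_weighted \<mu>) < \<infinity>"
proof -
  define m where "m = max 1 (1 / \<kappa>)"
  have m: "1 \<le> m" "1 / \<kappa> \<le> m" by (auto simp: m_def)
  have "wp (V x / ennreal \<kappa>) \<le> ennreal m * wp (V x)" for x
  proof -
    have "V x / ennreal \<kappa> = ennreal (1 / \<kappa>) * V x" using \<kappa>
      by (simp add: divide_ennreal_def inverse_ennreal inverse_eq_divide mult.commute)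
    also have "\<dots> \<le> ennreal m * V x" using m by (intro mult_right_mono ennreal_leI) auto
    finally show ?thesis using wp_scale[OF m(1), of "V x"] wp_mono order_trans by blast
  qed
  then have "(\<integral>\<^sup>+x. wp (V x / ennreal \<kappa>) \<partial>log_weighted \<mu>) \<le> (\<integral>\<^sup>+x. ennreal m * wp (V x) \<partial>log_weighted \<mu>)"
    by (intro nn_integral_mono)
  also have "\<dots> = ennreal m * (\<integral>\<^sup>+x. wp (V x) \<partial>log_weighted \<mu>)"
    by (intro nn_integral_cmult) (simp add: measurable_log_weighted)
  also have "\<dots> < \<infinity>" using V by (simp add: ennreal_mult_less_top)
  finally show ?thesis .
qed

lemma wp_norm_finite:
  assumes [measurable]: "V \<in> borel_measurable borel" and V: "(\<integral>\<^sup>+x. wp (V x) \<partial>log_weighted \<mu>) < \<infinity>"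
  shows "wp_norm (log_weighted \<mu>) V < \<infinity>"
proof -
  have div: "V x / ennreal (real (Suc i)) = ennreal (1 / real (Suc i)) * V x" for i x
    by (simp add: divide_ennreal_def inverse_ennreal inverse_eq_divide mult.commute del: of_nat_Suc)
  have "\<exists>i. (\<integral>\<^sup>+x. wp (V x / ennreal (real (Suc i))) \<partial>log_weighted \<mu>) \<le> 1"
  proof (rule wp_dominated[OF _ assms])
    show "V x / ennreal (real (Suc i)) \<le> V x" for i x
      unfolding div using mult_right_mono[of "ennreal (1 / real (Suc i))" 1 "V x"]
        by (simp add: ennreal_le_1 field_simps)
    show "(\<lambda>i. V x / ennreal (real (Suc i))) \<longlonglongrightarrow> 0" if "V x < \<infinity>" for x
    proof -
      obtain v where v: "V x = ennreal v" "0 \<le> v" using \<open>V x < \<infinity>\<close> by (cases "V x") auto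
      have "(\<lambda>i. ennreal (1 / real (Suc i) * v)) \<longlonglongrightarrow> ennreal (0 * v)"
        by (intro tendsto_ennrealI tendsto_mult_right LIMSEQ_Suc[OF lim_1_over_n])
      moreover have "ennreal (1 / real (Suc i) * v) = ennreal (1 / real (Suc i)) * ennreal v" for i
        using v(2) by (intro ennreal_mult) auto
      ultimately show ?thesis unfolding div unfolding v(1) by (simp only: mult_zero_left ennreal_0)
    qed
  qed measurable
  then obtain i where "(\<integral>\<^sup>+x. wp (V x / ennreal (real (Suc i))) \<partial>log_weighted \<mu>) \<le> 1" by blast
  then have "wp_norm (log_weighted \<mu>) V \<le> ennreal (real (Suc i))" by (intro wp_norm_le) auto
  also have "\<dots> < \<infinity>" by simp
  finally show ?thesis .
qed

lemma wp_norm_mono: assumes "\<And>x. U x \<le> V x" shows "wp_norm m U \<le> wp_norm m V"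
proof -
  have "(\<integral>\<^sup>+x. wp (U x / ennreal k) \<partial>m) \<le> (\<integral>\<^sup>+x. wp (V x / ennreal k) \<partial>m)" for k
    by (intro nn_integral_mono wp_mono divide_right_mono_ennreal assms)
  then show ?thesis unfolding wp_norm_def by (intro Inf_superset_mono) (blast intro: order_trans)
qed

text \<open>The difference of two partial sums beyond \<open>N\<close> has its maximal function
  below the tail of \<open>W\<close> after \<open>N\<close>, which tends to 0 wherever
  \<open>W\<close> is finite, hence almost everywhere for the weighted measure.\<close>

lemma hardy_orlicz_series:
  fixes b :: "nat \<Rightarrow> 'a \<Rightarrow> real" and a :: "nat \<Rightarrow> real"
  assumes b: "\<And>j. integrable \<mu> (b j)"
    and V: "(\<integral>\<^sup>+x. wp (\<Sum>j. ennreal \<bar>a j\<bar> * maximal_fun \<mu> n (b j) x) \<partial>log_weighted \<mu>) < \<infinity>"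
  defines "g \<equiv> \<lambda>k x. \<Sum>j<k. a j * b j x"
  shows "g k \<in> hardy_orlicz \<mu> n"
    and "\<epsilon> > 0 \<Longrightarrow> \<exists>N. \<forall>k\<ge>N. \<forall>l\<ge>N. hardy_orlicz_norm \<mu> n (\<lambda>x. g k x - g l x) < \<epsilon>"
proof -
  define v where "v j x = ennreal \<bar>a j\<bar> * maximal_fun \<mu> n (b j) x" for j x
  define W where "W x = (\<Sum>j. v j x)" for x
  have vm [measurable]: "v j \<in> borel_measurable borel" for j unfolding v_def by measurable
  have Wm [measurable]: "W \<in> borel_measurable borel" unfolding W_def by measurable
  have W: "(\<integral>\<^sup>+x. wp (W x) \<partial>log_weighted \<mu>) < \<infinity>" using V by (simp add: W_def v_def)
  have part: "(\<Sum>j\<in>J. v j x) \<le> W x" if "finite J" for J x unfolding W_def using that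
    by (intro sum_le_suminf) auto
  show "g k \<in> hardy_orlicz \<mu> n"
  proof -
    have "integrable \<mu> (g k)" unfolding g_def using b
      by (intro Bochner_Integration.integrable_sum integrable_mult_right) auto
    then have "g k \<in> L1loc \<mu>" by (rule integrable_L1loc)
    moreover have "maximal_fun \<mu> n (g k) x \<le> W x" for x
      using maximal_sum[of "{..<k}" b a x] part[of "{..<k}" x] b unfolding g_def v_def
        by (auto intro: order_trans)
    then have "wp_norm (log_weighted \<mu>) (maximal_fun \<mu> n (g k)) < \<infinity>"
      using wp_norm_mono[of "maximal_fun \<mu> n (g k)" W "log_weighted \<mu>"] wp_norm_finite[OF Wm W]
        by (auto intro: le_less_trans)
    ultimately show ?thesis by (simp add: hardy_orlicz_def Lwp_def measurable_log_weighted)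
  qed
  assume "\<epsilon> > 0"
  then obtain \<kappa> :: real where \<kappa>: "\<kappa> > 0" "ennreal \<kappa> < \<epsilon>"
  proof -
    obtain r :: ennreal where r: "0 < r" "r < \<epsilon>" using dense \<open>\<epsilon> > 0\<close> by blast
    then obtain s where "r = ennreal s" "0 \<le> s" by (cases r) auto
    then show ?thesis using r that[of s] by (cases "s = 0") auto
  qed
  let ?U = "\<lambda>N x. (W x - (\<Sum>j<N. v j x)) / ennreal \<kappa>"
  have "\<exists>N. (\<integral>\<^sup>+x. wp (?U N x) \<partial>log_weighted \<mu>) \<le> 1"
  proof (rule wp_dominated[OF _ _ wp_div_finite[OF Wm W \<kappa>(1)]])
    show "?U N x \<le> W x / ennreal \<kappa>" for N x by (intro divide_right_mono_ennreal) simp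
    show "(\<lambda>N. ?U N x) \<longlonglongrightarrow> 0" if "W x / ennreal \<kappa> < \<infinity>" for x
    proof -
      have fin: "W x < \<infinity>" using that by (cases "W x = top") (auto simp: ennreal_top_divide less_top)
      have "(\<lambda>N. \<Sum>j<N. v j x) \<longlonglongrightarrow> W x" unfolding W_def by (intro summable_LIMSEQ) auto
      then have "(\<lambda>N. W x - (\<Sum>j<N. v j x)) \<longlonglongrightarrow> W x - W x" using fin
        by (intro tendsto_diff_ennreal tendsto_const) auto
      then have "(\<lambda>N. inverse (ennreal \<kappa>) * (W x - (\<Sum>j<N. v j x))) \<longlonglongrightarrow> inverse (ennreal \<kappa>) * (W x - W x)"
        using \<kappa>(1) by (intro ennreal_tendsto_cmult) (auto simp: inverse_ennreal)
      then show ?thesis using fin by (simp add: divide_ennreal_def mult.commute)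
    qed
  qed measurable
  then obtain N where N: "(\<integral>\<^sup>+x. wp (?U N x) \<partial>log_weighted \<mu>) \<le> 1" by blast
  have "hardy_orlicz_norm \<mu> n (\<lambda>x. g k x - g l x) < \<epsilon>" if kl: "N \<le> k" "N \<le> l" for k l
  proof -
    define J where "J = {min k l..<max k l}"
    \<comment> \<open>The sign makes one formula serve both orders of \<open>k\<close> and
      \<open>l\<close>; it disappears in the absolute value.\<close>
    define e where "e = (\<lambda>j. if l \<le> k then a j else - a j)"
    have diff: "(\<lambda>x. g k x - g l x) = (\<lambda>x. \<Sum>j\<in>J. e j * b j x)"
    proof
      fix x
      have s: "(\<Sum>j<q. a j * b j x) - (\<Sum>j<p. a j * b j x) = (\<Sum>j\<in>{p..<q}. a j * b j x)" if "p \<le> q" for p q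
        using sum_diff_nat_ivl[of 0 p q "\<lambda>j. a j * b j x"] that by (simp add: atLeast0LessThan)
      show "g k x - g l x = (\<Sum>j\<in>J. e j * b j x)"
      proof (cases "l \<le> k")
        case True
        then show ?thesis using s[of l k] by (simp add: g_def J_def e_def)
      next
        case False
        then show ?thesis using s[of k l] by (simp add: g_def J_def e_def sum_negf)
      qed
    qed
    have "AE x in log_weighted \<mu>. wp (W x) \<noteq> \<infinity>"
      using W by (intro nn_integral_PInf_AE) (auto simp: measurable_log_weighted)
    then have "AE x in log_weighted \<mu>. wp (maximal_fun \<mu> n (\<lambda>x. g k x - g l x) x / ennreal \<kappa>) \<le> wp (?U N x)"
    proof eventually_elim
      case (elim x)
      then have fin: "W x < \<infinity>" by (auto simp: wp_def less_top split: if_splits)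
      have "maximal_fun \<mu> n (\<lambda>x. g k x - g l x) x \<le> (\<Sum>j\<in>J. ennreal \<bar>e j\<bar> * maximal_fun \<mu> n (b j) x)"
        unfolding diff using b by (intro maximal_sum) (auto simp: J_def)
      also have "\<dots> = (\<Sum>j\<in>J. v j x)" by (intro sum.cong) (auto simp: v_def e_def)
      \<comment> \<open>Cancelling the initial sum is legitimate because it is bounded by
        \<open>W x\<close>, which is finite at this point.\<close>
      also have "\<dots> = ((\<Sum>j\<in>J. v j x) + (\<Sum>j<N. v j x)) - (\<Sum>j<N. v j x)"
        by (subst ennreal_add_diff_cancel_right) (use le_less_trans[OF part[of "{..<N}" x] fin] in \<open>auto simp only: less_top infinity_ennreal_def finite_lessThan\<close>)
      also have "(\<Sum>j\<in>J. v j x) + (\<Sum>j<N. v j x) = (\<Sum>j\<in>J \<union> {..<N}. v j x)"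
        using kl by (intro sum.union_disjoint[symmetric]) (auto simp: J_def)
      also have "\<dots> - (\<Sum>j<N. v j x) \<le> W x - (\<Sum>j<N. v j x)"
        by (intro ennreal_minus_mono part) (auto simp: J_def)
      finally show ?case by (intro wp_mono divide_right_mono_ennreal)
    qed
    from order_trans[OF nn_integral_mono_AE[OF this] N]
    have "wp_norm (log_weighted \<mu>) (maximal_fun \<mu> n (\<lambda>x. g k x - g l x)) \<le> ennreal \<kappa>"
      by (rule wp_norm_le[OF \<kappa>(1)])
    then show ?thesis unfolding hardy_orlicz_norm_def using \<kappa>(2) by (rule le_less_trans)
  qed
  then show "\<exists>N. \<forall>k\<ge>N. \<forall>l\<ge>N. hardy_orlicz_norm \<mu> n (\<lambda>x. g k x - g l x) < \<epsilon>" by blast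
qed

text \<open>The coefficients \<open>c (R l)\<close> have no common bound; pointwise, each is at most
  \<open>|f x| + |f x - c (R l)|\<close>. The first part can be taken out of the sum, and the second
  is integrable against the maximal function of its own block.\<close>

lemma product_majorant:
  assumes f: "osc_family f c A" and sb: "\<And>l. simple_block D (P l) (R l) (t l) (\<beta> l)" and t: "summable t"
  shows "(\<integral>\<^sup>+x. wp (\<Sum>l. ennreal \<bar>c (R l)\<bar> * maximal_fun \<mu> n (\<beta> l) x) \<partial>log_weighted \<mu>) < \<infinity>"
proof -
  have fm [measurable]: "f \<in> borel_measurable borel" using osc_family_measurable[OF f]
    by (simp add: measurable_mu)
  let ?M = "\<lambda>l. maximal_fun \<mu> n (\<beta> l)"
  define G where "G x = (\<Sum>l. ?M l x)" for x
  define E where "E x = (\<Sum>l. ennreal \<bar>f x - c (R l)\<bar> * ?M l x)" for x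
  have Gm [measurable]: "G \<in> borel_measurable borel" and Em [measurable]: "E \<in> borel_measurable borel"
    unfolding G_def E_def by measurable
  have t0: "0 \<le> t l" for l using sb[of l] by (simp add: simple_block_def)
  have fin: "(\<Sum>l. ennreal (B * t l)) < \<infinity>" for B
  proof -
    have "(\<Sum>l. ennreal (B * t l)) \<le> (\<Sum>l. ennreal (\<bar>B\<bar> * t l))" using t0
      by (intro suminf_le ennreal_leI mult_right_mono) auto
    also have "\<dots> = ennreal (\<Sum>l. \<bar>B\<bar> * t l)" using t t0 by (intro suminf_ennreal2 summable_mult) auto
    finally show ?thesis by (auto intro: le_less_trans)
  qed
  have "(\<integral>\<^sup>+x. G x \<partial>\<mu>) = (\<Sum>l. \<integral>\<^sup>+x. ?M l x \<partial>\<mu>)" unfolding G_def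
    by (intro nn_integral_suminf) (simp add: measurable_mu)
  also have "\<dots> \<le> (\<Sum>l. ennreal (Bs 1 D * t l))" using sb by (intro suminf_le simple_block_maximal_L1) auto
  finally have G: "(\<integral>\<^sup>+x. G x \<partial>\<mu>) < \<infinity>" using fin[of "Bs 1 D"] by (rule le_less_trans)
  have "(\<integral>\<^sup>+x. E x \<partial>\<mu>) = (\<Sum>l. \<integral>\<^sup>+x. ennreal \<bar>f x - c (R l)\<bar> * ?M l x \<partial>\<mu>)"
    unfolding E_def by (intro nn_integral_suminf) (unfold measurable_mu, measurable)
  also have "\<dots> \<le> (\<Sum>l. ennreal (Bs A D * t l))" using sb f by (intro suminf_le simple_block_osc) auto
  finally have E: "(\<integral>\<^sup>+x. E x \<partial>\<mu>) < \<infinity>" using fin[of "Bs A D"] by (rule le_less_trans)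
  obtain \<tau> N where \<tau>: "\<tau> > 0" "(\<integral>\<^sup>+x. ennreal (exp (\<tau> * \<bar>f x\<bar>) / (exp 1 + norm x) ^ N) \<partial>\<mu>) < \<infinity>"
    using exp_integrable[OF f] by blast
  have le: "(\<Sum>l. ennreal \<bar>c (R l)\<bar> * ?M l x) \<le> ennreal \<bar>f x\<bar> * G x + E x" for x
  proof -
    have "(\<Sum>l. ennreal \<bar>c (R l)\<bar> * ?M l x) \<le> (\<Sum>l. ennreal \<bar>f x\<bar> * ?M l x + ennreal \<bar>f x - c (R l)\<bar> * ?M l x)"
    proof (intro suminf_le)
      fix l
      have "ennreal \<bar>c (R l)\<bar> \<le> ennreal \<bar>f x\<bar> + ennreal \<bar>f x - c (R l)\<bar>"
        using ennreal_leI[of "\<bar>c (R l)\<bar>" "\<bar>f x\<bar> + \<bar>f x - c (R l)\<bar>"] by simp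
      then show "ennreal \<bar>c (R l)\<bar> * ?M l x \<le> ennreal \<bar>f x\<bar> * ?M l x + ennreal \<bar>f x - c (R l)\<bar> * ?M l x"
        unfolding distrib_right[symmetric] by (rule mult_right_mono) simp
    qed auto
    also have "\<dots> = ennreal \<bar>f x\<bar> * G x + E x" unfolding G_def E_def by (subst suminf_add[symmetric]) auto
    finally show ?thesis .
  qed
  have "wp (\<Sum>l. ennreal \<bar>c (R l)\<bar> * ?M l x) \<le> wp (ennreal \<bar>f x\<bar> * G x) + E x" for x
    using wp_mono[OF le[of x]] wp_add[of "ennreal \<bar>f x\<bar> * G x" "E x"] add_left_mono[OF wp_le[of "E x"]]
      by (meson order_trans)
  then have "(\<integral>\<^sup>+x. wp (\<Sum>l. ennreal \<bar>c (R l)\<bar> * ?M l x) \<partial>log_weighted \<mu>)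
     \<le> (\<integral>\<^sup>+x. wp (ennreal \<bar>f x\<bar> * G x) + E x \<partial>log_weighted \<mu>)"
    by (intro nn_integral_mono)
  also have "\<dots> = (\<integral>\<^sup>+x. wp (ennreal \<bar>f x\<bar> * G x) \<partial>log_weighted \<mu>) + (\<integral>\<^sup>+x. E x \<partial>log_weighted \<mu>)"
    by (rule nn_integral_add) (unfold measurable_log_weighted, measurable)
  also have "\<dots> < \<infinity>" using product_orlicz[OF fm Gm \<tau> G] log_weighted_le[OF Em] E
    by (auto intro: le_less_trans)
  finally show ?thesis .
qed

lemma hardy_part:
  assumes f: "osc_family f c A" and hm: "h \<in> borel_measurable borel" and sb: "\<And>l. simple_block D (P l) (R l) (t l) (\<beta> l)" and t: "summable t"
    and d: "atb_decomposition \<mu> n h \<beta> R s"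
  shows "hardy_orlicz_dist \<mu> n (\<lambda>\<phi>. \<Sum>j. \<integral>x. c (R j) * \<beta> j x * \<phi> x \<partial>\<mu>)"
proof -
  let ?T = "\<lambda>\<phi>. \<Sum>j. \<integral>x. c (R j) * \<beta> j x * \<phi> x \<partial>\<mu>"
  have b: "integrable \<mu> (\<beta> j)" for j using sb[of j] by (simp add: simple_block_def)
  note V = product_majorant[OF f sb t]
  note ho = hardy_orlicz_series[of \<beta> "\<lambda>j. c (R j)", OF b V]
  note ds = product_distributions(2)[OF d hm f]
  have dl: "dist_limit \<mu> (\<lambda>k x. \<Sum>j<k. c (R j) * \<beta> j x) ?T"
    unfolding dist_limit_def
  proof (intro conjI allI ballI)
    show "(\<lambda>x. \<Sum>j<k. c (R j) * \<beta> j x) \<in> L1loc \<mu>" for k using ho(1)[of k] by (simp add: hardy_orlicz_def)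
    show "is_distribution ?T" using ds by (simp add: dist_sums_def)
    fix \<phi> :: "'a \<Rightarrow> real" assume \<phi>: "\<phi> \<in> test_functions"
    obtain K M where K: "lip_test K M \<phi>" using test_lip_test_ex[OF \<phi>] by blast
    have i: "integrable \<mu> (\<lambda>x. c (R j) * \<beta> j x * \<phi> x)" for j using b
      by (intro lip_test_integrable[OF _ K]) auto
    have "(\<integral>x. (\<Sum>j<k. c (R j) * \<beta> j x) * \<phi> x \<partial>\<mu>) = (\<Sum>j<k. \<integral>x. c (R j) * \<beta> j x * \<phi> x \<partial>\<mu>)" for k
      unfolding sum_distrib_right using i by (intro Bochner_Integration.integral_sum) auto
    moreover have "(\<lambda>j. \<integral>x. c (R j) * \<beta> j x * \<phi> x \<partial>\<mu>) sums ?T \<phi>" using ds \<phi> by (simp add: dist_sums_def)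
    ultimately show "(\<lambda>k. \<integral>x. (\<Sum>j<k. c (R j) * \<beta> j x) * \<phi> x \<partial>\<mu>) \<longlonglongrightarrow> ?T \<phi>" by (simp add: sums_def)
  qed
  show ?thesis unfolding hardy_orlicz_dist_def
    by (rule exI, intro conjI allI impI) (rule ho dl | assumption)+
qed

lemma L1_part:
  assumes f: "osc_family f c A" and d: "atb_decomposition \<mu> n h b R s"
  shows "\<exists>u. integrable \<mu> u \<and> (\<forall>\<phi>\<in>test_functions. (\<integral>x. u x * \<phi> x \<partial>\<mu>) = (\<Sum>j. \<integral>x. (f x - c (R j)) * b j x * \<phi> x \<partial>\<mu>))"
proof -
  let ?g = "\<lambda>j x. (f x - c (R j)) * b j x"
  have A: "0 \<le> A" using f by (simp add: osc_family_def S_lipschitz_def)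
  have ab: "atomic_block \<mu> n (R j) (b j) (s j)" for j using d by (simp add: atb_decomposition_def)
  have ss: "summable s" using d by (simp add: atb_decomposition_def)
  note bp = block_products[OF f ab]
  have s0: "0 \<le> s j" for j using block_s_nonneg[OF ab] .
  have gm [measurable]: "?g j \<in> borel_measurable \<mu>" for j using bp(1)
    by (rule borel_measurable_integrable)
  have ss2: "summable (\<lambda>j. B * s j)" for B using ss by (rule summable_mult)
  have nn: "0 \<le> 2 * A * s j" for j using A s0 by simp
  note S = L1_series[OF gm bp(4) ss2 nn]
  show ?thesis
  proof (intro exI[of _ "\<lambda>x. \<Sum>j. ?g j x"] conjI ballI S(3))
    fix \<phi> :: "'a \<Rightarrow> real" assume \<phi>: "\<phi> \<in> test_functions"
    obtain K M where K: "lip_test K M \<phi>" using test_lip_test_ex[OF \<phi>] by blast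
    have pm [measurable]: "\<phi> \<in> borel_measurable \<mu>" using lip_test_measurable[OF K]
      by (simp add: measurable_mu)
    have M: "\<bar>\<phi> x\<bar> \<le> M" for x using K by (simp add: lip_test_def)
    have M0: "0 \<le> M" using M[of undefined] by linarith
    have bd: "(\<integral>\<^sup>+x. ennreal \<bar>?g j x * \<phi> x\<bar> \<partial>\<mu>) \<le> ennreal (M * (2 * A) * s j)" for j
    proof -
      have "(\<integral>\<^sup>+x. ennreal \<bar>?g j x * \<phi> x\<bar> \<partial>\<mu>) \<le> (\<integral>\<^sup>+x. ennreal M * ennreal \<bar>?g j x\<bar> \<partial>\<mu>)"
        using M M0 by (intro nn_integral_mono) (auto simp: ennreal_mult[symmetric] abs_mult intro!: ennreal_leI mult_right_mono simp: mult.commute[of _ "\<bar>\<phi> _\<bar>"])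
      also have "\<dots> = ennreal M * (\<integral>\<^sup>+x. ennreal \<bar>?g j x\<bar> \<partial>\<mu>)" by (intro nn_integral_cmult) measurable
      also have "\<dots> \<le> ennreal M * ennreal (2 * A * s j)" by (intro mult_left_mono bp(4)) auto
      also have "\<dots> = ennreal (M * (2 * A) * s j)" using M0 A s0
        by (simp add: ennreal_mult[symmetric] mult_ac)
      finally show ?thesis .
    qed
    have "(\<lambda>j. \<integral>x. ?g j x * \<phi> x \<partial>\<mu>) sums (\<integral>x. (\<Sum>j. ?g j x * \<phi> x) \<partial>\<mu>)"
      by (rule L1_series(4)[OF _ bd ss2]) (use M0 A s0 in auto)
    moreover have "(\<integral>x. (\<Sum>j. ?g j x * \<phi> x) \<partial>\<mu>) = (\<integral>x. (\<Sum>j. ?g j x) * \<phi> x \<partial>\<mu>)"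
    proof (rule integral_cong_AE)
      show "AE x in \<mu>. (\<Sum>j. ?g j x * \<phi> x) = (\<Sum>j. ?g j x) * \<phi> x" using S(1)
      proof eventually_elim
        case (elim x)
        then have "summable (\<lambda>j. ?g j x)" by (rule summable_rabs_cancel)
        then show ?case by (rule suminf_mult2[symmetric])
      qed
    qed measurable
    ultimately show "(\<integral>x. (\<Sum>j. ?g j x) * \<phi> x \<partial>\<mu>) = (\<Sum>j. \<integral>x. ?g j x * \<phi> x \<partial>\<mu>)" by (simp add: sums_iff)
  qed
qed

text \<open>The distribution is built from the decomposition into blocks carried by two cubes, for
  which the membership is proved. For any other decomposition the same limit of truncated pairings
  represents both sums, so the two series attached to it have the same total.\<close>

theorem product_decomposition:
  assumes f: "osc_family f c A" and h: "h \<in> H1atb \<mu> n"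
  shows "\<exists>T. is_distribution T \<and>
    (\<forall>b R s. atb_decomposition \<mu> n h b R s \<longrightarrow>
       (\<exists>T1 T2. dist_sums \<mu> (\<lambda>j x. (f x - c (R j)) * b j x) T1 \<and> dist_sums \<mu> (\<lambda>j x. c (R j) * b j x) T2 \<and>
          (\<forall>\<phi>\<in>test_functions. T \<phi> = T1 \<phi> + T2 \<phi>))) \<and>
    in_L1_plus_hardy_orlicz \<mu> n T"
proof -
  have hm: "h \<in> borel_measurable borel" using h by (simp add: H1atb_def measurable_mu)
  obtain b0 R0 s0 where "atb_decomposition \<mu> n h b0 R0 s0" using h unfolding H1atb_def by blast
  from simple_decomposition[OF this] obtain \<beta> P R' t s' where
    sb: "\<And>l. simple_block Dc (P l) (R' l) (t l) (\<beta> l)" and t: "summable t" and d: "atb_decomposition \<mu> n h \<beta> R' s'"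
      by blast
  note pd = product_distributions[OF d hm f]
  let ?T = "\<lambda>\<phi>. \<Sum>j. \<integral>x. f x * \<beta> j x * \<phi> x \<partial>\<mu>"
  show ?thesis
  proof (rule exI[of _ ?T], intro conjI allI impI)
    show "is_distribution ?T" by (rule pd(3))
    fix b R s assume d': "atb_decomposition \<mu> n h b R s"
    note pd' = product_distributions[OF d' hm f]
    show "\<exists>T1 T2. dist_sums \<mu> (\<lambda>j x. (f x - c (R j)) * b j x) T1 \<and> dist_sums \<mu> (\<lambda>j x. c (R j) * b j x) T2 \<and>
          (\<forall>\<phi>\<in>test_functions. ?T \<phi> = T1 \<phi> + T2 \<phi>)"
    proof (intro exI conjI ballI)
      fix \<phi> :: "'a \<Rightarrow> real" assume \<phi>: "\<phi> \<in> test_functions"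
      show "?T \<phi> = (\<Sum>j. \<integral>x. (f x - c (R j)) * b j x * \<phi> x \<partial>\<mu>) + (\<Sum>j. \<integral>x. c (R j) * b j x * \<phi> x \<partial>\<mu>)"
        using pd(4)[OF \<phi>] pd'(4)[OF \<phi>] pd'(5)[OF \<phi>] by simp
    qed (rule pd'(1), rule pd'(2))
  next
    obtain u where "integrable \<mu> u" "\<forall>\<phi>\<in>test_functions. (\<integral>x. u x * \<phi> x \<partial>\<mu>) = (\<Sum>j. \<integral>x. (f x - c (R' j)) * \<beta> j x * \<phi> x \<partial>\<mu>)"
      using L1_part[OF f d] by blast
    then show "in_L1_plus_hardy_orlicz \<mu> n ?T"
      unfolding in_L1_plus_hardy_orlicz_def using hardy_part[OF f hm sb t d] pd(5)
        by (intro exI[of _ u] exI conjI) auto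
  qed
qed

end

theorem theorem1p2:
  fixes \<mu> :: "'a::euclidean_space measure" and n :: nat and C0 \<rho> \<eta> \<beta> :: real
    and f h :: "'a \<Rightarrow> real"
  assumes "0 < n" and "n \<le> DIM('a)" and "growth_measure \<mu> n C0"
    and "\<rho> > 1" and "\<eta> > 1" and "doubling_constant \<mu> n \<rho> \<beta>"
    and "f \<in> RBMO \<mu> n \<rho> \<eta> \<beta>" and "h \<in> H1atb \<mu> n"
  shows "\<exists>T. is_distribution T \<and>
    (\<forall>b R s. atb_decomposition \<mu> n h b R s \<longrightarrow>
       (\<exists>T1 T2.
          dist_sums \<mu> (\<lambda>j x. (f x - mean \<mu> f (cube_tilde \<mu> \<rho> \<beta> (R j))) * b j x) T1 \<and>
          dist_sums \<mu> (\<lambda>j x. mean \<mu> f (cube_tilde \<mu> \<rho> \<beta> (R j)) * b j x) T2 \<and>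
          (\<forall>\<phi>\<in>test_functions. T \<phi> = T1 \<phi> + T2 \<phi>))) \<and>
    in_L1_plus_hardy_orlicz \<mu> n T"
proof -
  have "growth_measure \<mu> n (max C0 1)"
  proof -
    have "ennreal (C0 * r ^ n) \<le> ennreal (max C0 1 * r ^ n)" if "r > 0" for r :: real
      using that by (intro ennreal_leI mult_right_mono) auto
    then show ?thesis using assms(3) unfolding growth_measure_def by (meson order_trans)
  qed
  then interpret growth_space \<mu> n "max C0 1" using assms by unfold_locales auto
  obtain A where "osc_family f (\<lambda>Q. mean \<mu> f (cube_tilde \<mu> \<rho> \<beta> Q)) A" using RBMO_osc_family assms
    by blast
  from product_decomposition[OF this assms(8)] show ?thesis .
qed

end
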